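(* Let $k\in\mathbb N$, $s\in(0,1)$, and $q\in[1,\infty)$. (i) Let $X$ and $Y$ be ball Banach function spaces whose lower generalized Boyd indices are respectively $p_X$ and $p_Y$. Assume that $p_X,p_Y\in(1,\infty)$ and $n(\frac{1-s}{p_X}+\frac s{p_Y}-\frac1q)<sk$. Then there exists a positive constant $C$, independent of $f$, such that, for any $f\in X\cap\dot W^{k,Y}$, $$\left\|\mathfrak D^{s,k}_q(f)\right\|_{X^{1-s}Y^s}\le C\|f\|_X^{1-s}\left\|\nabla^kf\right\|_Y^s.$$ The target space is optimal in the following sense: if $X$, $Y$, and $B$ are rearrangement invariant Banach function spaces, with $p_X,p_Y\in(1,\infty)$ and $n(\frac{1-s}{p_X}+\frac s{p_Y}-\frac1q)<sk$, then there exists a positive constant $C$ such that $$\left\|\mathfrak D^{s,k}_q(f)\right\|_B\le C\|f\|_X^{1-s}\left\|\nabla^kf\right\|_Y^s$$ holds for any $f\in X\cap\dot W^{k,Y}$ if and only if $X^{1-s}Y^s\hookrightarrow B$. (ii) Let $Y$ be a ball Banach function space whose lower generalized Boyd index is $p_Y$. Assume that $p_Y\in(1,\infty)$ and $n(\frac s{p_Y}-\frac1q)<sk$. Then there exists a positive constant $C$, independent of $f$, such that, for any $f\in\operatorname{BMO}\cap\dot W^{k,Y}$, $$\left\|\mathfrak D^{s,k}_q(f)\right\|_{Y^{\frac1s}}\le C\|f\|_{\operatorname{BMO}}^{1-s}\left\|\nabla^kf\right\|_Y^s.$$ The target $Y^{\frac1s}$ is optimal: if $Y$ and $B$ are rearrangement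 invariant Banach function spaces, with $p_Y\in(1,\infty)$ and $n(\frac s{p_Y}-\frac1q)<sk$, then there exists a positive constant $C$ such that $$\left\|\mathfrak D^{s,k}_q(f)\right\|_B\le C\|f\|_{\operatorname{BMO}}^{1-s}\left\|\nabla^kf\right\|_Y^s$$ holds for any $f\in\operatorname{BMO}\cap\dot W^{k,Y}$ if and only if $Y^{\frac1s}\hookrightarrow B$.
   Context: All functions are real-valued measurable functions on $\mathbb R^n$; $L^0$ is the set of all of them. $\Delta_h^kf(x):=\sum_{j=0}^k(-1)^{k-j}\binom kj f(x+jh)$ and $\mathfrak D^{s,k}_q(f)(x):=[\int_{\mathbb R^n}\frac{|\Delta_h^kf(x)|^q}{|h|^{n+skq}}\,dh]^{1/q}$. A ball Banach function (BBF) space is a Banach space $X\subset L^0$ with norm $\|\cdot\|_X$ defined (with values in $[0,\infty]$) on all of $L^0$ such that: (a) $\|f\|_X=0$ implies $f=0$ a.e.; (b) $|g|\le|f|$ a.e. implies $\|g\|_X\le\|f\|_X$; (c) $0\le f_m\uparrow f$ a.e. implies $\|f_m\|_X\uparrow\|f\|_X$; (d) $\mathbf 1_B\in X$ for every ball $B$; (e) for every ball $B$ there is $C_{(B)}>0$ with $\int_B|f|\le C_{(B)}\|f\|_X$ for all $f\in X$. A Banach function space is defined in the same way with balls in (d) and (e) replaced by arbitrary measurable sets of finite measure. A Banach function space $X$ is rearrangement invariant if, whenever $f\in L^0$ and $g\in X$ satisfy $|\{|f|>\alpha\}|=|\{|g|>\alpha\}|$ for all $\alpha>0$, one has $f\in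 X$ and $\|f\|_X=\|g\|_X$. For $p\in(0,\infty)$, the $p$-convexification is $X^p:=\{f\in L^0:|f|^p\in X\}$ with $\|f\|_{X^p}:=\||f|^p\|_X^{1/p}$. The lower generalized Boyd index is $p_X:=\sup(\{p\in(1,\infty): X^{1/p}\text{ is a BBF space and } M\text{ is bounded on }X^{1/p}\}\cup\{1\})$, where $M$ is the Hardy–Littlewood maximal operator. The Calderón–Lozanovskiĭ space $X^{1-s}Y^s$ is the set of $h\in L^0$ with $|h|\le|f|^{1-s}|g|^s$ for some $f\in X$, $g\in Y$, with norm $\|h\|_{X^{1-s}Y^s}:=\inf\{\|f\|_X^{1-s}\|g\|_Y^s:|h|\le|f|^{1-s}|g|^s\}$. $\hookrightarrow$ denotes continuous embedding. $\dot W^{k,Y}$ is the set of all $f\in L^1_{\rm loc}$ whose weak derivatives $\partial^\alpha f$ exist and belong to $Y$ for all $|\alpha|=k$; $\|\nabla^kf\|_Y:=\||\nabla^kf|\|_Y$. $\operatorname{BMO}$ is the space of $f\in L^1_{\rm loc}$ with $\|f\|_{\operatorname{BMO}}:=\sup_Q\inf_{c\in\mathbb R}\frac1{|Q|}\int_Q|f-c|<\infty$ (supremum over all cubes). *)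

theory Defs
  imports "HOL-Analysis.Analysis"
begin

text \<open>
  A function space is represented by its extended norm \<open>N\<close>, a functional on all functions with
  values in \<open>[0,\<infinity>]\<close>; the space itself is the set \<open>space_of N\<close> of measurable functions of finite
  norm. Only the values of \<open>N\<close> on \<open>L0\<close> matter. Functions are not quotiented by equality almost
  everywhere; instead all conditions are stated almost everywhere.
\<close>

type_synonym 'n fnorm = "(real ^ 'n \<Rightarrow> real) \<Rightarrow> ennreal"

definition L0 :: "(real ^ 'n::finite \<Rightarrow> real) set" where
  "L0 = borel_measurable lebesgue"

definition space_of :: "'n::finite fnorm \<Rightarrow> (real ^ 'n \<Rightarrow> real) set" where
  "space_of N = {f \<in> L0. N f < \<infinity>}"

definition ennreal_powr :: "ennreal \<Rightarrow> real \<Rightarrow> ennreal" where \<comment> \<open>for positive exponents only\<close>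
  "ennreal_powr a r = (if a = \<infinity> then \<infinity> else ennreal (enn2real a powr r))"

text \<open>
  Norm of a nonnegative function that may take the value \<open>\<infinity>\<close>, such as a maximal function or
  \<open>frac_diff s k q f\<close> below. Members of \<open>L0\<close> are real-valued, so the norm is infinite unless the
  function is finite almost everywhere.
\<close>
definition extended_norm :: "'n::finite fnorm \<Rightarrow> (real ^ 'n \<Rightarrow> ennreal) \<Rightarrow> ennreal" where
  "extended_norm N F =
     (if AE x in lebesgue. F x < \<infinity> then N (\<lambda>x. enn2real (F x)) else \<infinity>)"


section \<open>Banach function spaces\<close>

definition is_banach_norm :: "'n::finite fnorm \<Rightarrow> bool" where
  "is_banach_norm N \<longleftrightarrow>
     (\<forall>c. \<forall>f\<in>L0. N (\<lambda>x. c * f x) = ennreal \<bar>c\<bar> * N f) \<and>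
     (\<forall>f\<in>L0. \<forall>g\<in>L0. N (\<lambda>x. f x + g x) \<le> N f + N g) \<and>
     (\<forall>F::nat \<Rightarrow> real ^ 'n \<Rightarrow> real.
        (\<forall>m. F m \<in> space_of N) \<and>
        (\<forall>e>0. \<exists>M. \<forall>i\<ge>M. \<forall>j\<ge>M. N (\<lambda>x. F i x - F j x) < ennreal e)
        \<longrightarrow> (\<exists>f\<in>space_of N. (\<lambda>m. N (\<lambda>x. F m x - f x)) \<longlonglongrightarrow> 0))"

text \<open>
  The axioms common to ball Banach function spaces and Banach function spaces; \<open>\<S>\<close> is the
  family of sets whose indicator functions are required to belong to the space.
\<close>
definition banach_function_norm_over :: "(real ^ 'n::finite) set set \<Rightarrow> 'n fnorm \<Rightarrow> bool" where
  "banach_function_norm_over \<S> N \<longleftrightarrow>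
     is_banach_norm N \<and>
     (\<forall>f\<in>L0. N f = 0 \<longrightarrow> (AE x in lebesgue. f x = 0)) \<and>
     (\<forall>f\<in>L0. \<forall>g\<in>L0. (AE x in lebesgue. \<bar>g x\<bar> \<le> \<bar>f x\<bar>) \<longrightarrow> N g \<le> N f) \<and>
     (\<forall>F::nat \<Rightarrow> real ^ 'n \<Rightarrow> real. \<forall>f\<in>L0.
        (\<forall>m. F m \<in> L0) \<and>
        (AE x in lebesgue. (\<forall>m. 0 \<le> F m x) \<and> incseq (\<lambda>m. F m x) \<and> (\<lambda>m. F m x) \<longlonglongrightarrow> f x)
        \<longrightarrow> incseq (\<lambda>m. N (F m)) \<and> (\<lambda>m. N (F m)) \<longlonglongrightarrow> N f) \<and>
     (\<forall>E\<in>\<S>. (indicator E :: real ^ 'n \<Rightarrow> real) \<in> space_of N) \<and>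
     (\<forall>E\<in>\<S>. \<exists>C>0. \<forall>f\<in>space_of N.
        (\<integral>\<^sup>+x\<in>E. ennreal \<bar>f x\<bar> \<partial>lebesgue) \<le> ennreal C * N f)"

definition ball_banach_function_space :: "'n::finite fnorm \<Rightarrow> bool" where
  "ball_banach_function_space N \<longleftrightarrow>
     banach_function_norm_over {ball x r |x r. 0 < r} N"

definition banach_function_space :: "'n::finite fnorm \<Rightarrow> bool" where
  "banach_function_space N \<longleftrightarrow> banach_function_norm_over lmeasurable N"

definition rearrangement_invariant :: "'n::finite fnorm \<Rightarrow> bool" where
  "rearrangement_invariant N \<longleftrightarrow>
     (\<forall>f\<in>L0. \<forall>g\<in>space_of N.
        (\<forall>\<alpha>>0. emeasure lebesgue {x. \<bar>f x\<bar> > \<alpha>} = emeasure lebesgue {x. \<bar>g x\<bar> > \<alpha>})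
        \<longrightarrow> f \<in> space_of N \<and> N f = N g)"

definition ri_banach_function_space :: "'n::finite fnorm \<Rightarrow> bool" where
  "ri_banach_function_space N \<longleftrightarrow> banach_function_space N \<and> rearrangement_invariant N"

definition continuously_embedded :: "'n::finite fnorm \<Rightarrow> 'n fnorm \<Rightarrow> bool" where
  "continuously_embedded N N' \<longleftrightarrow>
     space_of N \<subseteq> space_of N' \<and> (\<exists>C>0. \<forall>f\<in>space_of N. N' f \<le> ennreal C * N f)"

definition convexification :: "real \<Rightarrow> 'n::finite fnorm \<Rightarrow> 'n fnorm" where
  "convexification p N = (\<lambda>f. ennreal_powr (N (\<lambda>x. \<bar>f x\<bar> powr p)) (1 / p))"

text \<open>
  As \<open>Inf {} = \<infinity>\<close> in \<open>ennreal\<close>, the norm of \<open>h\<close> is finite exactly if a majorant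
  \<open>\<bar>f\<bar> powr (1 - s) * \<bar>g\<bar> powr s\<close> with \<open>f\<close>, \<open>g\<close> in the two spaces exists.
\<close>
definition calderon_lozanovskii :: "real \<Rightarrow> 'n::finite fnorm \<Rightarrow> 'n fnorm \<Rightarrow> 'n fnorm" where
  "calderon_lozanovskii s N N' = (\<lambda>h.
     Inf {ennreal_powr (N f) (1 - s) * ennreal_powr (N' g) s |f g.
            f \<in> space_of N \<and> g \<in> space_of N' \<and>
            (AE x in lebesgue. \<bar>h x\<bar> \<le> \<bar>f x\<bar> powr (1 - s) * \<bar>g x\<bar> powr s)})"


section \<open>The maximal operator and the lower generalized Boyd index\<close>

definition maximal_function :: "(real ^ 'n::finite \<Rightarrow> real) \<Rightarrow> real ^ 'n \<Rightarrow> ennreal" where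
  "maximal_function f x =
     Sup {(\<integral>\<^sup>+y\<in>ball c r. ennreal \<bar>f y\<bar> \<partial>lebesgue) / emeasure lebesgue (ball c r) |c r.
            0 < r \<and> x \<in> ball c r}"

definition maximal_bounded_on :: "'n::finite fnorm \<Rightarrow> bool" where
  "maximal_bounded_on N \<longleftrightarrow>
     (\<exists>C>0. \<forall>f\<in>space_of N. extended_norm N (maximal_function f) \<le> ennreal C * N f)"

definition lower_boyd_index :: "'n::finite fnorm \<Rightarrow> ereal" where
  "lower_boyd_index N =
     Sup ({ereal p |p. 1 < p \<and> ball_banach_function_space (convexification (1 / p) N) \<and>
                        maximal_bounded_on (convexification (1 / p) N)} \<union> {1})"


section \<open>Weak derivatives, homogeneous Sobolev spaces and BMO\<close>

definition L1_loc :: "(real ^ 'n::finite \<Rightarrow> real) set" where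
  "L1_loc = {f \<in> L0. \<forall>K. compact K \<longrightarrow> set_integrable lebesgue K f}"

definition partial_deriv :: "'n::finite \<Rightarrow> (real ^ 'n \<Rightarrow> real) \<Rightarrow> real ^ 'n \<Rightarrow> real" where
  "partial_deriv i \<phi> = (\<lambda>x. frechet_derivative \<phi> (at x) (axis i 1))"

text \<open>
  All iterated partial derivatives exist and are (Frechet) differentiable, hence continuous.
\<close>
definition smooth :: "(real ^ 'n::finite \<Rightarrow> real) \<Rightarrow> bool" where
  "smooth \<phi> \<longleftrightarrow> (\<forall>is x. foldr partial_deriv is \<phi> differentiable at x)"

definition test_function :: "(real ^ 'n::finite \<Rightarrow> real) \<Rightarrow> bool" where
  "test_function \<phi> \<longleftrightarrow> smooth \<phi> \<and> compact (closure {x. \<phi> x \<noteq> 0})"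

definition multi_indices :: "nat \<Rightarrow> ('n::finite \<Rightarrow> nat) set" where
  "multi_indices k = {\<alpha>. (\<Sum>i\<in>UNIV. \<alpha> i) = k}"

text \<open>
  The order in which the partial derivatives are taken is left to \<open>SOME\<close>, since the index type
  \<open>'n\<close> carries no order. It is irrelevant for smooth functions, the only ones to which
  \<open>multi_deriv\<close> is applied.
\<close>
definition multi_deriv ::
  "('n::finite \<Rightarrow> nat) \<Rightarrow> (real ^ 'n \<Rightarrow> real) \<Rightarrow> real ^ 'n \<Rightarrow> real" where
  "multi_deriv \<alpha> \<phi> = foldr partial_deriv (SOME is. \<forall>i. count_list is i = \<alpha> i) \<phi>"

definition has_weak_deriv ::
  "(real ^ 'n::finite \<Rightarrow> real) \<Rightarrow> ('n \<Rightarrow> nat) \<Rightarrow> (real ^ 'n \<Rightarrow> real) \<Rightarrow> bool" where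
  "has_weak_deriv f \<alpha> g \<longleftrightarrow>
     g \<in> L1_loc \<and>
     (\<forall>\<phi>. test_function \<phi> \<longrightarrow>
        (\<integral>x. f x * multi_deriv \<alpha> \<phi> x \<partial>lebesgue)
        = (-1) ^ (\<Sum>i\<in>UNIV. \<alpha> i) * (\<integral>x. g x * \<phi> x \<partial>lebesgue))"

text \<open>A representative; weak derivatives are unique up to null sets.\<close>
definition weak_deriv ::
  "('n::finite \<Rightarrow> nat) \<Rightarrow> (real ^ 'n \<Rightarrow> real) \<Rightarrow> real ^ 'n \<Rightarrow> real" where
  "weak_deriv \<alpha> f = (SOME g. has_weak_deriv f \<alpha> g)"

definition homogeneous_sobolev ::
  "nat \<Rightarrow> 'n::finite fnorm \<Rightarrow> (real ^ 'n \<Rightarrow> real) set" where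
  "homogeneous_sobolev k N =
     {f \<in> L1_loc. \<forall>\<alpha>\<in>multi_indices k. \<exists>g. has_weak_deriv f \<alpha> g \<and> g \<in> space_of N}"

text \<open>The Euclidean length of the vector of all weak derivatives of order \<open>k\<close>.\<close>
definition grad_norm :: "nat \<Rightarrow> (real ^ 'n::finite \<Rightarrow> real) \<Rightarrow> real ^ 'n \<Rightarrow> real" where
  "grad_norm k f x = sqrt (\<Sum>\<alpha>\<in>multi_indices k. (weak_deriv \<alpha> f x)\<^sup>2)"

definition bmo_norm :: "'n::finite fnorm" where
  "bmo_norm f =
     (SUP (a, l) \<in> {(a :: real ^ 'n, l :: real). 0 < l}. INF c.
        (\<integral>\<^sup>+x\<in>cbox a (a + l *\<^sub>R One). ennreal \<bar>f x - c\<bar> \<partial>lebesgue)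
        / emeasure lebesgue (cbox a (a + l *\<^sub>R One)))"

definition BMO :: "(real ^ 'n::finite \<Rightarrow> real) set" where
  "BMO = {f \<in> L1_loc. bmo_norm f < \<infinity>}"


section \<open>Fractional differences\<close>

definition finite_diff ::
  "nat \<Rightarrow> real ^ 'n \<Rightarrow> (real ^ 'n \<Rightarrow> real) \<Rightarrow> real ^ 'n \<Rightarrow> real" where
  "finite_diff k h f x =
     (\<Sum>j=0..k. (-1) ^ (k - j) * real (k choose j) * f (x + real j *\<^sub>R h))"

definition frac_diff ::
  "real \<Rightarrow> nat \<Rightarrow> real \<Rightarrow> (real ^ 'n::finite \<Rightarrow> real) \<Rightarrow> real ^ 'n \<Rightarrow> ennreal" where
  "frac_diff s k q f x =
     ennreal_powr
       (\<integral>\<^sup>+h. ennreal (\<bar>finite_diff k h f x\<bar> powr q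
                     / norm h powr (real CARD('n) + s * real k * q)) \<partial>lebesgue)
       (1 / q)"

end

(* Upper bounds: let A = (M |f|^r1)^(1/r1) (or A = the BMO norm) and G = (M |grad f|^r2)^(1/r2), where the
   exponents come from the Boyd indices. Decomposing f into a telescoping sum of variations of ball averages over
   dyadic scales t, each variation is at most a constant times min(A, t^k G), up to powers of local averages.
   Integrating over dyadic annuli in h yields the pointwise bound
   D f <= C A^(1-s) G^s, and M is bounded on the spaces involved.

   Optimality: for simple functions F = sum a_i 1_{E_i} and G = sum b_i 1_{E_i}, replace each E_i by far-apart cubes
   of the same total measure and of side about (t a_i / b_i)^(1/k) with t small, and let f be the sum of bumps of
   height t a_i on these cubes. Then |f| and |grad f| are bounded by rearrangements of t F and G, while D f is at least
   c t^(1-s) times a rearrangement of F^(1-s) G^s. Cancel t^(1-s) and use the Fatou property. *)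
theory Submission
 imports Defs
begin

text \<open>A k-th order estimate needs averages that reproduce all polynomials of degree below k;
  \<open>Phi\<close> achieves this by combining ball means of radii t, ..., k t with the
  coefficients of the k-th difference. The obstacle is that differences at x involve points x + j h,
  where maximal functions at x control no single value, only averages over balls around x. At scale
  R / 2^i a local average l near x can be as large as 2^(i n), but its integral over the large ball
  stays bounded. So one power of l goes into the integral over h, and the remaining powers must be
  beaten by the decay of the scales: this budget is the condition on n, k, s and q. Being strict, it
  leaves room to replace Boyd indices by admissible exponents and s by s - \<delta> or s + \<delta>,
  which makes the annuli on either side of the balance scale L, given by A = G L^k, summable. The
  same balance fixes the side of the cubes in the lower bound. Equal cubes must fill the measure of
  E_i exactly, so their side meets the balance only up to a factor 2; and a bump spills over its
  cube, so its support is covered by 3^n translates of the cube.\<close>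

abbreviation nn_integral_lborel :: "('a::euclidean_space => ennreal) => ennreal" (binder "\<integral>+" 10) where
 "nn_integral_lborel f \<equiv> nn_integral lborel f"

abbreviation borel_fun :: "('a::topological_space => 'b::topological_space) set" where
 "borel_fun \<equiv> borel_measurable borel"

subsection \<open>A smooth bump\<close>

definition bump_poly :: "real poly" where "bump_poly = [:2, 1, -1:]"

text \<open>The parameters record a polynomial factor and the order of a pole: with w =
  \<open>bump_poly\<close>, a function p w^(-m) exp(-1/w) differentiates to another of the same kind
  (\<open>bump_fun_deriv\<close>), so the family contains all derivatives of the profile
  exp(-1/w).\<close>

definition bump_fun :: "real poly => nat => real => real" where
 "bump_fun p m x = (if poly bump_poly x > 0
   then poly p x * (1 / poly bump_poly x) ^ m * exp (- 1 / poly bump_poly x) else 0)"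

text \<open>A single term of the exponential series is at most its sum.\<close>

lemma power_exp_minus_le:
 fixes y :: real assumes "0 \<le> y" shows "y ^ m * exp (- y) \<le> fact m"
proof -
 have "(\<lambda>n. y ^ n /\<^sub>R fact n) sums exp y" by (rule exp_converges)
 hence "y ^ m /\<^sub>R fact m \<le> exp y"
  using sum_le_suminf[of "\<lambda>n. y ^ n /\<^sub>R fact n" "{m}"] assms by (simp add: sums_iff)
 hence "y ^ m \<le> fact m * exp y" by (simp add: field_simps)
 thus ?thesis by (simp add: exp_minus field_simps)
qed

text \<open>\<open>power_exp_minus_le\<close> with exponent m + 2 beats the pole of order m and
  leaves two powers of w. A zero of second order gives the derivative 0 at the roots of
  \<open>bump_poly\<close>.\<close>

lemma bump_fun_le:
 "\<bar>bump_fun p m x\<bar> \<le> \<bar>poly p x\<bar> * fact (m + 2) * (poly bump_poly x)\<^sup>2"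
proof (cases "poly bump_poly x > 0")
 case True
 define w where "w = poly bump_poly x"
 have w: "w > 0" using True w_def by simp
 have "(1 / w) ^ (m + 2) * exp (- (1 / w)) \<le> fact (m + 2)"
  by (rule power_exp_minus_le) (use w in simp)
 hence "(1 / w) ^ m * exp (- 1 / w) \<le> fact (m + 2) * w\<^sup>2"
  using w by (simp add: power_add power2_eq_square divide_simps mult_ac del: fact_Suc)
 hence "\<bar>poly p x\<bar> * ((1 / w) ^ m * exp (- 1 / w)) \<le> \<bar>poly p x\<bar> * (fact (m + 2) * w\<^sup>2)"
  by (rule mult_left_mono) simp
 thus ?thesis using w by (simp add: bump_fun_def w_def abs_mult mult.assoc)
qed (simp add: bump_fun_def)

lemma bump_fun_deriv:
 "\<exists>p' m'. \<forall>x. (bump_fun p m has_real_derivative bump_fun p' m' x) (at x)"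
proof -
 define w where "w = poly bump_poly"
 \<comment> \<open>With v = 1/w, the derivative of p v^m exp(-v) is brought to the common power
   v^(m+2), using v^m = w^2 v^(m+2) and its analogue for v^(m+1); this is the resulting
   numerator.\<close>
 define p' where "p' = pderiv p * bump_poly\<^sup>2 - smult (real m) (p * pderiv bump_poly * bump_poly) + p * pderiv bump_poly"
 have cont: "isCont w x" for x by (simp add: w_def)
 have "(bump_fun p m has_real_derivative bump_fun p' (m + 2) x) (at x)" for x
 proof (cases "w x > 0")
  case True
  have ev: "\<forall>\<^sub>F y in nhds x. w y > 0"
   unfolding eventually_nhds w_def
   by (intro exI[of _ "{y. 0 < poly bump_poly y}"] conjI open_Collect_less continuous_intros) (use True w_def in auto)
  have wd: "(w has_real_derivative poly (pderiv bump_poly) x) (at x)"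
   unfolding w_def by (rule poly_DERIV)
  have id: "((\<lambda>y. 1 / w y) has_real_derivative (- poly (pderiv bump_poly) x * (1 / w x)\<^sup>2)) (at x)"
   using DERIV_inverse_fun[OF wd] True by (simp add: inverse_eq_divide power2_eq_square field_simps)
  define v where "v = 1 / w x"
  have v: "w x * v = 1" using True v_def by simp
  have d1: "((\<lambda>y. poly p y * (1 / w y) ^ m * exp (- (1 / w y))) has_real_derivative
    (poly (pderiv p) x * v ^ m + poly p x * (real m * (- poly (pderiv bump_poly) x * v\<^sup>2) * v ^ (m - 1))) * exp (- v)
     + poly p x * v ^ m * (exp (- v) * (poly (pderiv bump_poly) x * v\<^sup>2))) (at x)"
   unfolding v_def
   by (rule derivative_eq_intros poly_DERIV id refl)+ (simp add: algebra_simps power2_eq_square)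
  have e1: "v ^ m = (w x)\<^sup>2 * v ^ (m + 2)"
  proof -
   have "(w x)\<^sup>2 * v ^ (m + 2) = (w x * v)\<^sup>2 * v ^ m" by (simp add: power_add power2_eq_square mult_ac)
   thus ?thesis using v by simp
  qed
  have e2: "real m * v\<^sup>2 * v ^ (m - 1) = real m * w x * v ^ (m + 2)"
  proof (cases m)
   case (Suc j)
   have "w x * v ^ (m + 2) = w x * v * (v\<^sup>2 * v ^ j)" using Suc by (simp add: power_add power2_eq_square mult_ac)
   also have "\<dots> = v\<^sup>2 * v ^ j" using v by simp
   finally show ?thesis using Suc by (simp only: diff_Suc_1) (metis mult.assoc)
  qed simp
  have e3: "v ^ m * v\<^sup>2 = v ^ (m + 2)" by (simp add: power_add power2_eq_square)
  have "(poly (pderiv p) x * v ^ m + poly p x * (real m * (- poly (pderiv bump_poly) x * v\<^sup>2) * v ^ (m - 1))) * exp (- v)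
     + poly p x * v ^ m * (exp (- v) * (poly (pderiv bump_poly) x * v\<^sup>2))
    = exp (- v) * (poly (pderiv p) x * v ^ m - poly p x * poly (pderiv bump_poly) x * (real m * v\<^sup>2 * v ^ (m - 1))
      + poly p x * poly (pderiv bump_poly) x * (v ^ m * v\<^sup>2))" by (simp add: algebra_simps)
  also have "\<dots> = bump_fun p' (m + 2) x"
  proof -
   have "bump_fun p' (m + 2) x = poly p' x * v ^ (m + 2) * exp (- v)"
    using True by (simp add: bump_fun_def w_def v_def)
   moreover have "poly p' x = poly (pderiv p) x * (w x)\<^sup>2 - real m * (poly p x * poly (pderiv bump_poly) x * w x)
     + poly p x * poly (pderiv bump_poly) x" by (simp add: p'_def w_def)
   ultimately show ?thesis unfolding e2 e3 by (subst e1) (simp add: algebra_simps)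
  qed
  finally have d: "((\<lambda>y. poly p y * (1 / w y) ^ m * exp (- 1 / w y)) has_real_derivative bump_fun p' (m + 2) x) (at x)"
   using d1 by simp
  have "\<forall>\<^sub>F y in nhds x. bump_fun p m y = poly p y * (1 / w y) ^ m * exp (- 1 / w y)"
   using ev by eventually_elim (simp add: bump_fun_def w_def)
  from DERIV_cong_ev[OF refl this refl] d show ?thesis by simp
 next
  case False
  define C where "C y = \<bar>poly p y\<bar> * fact (m + 2) * \<bar>poly [:1,-1:] (y+x)\<bar> * \<bar>w y\<bar>" for y
  show ?thesis
  proof (cases "w x = 0")
   case True
   \<comment> \<open>As x is a root of w, the factor y - x splits off. Of the two factors w in
     \<open>bump_fun_le\<close>, one cancels the denominator of the difference quotient and the
     other tends to w x = 0.\<close>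
   have fac: "w y = (y - x) * poly [:1,-1:] (y+x)" for y
    using True unfolding w_def bump_poly_def by (simp add: algebra_simps)
   have "(\<lambda>h. bump_fun p m (x + h) / h) \<midarrow>0\<rightarrow> 0"
   proof (rule Lim_null_comparison)
    show "\<forall>\<^sub>F h in at 0. norm (bump_fun p m (x + h) / h) \<le> C (x + h)"
     unfolding eventually_at
    proof (intro exI[of _ 1] conjI ballI impI)
     fix h :: real assume "h \<noteq> 0 \<and> dist h 0 < 1"
     hence h: "h \<noteq> 0" by simp
     have "\<bar>bump_fun p m (x+h)\<bar> \<le> \<bar>poly p (x+h)\<bar> * fact (m + 2) * (w (x+h))\<^sup>2"
      using bump_fun_le w_def by metis
     also have "(w (x+h))\<^sup>2 = \<bar>w (x+h)\<bar> * \<bar>w (x+h)\<bar>" by (simp add: power2_eq_square flip: abs_mult)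
     also have "\<bar>w (x+h)\<bar> * \<bar>w (x+h)\<bar> = \<bar>h\<bar> * \<bar>poly [:1,-1:] (x+h+x)\<bar> * \<bar>w (x+h)\<bar>"
      by (subst (1) fac) (simp add: abs_mult)
     finally show "norm (bump_fun p m (x + h) / h) \<le> C (x + h)"
      using h by (simp add: C_def field_simps)
    qed simp
    have "isCont (\<lambda>h. C (x + h)) 0"
     unfolding C_def w_def by (intro continuous_intros) 
    thus "(\<lambda>h. C (x + h)) \<midarrow>0\<rightarrow> 0" using True unfolding isCont_def C_def by simp
   qed
   moreover have "bump_fun p m x = 0" "bump_fun p' (m + 2) x = 0" using True by (simp_all add: bump_fun_def w_def)
   ultimately show ?thesis by (simp add: DERIV_def)
  next
   case neg: False
   hence neg: "w x < 0" using False by simp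
   have ev: "\<forall>\<^sub>F y in nhds x. w y < 0"
    unfolding eventually_nhds w_def
    by (intro exI[of _ "{y. poly bump_poly y < 0}"] conjI open_Collect_less continuous_intros) (use neg w_def in auto)
   have "\<forall>\<^sub>F y in nhds x. bump_fun p m y = 0"
    using ev by eventually_elim (simp add: bump_fun_def w_def)
   hence "(bump_fun p m has_real_derivative 0) (at x)"
    using DERIV_cong_ev[OF refl, of "bump_fun p m" "\<lambda>y. 0" x 0 0] by simp
   moreover have "bump_fun p' (m + 2) x = 0" using neg by (simp add: bump_fun_def w_def)
   ultimately show ?thesis by simp
  qed
 qed
 thus ?thesis by blast
qed

text \<open>The profile lives on (-1, 2) with the interval from 0 to 1 as its core, three unit
  intervals in all. In n dimensions the core becomes \<open>hcube\<close> and the whole becomes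
  \<open>hull3\<close>, which splits into translates of the core.\<close>

definition psiD :: "nat => real => real" where
 "psiD m = (deriv ^^ m) (bump_fun 1 0)"

lemma psiD_form: "\<exists>p j. psiD m = bump_fun p j"
proof (induction m)
 case 0 show ?case by (auto simp: psiD_def)
next
 case (Suc m)
 then obtain p j where "psiD m = bump_fun p j" by blast
 moreover obtain p' j' where "\<forall>x. (bump_fun p j has_real_derivative bump_fun p' j' x) (at x)"
  using bump_fun_deriv by blast
 hence "deriv (bump_fun p j) = bump_fun p' j'" by (auto intro!: DERIV_imp_deriv)
 ultimately show ?case by (auto simp: psiD_def)
qed

lemma psiD_deriv: "(psiD m has_real_derivative psiD (Suc m) x) (at x)"
proof -
 obtain p j where pj: "psiD m = bump_fun p j" using psiD_form by blast
 obtain p' j' where d: "\<And>x. (bump_fun p j has_real_derivative bump_fun p' j' x) (at x)"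
  using bump_fun_deriv by blast
 hence "deriv (bump_fun p j) = bump_fun p' j'" by (auto intro!: DERIV_imp_deriv)
 thus ?thesis using d pj by (auto simp: psiD_def)
qed

lemma psiD_support: assumes "x \<le> -1 \<or> 2 \<le> x" shows "psiD m x = 0"
proof -
 have "poly bump_poly x = (x + 1) * (2 - x)" by (simp add: bump_poly_def algebra_simps)
 also have "\<dots> \<le> 0" using assms by (auto simp: mult_le_0_iff)
 finally show ?thesis using psiD_form[of m] by (auto simp: bump_fun_def)
qed

lemma psiD_isCont: "isCont (psiD m) x"
 using psiD_deriv by (rule DERIV_isCont)

lemma psiD_bounded: "\<exists>B>0. \<forall>x. \<bar>psiD m x\<bar> \<le> B"
proof -
 have "compact (psiD m ` {-1..2})"
  by (intro compact_continuous_image continuous_at_imp_continuous_on ballI psiD_isCont) simp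
 then obtain B where B: "\<And>x. x \<in> {-1..2} ==> \<bar>psiD m x\<bar> \<le> B"
  using compact_imp_bounded bounded_iff by (metis image_eqI real_norm_def)
 have "\<bar>psiD m x\<bar> \<le> max B 1" for x
  using B[of x] psiD_support[of x m] by (cases "x \<in> {-1..2}") auto
 thus ?thesis by (intro exI[of _ "max B 1"]) auto
qed

lemma psiD_0_nonneg: "0 \<le> psiD 0 x" and psiD_0_le_1: "psiD 0 x \<le> 1"
 by (auto simp: psiD_def bump_fun_def)

lemma psiD_0_lower: assumes "0 \<le> x" "x \<le> 1" shows "exp (- 1 / 2) \<le> psiD 0 x"
proof -
 have "poly bump_poly x = 2 + x * (1 - x)" by (simp add: bump_poly_def algebra_simps)
 moreover have "x * (1 - x) \<ge> 0" using assms by simp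
 ultimately have "poly bump_poly x \<ge> 2" by simp
 thus ?thesis by (simp add: psiD_def bump_fun_def field_simps)
qed

text \<open>\<open>bump l c \<alpha>\<close> is the \<open>\<alpha>\<close>-th partial derivative of \<open>bump l c (\<lambda>_. 0)\<close>, which is positive on the open
 cube of side \<open>3 * l\<close> concentric with the cube of corner \<open>c\<close> and side \<open>l\<close>, and bounded below on the latter.\<close>

definition bump :: "real => real ^ 'n::finite => ('n => nat) => real ^ 'n => real" where
 "bump l c \<alpha> x = (1 / l) ^ (\<Sum>i\<in>UNIV. \<alpha> i) * (\<Prod>i\<in>UNIV. psiD (\<alpha> i) ((x $ i - c $ i) / l))"

definition incr :: "('n => nat) => 'n => 'n => nat" where
 "incr \<alpha> i = \<alpha>(i := Suc (\<alpha> i))"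

lemma sum_incr: "(\<Sum>j\<in>UNIV. incr \<alpha> i j) = Suc (\<Sum>j\<in>UNIV. \<alpha> j)" for i :: "'n::finite"
proof -
 have "(\<Sum>j\<in>UNIV. incr \<alpha> i j) = incr \<alpha> i i + (\<Sum>j\<in>UNIV-{i}. incr \<alpha> i j)"
  by (rule sum.remove) auto
 also have "(\<Sum>j\<in>UNIV-{i}. incr \<alpha> i j) = (\<Sum>j\<in>UNIV-{i}. \<alpha> j)"
  by (rule sum.cong) (auto simp: incr_def)
 also have "incr \<alpha> i i + (\<Sum>j\<in>UNIV-{i}. \<alpha> j) = Suc (\<alpha> i + (\<Sum>j\<in>UNIV-{i}. \<alpha> j))" by (simp add: incr_def)
 also have "\<alpha> i + (\<Sum>j\<in>UNIV-{i}. \<alpha> j) = (\<Sum>j\<in>UNIV. \<alpha> j)" by (rule sum.remove[symmetric]) auto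
 finally show ?thesis .
qed

lemma bump_has_derivative:
 fixes c x :: "real ^ 'n::finite"
 assumes "l > 0"
 shows "(bump l c \<alpha> has_derivative (\<lambda>h. \<Sum>i\<in>UNIV. h $ i * bump l c (incr \<alpha> i) x)) (at x)"
proof -
 have 1: "((\<lambda>x. psiD (\<alpha> i) ((x $ i - c $ i) / l)) has_derivative
   (\<lambda>h. h $ i * (psiD (Suc (\<alpha> i)) ((x $ i - c $ i) / l) / l))) (at x)" for i
 proof -
  have "((\<lambda>x. (x $ i - c $ i) / l) has_derivative (\<lambda>h. h $ i / l)) (at x)"
   using assms by (auto intro!: derivative_eq_intros bounded_linear_imp_has_derivative bounded_linear_vec_nth)
  from has_derivative_compose[OF this psiD_deriv[unfolded has_field_derivative_def]]
  show ?thesis by (simp add: mult.commute)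
 qed
 have P: "(\<Prod>j\<in>UNIV. psiD (incr \<alpha> i j) ((x $ j - c $ j) / l)) = 
   psiD (Suc (\<alpha> i)) ((x $ i - c $ i) / l) * (\<Prod>j\<in>UNIV - {i}. psiD (\<alpha> j) ((x $ j - c $ j) / l))" for i
 proof -
  have "(\<Prod>j\<in>UNIV. psiD (incr \<alpha> i j) ((x $ j - c $ j) / l)) = psiD (incr \<alpha> i i) ((x $ i - c $ i) / l)
    * (\<Prod>j\<in>UNIV-{i}. psiD (incr \<alpha> i j) ((x $ j - c $ j) / l))" by (rule prod.remove) auto
  also have "(\<Prod>j\<in>UNIV-{i}. psiD (incr \<alpha> i j) ((x $ j - c $ j) / l)) = (\<Prod>j\<in>UNIV-{i}. psiD (\<alpha> j) ((x $ j - c $ j) / l))"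
   by (rule prod.cong) (auto simp: incr_def)
  finally show ?thesis by (simp add: incr_def)
 qed
 have D: "((\<lambda>x. \<Prod>j\<in>UNIV. psiD (\<alpha> j) ((x $ j - c $ j) / l)) has_derivative
   (\<lambda>h. \<Sum>i\<in>UNIV. h $ i * (psiD (Suc (\<alpha> i)) ((x $ i - c $ i) / l) / l)
     * (\<Prod>j\<in>UNIV - {i}. psiD (\<alpha> j) ((x $ j - c $ j) / l)))) (at x)"
  by (rule has_derivative_prod) (rule 1)
 have E: "(1 / l) ^ (\<Sum>i\<in>UNIV. \<alpha> i) * (h $ i * (psiD (Suc (\<alpha> i)) ((x $ i - c $ i) / l) / l)
     * (\<Prod>j\<in>UNIV - {i}. psiD (\<alpha> j) ((x $ j - c $ j) / l))) = h $ i * bump l c (incr \<alpha> i) x" for i h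
  unfolding bump_def P sum_incr by simp
 from has_derivative_mult_right[OF D, of "(1 / l) ^ (\<Sum>i\<in>UNIV. \<alpha> i)"]
 show ?thesis unfolding sum_distrib_left E bump_def[symmetric] .
qed

lemma partial_deriv_bump: "l > 0 ==> partial_deriv i (bump l c \<alpha>) = bump l c (incr \<alpha> i)"
proof
 fix x assume "l > 0"
 hence "frechet_derivative (bump l c \<alpha>) (at x) = (\<lambda>h. \<Sum>i\<in>UNIV. h $ i * bump l c (incr \<alpha> i) x)"
  by (intro frechet_derivative_at[OF bump_has_derivative, symmetric])
 thus "partial_deriv i (bump l c \<alpha>) x = bump l c (incr \<alpha> i) x"
  by (simp add: partial_deriv_def axis_def if_distrib[where f="\<lambda>t. t * _"] if_distrib[where f="\<lambda>t. _ * t"] cong: if_cong)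
qed

lemma foldr_partial_deriv_bump:
 "l > 0 ==> foldr partial_deriv is (bump l c \<alpha>) = bump l c (\<lambda>i. \<alpha> i + count_list is i)"
proof (induction "is")
 case (Cons j js)
 have "incr (\<lambda>i. \<alpha> i + count_list js i) j = (\<lambda>i. \<alpha> i + count_list (j # js) i)"
  by (auto simp: incr_def)
 with Cons show ?case by (simp add: partial_deriv_bump)
qed simp

lemma bump_support: "bump l c \<alpha> x \<noteq> 0 ==> l > 0 ==> x $ i \<in> {c $ i - l <..< c $ i + 2 * l}"
proof -
 assume "bump l c \<alpha> x \<noteq> 0" "l > 0"
 hence "psiD (\<alpha> i) ((x $ i - c $ i) / l) \<noteq> 0" unfolding bump_def by fastforce
 hence "\<not> ((x $ i - c $ i) / l \<le> -1 \<or> 2 \<le> (x $ i - c $ i) / l)" using psiD_support by blast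
 thus ?thesis using \<open>l > 0\<close> by (auto simp: field_simps)
qed

lemma bump_support_cbox: "l > 0 ==> {x. bump l c \<alpha> x \<noteq> 0} \<subseteq> cbox (\<chi> i. c $ i - l) (\<chi> i. c $ i + 2 * l)"
proof
 fix x assume "l > 0" "x \<in> {x. bump l c \<alpha> x \<noteq> 0}"
 hence "x $ i \<in> {c $ i - l <..< c $ i + 2 * l}" for i using bump_support by blast
 thus "x \<in> cbox (\<chi> i. c $ i - l) (\<chi> i. c $ i + 2 * l)"
  by (auto simp: mem_box_cart intro: less_imp_le)
qed

lemma bump_support_norm:
 fixes x :: "real ^ 'n::finite"
 assumes "bump l c \<alpha> x \<noteq> 0" "l > 0" shows "norm (x - c) < 2 * real CARD('n) * l"
proof -
 have "norm (x - c) \<le> (\<Sum>i\<in>UNIV. \<bar>(x - c) $ i\<bar>)" by (rule norm_le_l1_cart)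
 also have "\<dots> < (\<Sum>i\<in>(UNIV::'n set). 2 * l)"
 proof (intro sum_strict_mono)
  show "\<bar>(x - c) $ i\<bar> < 2 * l" for i
   using bump_support[OF assms, of i] assms(2) by (simp add: abs_if)
 qed auto
 finally show ?thesis by simp
qed

lemma bump_differentiable: "l > 0 ==> bump l c \<alpha> differentiable at x"
 using bump_has_derivative differentiable_def by blast

lemma bump_continuous: "l > 0 ==> continuous_on S (bump l c \<alpha>)"
 by (meson bump_differentiable continuous_at_imp_continuous_on differentiable_imp_continuous_within)

lemma test_function_bump: "l > 0 ==> test_function (bump l c \<alpha>)"
 unfolding test_function_def smooth_def
 using bump_support_cbox[of l c \<alpha>] 
 by (auto simp: foldr_partial_deriv_bump bump_differentiable compact_eq_bounded_closed
   intro: bounded_subset[OF bounded_cbox])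

lemma count_list_exists:
 fixes \<alpha> :: "'n::finite => nat" shows "\<exists>is. \<forall>i. count_list is i = \<alpha> i"
proof -
 have "count (Abs_multiset \<alpha>) = \<alpha>" by (rule count_Abs_multiset) simp
 then obtain M where "count M = \<alpha>" by blast
 moreover obtain xs where "mset xs = M" using ex_mset by blast
 ultimately show ?thesis by (metis count_mset)
qed

text \<open>Of the list picked by \<open>SOME\<close> only the number of occurrences of each index
  is known. Derivatives of bumps depend on nothing else (\<open>foldr_partial_deriv_bump\<close>),
  so every choice leads to the same formula.\<close>

lemma multi_deriv_eq:
 obtains "is" where "\<And>i. count_list is i = \<alpha> i" "length is = (\<Sum>i\<in>UNIV. \<alpha> i)"
  "\<And>\<phi>. multi_deriv \<alpha> \<phi> = foldr partial_deriv is \<phi>"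
proof -
 let ?is = "SOME is. \<forall>i. count_list is i = \<alpha> i"
 have c: "\<forall>i. count_list ?is i = \<alpha> i" using someI_ex[OF count_list_exists] .
 have n: "i \<notin> set ?is ==> \<alpha> i = 0" for i using c by (metis count_list_0_iff)
 have "length ?is = (\<Sum>i\<in>set ?is. count_list ?is i)" by (simp add: sum_count_set)
 also have "\<dots> = (\<Sum>i\<in>UNIV. \<alpha> i)" using c
  by (intro sum.mono_neutral_cong_left) (auto simp: n)
 finally show ?thesis using that[of ?is] c by (auto simp: multi_deriv_def)
qed

lemma multi_deriv_bump: "l > 0 ==> multi_deriv \<alpha> (bump l c \<beta>) = bump l c (\<lambda>i. \<beta> i + \<alpha> i)"
 by (rule multi_deriv_eq[of \<alpha>]) (simp add: foldr_partial_deriv_bump)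

text \<open>All bumps are rescaled translates of one function, each derivative costing a factor 1/l,
  so the constant is uniform in l and c.\<close>

lemma bump_bounded:
 fixes \<alpha> :: "'n::finite => nat"
 obtains K where "0 < K" "\<And>l c x. 0 < l ==> \<bar>bump l c \<alpha> x\<bar> \<le> K * (1 / l) ^ (\<Sum>i\<in>UNIV. \<alpha> i)"
proof -
 obtain B where B: "\<And>m. B m > 0" "\<And>m x. \<bar>psiD m x\<bar> \<le> B m"
  using psiD_bounded by metis
 show ?thesis
 proof (rule that[of "\<Prod>i\<in>UNIV. B (\<alpha> i)"])
  show "0 < (\<Prod>i\<in>UNIV. B (\<alpha> i))" by (simp add: B prod_pos)
  fix l :: real and c x :: "real^'n" assume "0 < l"
  have "(\<Prod>i\<in>UNIV. \<bar>psiD (\<alpha> i) ((x $ i - c $ i) / l)\<bar>) \<le> (\<Prod>i\<in>UNIV. B (\<alpha> i))"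
   by (intro prod_mono) (simp add: B)
  thus "\<bar>bump l c \<alpha> x\<bar> \<le> (\<Prod>i\<in>UNIV. B (\<alpha> i)) * (1 / l) ^ (\<Sum>i\<in>UNIV. \<alpha> i)"
   using \<open>0 < l\<close> unfolding bump_def abs_mult abs_prod
   by (subst mult.commute) (auto intro!: mult_right_mono)
 qed
qed

subsection \<open>Translations, dilations and averages\<close>

lemma nn_integral_lborel_affine:
 fixes t :: "'a::euclidean_space"
 assumes [measurable]: "f \<in> borel_fun" and c: "c \<noteq> 0"
 shows "(\<integral>+ x. f x) = ennreal (\<bar>c\<bar> ^ DIM('a)) * (\<integral>+ x. f (t + c *\<^sub>R x))"
 by (subst lborel_affine[OF c, of t])
   (simp add: nn_integral_density nn_integral_distr nn_integral_cmult ennreal_power)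

lemma nn_integral_lborel_translate:
 fixes t :: "'a::euclidean_space"
 assumes "f \<in> borel_fun"
 shows "(\<integral>+ x. f (x + t)) = (\<integral>+ x. f x)"
 using nn_integral_lborel_affine[OF assms, of 1 t] by (simp add: add.commute)

lemma AE_lborel_affine:
 fixes t :: "'a::euclidean_space"
 assumes c: "c \<noteq> 0" and ae: "AE x in lborel. P x"
 shows "AE x in lborel. P (t + c *\<^sub>R x)"
proof -
 obtain N where N: "{x. \<not> P x} \<subseteq> N" "emeasure lborel N = 0" "N \<in> sets borel"
  using AE_E[OF ae] by auto
 have "emeasure lborel N = ennreal (\<bar>c\<bar> ^ DIM('a)) * (\<integral>+ x. indicator N (t + c *\<^sub>R x))"
  using nn_integral_lborel_affine[of "indicator N :: 'a => ennreal" c t] N(3) c by simp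
 hence "(\<integral>+ x. indicator N (t + c *\<^sub>R x)) = 0"
  using N(2) c by simp
 hence "AE x in lborel. indicator N (t + c *\<^sub>R x) = (0::ennreal)"
  using N(3) by (subst (asm) nn_integral_0_iff_AE) auto
 thus ?thesis using N(1) by (auto elim!: eventually_mono simp: indicator_def split: if_splits)
qed

lemma emeasure_ball_scale:
 fixes x y :: "'a::euclidean_space"
 assumes "0 \<le> c" "0 \<le> r"
 shows "emeasure lborel (ball x (c * r)) = ennreal (c ^ DIM('a)) * emeasure lborel (ball y r)"
 using assms by (simp add: emeasure_ball power_mult_distrib mult_ac flip: ennreal_mult')

lemma emeasure_ball_pos_finite:
 fixes x :: "'a::euclidean_space"
 assumes "0 < r"
 shows "0 < emeasure lborel (ball x r)" "emeasure lborel (ball x r) < \<infinity>"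
 using assms by (auto simp: emeasure_ball unit_ball_vol_pos)

lemma ball_in_sets_borel[measurable]: "ball x r \<in> sets borel"
 by simp

text \<open>\<open>V m\<close> consists of the points of U at distance at least 1/(m+1) from the
  complement, and these sets exhaust U. If a shift by less than 1/(m+1) changes membership in U,
  then whichever of x and x + v lies in U belongs to U - \<open>V m\<close>, a set of small
  measure.\<close>

lemma translate_indicator_L1:
 fixes U :: "'a::euclidean_space set"
 assumes U: "open U" and fin: "emeasure lborel U < \<infinity>" and e: "0 < e"
 shows "\<exists>d>0. \<forall>v. norm v < d \<longrightarrow> (\<integral>+ x. ennreal \<bar>indicator U (x + v) - indicator U x\<bar>) \<le> ennreal e"
proof -
 have [measurable]: "U \<in> sets borel" using U by simp
 define V where "V m = {x. ball x (1 / real (Suc m)) \<subseteq> U}" for m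
 have "- V m = (\<Union>y\<in>- U. ball y (1 / real (Suc m)))" for m
  unfolding V_def by (auto simp: dist_commute)
 hence "open (- V m)" for m by (metis open_UN open_ball)
 hence [measurable]: "V m \<in> sets borel" for m by (metis borel_closed closed_def)
 have "(\<lambda>m. emeasure lborel (U - V m)) \<longlonglongrightarrow> emeasure lborel (\<Inter>m. U - V m)"
 proof (rule Lim_emeasure_decseq)
  show "decseq (\<lambda>m. U - V m)"
  proof (rule decseq_SucI)
   fix m
   have "ball x (1 / real (Suc (Suc m))) \<subseteq> ball x (1 / real (Suc m))" for x :: 'a
    by (rule subset_ball) (simp add: divide_simps)
   thus "U - V (Suc m) \<subseteq> U - V m" unfolding V_def by blast
  qed
  show "emeasure lborel (U - V m) \<noteq> \<infinity>" for m
   using fin emeasure_mono[of "U - V m" U lborel] by (auto simp: top_unique less_top)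
 qed auto
 moreover have empty: "(\<Inter>m. U - V m) = {}"
 proof -
  have "\<exists>m. x \<in> V m" if "x \<in> U" for x
  proof -
   obtain r where r: "r > 0" "ball x r \<subseteq> U" using U \<open>x \<in> U\<close> openE by blast
   obtain m where "1 / real (Suc m) < r" using r(1) nat_approx_posE by blast
   hence "ball x (1 / real (Suc m)) \<subseteq> U" using r(2) subset_ball[of "1 / real (Suc m)" r x] by auto
   thus ?thesis unfolding V_def by blast
  qed
  thus ?thesis by blast
 qed
 ultimately have "(\<lambda>m. emeasure lborel (U - V m)) \<longlonglongrightarrow> 0" by (simp only: emeasure_empty)
 hence "\<forall>\<^sub>F m in sequentially. emeasure lborel (U - V m) < ennreal (e / 2)"
  using e by (intro order_tendstoD) auto
 then obtain m where m: "emeasure lborel (U - V m) < ennreal (e / 2)"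
  by (auto simp: eventually_sequentially)
 have "(\<integral>+ x. ennreal \<bar>indicator U (x + v) - indicator U x\<bar>) \<le> ennreal e"
  if v: "norm v < 1 / real (Suc m)" for v
 proof -
  have "\<bar>indicator U (x + v) - indicator U x\<bar> \<le> (indicator (U - V m) (x + v) + indicator (U - V m) x :: real)" for x
  proof (cases "x \<in> U \<longleftrightarrow> x + v \<in> U")
   case True thus ?thesis by (auto simp: indicator_def)
  next
   case False
   have "x \<in> ball (x + v) (1 / real (Suc m))" "x + v \<in> ball x (1 / real (Suc m))"
    using v by (auto simp: dist_norm)
   thus ?thesis using False unfolding V_def by (auto simp: indicator_def)
  qed
  hence "(\<integral>+ x. ennreal \<bar>indicator U (x + v) - indicator U x\<bar>)
    \<le> (\<integral>+ x. indicator (U - V m) (x + v) + indicator (U - V m) x)"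
  proof (intro nn_integral_mono)
   fix x assume *: "\<And>x. \<bar>indicator U (x + v) - indicator U x\<bar> \<le> (indicator (U - V m) (x + v) + indicator (U - V m) x :: real)"
   show "ennreal \<bar>indicator U (x + v) - indicator U x\<bar> \<le> indicator (U - V m) (x + v) + indicator (U - V m) x"
    using ennreal_leI[OF *[of x]] by (simp add: ennreal_plus ennreal_indicator)
  qed
  also have "\<dots> = (\<integral>+ x. indicator (U - V m) (x + v)) + (\<integral>+ x. indicator (U - V m) x)"
   by (rule nn_integral_add) auto
  also have "(\<integral>+ x. indicator (U - V m) (x + v)) = (\<integral>+ x. indicator (U - V m) x)"
   by (rule nn_integral_lborel_translate) auto
  also have "(\<integral>+ x. indicator (U - V m) x) + (\<integral>+ x. indicator (U - V m) x)
    \<le> ennreal (e / 2) + ennreal (e / 2)" using m by (intro add_mono) auto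
  also have "\<dots> = ennreal e" using e by (simp flip: ennreal_plus)
  finally show ?thesis .
 qed
 thus ?thesis by (intro exI[of _ "1 / real (Suc m)"]) simp
qed

lemma nn_integral_abs_triangle:
 fixes f g h :: "'a => real"
 assumes [measurable]: "f \<in> borel_measurable M" "g \<in> borel_measurable M" "h \<in> borel_measurable M"
 shows "(\<integral>\<^sup>+x. ennreal \<bar>f x - h x\<bar> \<partial>M) \<le> (\<integral>\<^sup>+x. ennreal \<bar>f x - g x\<bar> \<partial>M) + (\<integral>\<^sup>+x. ennreal \<bar>g x - h x\<bar> \<partial>M)"
proof -
 have "(\<integral>\<^sup>+x. ennreal \<bar>f x - h x\<bar> \<partial>M) \<le> (\<integral>\<^sup>+x. ennreal \<bar>f x - g x\<bar> + ennreal \<bar>g x - h x\<bar> \<partial>M)"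
  by (intro nn_integral_mono) (simp flip: ennreal_plus)
 also have "\<dots> = (\<integral>\<^sup>+x. ennreal \<bar>f x - g x\<bar> \<partial>M) + (\<integral>\<^sup>+x. ennreal \<bar>g x - h x\<bar> \<partial>M)"
  by (rule nn_integral_add) auto
 finally show ?thesis .
qed

text \<open>Three errors of e/3 each; the error of the shifted pair equals that of the unshifted
  pair by translation invariance.\<close>

lemma translate_L1_approx:
 fixes f g :: "'a::euclidean_space => real"
 assumes [measurable]: "f \<in> borel_fun" "g \<in> borel_fun"
  and e: "0 < e" and fg: "(\<integral>+ x. ennreal \<bar>f x - g x\<bar>) \<le> ennreal (e / 3)"
  and g: "(\<integral>+ x. ennreal \<bar>g (x + v) - g x\<bar>) \<le> ennreal (e / 3)"
 shows "(\<integral>+ x. ennreal \<bar>f (x + v) - f x\<bar>) \<le> ennreal e"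
proof -
 let ?D = "\<lambda>f g. (\<integral>+ x. ennreal \<bar>f x - g x\<bar>)"
 have 1: "?D (\<lambda>x. f (x + v)) f \<le> ?D (\<lambda>x. f (x + v)) (\<lambda>x. g (x + v)) + ?D (\<lambda>x. g (x + v)) f"
  by (rule nn_integral_abs_triangle) auto
 have 2: "?D (\<lambda>x. g (x + v)) f \<le> ?D (\<lambda>x. g (x + v)) g + ?D g f"
  by (rule nn_integral_abs_triangle) auto
 have 3: "?D g f = ?D f g" by (simp add: abs_minus_commute)
 have 4: "?D (\<lambda>x. f (x + v)) (\<lambda>x. g (x + v)) = ?D f g"
  using nn_integral_lborel_translate[of "\<lambda>x. ennreal \<bar>f x - g x\<bar>" v] by simp
 note 1
 also have "?D (\<lambda>x. f (x + v)) (\<lambda>x. g (x + v)) + ?D (\<lambda>x. g (x + v)) f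
  \<le> ennreal (e / 3) + (ennreal (e / 3) + ennreal (e / 3))"
  unfolding 4 by (intro add_mono fg order_trans[OF 2]) (use g fg 3 in auto)
 also have "\<dots> = ennreal e" using e by (simp flip: ennreal_plus)
 finally show ?thesis .
qed

text \<open>Induction over integrable functions: a Borel set of finite measure is approximated from
  outside by an open set, which \<open>translate_indicator_L1\<close> covers; sums add up; limits
  follow by dominated convergence and \<open>translate_L1_approx\<close>.\<close>

lemma translate_L1:
 fixes f :: "'a::euclidean_space => real"
 assumes "integrable lborel f"
 shows "\<forall>e>0. \<exists>d>0. \<forall>v. norm v < d \<longrightarrow> (\<integral>+ x. ennreal \<bar>f (x + v) - f x\<bar>) \<le> ennreal e"
 using assms
proof (induction rule: integrable_induct)
 case (base A c)
 have A[measurable]: "A \<in> sets borel" using base by simp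
 show ?case
 proof (intro allI impI)
  fix e :: real assume e: "e > 0"
  \<comment> \<open>The added 1 keeps the quotient meaningful for c = 0.\<close>
  define e' where "e' = e / (\<bar>c\<bar> + 1)"
  have e': "e' > 0" using e by (simp add: e'_def)
  obtain U where U: "open U" "A \<subseteq> U" "emeasure lborel (U - A) < ennreal (e' / 3)"
   using outer_regular_lborel[OF A, of "e' / 3"] e' by auto
  have [measurable]: "U \<in> sets borel" using U by simp
  have "emeasure lborel U \<le> emeasure lborel A + emeasure lborel (U - A)"
   using emeasure_subadditive[of A lborel "U - A"] U(2) by (simp add: Un_absorb1)
  also have "\<dots> < \<infinity>" using base less_trans[OF U(3) ennreal_less_top] by simp
  finally have finU: "emeasure lborel U < \<infinity>" .
  obtain d where d: "d > 0" "\<And>v. norm v < d ==> (\<integral>+ x. ennreal \<bar>indicator U (x + v) - indicator U x\<bar>) \<le> ennreal (e' / 3)"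
   using translate_indicator_L1[OF U(1) finU, of "e' / 3"] e' by auto
  have "(\<integral>+ x. ennreal \<bar>indicator A (x + v) *\<^sub>R c - indicator A x *\<^sub>R c\<bar>) \<le> ennreal e" if v: "norm v < d" for v
  proof -
   have 1: "(\<integral>+ x. ennreal \<bar>indicator A x - indicator U x\<bar>) = emeasure lborel (U - A)"
   proof -
    have "(\<integral>+ x. ennreal \<bar>indicator A x - indicator U x\<bar>) = (\<integral>+ x. indicator (U - A) x)"
     using U(2) by (intro nn_integral_cong) (auto simp: indicator_def)
    thus ?thesis by (simp add: nn_integral_indicator)
   qed
   have 2: "(\<integral>+ x. ennreal \<bar>indicator A (x + v) - indicator A x\<bar>) \<le> ennreal e'"
   proof (rule translate_L1_approx[where g="indicator U"])
    show "(\<integral>+ x. ennreal \<bar>indicator A x - indicator U x\<bar>) \<le> ennreal (e' / 3)"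
     unfolding 1 using U(3) by (rule less_imp_le)
   qed (use d(2)[OF v] e' in auto)
   have "(\<integral>+ x. ennreal \<bar>indicator A (x + v) *\<^sub>R c - indicator A x *\<^sub>R c\<bar>)
    = (\<integral>+ x. ennreal \<bar>c\<bar> * ennreal \<bar>indicator A (x + v) - indicator A x\<bar>)"
   proof (intro nn_integral_cong)
    fix x
    have "\<bar>indicator A (x + v) *\<^sub>R c - indicator A x *\<^sub>R c\<bar> = \<bar>c\<bar> * \<bar>indicator A (x + v) - indicator A x\<bar>"
     unfolding abs_mult[symmetric] by (simp add: algebra_simps)
    thus "ennreal \<bar>indicator A (x + v) *\<^sub>R c - indicator A x *\<^sub>R c\<bar> = ennreal \<bar>c\<bar> * ennreal \<bar>indicator A (x + v) - indicator A x\<bar>"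
     by (simp only: ennreal_mult'[symmetric] abs_ge_zero)
   qed
   also have "\<dots> = ennreal \<bar>c\<bar> * (\<integral>+ x. ennreal \<bar>indicator A (x + v) - indicator A x\<bar>)"
    by (rule nn_integral_cmult) auto
   also have "\<dots> \<le> ennreal \<bar>c\<bar> * ennreal e'" by (intro mult_left_mono 2) simp
   also have "\<dots> \<le> ennreal e" using e by (auto simp: e'_def field_simps simp flip: ennreal_mult' intro!: ennreal_leI)
   finally show ?thesis .
  qed
  thus "\<exists>d>0. \<forall>v. norm v < d \<longrightarrow> (\<integral>+ x. ennreal \<bar>indicator A (x + v) *\<^sub>R c - indicator A x *\<^sub>R c\<bar>) \<le> ennreal e"
   using d(1) by blast
 qed
next
 case (add f g)
 note [measurable] = borel_measurable_integrable[OF add.hyps(1)] borel_measurable_integrable[OF add.hyps(2)]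
 show ?case
 proof (intro allI impI)
  fix e :: real assume e: "e > 0"
  obtain d1 where d1: "d1 > 0" "\<And>v. norm v < d1 ==> (\<integral>+ x. ennreal \<bar>f (x + v) - f x\<bar>) \<le> ennreal (e / 2)"
   using add.IH(1)[rule_format, of "e / 2"] e by auto
  obtain d2 where d2: "d2 > 0" "\<And>v. norm v < d2 ==> (\<integral>+ x. ennreal \<bar>g (x + v) - g x\<bar>) \<le> ennreal (e / 2)"
   using add.IH(2)[rule_format, of "e / 2"] e by auto
  have "(\<integral>+ x. ennreal \<bar>f (x + v) + g (x + v) - (f x + g x)\<bar>) \<le> ennreal e" if "norm v < min d1 d2" for v
  proof -
   have "(\<integral>+ x. ennreal \<bar>f (x + v) + g (x + v) - (f x + g x)\<bar>)
    \<le> (\<integral>+ x. ennreal \<bar>f (x + v) - f x\<bar> + ennreal \<bar>g (x + v) - g x\<bar>)"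
    by (intro nn_integral_mono) (simp flip: ennreal_plus)
   also have "\<dots> = (\<integral>+ x. ennreal \<bar>f (x + v) - f x\<bar>) + (\<integral>+ x. ennreal \<bar>g (x + v) - g x\<bar>)"
    by (rule nn_integral_add) auto
   also have "\<dots> \<le> ennreal (e / 2) + ennreal (e / 2)"
    using that by (intro add_mono d1 d2) auto
   also have "\<dots> = ennreal e" using e by (simp flip: ennreal_plus)
   finally show ?thesis .
  qed
  thus "\<exists>d>0. \<forall>v. norm v < d \<longrightarrow> (\<integral>+ x. ennreal \<bar>f (x + v) + g (x + v) - (f x + g x)\<bar>) \<le> ennreal e"
   using d1(1) d2(1) by (intro exI[of _ "min d1 d2"]) simp
 qed
next
 case (lim f s)
 note [measurable] = borel_measurable_integrable[OF lim.hyps(1)] borel_measurable_integrable[OF lim.hyps(4)]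
 show ?case
 proof (intro allI impI)
  fix e :: real assume e: "e > 0"
  have "(\<lambda>i. (\<integral>+ x. ennreal (norm (f x - s i x)))) \<longlonglongrightarrow> 0"
  proof (rule nn_integral_dominated_convergence_norm[where w="\<lambda>x. 2 * norm (f x)"])
   show "AE x in lborel. (\<lambda>i. s i x) \<longlonglongrightarrow> f x" using lim.hyps by auto
   show "AE x in lborel. norm (s j x) \<le> 2 * norm (f x)" for j using lim.hyps by auto
   have "integrable lborel (\<lambda>x. 2 * norm (f x))" using lim.hyps by auto
   thus "(\<integral>+ x. ennreal (2 * norm (f x))) < \<infinity>" unfolding integrable_iff_bounded by (simp add: abs_mult)
  qed auto
  hence "\<forall>\<^sub>F i in sequentially. (\<integral>+ x. ennreal (norm (f x - s i x))) < ennreal (e / 3)"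
   using e by (intro order_tendstoD) auto
  then obtain i where i: "(\<integral>+ x. ennreal \<bar>f x - s i x\<bar>) \<le> ennreal (e / 3)"
   by (auto simp: eventually_sequentially intro: less_imp_le)
  obtain d where d: "d > 0" "\<And>v. norm v < d ==> (\<integral>+ x. ennreal \<bar>s i (x + v) - s i x\<bar>) \<le> ennreal (e / 3)"
   using lim.IH[of i, rule_format, of "e / 3"] e by auto
  show "\<exists>d>0. \<forall>v. norm v < d \<longrightarrow> (\<integral>+ x. ennreal \<bar>f (x + v) - f x\<bar>) \<le> ennreal e"
  proof (intro exI[of _ d] conjI allI impI d(1))
   fix v :: 'a assume "norm v < d"
   from translate_L1_approx[OF _ _ e i d(2)[OF this]]
   show "(\<integral>+ x. ennreal \<bar>f (x + v) - f x\<bar>) \<le> ennreal e" by simp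
  qed
 qed
qed

text \<open>The Borel form of \<open>L1_loc\<close>. The estimates are proved for Borel
  representatives with respect to \<open>lborel\<close>, where Fubini and affine substitutions
  preserve measurability, and are transferred by \<open>L1_loc_iff_loc_int\<close>. Balls around the
  origin exhaust all bounded sets.\<close>

definition loc_int :: "('a::euclidean_space => real) => bool" where
 "loc_int f \<longleftrightarrow> f \<in> borel_fun \<and> (\<forall>r. (\<integral>+ x. ennreal \<bar>f x\<bar> * indicator (ball 0 r) x) < \<infinity>)"

lemma loc_int_measurable[measurable_dest]: "loc_int f ==> f \<in> borel_fun"
 by (simp add: loc_int_def)

lemma loc_int_bounded:
 fixes f :: "'a::euclidean_space => real"
 assumes "loc_int f" "bounded A" shows "(\<integral>+ x. ennreal \<bar>f x\<bar> * indicator A x) < \<infinity>"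
proof -
 obtain r where "A \<subseteq> ball 0 r" using bounded_subset_ballD[OF assms(2)] by blast
 hence "(\<integral>+ x. ennreal \<bar>f x\<bar> * indicator A x) \<le> (\<integral>+ x. ennreal \<bar>f x\<bar> * indicator (ball 0 r) x)"
  by (intro nn_integral_mono) (auto simp: indicator_def)
 also have "\<dots> < \<infinity>" using assms(1) by (simp add: loc_int_def)
 finally show ?thesis .
qed

lemma loc_int_mult_integrable:
 fixes f K :: "'a::euclidean_space => real"
 assumes f: "loc_int f" and [measurable]: "K \<in> borel_fun" and "bounded {x. K x \<noteq> 0}"
  and B: "\<And>x. \<bar>K x\<bar> \<le> B"
 shows "integrable lborel (\<lambda>x. f x * K x)"
proof -
 note loc_int_measurable[OF f, measurable]
 obtain r where r: "{x. K x \<noteq> 0} \<subseteq> ball 0 r" using bounded_subset_ballD[OF assms(3)] by blast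
 have "B \<ge> 0" using B[of undefined] by linarith
 have "(\<integral>+ x. ennreal (norm (f x * K x))) \<le> (\<integral>+ x. ennreal B * (ennreal \<bar>f x\<bar> * indicator (ball 0 r) x))"
 proof (intro nn_integral_mono)
  fix x
  show "ennreal (norm (f x * K x)) \<le> ennreal B * (ennreal \<bar>f x\<bar> * indicator (ball 0 r) x)"
  proof (cases "K x = 0")
   case False
   hence "x \<in> ball 0 r" using r by blast
   moreover have "\<bar>f x * K x\<bar> \<le> B * \<bar>f x\<bar>"
    unfolding abs_mult by (subst mult.commute) (intro mult_right_mono B abs_ge_zero)
   ultimately show ?thesis using \<open>B \<ge> 0\<close> by (auto intro!: ennreal_leI simp flip: ennreal_mult')
  qed simp
 qed
 also have "\<dots> = ennreal B * (\<integral>+ x. ennreal \<bar>f x\<bar> * indicator (ball 0 r) x)"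
  by (rule nn_integral_cmult) auto
 also have "\<dots> < \<infinity>" using loc_int_bounded[OF f bounded_ball, of 0 r] by (simp add: ennreal_mult_less_top)
 finally show ?thesis unfolding integrable_iff_bounded by simp
qed

lemma loc_int_affine:
 fixes f :: "'a::euclidean_space => real"
 assumes f: "loc_int f" and c: "c \<noteq> 0" shows "loc_int (\<lambda>x. f (t + c *\<^sub>R x))"
proof -
 note loc_int_measurable[OF f, measurable]
 have "(\<integral>+ x. ennreal \<bar>f (t + c *\<^sub>R x)\<bar> * indicator (ball 0 r) x) < \<infinity>" for r
 proof -
  define h where "h y = ennreal \<bar>f y\<bar> * indicator (ball t (\<bar>c\<bar> * r)) y" for y
  have [measurable]: "h \<in> borel_fun" unfolding h_def by simp
  have "h (t + c *\<^sub>R x) = ennreal \<bar>f (t + c *\<^sub>R x)\<bar> * indicator (ball 0 r) x" for x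
   using c by (auto simp: h_def indicator_def dist_norm)
  moreover have "(\<integral>+ x. h x) < \<infinity>" unfolding h_def by (rule loc_int_bounded[OF f bounded_ball])
  hence "ennreal (\<bar>c\<bar> ^ DIM('a)) * (\<integral>+ x. h (t + c *\<^sub>R x)) < \<infinity>"
   using nn_integral_lborel_affine[of h c t] c by simp
  hence "(\<integral>+ x. h (t + c *\<^sub>R x)) < \<infinity>"
   using c by (auto simp: ennreal_mult_less_top)
  ultimately show ?thesis by simp
 qed
 thus ?thesis by (simp add: loc_int_def)
qed

text \<open>K = \<open>ballW\<close> gives the mean over the ball of radius t around y, K =
  \<open>eta\<close> a mollification at scale t. Ball means lead to maximal functions,
  mollifications are smooth; the proof combines both.\<close>

definition smear :: "('a::euclidean_space => real) => ('a => real) => real => 'a => real" where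
 "smear K f t y = (\<integral>z. f (y + t *\<^sub>R z) * K z \<partial>lborel)"

definition avg_kernel :: "('a::euclidean_space => real) => bool" where
 "avg_kernel K \<longleftrightarrow> K \<in> borel_fun \<and> bounded {x. K x \<noteq> 0} \<and> (\<exists>B. \<forall>x. \<bar>K x\<bar> \<le> B)
   \<and> (\<forall>x. 0 \<le> K x) \<and> (\<integral>+ x. ennreal (K x)) = 1"

lemma avg_kernelD:
 fixes K :: "'a::euclidean_space => real"
 assumes "avg_kernel K"
 shows "K \<in> borel_fun" "bounded {x. K x \<noteq> 0}" "0 \<le> K x" "(\<integral>+ x. ennreal (K x)) = 1"
  "integrable lborel K" "(\<integral>x. K x \<partial>lborel) = 1"
proof -
 show m[measurable]: "K \<in> borel_fun" and "bounded {x. K x \<noteq> 0}" and nn: "0 \<le> K x"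
  and 1: "(\<integral>+ x. ennreal (K x)) = 1" for x using assms by (auto simp: avg_kernel_def)
 show i: "integrable lborel K" unfolding integrable_iff_bounded using nn 1 by simp
 show "(\<integral>x. K x \<partial>lborel) = 1" using 1 nn by (subst integral_eq_nn_integral) auto
qed

lemma smear_integrable:
 fixes f K :: "'a::euclidean_space => real"
 assumes "avg_kernel K" "loc_int f" "t \<noteq> 0"
 shows "integrable lborel (\<lambda>z. f (y + t *\<^sub>R z) * K z)"
proof -
 obtain B where "\<And>x. \<bar>K x\<bar> \<le> B" using assms(1) unfolding avg_kernel_def by blast
 thus ?thesis using assms(1)
  by (intro loc_int_mult_integrable[OF loc_int_affine[OF assms(2,3)], where B=B]) (auto simp: avg_kernel_def)
qed

lemma smear_measurable[measurable]:
 fixes f K :: "'a::euclidean_space => real"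
 assumes [measurable]: "f \<in> borel_fun" "K \<in> borel_fun"
 shows "smear K f t \<in> borel_fun"
 unfolding smear_def[abs_def] by measurable

text \<open>By Fubini the error is at most a mean over z of the L1 distance between f and its
  translate by t z, which \<open>translate_L1\<close> makes small uniformly over the bounded support
  of K.\<close>

lemma smear_L1_loc:
 fixes f K :: "'a::euclidean_space => real"
 assumes K: "avg_kernel K" and f: "loc_int f" and e: "0 < e"
 shows "\<exists>d>0. \<forall>t. 0 < t \<and> t < d \<longrightarrow>
  (\<integral>+ x. ennreal \<bar>smear K f t x - f x\<bar> * indicator (ball 0 r) x) \<le> ennreal e"
proof -
 have [measurable]: "f \<in> borel_fun" "K \<in> borel_fun"
  using f K by (auto simp: loc_int_def avg_kernel_def)
 obtain \<rho> where \<rho>: "\<rho> > 0" "{x. K x \<noteq> 0} \<subseteq> ball 0 \<rho>"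
  using bounded_subset_ballD[of "{x. K x \<noteq> 0}" 0] avg_kernelD(2)[OF K] by blast
 \<comment> \<open>f is only locally integrable. Cutting it off at radius r + 1 changes nothing for
   points of the ball of radius r shifted by less than 1, whence the bound \<open>min d 1\<close> on
   the shifts.\<close>
 define g where "g x = f x * indicator (ball 0 (r + 1)) x" for x
 have [measurable]: "g \<in> borel_fun" unfolding g_def by simp
 have gi: "integrable lborel g" unfolding g_def
  by (rule loc_int_mult_integrable[OF f, where B=1]) (auto simp: indicator_def intro: bounded_subset[OF bounded_ball[of 0 "r+1"]])
 then obtain d where d: "d > 0" "\<And>v. norm v < d ==> (\<integral>+ x. ennreal \<bar>g (x + v) - g x\<bar>) \<le> ennreal e"
  using translate_L1[OF gi, rule_format, OF e] by auto
 have "(\<integral>+ x. ennreal \<bar>smear K f t x - f x\<bar> * indicator (ball 0 r) x) \<le> ennreal e"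
  if t: "0 < t" "t < min d 1 / \<rho>" for t
 proof -
  have tz: "norm (t *\<^sub>R z) < min d 1" if "K z \<noteq> 0" for z
  proof -
   have "norm z < \<rho>" using \<rho>(2) that by auto
   hence "norm (t *\<^sub>R z) \<le> t * \<rho>" using t by simp
   also have "\<dots> < min d 1" using t(2) \<rho>(1) by (simp add: field_simps)
   finally show ?thesis .
  qed
  have "(\<integral>+ x. ennreal \<bar>smear K f t x - f x\<bar> * indicator (ball 0 r) x)
   \<le> (\<integral>\<^sup>+x. (\<integral>+ z. ennreal (K z) * ennreal \<bar>g (x + t *\<^sub>R z) - g x\<bar>) \<partial>lborel)"
  proof (intro nn_integral_mono)
   fix x
   show "ennreal \<bar>smear K f t x - f x\<bar> * indicator (ball 0 r) x
    \<le> (\<integral>+ z. ennreal (K z) * ennreal \<bar>g (x + t *\<^sub>R z) - g x\<bar>)"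
   proof (cases "x \<in> ball 0 r")
    case True
    have i1: "integrable lborel (\<lambda>z. f (x + t *\<^sub>R z) * K z)" by (rule smear_integrable[OF K f]) (use t in simp)
    have i2: "integrable lborel (\<lambda>z. f x * K z)" using avg_kernelD(5)[OF K] by simp
    have "smear K f t x - f x = (\<integral>z. f (x + t *\<^sub>R z) * K z - f x * K z \<partial>lborel)"
     unfolding smear_def using i1 i2 avg_kernelD(6)[OF K] by simp
    also have "ennreal \<bar>\<dots>\<bar> \<le> (\<integral>+ z. ennreal (norm (f (x + t *\<^sub>R z) * K z - f x * K z)))"
     using integral_norm_bound_ennreal[OF Bochner_Integration.integrable_diff[OF i1 i2]] by simp
    also have "\<dots> = (\<integral>+ z. ennreal (K z) * ennreal \<bar>g (x + t *\<^sub>R z) - g x\<bar>)"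
    proof (intro nn_integral_cong)
     fix z
     show "ennreal (norm (f (x + t *\<^sub>R z) * K z - f x * K z)) = ennreal (K z) * ennreal \<bar>g (x + t *\<^sub>R z) - g x\<bar>"
     proof (cases "K z = 0")
      case False
      have "norm (x + t *\<^sub>R z) < r + 1" using tz[OF False] True norm_triangle_ineq[of x "t *\<^sub>R z"] by auto
      hence "g (x + t *\<^sub>R z) = f (x + t *\<^sub>R z)" "g x = f x" using True by (auto simp: g_def)
      moreover have "\<bar>f (x + t *\<^sub>R z) * K z - f x * K z\<bar> = K z * \<bar>f (x + t *\<^sub>R z) - f x\<bar>"
       using avg_kernelD(3)[OF K, of z] unfolding left_diff_distrib[symmetric] abs_mult by simp
      ultimately show ?thesis using avg_kernelD(3)[OF K, of z] by (simp add: ennreal_mult')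
     qed simp
    qed
    finally show ?thesis using True by simp
   qed simp
  qed
  also have "\<dots> = (\<integral>\<^sup>+z. (\<integral>+ x. ennreal (K z) * ennreal \<bar>g (x + t *\<^sub>R z) - g x\<bar>) \<partial>lborel)"
   by (rule lborel_pair.Fubini') simp
  also have "\<dots> \<le> (\<integral>+ z. ennreal (K z) * ennreal e)"
  proof (intro nn_integral_mono)
   fix z
   show "(\<integral>+ x. ennreal (K z) * ennreal \<bar>g (x + t *\<^sub>R z) - g x\<bar>) \<le> ennreal (K z) * ennreal e"
   proof (cases "K z = 0")
    case False
    have "(\<integral>+ x. ennreal (K z) * ennreal \<bar>g (x + t *\<^sub>R z) - g x\<bar>)
     = ennreal (K z) * (\<integral>+ x. ennreal \<bar>g (x + t *\<^sub>R z) - g x\<bar>)" by (rule nn_integral_cmult) simp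
    also have "\<dots> \<le> ennreal (K z) * ennreal e" using tz[OF False] by (intro mult_left_mono d(2)) auto
    finally show ?thesis .
   qed simp
  qed
  also have "\<dots> = ennreal e" using avg_kernelD(4)[OF K] by (simp add: nn_integral_multc)
  finally show ?thesis .
 qed
 thus ?thesis using d(1) \<rho>(1) by (intro exI[of _ "min d 1 / \<rho>"]) auto
qed

subsection \<open>Differentiation and integration\<close>

lemma continuous_compact_support_bounded:
 fixes w :: "'a::euclidean_space => real"
 assumes "continuous_on UNIV w" "bounded {x. w x \<noteq> 0}"
 obtains B where "\<And>x. \<bar>w x\<bar> \<le> B"
proof -
 obtain r where r: "{x. w x \<noteq> 0} \<subseteq> ball 0 r" using bounded_subset_ballD[OF assms(2)] by blast
 have "compact (w ` cball 0 r)"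
  by (intro compact_continuous_image continuous_on_subset[OF assms(1)]) auto
 then obtain B where B: "\<forall>y\<in>w ` cball 0 r. norm y \<le> B"
  using compact_imp_bounded bounded_iff by blast
 have "\<bar>w x\<bar> \<le> max B 0" for x
 proof (cases "w x = 0")
  case False
  hence "x \<in> cball 0 r" using r by auto
  thus ?thesis using B by (auto simp: le_max_iff_disj)
 qed simp
 thus ?thesis by (rule that)
qed

lemma loc_int_1: "loc_int (\<lambda>_::'a::euclidean_space. 1)"
proof -
 have "(\<integral>+ x. ennreal \<bar>1\<bar> * indicator (ball (0::'a) r) x) = emeasure lborel (ball (0::'a) r)" for r
  by simp
 thus ?thesis using emeasure_lborel_ball_finite[of "0::'a"] by (auto simp: loc_int_def)
qed

text \<open>Testing along a sequence suffices for the difference quotient, so dominated convergence applies.\<close>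

lemma DERIV_integral_translate:
 fixes f \<kappa> \<kappa>' :: "'a::euclidean_space => real" and p d :: 'a
 assumes f: "loc_int f" and c1: "continuous_on UNIV \<kappa>" and c2: "continuous_on UNIV \<kappa>'"
  and s1: "bounded {x. \<kappa> x \<noteq> 0}" and s2: "bounded {x. \<kappa>' x \<noteq> 0}"
  and der: "\<And>w u. ((\<lambda>u. \<kappa> (w - (p + u *\<^sub>R d))) has_real_derivative \<kappa>' (w - (p + u *\<^sub>R d))) (at u)"
 shows "((\<lambda>u. \<integral>w. f w * \<kappa> (w - (p + u *\<^sub>R d)) \<partial>lborel) has_real_derivative
     (\<integral>w. f w * \<kappa>' (w - (p + u *\<^sub>R d)) \<partial>lborel)) (at u)"
proof -
 note loc_int_measurable[OF f, measurable]
 have [measurable]: "\<kappa> \<in> borel_fun" "\<kappa>' \<in> borel_fun"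
  using c1 c2 by (auto intro: borel_measurable_continuous_onI)
 obtain B1 where B1: "\<And>x. \<bar>\<kappa> x\<bar> \<le> B1" using continuous_compact_support_bounded[OF c1 s1] by blast
 obtain B2 where B2: "\<And>x. \<bar>\<kappa>' x\<bar> \<le> B2" using continuous_compact_support_bounded[OF c2 s2] by blast
 obtain r where r: "r > 0" "{x. \<kappa> x \<noteq> 0} \<subseteq> ball 0 r" using bounded_subset_ballD[OF s1] by blast
 have B2_0: "B2 \<ge> 0" using B2[of 0] by linarith
 have trans_bdd: "bounded {w. g (w - q) \<noteq> 0}" if "bounded {x. g x \<noteq> 0}" for g :: "'a => real" and q
 proof -
  have "{w. g (w - q) \<noteq> 0} = (+) q ` {x. g x \<noteq> 0}" by (force simp: image_iff)
  thus ?thesis using bounded_translation[OF that, of q] by simp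
 qed
 have int1: "integrable lborel (\<lambda>w. f w * \<kappa> (w - q))" for q
  by (rule loc_int_mult_integrable[OF f _ trans_bdd[OF s1]]) (auto intro: B1)
 have int2: "integrable lborel (\<lambda>w. f w * \<kappa>' (w - q))" for q
  by (rule loc_int_mult_integrable[OF f _ trans_bdd[OF s2]]) (auto intro: B2)
 show ?thesis unfolding DERIV_def tendsto_at_iff_sequentially
 proof (intro allI impI)
  fix X :: "nat => real" assume X: "\<forall>i. X i \<in> UNIV - {0}" "X \<longlonglongrightarrow> 0"
  obtain S where S: "\<And>i. \<bar>X i\<bar> \<le> S" using X(2) convergent_imp_Bseq[of X] unfolding convergent_def Bseq_def by auto
  have S0: "S \<ge> 0" using S[of 0] by linarith
  define q where "q i w = (\<kappa> (w - (p + (u + X i) *\<^sub>R d)) - \<kappa> (w - (p + u *\<^sub>R d))) / X i" for i w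
  have [measurable]: "q i \<in> borel_fun" for i unfolding q_def by simp
  \<comment> \<open>The mean value theorem bounds all difference quotients by the supremum of
    \<kappa>'.\<close>
  have qB: "\<bar>q i w\<bar> \<le> B2" for i w
  proof -
   have "\<exists>\<xi>. \<kappa> (w - (p + (u + X i) *\<^sub>R d)) - \<kappa> (w - (p + u *\<^sub>R d)) = X i * \<kappa>' (w - (p + \<xi> *\<^sub>R d))"
   proof (cases "X i > 0")
    case True
    then obtain z where "\<kappa> (w - (p + (u + X i) *\<^sub>R d)) - \<kappa> (w - (p + u *\<^sub>R d)) = (u + X i - u) * \<kappa>' (w - (p + z *\<^sub>R d))"
     using MVT2[of u "u + X i" "\<lambda>u. \<kappa> (w - (p + u *\<^sub>R d))" "\<lambda>u. \<kappa>' (w - (p + u *\<^sub>R d))"] der by auto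
    thus ?thesis by auto
   next
    case False
    hence "X i < 0" using X(1) by (metis DiffE insertI1 linorder_neqE_linordered_idom)
    then obtain z where "\<kappa> (w - (p + u *\<^sub>R d)) - \<kappa> (w - (p + (u + X i) *\<^sub>R d)) = (u - (u + X i)) * \<kappa>' (w - (p + z *\<^sub>R d))"
     using MVT2[of "u + X i" u "\<lambda>u. \<kappa> (w - (p + u *\<^sub>R d))" "\<lambda>u. \<kappa>' (w - (p + u *\<^sub>R d))"] der by auto
    thus ?thesis by (intro exI[of _ z]) (simp add: algebra_simps)
   qed
   then obtain \<xi> where \<xi>: "\<kappa> (w - (p + (u + X i) *\<^sub>R d)) - \<kappa> (w - (p + u *\<^sub>R d)) = X i * \<kappa>' (w - (p + \<xi> *\<^sub>R d))" by blast
   have "X i \<noteq> 0" using X(1) by auto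
   hence "q i w = \<kappa>' (w - (p + \<xi> *\<^sub>R d))" unfolding q_def \<xi> by simp
   thus ?thesis using B2 by simp
  qed
  \<comment> \<open>The increments are bounded by S, so one ball contains the supports of all
    difference quotients, and f restricted to it yields an integrable majorant.\<close>
  define R where "R = r + S * norm d"
  have qs: "w \<in> ball (p + u *\<^sub>R d) R" if "q i w \<noteq> 0" for i w
  proof -
   have "\<kappa> (w - (p + (u + X i) *\<^sub>R d)) \<noteq> 0 \<or> \<kappa> (w - (p + u *\<^sub>R d)) \<noteq> 0" using that by (auto simp: q_def)
   hence "norm (w - (p + (u + X i) *\<^sub>R d)) < r \<or> norm (w - (p + u *\<^sub>R d)) < r" using r(2) by auto
   moreover have "norm (w - (p + u *\<^sub>R d)) \<le> norm (w - (p + (u + X i) *\<^sub>R d)) + norm (X i *\<^sub>R d)"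
    using norm_triangle_ineq[of "w - (p + (u + X i) *\<^sub>R d)" "X i *\<^sub>R d"] by (simp add: algebra_simps)
   moreover have "norm (X i *\<^sub>R d) \<le> S * norm d" using S[of i] by (simp add: mult_right_mono)
   moreover have "S * norm d \<ge> 0" using S0 by simp
   ultimately have "norm (w - (p + u *\<^sub>R d)) < R" unfolding R_def by linarith
   thus ?thesis by (simp add: dist_norm norm_minus_commute)
  qed
  have lim: "(\<lambda>i. \<integral>w. f w * q i w \<partial>lborel) \<longlonglongrightarrow> (\<integral>w. f w * \<kappa>' (w - (p + u *\<^sub>R d)) \<partial>lborel)"
  proof (rule integral_dominated_convergence[where w="\<lambda>w. B2 * \<bar>f w * indicator (ball (p + u *\<^sub>R d) R) w\<bar>"])
   have "integrable lborel (\<lambda>w. f w * indicator (ball (p + u *\<^sub>R d) R) w)"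
    by (rule loc_int_mult_integrable[OF f, where B=1]) (auto simp: indicator_def intro: bounded_subset[OF bounded_ball])
   thus "integrable lborel (\<lambda>w. B2 * \<bar>f w * indicator (ball (p + u *\<^sub>R d) R) w\<bar>)" by simp
   show "AE w in lborel. (\<lambda>i. f w * q i w) \<longlonglongrightarrow> f w * \<kappa>' (w - (p + u *\<^sub>R d))"
   proof (rule AE_I2, intro tendsto_intros)
    fix w
    have "(\<lambda>h. (\<kappa> (w - (p + (u + h) *\<^sub>R d)) - \<kappa> (w - (p + u *\<^sub>R d))) / h) \<midarrow>0\<rightarrow> \<kappa>' (w - (p + u *\<^sub>R d))"
     using der[of w u] unfolding DERIV_def .
    thus "(\<lambda>i. q i w) \<longlonglongrightarrow> \<kappa>' (w - (p + u *\<^sub>R d))"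
     using X unfolding tendsto_at_iff_sequentially q_def comp_def by blast
   qed
   show "AE w in lborel. norm (f w * q i w) \<le> B2 * \<bar>f w * indicator (ball (p + u *\<^sub>R d) R) w\<bar>" for i
   proof (rule AE_I2)
    fix w
    show "norm (f w * q i w) \<le> B2 * \<bar>f w * indicator (ball (p + u *\<^sub>R d) R) w\<bar>"
    proof (cases "q i w = 0")
     case False
     have "norm (f w * q i w) \<le> \<bar>f w\<bar> * B2" unfolding real_norm_def abs_mult
      by (intro mult_left_mono qB) simp
     thus ?thesis using qs[OF False] by (simp add: mult.commute)
    qed (use B2_0 in simp)
   qed
  qed auto
  have "(\<integral>w. f w * q i w \<partial>lborel) = ((\<integral>w. f w * \<kappa> (w - (p + (u + X i) *\<^sub>R d)) \<partial>lborel) - (\<integral>w. f w * \<kappa> (w - (p + u *\<^sub>R d)) \<partial>lborel)) / X i" for i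
  proof -
   have "(\<lambda>w. f w * q i w) = (\<lambda>w. (f w * \<kappa> (w - (p + (u + X i) *\<^sub>R d)) - f w * \<kappa> (w - (p + u *\<^sub>R d))) / X i)"
    by (auto simp: q_def diff_divide_distrib right_diff_distrib)
   thus ?thesis using int1 by simp
  qed
  thus "((\<lambda>h. ((\<integral>w. f w * \<kappa> (w - (p + (u + h) *\<^sub>R d)) \<partial>lborel) - (\<integral>w. f w * \<kappa> (w - (p + u *\<^sub>R d)) \<partial>lborel)) / h) \<circ> X)
   \<longlonglongrightarrow> (\<integral>w. f w * \<kappa>' (w - (p + u *\<^sub>R d)) \<partial>lborel)"
   using lim unfolding comp_def by simp
 qed
qed

text \<open>The integral of a translate does not depend on the translation, so differentiating it in the
 direction \<open>d\<close> gives zero.\<close>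

lemma integral_directional_deriv_eq_0:
 fixes \<kappa> \<kappa>' :: "'a::euclidean_space => real" and d :: 'a
 assumes c1: "continuous_on UNIV \<kappa>" and c2: "continuous_on UNIV \<kappa>'"
  and s1: "bounded {x. \<kappa> x \<noteq> 0}" and s2: "bounded {x. \<kappa>' x \<noteq> 0}"
  and der: "\<And>w u. ((\<lambda>u. \<kappa> (w + u *\<^sub>R d)) has_real_derivative \<kappa>' (w + u *\<^sub>R d)) (at u)"
 shows "(\<integral>w. \<kappa>' w \<partial>lborel) = 0"
proof -
 have shift: "(\<integral>w. g (w - v) \<partial>lborel) = (\<integral>w. g w \<partial>lborel)" if "g \<in> borel_fun" for g :: "'a => real" and v
  using lborel_distr_plus[of "-v"] integral_distr[of "(+) (-v)" lborel borel g] that by simp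
 have [measurable]: "\<kappa> \<in> borel_fun" "\<kappa>' \<in> borel_fun"
  using c1 c2 by (auto intro: borel_measurable_continuous_onI)
 have "((\<lambda>u. \<integral>w. 1 * \<kappa> (w - (0 + u *\<^sub>R (- d))) \<partial>lborel) has_real_derivative
     (\<integral>w. 1 * \<kappa>' (w - (0 + 0 *\<^sub>R (- d))) \<partial>lborel)) (at 0)"
  by (rule DERIV_integral_translate[OF loc_int_1 c1 c2 s1 s2]) (use der in simp)
 moreover have "(\<integral>w. 1 * \<kappa> (w - (0 + u *\<^sub>R (- d))) \<partial>lborel) = (\<integral>w. \<kappa> w \<partial>lborel)" for u
  using shift[of \<kappa> "u *\<^sub>R (- d)"] by simp
 ultimately have "((\<lambda>u::real. \<integral>w. \<kappa> w \<partial>lborel) has_real_derivative (\<integral>w. \<kappa>' w \<partial>lborel)) (at 0)"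
  by simp
 thus ?thesis using DERIV_unique DERIV_const by blast
qed

section \<open>Integration by parts against bumps\<close>

lemma bounded_bump_support: "l > 0 ==> bounded {x. bump l c \<alpha> x \<noteq> 0}"
 using bounded_subset[OF bounded_cbox bump_support_cbox] .

lemma bump_measurable[measurable]: "l > 0 ==> bump l c \<alpha> \<in> borel_fun"
 by (intro borel_measurable_continuous_onI bump_continuous)

lemma DERIV_along_line:
 fixes g :: "'a::real_normed_vector => real"
 assumes "(g has_derivative g') (at (x + u *\<^sub>R d))"
 shows "((\<lambda>u. g (x + u *\<^sub>R d)) has_real_derivative g' d) (at u)"
proof -
 have "((\<lambda>u. x + u *\<^sub>R d) has_derivative (\<lambda>h. h *\<^sub>R d)) (at u)"
  by (auto intro!: derivative_eq_intros)
 from has_derivative_compose[OF this assms]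
 have "((\<lambda>u. g (x + u *\<^sub>R d)) has_derivative (\<lambda>h. g' (h *\<^sub>R d))) (at u)" .
 moreover have "g' (h *\<^sub>R d) = g' d * h" for h
  using linear_scale[OF has_derivative_linear[OF assms]] by simp
 ultimately show ?thesis by (simp add: has_field_derivative_def)
qed

lemma partial_deriv_DERIV:
 assumes "g differentiable (at (x + u *\<^sub>R axis i 1))"
 shows "((\<lambda>u. g (x + u *\<^sub>R axis i 1)) has_real_derivative partial_deriv i g (x + u *\<^sub>R axis i 1)) (at u)"
 unfolding partial_deriv_def using DERIV_along_line frechet_derivative_works assms by blast

text \<open>The product of the bump and v has compact support, so its partial derivative integrates
  to 0.\<close>

lemma bump_integration_by_parts:
 fixes v :: "real ^ 'n::finite => real"
 assumes l: "l > 0" and v: "\<And>x. v differentiable at x" and v': "\<And>x. partial_deriv i v differentiable at x"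
 shows "(\<integral>x. bump l c \<alpha> x * partial_deriv i v x \<partial>lborel) = - (\<integral>x. bump l c (incr \<alpha> i) x * v x \<partial>lborel)"
proof -
 have cv: "continuous_on UNIV v" "continuous_on UNIV (partial_deriv i v)"
  using v v' by (auto intro!: continuous_at_imp_continuous_on differentiable_imp_continuous_within)
 have s: "bounded {x. bump l c \<beta> x * g x \<noteq> 0}" for \<beta> and g :: "real^'n => real"
  by (rule bounded_subset[OF bounded_bump_support[OF l, of c \<beta>]]) auto
 define \<kappa>' where "\<kappa>' x = bump l c (incr \<alpha> i) x * v x + bump l c \<alpha> x * partial_deriv i v x" for x
 have int: "integrable lborel (\<lambda>x. bump l c \<beta> x * g x)" if g: "continuous_on UNIV g" for \<beta> and g :: "real^'n => real"
 proof -
  have c: "continuous_on UNIV (\<lambda>x. bump l c \<beta> x * g x)"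
   by (intro continuous_intros bump_continuous l g)
  obtain B where "\<And>x. \<bar>bump l c \<beta> x * g x\<bar> \<le> B" using continuous_compact_support_bounded[OF c s] by blast
  hence "integrable lborel (\<lambda>x. 1 * (bump l c \<beta> x * g x))"
   by (intro loc_int_mult_integrable[OF loc_int_1, where B=B] s borel_measurable_continuous_onI c)
  thus ?thesis by simp
 qed
 have "(\<integral>x. \<kappa>' x \<partial>lborel) = 0"
 proof (rule integral_directional_deriv_eq_0[where \<kappa>="\<lambda>x. bump l c \<alpha> x * v x" and d="axis i 1"])
  show "continuous_on UNIV (\<lambda>x. bump l c \<alpha> x * v x)" "continuous_on UNIV \<kappa>'"
   unfolding \<kappa>'_def by (intro continuous_intros bump_continuous l cv)+
  show "bounded {x. bump l c \<alpha> x * v x \<noteq> 0}" by (rule s)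
  show "bounded {x. \<kappa>' x \<noteq> 0}"
   by (rule bounded_subset[of "{x. bump l c (incr \<alpha> i) x \<noteq> 0} \<union> {x. bump l c \<alpha> x \<noteq> 0}"])
     (auto simp: \<kappa>'_def bounded_bump_support[OF l])
  fix w u
  show "((\<lambda>u. bump l c \<alpha> (w + u *\<^sub>R axis i 1) * v (w + u *\<^sub>R axis i 1)) has_real_derivative \<kappa>' (w + u *\<^sub>R axis i 1)) (at u)"
   by (rule DERIV_cong[OF DERIV_mult[OF partial_deriv_DERIV[OF bump_differentiable[OF l]] partial_deriv_DERIV[OF v]]])
     (simp add: \<kappa>'_def partial_deriv_bump[OF l])
 qed
 thus ?thesis unfolding \<kappa>'_def using int cv by simp
qed

lemma bump_integrate_foldr:
 fixes \<phi> :: "real ^ 'n::finite => real"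
 assumes l: "l > 0" and \<phi>: "smooth \<phi>"
 shows "(\<integral>x. bump l c \<alpha> x * foldr partial_deriv is \<phi> x \<partial>lborel)
  = (-1) ^ length is * (\<integral>x. bump l c (\<lambda>i. \<alpha> i + count_list is i) x * \<phi> x \<partial>lborel)"
proof (induction "is" arbitrary: \<alpha>)
 case (Cons j js)
 have d: "foldr partial_deriv js \<phi> differentiable at x" "partial_deriv j (foldr partial_deriv js \<phi>) differentiable at x" for x
  using \<phi>[unfolded smooth_def, rule_format, of js x] \<phi>[unfolded smooth_def, rule_format, of "j # js" x] by simp_all
 have "(\<integral>x. bump l c \<alpha> x * foldr partial_deriv (j # js) \<phi> x \<partial>lborel)
   = - (\<integral>x. bump l c (incr \<alpha> j) x * foldr partial_deriv js \<phi> x \<partial>lborel)"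
  using bump_integration_by_parts[OF l d] by simp
 also have "\<dots> = - ((-1) ^ length js * (\<integral>x. bump l c (\<lambda>i. incr \<alpha> j i + count_list js i) x * \<phi> x \<partial>lborel))"
  by (simp only: Cons.IH)
 also have "(\<lambda>i. incr \<alpha> j i + count_list js i) = (\<lambda>i. \<alpha> i + count_list (j # js) i)"
  by (auto simp: incr_def)
 finally show ?case by simp
qed simp

lemma bump_weak_deriv_lborel:
 fixes \<phi> :: "real ^ 'n::finite => real"
 assumes l: "l > 0" and \<phi>: "smooth \<phi>"
 shows "(\<integral>x. bump l c (\<lambda>_. 0) x * multi_deriv \<alpha> \<phi> x \<partial>lborel)
  = (-1) ^ (\<Sum>i\<in>UNIV. \<alpha> i) * (\<integral>x. bump l c \<alpha> x * \<phi> x \<partial>lborel)"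
proof -
 obtain "is" where "\<And>i. count_list is i = \<alpha> i" "length is = (\<Sum>i\<in>UNIV. \<alpha> i)"
  "\<And>\<phi>::real ^ 'n => real. multi_deriv \<alpha> \<phi> = foldr partial_deriv is \<phi>" by (rule multi_deriv_eq[of \<alpha>]) blast
 thus ?thesis using bump_integrate_foldr[OF l \<phi>, of c "\<lambda>_. 0" "is"] by simp
qed

subsection \<open>Finite differences and Taylor's formula\<close>

text \<open>Pascal's rule in summed form: a difference of order k + 1 is a difference of order k
  applied to first differences.\<close>

lemma alternating_binomial_Suc:
 fixes g :: "nat => real"
 shows "(\<Sum>j=0..Suc k. (-1) ^ (Suc k - j) * real (Suc k choose j) * g j)
  = (\<Sum>j=0..k. (-1) ^ (k - j) * real (k choose j) * (g (Suc j) - g j))"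
proof -
 have "(\<Sum>j=0..Suc k. (-1) ^ (Suc k - j) * real (Suc k choose j) * g j)
   = (-1) ^ Suc k * g 0 + (\<Sum>j=0..k. (-1) ^ (k - j) * real (Suc k choose Suc j) * g (Suc j))"
  by (subst sum.atLeast0_atMost_Suc_shift) simp
 also have "(\<Sum>j=0..k. (-1) ^ (k - j) * real (Suc k choose Suc j) * g (Suc j))
   = (\<Sum>j=0..k. (-1) ^ (k - j) * real (k choose j) * g (Suc j)) + (\<Sum>j=0..k. (-1) ^ (k - j) * real (k choose Suc j) * g (Suc j))"
  by (simp add: algebra_simps sum.distrib)
 also have "(-1) ^ Suc k * g 0 + ((\<Sum>j=0..k. (-1) ^ (k - j) * real (k choose j) * g (Suc j)) + (\<Sum>j=0..k. (-1) ^ (k - j) * real (k choose Suc j) * g (Suc j)))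
  = (\<Sum>j=0..k. (-1) ^ (k - j) * real (k choose j) * g (Suc j)) + (\<Sum>j=0..Suc k. (-1) ^ (Suc k - j) * real (k choose j) * g j)"
 proof -
  have "(\<Sum>j=0..Suc k. (-1) ^ (Suc k - j) * real (k choose j) * g j)
   = (-1) ^ Suc k * g 0 + (\<Sum>j=0..k. (-1) ^ (k - j) * real (k choose Suc j) * g (Suc j))"
   by (subst sum.atLeast0_atMost_Suc_shift) simp
  thus ?thesis by linarith
 qed
 also have "(\<Sum>j=0..Suc k. (-1) ^ (Suc k - j) * real (k choose j) * g j) = (\<Sum>j=0..k. (-1) ^ (Suc k - j) * real (k choose j) * g j)"
  by simp
 also have "\<dots> = - (\<Sum>j=0..k. (-1) ^ (k - j) * real (k choose j) * g j)"
  by (simp add: Suc_diff_le flip: sum_negf)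
 finally show ?thesis by (simp add: right_diff_distrib sum_subtractf)
qed

text \<open>The first difference of a power is a combination of lower powers, to each of which the
  induction hypothesis applies.\<close>

lemma alternating_binomial_moment:
 fixes a b :: real
 assumes "m < k"
 shows "(\<Sum>j=0..k. (-1) ^ (k - j) * real (k choose j) * (a + b * real j) ^ m) = 0"
 using assms
proof (induction k arbitrary: a b m)
 case (Suc k)
 have step: "(a + b * real (Suc j)) ^ m - (a + b * real j) ^ m
   = (\<Sum>i<m. real (m choose i) * b ^ (m - i) * (a + b * real j) ^ i)" for j
 proof -
  have "(a + b * real (Suc j)) ^ m = ((a + b * real j) + b) ^ m" by (simp add: algebra_simps)
  also have "\<dots> = (\<Sum>i\<le>m. real (m choose i) * (a + b * real j) ^ i * b ^ (m - i))"
   by (rule binomial_ring)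
  also have "\<dots> = (\<Sum>i<m. real (m choose i) * (a + b * real j) ^ i * b ^ (m - i)) + (a + b * real j) ^ m"
   by (simp add: lessThan_Suc_atMost[symmetric])
  finally show ?thesis by (simp add: mult_ac)
 qed
 have "(\<Sum>j=0..k. (-1) ^ (k - j) * real (k choose j) * (\<Sum>i<m. real (m choose i) * b ^ (m - i) * (a + b * real j) ^ i))
  = (\<Sum>i<m. real (m choose i) * b ^ (m - i) * (\<Sum>j=0..k. (-1) ^ (k - j) * real (k choose j) * (a + b * real j) ^ i))"
  unfolding sum_distrib_left by (subst sum.swap) (simp add: mult_ac)
 also have "\<dots> = 0" using Suc.IH Suc.prems by (intro sum.neutral) auto
 finally show ?case unfolding alternating_binomial_Suc step .
qed simp

text \<open>These arise by solving the k-th difference for its term j = 0: f x equals (-1)^k times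
  the difference plus the sum over j \<ge> 1 of \<open>ccoef k j\<close> f(x + j h). Where the
  difference vanishes, as on polynomials of degree below k, the sum reproduces f x.\<close>

definition ccoef :: "nat => nat => real" where
 "ccoef k j = (-1) ^ Suc j * real (k choose j)"

lemma ccoef_moment:
 fixes a b :: real
 assumes "m < k"
 shows "(\<Sum>j=1..k. ccoef k j * (a + b * real j) ^ m) = a ^ m"
proof -
 have "(-1) ^ (k - j) = (-1) ^ k * ((-1::real) ^ j)" if "j \<le> k" for j
 proof -
  define d where "d = k - j"
  have d: "k = j + d" using that by (simp add: d_def)
  have "(-1) ^ k * ((-1::real) ^ j) = ((-1) ^ j * (-1) ^ j) * (-1) ^ d"
   unfolding d by (simp only: power_add mult_ac)
  also have "(-1) ^ j * (-1) ^ j = (1::real)" by (subst power_mult_distrib[symmetric]) simp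
  finally show ?thesis by (simp add: d_def)
 qed
 hence "0 = (\<Sum>j=0..k. (-1) ^ k * ((-1) ^ j * real (k choose j) * (a + b * real j) ^ m))"
  using alternating_binomial_moment[OF assms, of a b] by (simp add: mult_ac)
 hence "(\<Sum>j=0..k. (-1) ^ j * real (k choose j) * (a + b * real j) ^ m) = 0"
  unfolding sum_distrib_left[symmetric] by simp
 moreover have "{0..k} = insert 0 {1..k}" by auto
 ultimately have "a ^ m + (\<Sum>j=1..k. (-1) ^ j * real (k choose j) * (a + b * real j) ^ m) = 0" by simp
 thus ?thesis unfolding ccoef_def by (simp add: sum_negf)
qed

lemma ccoef_sum: "0 < k ==> (\<Sum>j=1..k. ccoef k j) = 1"
 using ccoef_moment[of 0 k 0 1] by simp

text \<open>Peano kernel estimate, with \<open>Dg m\<close> the m-th derivative of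
  \<open>Dg 0\<close>. Taylor's formula at \<open>lo\<close> with integral remainder is used at
  every node: the moments cancel the polynomial parts, and each remainder is at most (hi - lo)^(k-1)
  times the integral of the absolute k-th derivative.\<close>

lemma Taylor_functional_bound:
 fixes Dg :: "nat => real => real"
 assumes k: "0 < k" and der: "\<And>m u. (Dg m has_real_derivative Dg (Suc m) u) (at u)"
  and I: "finite I" and nodes: "\<And>i. i \<in> I ==> lo \<le> u i \<and> u i \<le> hi" and lohi: "lo \<le> hi"
  and moments: "\<And>m. m < k ==> (\<Sum>i\<in>I. w i * (u i - lo) ^ m) = 0"
 shows "ennreal \<bar>\<Sum>i\<in>I. w i * Dg 0 (u i)\<bar>
   \<le> ennreal ((\<Sum>i\<in>I. \<bar>w i\<bar>) * (hi - lo) ^ (k - 1)) * (\<integral>+ v. ennreal \<bar>Dg k v\<bar> * indicator {lo..hi} v)"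
proof -
 have cont: "continuous_on S (Dg m)" for S m
  by (meson DERIV_isCont continuous_at_imp_continuous_on der)
 have [measurable]: "Dg k \<in> borel_fun"
  by (rule borel_measurable_continuous_onI[OF cont])
 define J where "J = integral {lo..hi} (\<lambda>v. \<bar>Dg k v\<bar>)"
 have Jint: "(\<lambda>v. \<bar>Dg k v\<bar>) integrable_on {a..b}" for a b
  by (intro integrable_continuous_interval continuous_intros cont)
 have J0: "J \<ge> 0" unfolding J_def by (intro integral_nonneg Jint) simp
 define r where "r i = Dg 0 (u i) - (\<Sum>m<k. ((u i - lo) ^ m / fact m) * Dg m lo)" for i
 have r: "\<bar>r i\<bar> \<le> (hi - lo) ^ (k - 1) * J" if "i \<in> I" for i
 proof -
  have T: "((\<lambda>x. ((u i - x) ^ (k - 1) / fact (k - 1)) *\<^sub>R Dg k x) has_integral r i) {lo..u i}"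
   using Taylor_has_integral[where p=k and Df=Dg and f="Dg 0" and a=lo and b="u i", OF k refl]
    der nodes[OF that] unfolding r_def
   by (auto simp: has_real_derivative_iff_has_vector_derivative[symmetric] intro: has_field_derivative_at_within)
  have "\<bar>r i\<bar> = \<bar>integral {lo..u i} (\<lambda>x. ((u i - x) ^ (k - 1) / fact (k - 1)) *\<^sub>R Dg k x)\<bar>"
   using integral_unique[OF T] by simp
  also have "\<dots> \<le> integral {lo..u i} (\<lambda>x. (hi - lo) ^ (k - 1) * \<bar>Dg k x\<bar>)"
  proof -
   have "norm (integral {lo..u i} (\<lambda>x. ((u i - x) ^ (k - 1) / fact (k - 1)) *\<^sub>R Dg k x)) \<le> integral {lo..u i} (\<lambda>x. (hi - lo) ^ (k - 1) * \<bar>Dg k x\<bar>)"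
   proof (rule integral_norm_bound_integral)
    show "(\<lambda>x. ((u i - x) ^ (k - 1) / fact (k - 1)) *\<^sub>R Dg k x) integrable_on {lo..u i}" using T by blast
    show "(\<lambda>x. (hi - lo) ^ (k - 1) * \<bar>Dg k x\<bar>) integrable_on {lo..u i}"
     by (intro integrable_continuous_interval continuous_intros cont)
    fix x assume x: "x \<in> {lo..u i}"
    have "(u i - x) ^ (k - 1) / fact (k - 1) \<le> (u i - x) ^ (k - 1)"
     using divide_left_mono[of 1 "fact (k - 1)" "(u i - x) ^ (k - 1)"] x by (simp add: fact_ge_1)
    also have "\<dots> \<le> (hi - lo) ^ (k - 1)" using x nodes[OF that] by (intro power_mono) auto
    finally have "(u i - x) ^ (k - 1) / fact (k - 1) \<le> (hi - lo) ^ (k - 1)" .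
    thus "norm (((u i - x) ^ (k - 1) / fact (k - 1)) *\<^sub>R Dg k x) \<le> (hi - lo) ^ (k - 1) * \<bar>Dg k x\<bar>"
     using x unfolding real_norm_def real_scaleR_def abs_mult by (intro mult_right_mono) auto
   qed
   thus ?thesis by simp
  qed
  also have "\<dots> = (hi - lo) ^ (k - 1) * integral {lo..u i} (\<lambda>x. \<bar>Dg k x\<bar>)" by simp
  also have "\<dots> \<le> (hi - lo) ^ (k - 1) * J" unfolding J_def
   using nodes[OF that] lohi by (intro mult_left_mono integral_subset_le Jint) auto
  finally show ?thesis .
 qed
 have "(\<Sum>i\<in>I. w i * Dg 0 (u i)) = (\<Sum>i\<in>I. w i * r i) + (\<Sum>i\<in>I. \<Sum>m<k. w i * (((u i - lo) ^ m / fact m) * Dg m lo))"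
  unfolding r_def by (simp add: right_diff_distrib sum_subtractf sum_distrib_left)
 also have "(\<Sum>i\<in>I. \<Sum>m<k. w i * (((u i - lo) ^ m / fact m) * Dg m lo)) = (\<Sum>m<k. (\<Sum>i\<in>I. w i * (u i - lo) ^ m) * (Dg m lo / fact m))"
  by (subst sum.swap) (auto simp only: sum_distrib_right intro!: sum.cong, simp)
 also have "\<dots> = 0" using moments by (intro sum.neutral) simp
 finally have "\<bar>\<Sum>i\<in>I. w i * Dg 0 (u i)\<bar> = \<bar>\<Sum>i\<in>I. w i * r i\<bar>" by simp
 also have "\<dots> \<le> (\<Sum>i\<in>I. \<bar>w i\<bar> * ((hi - lo) ^ (k - 1) * J))"
  by (rule order_trans[OF sum_abs], unfold abs_mult, intro sum_mono mult_left_mono r) auto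
 also have "\<dots> = (\<Sum>i\<in>I. \<bar>w i\<bar>) * (hi - lo) ^ (k - 1) * J" by (simp only: sum_distrib_right mult.assoc)
 finally have "ennreal \<bar>\<Sum>i\<in>I. w i * Dg 0 (u i)\<bar> \<le> ennreal ((\<Sum>i\<in>I. \<bar>w i\<bar>) * (hi - lo) ^ (k - 1)) * ennreal J"
  using lohi J0 by (subst ennreal_mult[symmetric]) (auto intro!: ennreal_leI mult_nonneg_nonneg sum_nonneg)
 also have "ennreal J = (\<integral>+ v. ennreal (indicator {lo..hi} v * \<bar>Dg k v\<bar>))"
 proof (rule nn_integral_has_integral_lborel[symmetric])
  have "((\<lambda>v. \<bar>Dg k v\<bar>) has_integral J) {lo..hi}"
   unfolding J_def by (rule integrable_integral[OF Jint])
  moreover have "(\<lambda>v. indicator {lo..hi} v * \<bar>Dg k v\<bar>) = (\<lambda>v. if v \<in> {lo..hi} then \<bar>Dg k v\<bar> else 0)"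
   by (auto simp: indicator_def)
  ultimately show "((\<lambda>v. indicator {lo..hi} v * \<bar>Dg k v\<bar>) has_integral J) UNIV"
   by (simp only: has_integral_restrict_UNIV)
 qed auto
 also have "\<dots> = (\<integral>+ v. ennreal \<bar>Dg k v\<bar> * indicator {lo..hi} v)"
  by (intro nn_integral_cong) (auto simp: indicator_def)
 finally show ?thesis .
qed

subsection \<open>Ball averages and mollification\<close>

definition bavg :: "('a::euclidean_space => ennreal) => 'a => real => ennreal" where
 "bavg P y r = (\<integral>+ w. P w * indicator (ball y r) w) / emeasure lborel (ball y r)"

definition ballW :: "'a::euclidean_space => real" where
 "ballW z = indicator (ball 0 1) z / measure lborel (ball (0::'a) 1)"

lemma unit_ball_measure: "0 < measure lborel (ball (0::'a::euclidean_space) 1)"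
 "emeasure lborel (ball (0::'a) 1) = ennreal (measure lborel (ball (0::'a) 1))"
proof -
 show "0 < measure lborel (ball (0::'a) 1)" by (rule content_ball_pos) simp
 have "emeasure lborel (ball (0::'a) 1) \<noteq> \<infinity>"
  using emeasure_lborel_ball_finite[of "0::'a" 1] by (simp add: order_less_imp_not_eq)
 thus "emeasure lborel (ball (0::'a) 1) = ennreal (measure lborel (ball (0::'a) 1))"
  by (intro emeasure_eq_ennreal_measure) simp
qed

lemma ballW_measurable[measurable]: "ballW \<in> borel_fun"
 unfolding ballW_def by simp

lemma ennreal_mult_div_cancel:
 assumes "0 < a" "0 < m"
 shows "ennreal a * I / (ennreal a * ennreal m) = I / ennreal m"
proof (cases I)
 case (real r)
 thus ?thesis using assms by (simp add: divide_ennreal flip: ennreal_mult')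
next
 case top
 thus ?thesis using assms by (simp add: ennreal_mult_top ennreal_top_divide flip: ennreal_mult')
qed

lemma ballW_nn_integral:
 fixes H :: "'a::euclidean_space => ennreal"
 assumes [measurable]: "H \<in> borel_fun" and "0 < \<sigma>"
 shows "(\<integral>+ z. ennreal (ballW z) * H (y + \<sigma> *\<^sub>R z)) = bavg H y \<sigma>"
proof -
 define m where "m = measure lborel (ball (0::'a) 1)"
 have m: "m > 0" "emeasure lborel (ball (0::'a) 1) = ennreal m" using unit_ball_measure unfolding m_def by auto
 define I where "I = (\<integral>+ z. H (y + \<sigma> *\<^sub>R z) * indicator (ball 0 1) z)"
 have "(\<integral>+ w. H w * indicator (ball y \<sigma>) w)
  = ennreal (\<bar>\<sigma>\<bar> ^ DIM('a)) * (\<integral>+ z. H (y + \<sigma> *\<^sub>R z) * indicator (ball y \<sigma>) (y + \<sigma> *\<^sub>R z))"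
  by (rule nn_integral_lborel_affine) (use assms in auto)
 also have "(\<integral>+ z. H (y + \<sigma> *\<^sub>R z) * indicator (ball y \<sigma>) (y + \<sigma> *\<^sub>R z)) = I"
  unfolding I_def using \<open>0 < \<sigma>\<close> by (intro nn_integral_cong) (auto simp: indicator_def dist_norm)
 finally have 1: "(\<integral>+ w. H w * indicator (ball y \<sigma>) w) = ennreal (\<sigma> ^ DIM('a)) * I" using assms by simp
 have 2: "emeasure lborel (ball y \<sigma>) = ennreal (\<sigma> ^ DIM('a)) * ennreal m"
  using emeasure_ball_scale[of \<sigma> 1 y "0::'a"] assms m by simp
 have "bavg H y \<sigma> = I / ennreal m" unfolding bavg_def 1 2
  by (rule ennreal_mult_div_cancel) (use assms m in auto)
 also have "\<dots> = (\<integral>+ z. H (y + \<sigma> *\<^sub>R z) * indicator (ball 0 1) z / ennreal m)"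
  unfolding I_def by (rule nn_integral_divide[symmetric]) simp
 also have "\<dots> = (\<integral>+ z. ennreal (ballW z) * H (y + \<sigma> *\<^sub>R z))"
  using m(1) by (intro nn_integral_cong)
   (auto simp: ballW_def indicator_def m_def[symmetric] divide_ennreal_def inverse_ennreal mult.commute divide_inverse split: if_splits)
 finally show ?thesis by simp
qed

lemma avg_kernel_ballW: "avg_kernel (ballW :: 'a::euclidean_space => real)"
 unfolding avg_kernel_def
proof (intro conjI)
 let ?m = "measure lborel (ball (0::'a) 1)"
 show "bounded {x::'a. ballW x \<noteq> 0}"
  by (rule bounded_subset[OF bounded_ball[of 0 1]]) (auto simp: ballW_def indicator_def)
 show "\<exists>B. \<forall>x::'a. \<bar>ballW x\<bar> \<le> B"
  using unit_ball_measure(1)[where 'a='a] by (intro exI[of _ "1 / ?m"]) (auto simp: ballW_def indicator_def)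
 show "\<forall>x::'a. 0 \<le> ballW x" by (simp add: ballW_def)
 have "(\<integral>+ x. ennreal (ballW (x::'a))) = bavg (\<lambda>_. 1) (0::'a) 1"
  using ballW_nn_integral[of "\<lambda>_. 1" 1 "0::'a"] by simp
 also have "\<dots> = 1" unfolding bavg_def using unit_ball_measure[where 'a='a]
  by (simp add: ennreal_divide_self)
 finally show "(\<integral>+ x. ennreal (ballW (x::'a))) = 1" .
qed simp

lemma bavg_mono_ball:
 fixes H :: "'a::euclidean_space => ennreal"
 assumes "0 < \<sigma>" "ball y \<sigma> \<subseteq> ball x r" "0 < r" "r \<le> \<kappa> * \<sigma>"
 shows "bavg H y \<sigma> \<le> ennreal (\<kappa> ^ DIM('a)) * bavg H x r"
proof -
 define m where "m = measure lborel (ball (0::'a) 1)"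
 have m: "m > 0" "emeasure lborel (ball (0::'a) 1) = ennreal m" using unit_ball_measure unfolding m_def by auto
 have E: "emeasure lborel (ball z s) = ennreal (s ^ DIM('a) * m)" if "s > 0" for s and z :: 'a
  using emeasure_ball_scale[of s 1 z "0::'a"] that m by (simp add: ennreal_mult')
 have \<kappa>: "\<kappa> > 0" using assms by (smt (verit) zero_less_mult_pos2)
 have le: "(\<integral>+ w. H w * indicator (ball y \<sigma>) w) \<le> (\<integral>+ w. H w * indicator (ball x r) w)" (is "?I \<le> ?J")
  using assms(2) by (intro nn_integral_mono) (auto simp: indicator_def)
 have "bavg H y \<sigma> \<le> ?J / ennreal (\<sigma> ^ DIM('a) * m)"
  unfolding bavg_def E[OF assms(1)] by (rule divide_right_mono_ennreal[OF le])
 also have "\<dots> \<le> ennreal (\<kappa> ^ DIM('a)) * (?J / ennreal (r ^ DIM('a) * m))"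
 proof (cases ?J)
  case (real j)
  have "r ^ DIM('a) \<le> \<kappa> ^ DIM('a) * \<sigma> ^ DIM('a)" using power_mono[OF assms(4), of "DIM('a)"] assms by (simp add: power_mult_distrib)
  hence "j / (\<sigma> ^ DIM('a) * m) \<le> \<kappa> ^ DIM('a) * (j / (r ^ DIM('a) * m))"
   using assms m(1) real mult_left_mono[of "r ^ DIM('a)" "\<kappa> ^ DIM('a) * \<sigma> ^ DIM('a)" j] by (simp add: field_simps)
  thus ?thesis using real assms m(1) \<kappa> by (simp add: divide_ennreal ennreal_leI flip: ennreal_mult')
 next
  case top
  thus ?thesis using assms m(1) \<kappa> by (simp add: ennreal_top_divide ennreal_mult_top)
 qed
 finally show ?thesis unfolding bavg_def E[OF assms(3)] .
qed

text \<open>After exchanging the integrals, a shift by \<epsilon> z with z in the support of K moves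
  the ball by at most \<epsilon> \<rho>, and the weights K z have total mass 1.\<close>

lemma nn_integral_smear_le:
 fixes P :: "'a::euclidean_space => ennreal"
 assumes K: "avg_kernel K" and [measurable]: "P \<in> borel_fun" and \<rho>: "{z. K z \<noteq> 0} \<subseteq> ball 0 \<rho>" and "0 < \<epsilon>"
 shows "(\<integral>\<^sup>+x. (\<integral>+ z. ennreal (K z) * P (x + \<epsilon> *\<^sub>R z)) * indicator (ball y r) x \<partial>lborel)
   \<le> (\<integral>+ x. P x * indicator (ball y (r + \<epsilon> * \<rho>)) x)"
proof -
 have [measurable]: "K \<in> borel_fun" using K by (simp add: avg_kernel_def)
 have "(\<integral>\<^sup>+x. (\<integral>+ z. ennreal (K z) * P (x + \<epsilon> *\<^sub>R z)) * indicator (ball y r) x \<partial>lborel)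
  = (\<integral>\<^sup>+x. (\<integral>+ z. ennreal (K z) * P (x + \<epsilon> *\<^sub>R z) * indicator (ball y r) x) \<partial>lborel)"
  by (intro nn_integral_cong nn_integral_multc[symmetric]) simp
 also have "\<dots> = (\<integral>\<^sup>+z. (\<integral>+ x. ennreal (K z) * P (x + \<epsilon> *\<^sub>R z) * indicator (ball y r) x) \<partial>lborel)"
  by (rule lborel_pair.Fubini') simp
 also have "\<dots> \<le> (\<integral>\<^sup>+z. ennreal (K z) * (\<integral>+ x. P x * indicator (ball y (r + \<epsilon> * \<rho>)) x) \<partial>lborel)"
 proof (intro nn_integral_mono)
  fix z
  show "(\<integral>+ x. ennreal (K z) * P (x + \<epsilon> *\<^sub>R z) * indicator (ball y r) x)
   \<le> ennreal (K z) * (\<integral>+ x. P x * indicator (ball y (r + \<epsilon> * \<rho>)) x)"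
  proof (cases "K z = 0")
   case False
   hence z: "norm z < \<rho>" using \<rho> by auto
   have in_ball: "x + \<epsilon> *\<^sub>R z \<in> ball y (r + \<epsilon> * \<rho>)" if "x \<in> ball y r" for x
   proof -
    have "norm (y - x - \<epsilon> *\<^sub>R z) \<le> norm (y - x) + norm (\<epsilon> *\<^sub>R z)" by (rule norm_triangle_ineq4)
    also have "norm (\<epsilon> *\<^sub>R z) \<le> \<epsilon> * \<rho>" using z \<open>0 < \<epsilon>\<close> by simp
    finally show ?thesis using that by (simp add: dist_norm algebra_simps)
   qed
   have "(\<integral>+ x. ennreal (K z) * P (x + \<epsilon> *\<^sub>R z) * indicator (ball y r) x)
    = ennreal (K z) * (\<integral>+ x. P (x + \<epsilon> *\<^sub>R z) * indicator (ball y r) x)"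
    by (subst nn_integral_cmult[symmetric]) (auto simp: mult.assoc)
   also have "(\<integral>+ x. P (x + \<epsilon> *\<^sub>R z) * indicator (ball y r) x)
    \<le> (\<integral>+ x. P (x + \<epsilon> *\<^sub>R z) * indicator (ball y (r + \<epsilon> * \<rho>)) (x + \<epsilon> *\<^sub>R z))"
    using in_ball by (intro nn_integral_mono) (auto simp: indicator_def simp del: mem_ball)
   also have "\<dots> = (\<integral>+ x. P x * indicator (ball y (r + \<epsilon> * \<rho>)) x)"
    by (rule nn_integral_lborel_translate) simp
   finally show ?thesis by (simp add: mult_left_mono)
  qed simp
 qed
 also have "\<dots> = (\<integral>+ x. P x * indicator (ball y (r + \<epsilon> * \<rho>)) x)"
  using avg_kernelD(4)[OF K] by (simp add: nn_integral_multc)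
 finally show ?thesis .
qed

lemma abs_smear_le:
 fixes f :: "'a::euclidean_space => real"
 assumes K: "avg_kernel K" and f: "loc_int f" and "t \<noteq> 0"
 shows "ennreal \<bar>smear K f t y\<bar> \<le> (\<integral>+ z. ennreal (K z) * ennreal \<bar>f (y + t *\<^sub>R z)\<bar>)"
proof -
 have "ennreal (norm (\<integral>z. f (y + t *\<^sub>R z) * K z \<partial>lborel)) \<le> (\<integral>+ z. ennreal (norm (f (y + t *\<^sub>R z) * K z)))"
  by (rule integral_norm_bound_ennreal[OF smear_integrable[OF assms]])
 also have "\<dots> = (\<integral>+ z. ennreal (K z) * ennreal \<bar>f (y + t *\<^sub>R z)\<bar>)"
  using avg_kernelD(3)[OF K] by (intro nn_integral_cong) (simp add: abs_mult mult.commute flip: ennreal_mult')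
 finally show ?thesis by (simp add: smear_def)
qed

lemma loc_int_smear:
 fixes f :: "'a::euclidean_space => real"
 assumes K: "avg_kernel K" and f: "loc_int f" and "0 < t"
 shows "loc_int (smear K f t)"
proof -
 have [measurable]: "f \<in> borel_fun" "K \<in> borel_fun" using K f by (auto simp: avg_kernel_def loc_int_def)
 obtain \<rho> where \<rho>: "{x. K x \<noteq> 0} \<subseteq> ball 0 \<rho>"
  using bounded_subset_ballD[of "{x. K x \<noteq> 0}" 0] avg_kernelD(2)[OF K] by blast
 have "(\<integral>+ x. ennreal \<bar>smear K f t x\<bar> * indicator (ball 0 r) x) < \<infinity>" for r
 proof -
  have "(\<integral>+ x. ennreal \<bar>smear K f t x\<bar> * indicator (ball 0 r) x)
   \<le> (\<integral>\<^sup>+x. (\<integral>+ z. ennreal (K z) * ennreal \<bar>f (x + t *\<^sub>R z)\<bar>) * indicator (ball 0 r) x \<partial>lborel)"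
   using assms by (intro nn_integral_mono mult_right_mono abs_smear_le) auto
  also have "\<dots> \<le> (\<integral>+ x. ennreal \<bar>f x\<bar> * indicator (ball 0 (r + t * \<rho>)) x)"
   by (rule nn_integral_smear_le[OF K _ \<rho> \<open>0 < t\<close>]) simp
  also have "\<dots> < \<infinity>" by (rule loc_int_bounded[OF f bounded_ball])
  finally show ?thesis .
 qed
 thus ?thesis by (simp add: loc_int_def)
qed

lemma integral_lborel_affine:
 fixes t :: "'a::euclidean_space" and f :: "'a => real"
 assumes [measurable]: "f \<in> borel_fun" and c: "c \<noteq> 0"
 shows "(\<integral>x. f x \<partial>lborel) = \<bar>c\<bar> ^ DIM('a) * (\<integral>x. f (t + c *\<^sub>R x) \<partial>lborel)"
 by (subst lborel_affine[OF c, of t]) (simp add: integral_density integral_distr)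

section \<open>The smooth mollifier\<close>

definition bump_mass :: "'n::finite itself => real" where
 "bump_mass _ = (\<integral>x. bump 1 0 (\<lambda>_::'n. 0) x \<partial>lborel)"

definition eta :: "real ^ 'n::finite => real" where
 "eta x = bump 1 0 (\<lambda>_. 0) x / bump_mass TYPE('n)"

lemma bump_0_nonneg: "0 < l ==> 0 \<le> bump l c (\<lambda>_. 0) x" and bump_0_le_1: "bump l c (\<lambda>_. 0) x \<le> 1"
 unfolding bump_def by (auto intro!: prod_nonneg prod_le_1 simp: psiD_0_nonneg psiD_0_le_1)

lemma bump_0_lower:
 fixes x :: "real ^ 'n::finite"
 assumes "0 < l" "\<And>i. c $ i \<le> x $ i \<and> x $ i \<le> c $ i + l"
 shows "exp (- 1 / 2) ^ CARD('n) \<le> bump l c (\<lambda>_. 0) x"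
proof -
 have "(\<Prod>i\<in>(UNIV::'n set). exp (- 1 / 2)) \<le> (\<Prod>i\<in>UNIV. psiD 0 ((x $ i - c $ i) / l))"
  using assms by (intro prod_mono conjI psiD_0_lower) (auto simp: field_simps)
 thus ?thesis by (simp add: bump_def)
qed

lemma bump_integrable:
 fixes c :: "real ^ 'n::finite"
 assumes "0 < l" shows "integrable lborel (bump l c \<alpha>)"
proof -
 obtain B where "\<And>x. \<bar>bump l c \<alpha> x\<bar> \<le> B"
  using continuous_compact_support_bounded[OF bump_continuous[OF assms] bounded_bump_support[OF assms]] by blast
 hence "integrable lborel (\<lambda>x. 1 * bump l c \<alpha> x)"
  by (intro loc_int_mult_integrable[OF loc_int_1, where B=B] bump_measurable bounded_bump_support assms)
 thus ?thesis by simp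
qed

lemma bump_mass_pos: "0 < bump_mass TYPE('n::finite)"
proof -
 let ?C = "cbox 0 (\<chi> i. 1) :: (real^'n) set"
 define e where "e = exp (- 1 / 2 :: real) ^ CARD('n)"
 have e: "e > 0" by (simp add: e_def)
 have fin: "emeasure lborel ?C < \<infinity>" by (rule emeasure_lborel_cbox_finite)
 have "measure lborel ?C = 1" by (subst content_cbox_cart) (auto simp: interval_ne_empty_cart)
 hence "e * 1 = (\<integral>x. e * indicator ?C x \<partial>lborel)" using fin by simp
 also have "\<dots> \<le> (\<integral>x. bump 1 0 (\<lambda>_::'n. 0) x \<partial>lborel)"
 proof (rule integral_mono)
  show "integrable lborel (\<lambda>x. e * indicator ?C x)" using fin by simp
  show "integrable lborel (bump 1 0 (\<lambda>_::'n. 0))" by (rule bump_integrable) simp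
  fix x :: "real^'n"
  show "e * indicator ?C x \<le> bump 1 0 (\<lambda>_. 0) x"
   using bump_0_lower[of 1 0 x] bump_0_nonneg[of 1 0 x] by (auto simp: indicator_def mem_box_cart e_def)
 qed
 finally show ?thesis using e by (simp add: bump_mass_def)
qed

lemma eta_support: "{z :: real ^ 'n::finite. eta z \<noteq> 0} \<subseteq> ball 0 (2 * real CARD('n))"
 using bump_support_norm[of 1 "0::real^'n" "\<lambda>_. 0"] by (auto simp: eta_def)

lemma avg_kernel_eta: "avg_kernel (eta :: real ^ 'n::finite => real)"
 unfolding avg_kernel_def
proof (intro conjI)
 note I = bump_mass_pos[where 'n='n]
 show [measurable]: "(eta :: real ^ 'n => real) \<in> borel_fun"
  unfolding eta_def using bump_measurable[of 1 "0::real^'n" "\<lambda>_. 0"] by simp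
 show "bounded {x::real^'n. eta x \<noteq> 0}" by (rule bounded_subset[OF bounded_ball eta_support])
 show "\<exists>B. \<forall>x::real^'n. \<bar>eta x\<bar> \<le> B"
 proof (intro exI allI)
  fix x :: "real^'n"
  show "\<bar>eta x\<bar> \<le> 1 / bump_mass TYPE('n)"
   using bump_0_nonneg[of 1 0 x] bump_0_le_1[of 1 0 x] I by (simp add: eta_def divide_right_mono)
 qed
 show nn: "\<forall>x::real^'n. 0 \<le> eta x" using bump_0_nonneg[of 1 "0::real^'n"] I by (auto simp: eta_def intro!: divide_nonneg_pos)
 have i: "integrable lborel (eta :: real ^ 'n => real)" unfolding eta_def[abs_def]
  using bump_integrable[of 1] by (intro integrable_divide) simp
 have "(\<integral>x. eta (x::real^'n) \<partial>lborel) = (\<integral>x. bump 1 0 (\<lambda>_::'n. 0) x \<partial>lborel) / bump_mass TYPE('n)"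
  unfolding eta_def by simp
 also have "\<dots> = 1" using I by (simp add: bump_mass_def)
 finally show "(\<integral>+ x. ennreal (eta (x::real^'n))) = 1"
  using nn i by (subst nn_integral_eq_integral) auto
qed

lemma bump_translate: "bump l c \<alpha> w = bump l 0 \<alpha> (w - c)"
 by (simp add: bump_def)

text \<open>Substitution moves the point y from the argument of f into the kernel. There it can be
  differentiated, and the kernel becomes a bump centred at y, which is a test function.\<close>

lemma eta_smear:
 fixes f :: "real ^ 'n::finite => real"
 assumes f: "loc_int f" and \<epsilon>: "0 < \<epsilon>"
 shows "smear eta f \<epsilon> y = (\<integral>w. f w * bump \<epsilon> 0 (\<lambda>_. 0) (w - y) \<partial>lborel) / (\<epsilon> ^ CARD('n) * bump_mass TYPE('n))"
proof -
 note loc_int_measurable[OF f, measurable]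
 have [measurable]: "bump \<epsilon> (0::real^'n) (\<lambda>_. 0) \<in> borel_fun" using \<epsilon> by simp
 have "(\<integral>w. f w * bump \<epsilon> 0 (\<lambda>_. 0) (w - y) \<partial>lborel)
  = \<epsilon> ^ CARD('n) * (\<integral>z. f (y + \<epsilon> *\<^sub>R z) * bump \<epsilon> 0 (\<lambda>_. 0) ((y + \<epsilon> *\<^sub>R z) - y) \<partial>lborel)"
  using integral_lborel_affine[of "\<lambda>w. f w * bump \<epsilon> 0 (\<lambda>_. 0) (w - y)" \<epsilon> y] \<epsilon> by simp
 also have "(\<lambda>z. f (y + \<epsilon> *\<^sub>R z) * bump \<epsilon> 0 (\<lambda>_. 0) ((y + \<epsilon> *\<^sub>R z) - y)) = (\<lambda>z. f (y + \<epsilon> *\<^sub>R z) * eta z * bump_mass TYPE('n))"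
  using \<epsilon> bump_mass_pos[where 'n='n] by (auto simp: bump_def eta_def)
 also have "(\<integral>z. f (y + \<epsilon> *\<^sub>R z) * eta z * bump_mass TYPE('n) \<partial>lborel) = smear eta f \<epsilon> y * bump_mass TYPE('n)"
  by (simp add: smear_def)
 finally show ?thesis using \<epsilon> bump_mass_pos[where 'n='n] by simp
qed

subsection \<open>Derivatives of mollified functions\<close>

text \<open>Up to normalisation, the \<open>\<alpha>\<close>-th derivative of the mollification of \<open>f\<close> at scale \<open>\<epsilon>\<close>; \<open>Gd\<close> adds \<open>j\<close>
 differentiations in the direction \<open>d\<close>.\<close>

definition Fm :: "(real ^ 'n::finite => real) => real => ('n => nat) => real ^ 'n => real" where
 "Fm f \<epsilon> \<alpha> p = (-1) ^ (\<Sum>i\<in>UNIV. \<alpha> i) * (\<integral>w. f w * bump \<epsilon> 0 \<alpha> (w - p) \<partial>lborel)"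

lemma loc_int_bump_integrable:
 fixes f :: "real ^ 'n::finite => real"
 assumes f: "loc_int f" and \<epsilon>: "0 < \<epsilon>"
 shows "integrable lborel (\<lambda>w. f w * bump \<epsilon> c \<alpha> w)"
proof -
 obtain B where "\<And>x. \<bar>bump \<epsilon> c \<alpha> x\<bar> \<le> B"
  using continuous_compact_support_bounded[OF bump_continuous[OF \<epsilon>] bounded_bump_support[OF \<epsilon>]] by blast
 thus ?thesis by (intro loc_int_mult_integrable[OF f, where B=B] bump_measurable bounded_bump_support \<epsilon>)
qed

lemma DERIV_Fm:
 fixes f :: "real ^ 'n::finite => real"
 assumes f: "loc_int f" and \<epsilon>: "0 < \<epsilon>"
 shows "((\<lambda>u. Fm f \<epsilon> \<alpha> (p + u *\<^sub>R d)) has_real_derivative (\<Sum>i\<in>UNIV. d $ i * Fm f \<epsilon> (incr \<alpha> i) (p + u *\<^sub>R d))) (at u)"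
proof -
 \<comment> \<open>The point p enters the bump with a minus sign, so moving along d differentiates
   the bump along -d; the sign is absorbed by the power of -1 in \<open>Fm\<close>.\<close>
 define \<kappa>' where "\<kappa>' w = (\<Sum>i\<in>UNIV. (- d) $ i * bump \<epsilon> 0 (incr \<alpha> i) w)" for w
 have s2: "bounded {w. \<kappa>' w \<noteq> 0}"
 proof (rule bounded_subset[of "\<Union>i\<in>UNIV. {w. bump \<epsilon> 0 (incr \<alpha> i) w \<noteq> 0}"])
  show "bounded (\<Union>i\<in>UNIV. {w. bump \<epsilon> 0 (incr \<alpha> i) w \<noteq> 0})"
   by (intro bounded_UN) (auto simp: bounded_bump_support[OF \<epsilon>])
  show "{w. \<kappa>' w \<noteq> 0} \<subseteq> (\<Union>i\<in>UNIV. {w. bump \<epsilon> 0 (incr \<alpha> i) w \<noteq> 0})"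
  proof
   fix w assume "w \<in> {w. \<kappa>' w \<noteq> 0}"
   hence "(\<Sum>i\<in>UNIV. (- d) $ i * bump \<epsilon> 0 (incr \<alpha> i) w) \<noteq> 0" by (simp add: \<kappa>'_def)
   then obtain i where "(- d) $ i * bump \<epsilon> 0 (incr \<alpha> i) w \<noteq> 0"
    by (rule sum.not_neutral_contains_not_neutral)
   thus "w \<in> (\<Union>i\<in>UNIV. {w. bump \<epsilon> 0 (incr \<alpha> i) w \<noteq> 0})" by auto
  qed
 qed
 have der: "((\<lambda>u. bump \<epsilon> 0 \<alpha> (w - (p + u *\<^sub>R d))) has_real_derivative \<kappa>' (w - (p + u *\<^sub>R d))) (at u)" for w u
  using DERIV_along_line[of "bump \<epsilon> 0 \<alpha>" _ "w - p" u "- d", OF bump_has_derivative[OF \<epsilon>]]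
  unfolding \<kappa>'_def by (simp add: algebra_simps)
 have "((\<lambda>u. \<integral>w. f w * bump \<epsilon> 0 \<alpha> (w - (p + u *\<^sub>R d)) \<partial>lborel) has_real_derivative
     (\<integral>w. f w * \<kappa>' (w - (p + u *\<^sub>R d)) \<partial>lborel)) (at u)"
  by (rule DERIV_integral_translate[OF f _ _ _ s2 der])
    (auto intro!: bump_continuous \<epsilon> bounded_bump_support continuous_intros simp: \<kappa>'_def)
 moreover have "(\<integral>w. f w * \<kappa>' (w - q) \<partial>lborel) = - (\<Sum>i\<in>UNIV. d $ i * (\<integral>w. f w * bump \<epsilon> 0 (incr \<alpha> i) (w - q) \<partial>lborel))" for q
 proof -
  have i: "integrable lborel (\<lambda>w. f w * bump \<epsilon> 0 \<beta> (w - q))" for \<beta>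
   using loc_int_bump_integrable[OF f \<epsilon>, of q \<beta>] by (subst (asm) bump_translate)
  have "(\<integral>w. f w * \<kappa>' (w - q) \<partial>lborel) = (\<integral>w. (\<Sum>i\<in>UNIV. - d $ i * (f w * bump \<epsilon> 0 (incr \<alpha> i) (w - q))) \<partial>lborel)"
   unfolding \<kappa>'_def sum_distrib_left by (intro Bochner_Integration.integral_cong sum.cong refl) simp
  also have "\<dots> = (\<Sum>i\<in>UNIV. - d $ i * (\<integral>w. f w * bump \<epsilon> 0 (incr \<alpha> i) (w - q) \<partial>lborel))"
   using i by (subst Bochner_Integration.integral_sum) auto
  finally show ?thesis by (simp add: sum_negf)
 qed
 ultimately have "((\<lambda>u. \<integral>w. f w * bump \<epsilon> 0 \<alpha> (w - (p + u *\<^sub>R d)) \<partial>lborel) has_real_derivative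
     - (\<Sum>i\<in>UNIV. d $ i * (\<integral>w. f w * bump \<epsilon> 0 (incr \<alpha> i) (w - (p + u *\<^sub>R d)) \<partial>lborel))) (at u)" by simp
 from DERIV_cmult[OF this, of "(-1) ^ (\<Sum>i\<in>UNIV. \<alpha> i)"]
 show ?thesis unfolding Fm_def sum_incr by (rule DERIV_cong) (simp add: sum_distrib_left sum_negf mult_ac)
qed

primrec Gd :: "(real ^ 'n::finite => real) => real => real ^ 'n => nat => ('n => nat) => real ^ 'n => real" where
 "Gd f \<epsilon> d 0 \<alpha> p = Fm f \<epsilon> \<alpha> p"
| "Gd f \<epsilon> d (Suc j) \<alpha> p = (\<Sum>i\<in>UNIV. d $ i * Gd f \<epsilon> d j (incr \<alpha> i) p)"

lemma DERIV_Gd: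
 fixes f :: "real ^ 'n::finite => real"
 assumes "loc_int f" "0 < \<epsilon>"
 shows "((\<lambda>u. Gd f \<epsilon> d j \<alpha> (p + u *\<^sub>R d)) has_real_derivative Gd f \<epsilon> d (Suc j) \<alpha> (p + u *\<^sub>R d)) (at u)"
proof (induction j arbitrary: \<alpha>)
 case 0
 show ?case using DERIV_Fm[OF assms] by simp
next
 case (Suc j)
 have "((\<lambda>u. \<Sum>i\<in>UNIV. d $ i * Gd f \<epsilon> d j (incr \<alpha> i) (p + u *\<^sub>R d)) has_real_derivative
   (\<Sum>i\<in>UNIV. d $ i * Gd f \<epsilon> d (Suc j) (incr \<alpha> i) (p + u *\<^sub>R d))) (at u)"
  by (intro DERIV_sum DERIV_cmult Suc.IH)
 thus ?case by simp
qed

section \<open>Controlling mollifications by a majorant of the weak derivatives\<close>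

lemma finite_multi_indices: "finite (multi_indices k :: ('n::finite => nat) set)"
proof (rule finite_subset)
 show "(multi_indices k :: ('n => nat) set) \<subseteq> PiE UNIV (\<lambda>_. {..k})"
  by (auto simp: multi_indices_def intro!: member_le_sum)
 show "finite (PiE UNIV (\<lambda>_. {..k}) :: ('n => nat) set)" by (intro finite_PiE) auto
qed

text \<open>Every directional derivative expands into a sum over the coordinates, and each partial
  derivative that results is among those summed over \<open>multi_indices\<close>.\<close>

lemma Gd_bound:
 fixes d :: "real ^ 'n::finite"
 shows "\<bar>Gd f \<epsilon> d j \<alpha> p\<bar> \<le> (\<Sum>i\<in>UNIV. \<bar>d $ i\<bar>) ^ j * (\<Sum>\<beta>\<in>multi_indices ((\<Sum>i\<in>UNIV. \<alpha> i) + j). \<bar>Fm f \<epsilon> \<beta> p\<bar>)"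
proof (induction j arbitrary: \<alpha>)
 case 0
 have "\<alpha> \<in> multi_indices (\<Sum>i\<in>UNIV. \<alpha> i)" by (simp add: multi_indices_def)
 thus ?case by (auto intro!: member_le_sum finite_multi_indices)
next
 case (Suc j)
 let ?S = "\<Sum>\<beta>\<in>multi_indices ((\<Sum>i\<in>UNIV. \<alpha> i) + Suc j). \<bar>Fm f \<epsilon> \<beta> p\<bar>"
 have "\<bar>Gd f \<epsilon> d (Suc j) \<alpha> p\<bar> \<le> (\<Sum>i\<in>UNIV. \<bar>d $ i\<bar> * \<bar>Gd f \<epsilon> d j (incr \<alpha> i) p\<bar>)"
  using sum_abs[of "\<lambda>i. d $ i * Gd f \<epsilon> d j (incr \<alpha> i) p" UNIV] by (simp add: abs_mult)
 also have "\<dots> \<le> (\<Sum>i\<in>UNIV. \<bar>d $ i\<bar> * ((\<Sum>i\<in>UNIV. \<bar>d $ i\<bar>) ^ j * ?S))"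
 proof (intro sum_mono mult_left_mono)
  fix i
  show "\<bar>Gd f \<epsilon> d j (incr \<alpha> i) p\<bar> \<le> (\<Sum>i\<in>UNIV. \<bar>d $ i\<bar>) ^ j * ?S"
   using Suc.IH[of "incr \<alpha> i"] by (simp add: sum_incr)
 qed simp
 also have "\<dots> = (\<Sum>i\<in>UNIV. \<bar>d $ i\<bar>) ^ Suc j * ?S" by (simp add: sum_distrib_right[symmetric])
 finally show ?case .
qed

text \<open>This is what the estimates use of f: local integrability and one common majorant P of
  all its weak derivatives of order k. P takes extended values, so it can be averaged and mollified
  freely; in the end it is a Borel representative of \<open>grad_norm\<close>.\<close>

definition weak_grad_bound :: "nat => (real ^ 'n::finite => real) => (real ^ 'n => ennreal) => bool" where
 "weak_grad_bound k f P \<longleftrightarrow> loc_int f \<and> P \<in> borel_fun \<and>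
   (\<forall>\<beta>\<in>multi_indices k. \<exists>g. loc_int g \<and> (AE x in lborel. ennreal \<bar>g x\<bar> \<le> P x) \<and>
    (\<forall>\<phi>. test_function \<phi> \<longrightarrow>
      (\<integral>x. f x * multi_deriv \<beta> \<phi> x \<partial>lborel) = (-1) ^ k * (\<integral>x. g x * \<phi> x \<partial>lborel)))"

text \<open>Testing with the bump centred at p turns the derivative of the mollification into the
  mollification of the weak derivative; the two signs (-1)^k cancel.\<close>

lemma Fm_weak_bound:
 fixes f :: "real ^ 'n::finite => real"
 assumes wg: "weak_grad_bound k f P" and \<epsilon>: "0 < \<epsilon>" and \<beta>: "\<beta> \<in> multi_indices k"
 shows "ennreal \<bar>Fm f \<epsilon> \<beta> p / (\<epsilon> ^ CARD('n) * bump_mass TYPE('n))\<bar> \<le> (\<integral>+ z. ennreal (eta z) * P (p + \<epsilon> *\<^sub>R z))"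
proof -
 note I = bump_mass_pos[where 'n='n]
 obtain g where g: "loc_int g" "AE x in lborel. ennreal \<bar>g x\<bar> \<le> P x"
  "\<And>\<phi>. test_function \<phi> ==> (\<integral>x. f x * multi_deriv \<beta> \<phi> x \<partial>lborel) = (-1) ^ k * (\<integral>x. g x * \<phi> x \<partial>lborel)"
  using wg \<beta> unfolding weak_grad_bound_def by blast
 have k: "(\<Sum>i\<in>UNIV. \<beta> i) = k" using \<beta> by (simp add: multi_indices_def)
 have "(\<integral>w. f w * bump \<epsilon> p \<beta> w \<partial>lborel) = (-1) ^ k * (\<integral>w. g w * bump \<epsilon> p (\<lambda>_. 0) w \<partial>lborel)"
  using g(3)[OF test_function_bump[OF \<epsilon>, of p "\<lambda>_. 0"]] by (simp add: multi_deriv_bump[OF \<epsilon>])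
 hence "Fm f \<epsilon> \<beta> p = ((-1) ^ k * (-1) ^ k) * (\<integral>w. g w * bump \<epsilon> 0 (\<lambda>_. 0) (w - p) \<partial>lborel)"
  unfolding Fm_def k by (subst (asm) (1 2) bump_translate) simp
 also have "(-1) ^ k * (-1) ^ k = (1::real)" by (subst power_mult_distrib[symmetric]) simp
 finally have "Fm f \<epsilon> \<beta> p / (\<epsilon> ^ CARD('n) * bump_mass TYPE('n)) = smear eta g \<epsilon> p"
  unfolding eta_smear[OF g(1) \<epsilon>] by simp
 hence "ennreal \<bar>Fm f \<epsilon> \<beta> p / (\<epsilon> ^ CARD('n) * bump_mass TYPE('n))\<bar> \<le> (\<integral>+ z. ennreal (eta z) * ennreal \<bar>g (p + \<epsilon> *\<^sub>R z)\<bar>)"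
  using abs_smear_le[OF avg_kernel_eta g(1), of \<epsilon> p] \<epsilon> by simp
 also have "\<dots> \<le> (\<integral>+ z. ennreal (eta z) * P (p + \<epsilon> *\<^sub>R z))"
 proof (rule nn_integral_mono_AE)
  have "AE z in lborel. ennreal \<bar>g (p + \<epsilon> *\<^sub>R z)\<bar> \<le> P (p + \<epsilon> *\<^sub>R z)"
   using AE_lborel_affine[OF _ g(2), of \<epsilon> p] \<epsilon> by simp
  thus "AE z in lborel. ennreal (eta z) * ennreal \<bar>g (p + \<epsilon> *\<^sub>R z)\<bar> \<le> ennreal (eta z) * P (p + \<epsilon> *\<^sub>R z)"
   by eventually_elim (rule mult_left_mono, auto)
 qed
 finally show ?thesis .
qed

text \<open>A bound for the sum of the absolute values of all partial derivatives of order k of the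
  mollification at scale \<epsilon>; the cardinality counts these derivatives.\<close>

definition Qm :: "nat => real => (real ^ 'n::finite => ennreal) => real ^ 'n => ennreal" where
 "Qm k \<epsilon> P p = ennreal (real (card (multi_indices k :: ('n => nat) set))) * (\<integral>+ z. ennreal (eta z) * P (p + \<epsilon> *\<^sub>R z))"

lemma Qm_measurable:
 fixes P :: "real ^ 'n::finite => ennreal"
 assumes [measurable]: "P \<in> borel_fun" shows "Qm k \<epsilon> P \<in> borel_fun"
proof -
 have [measurable]: "(eta :: real ^ 'n => real) \<in> borel_fun" using avg_kernelD(1)[OF avg_kernel_eta] .
 show ?thesis unfolding Qm_def[abs_def] by measurable
qed

text \<open>\<open>Taylor_functional_bound\<close> along the line p + v d. Differentiating k times
  along d costs the factor (n |d|)^k on top of a bound for the partial derivatives, which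
  \<open>Qm\<close> supplies.\<close>

lemma mollified_functional_bound:
 fixes f :: "real ^ 'n::finite => real"
 assumes wg: "weak_grad_bound k f P" and \<epsilon>: "0 < \<epsilon>" and k: "0 < k"
  and I: "finite I" and nodes: "\<And>i. i \<in> I ==> lo \<le> u i \<and> u i \<le> hi" and lohi: "lo \<le> hi"
  and moments: "\<And>m. m < k ==> (\<Sum>i\<in>I. w i * (u i - lo) ^ m) = 0"
 shows "ennreal \<bar>\<Sum>i\<in>I. w i * smear eta f \<epsilon> (p + u i *\<^sub>R d)\<bar>
   \<le> ennreal ((\<Sum>i\<in>I. \<bar>w i\<bar>) * (hi - lo) ^ (k - 1) * (real CARD('n) * norm d) ^ k)
    * (\<integral>+ v. Qm k \<epsilon> P (p + v *\<^sub>R d) * indicator {lo..hi} v)"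
proof -
 have f: "loc_int f" using wg by (simp add: weak_grad_bound_def)
 have [measurable]: "P \<in> borel_fun" using wg by (simp add: weak_grad_bound_def)
 note Qm_measurable[measurable]
 define c where "c = 1 / (\<epsilon> ^ CARD('n) * bump_mass TYPE('n))"
 have c: "c > 0" using \<epsilon> bump_mass_pos[where 'n='n] by (simp add: c_def)
 define Dg where "Dg m v = c * Gd f \<epsilon> d m (\<lambda>_. 0) (p + v *\<^sub>R d)" for m v
 have D: "(Dg m has_real_derivative Dg (Suc m) v) (at v)" for m v
  unfolding Dg_def by (intro DERIV_cmult DERIV_Gd f \<epsilon>)
 have D0: "Dg 0 v = smear eta f \<epsilon> (p + v *\<^sub>R d)" for v
  unfolding Dg_def eta_smear[OF f \<epsilon>] by (simp add: c_def Fm_def)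
 have Dk: "ennreal \<bar>Dg k v\<bar> \<le> ennreal ((real CARD('n) * norm d) ^ k) * Qm k \<epsilon> P (p + v *\<^sub>R d)" for v
 proof -
  let ?q = "p + v *\<^sub>R d"
  let ?M = "multi_indices k :: ('n => nat) set"
  have sumd: "(\<Sum>i\<in>UNIV. \<bar>d $ i\<bar>) \<le> real CARD('n) * norm d"
   using sum_mono[of UNIV "\<lambda>i. \<bar>d $ i\<bar>" "\<lambda>_. norm d"] component_le_norm_cart[of d] by simp
  have "\<bar>Dg k v\<bar> \<le> c * ((\<Sum>i\<in>UNIV. \<bar>d $ i\<bar>) ^ k * (\<Sum>\<beta>\<in>?M. \<bar>Fm f \<epsilon> \<beta> ?q\<bar>))"
   using Gd_bound[of f \<epsilon> d k "\<lambda>_. 0" ?q] c unfolding Dg_def abs_mult by (simp add: mult_left_mono)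
  also have "\<dots> \<le> c * ((real CARD('n) * norm d) ^ k * (\<Sum>\<beta>\<in>?M. \<bar>Fm f \<epsilon> \<beta> ?q\<bar>))"
   using c sumd by (intro mult_left_mono mult_right_mono power_mono sum_nonneg) auto
  also have "\<dots> = (real CARD('n) * norm d) ^ k * (\<Sum>\<beta>\<in>?M. \<bar>Fm f \<epsilon> \<beta> ?q / (\<epsilon> ^ CARD('n) * bump_mass TYPE('n))\<bar>)"
  proof -
   have "\<bar>x / (\<epsilon> ^ CARD('n) * bump_mass TYPE('n))\<bar> = c * \<bar>x\<bar>" for x
    using c by (simp add: c_def abs_mult divide_inverse mult.commute)
     (metis abs_of_pos c c_def divide_inverse mult_1 abs_mult abs_inverse inverse_mult_distrib)
   thus ?thesis by (simp add: sum_distrib_left mult_ac)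
  qed
  finally have "ennreal \<bar>Dg k v\<bar> \<le> ennreal ((real CARD('n) * norm d) ^ k) * ennreal (\<Sum>\<beta>\<in>?M. \<bar>Fm f \<epsilon> \<beta> ?q / (\<epsilon> ^ CARD('n) * bump_mass TYPE('n))\<bar>)"
   by (subst ennreal_mult[symmetric]) (auto intro!: ennreal_leI sum_nonneg)
  also have "ennreal (\<Sum>\<beta>\<in>?M. \<bar>Fm f \<epsilon> \<beta> ?q / (\<epsilon> ^ CARD('n) * bump_mass TYPE('n))\<bar>)
    = (\<Sum>\<beta>\<in>?M. ennreal \<bar>Fm f \<epsilon> \<beta> ?q / (\<epsilon> ^ CARD('n) * bump_mass TYPE('n))\<bar>)"
   by (rule sum_ennreal[symmetric]) simp
  also have "\<dots> \<le> (\<Sum>\<beta>\<in>?M. (\<integral>+ z. ennreal (eta z) * P (?q + \<epsilon> *\<^sub>R z)))"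
   by (intro sum_mono Fm_weak_bound[OF wg \<epsilon>])
  also have "\<dots> = Qm k \<epsilon> P ?q" by (simp add: Qm_def ennreal_of_nat_eq_real_of_nat)
  finally show ?thesis by (simp add: mult_left_mono)
 qed
 have "ennreal \<bar>\<Sum>i\<in>I. w i * smear eta f \<epsilon> (p + u i *\<^sub>R d)\<bar> = ennreal \<bar>\<Sum>i\<in>I. w i * Dg 0 (u i)\<bar>" by (simp add: D0)
 also have "\<dots> \<le> ennreal ((\<Sum>i\<in>I. \<bar>w i\<bar>) * (hi - lo) ^ (k - 1)) * (\<integral>+ v. ennreal \<bar>Dg k v\<bar> * indicator {lo..hi} v)"
  by (rule Taylor_functional_bound[where Dg=Dg and lo=lo and u=u and w=w, OF k D I nodes lohi moments])
 also have "(\<integral>+ v. ennreal \<bar>Dg k v\<bar> * indicator {lo..hi} v)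
   \<le> (\<integral>+ v. ennreal ((real CARD('n) * norm d) ^ k) * (Qm k \<epsilon> P (p + v *\<^sub>R d) * indicator {lo..hi} v))"
  using Dk by (intro nn_integral_mono) (auto simp: indicator_def)
 also have "\<dots> = ennreal ((real CARD('n) * norm d) ^ k) * (\<integral>+ v. Qm k \<epsilon> P (p + v *\<^sub>R d) * indicator {lo..hi} v)"
  by (rule nn_integral_cmult) measurable
 finally have "ennreal \<bar>\<Sum>i\<in>I. w i * smear eta f \<epsilon> (p + u i *\<^sub>R d)\<bar>
  \<le> ennreal ((\<Sum>i\<in>I. \<bar>w i\<bar>) * (hi - lo) ^ (k - 1)) * (ennreal ((real CARD('n) * norm d) ^ k)
    * (\<integral>+ v. Qm k \<epsilon> P (p + v *\<^sub>R d) * indicator {lo..hi} v))" by (simp add: mult_left_mono)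
 thus ?thesis using lohi by (simp add: ennreal_mult' ennreal_mult sum_nonneg mult.assoc)
qed

text \<open>Mollifying spreads P by at most 2 n \<epsilon> \<le> r, so doubling the radius of the
  ball compensates for it, at the price of 2^n in the volume.\<close>

lemma bavg_Qm:
 fixes P :: "real ^ 'n::finite => ennreal"
 assumes [measurable]: "P \<in> borel_fun" and "0 < \<epsilon>" "0 < r" and le: "\<epsilon> * (2 * real CARD('n)) \<le> r"
 shows "bavg (Qm k \<epsilon> P) y r \<le> ennreal (real (card (multi_indices k :: ('n => nat) set)) * 2 ^ CARD('n)) * bavg P y (2 * r)"
proof -
 have [measurable]: "(eta :: real ^ 'n => real) \<in> borel_fun" using avg_kernelD(1)[OF avg_kernel_eta] .
 let ?N = "ennreal (real (card (multi_indices k :: ('n => nat) set)))"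
 let ?J = "(\<integral>+ x. P x * indicator (ball y (2 * r)) x)"
 have "(\<integral>+ w. Qm k \<epsilon> P w * indicator (ball y r) w)
  = ?N * (\<integral>\<^sup>+w. (\<integral>+ z. ennreal (eta z) * P (w + \<epsilon> *\<^sub>R z)) * indicator (ball y r) w \<partial>lborel)"
  unfolding Qm_def by (subst nn_integral_cmult[symmetric]) (auto simp: mult.assoc)
 also have "\<dots> \<le> ?N * (\<integral>+ x. P x * indicator (ball y (r + \<epsilon> * (2 * real CARD('n)))) x)"
  by (intro mult_left_mono nn_integral_smear_le[OF avg_kernel_eta] eta_support) (use assms in auto)
 also have "\<dots> \<le> ?N * ?J"
  using le by (intro mult_left_mono nn_integral_mono) (auto simp: indicator_def)
 finally have "bavg (Qm k \<epsilon> P) y r \<le> ?N * ?J / emeasure lborel (ball y r)"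
  unfolding bavg_def by (rule divide_right_mono_ennreal)
 also have "\<dots> = ?N * (?J / emeasure lborel (ball y r))" by (simp add: ennreal_times_divide)
 also have "?J / emeasure lborel (ball y r) = ennreal (2 ^ CARD('n)) * bavg P y (2 * r)"
 proof -
  define m where "m = measure lborel (ball y r)"
  have m: "m > 0" "emeasure lborel (ball y r) = ennreal m"
   using assms(3) emeasure_ball_pos_finite[OF assms(3), of y] by (auto simp: m_def content_ball_pos emeasure_eq_ennreal_measure)
  have E2: "emeasure lborel (ball y (2 * r)) = ennreal (2 ^ CARD('n)) * ennreal m"
   using emeasure_ball_scale[of 2 r y y] assms(3) m by simp
  have "ennreal (2 ^ CARD('n)) * bavg P y (2 * r) = ennreal (2 ^ CARD('n)) * ?J / (ennreal (2 ^ CARD('n)) * ennreal m)"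
   unfolding bavg_def E2 by (simp add: ennreal_times_divide)
  also have "\<dots> = ?J / ennreal m" by (rule ennreal_mult_div_cancel) (use m in auto)
  finally show ?thesis using m by simp
 qed
 finally show ?thesis by (simp add: ennreal_mult mult.assoc)
qed

subsection \<open>The two scales of estimates\<close>

text \<open>Centre and radius of the balls depend affinely on the parameter. For fixed z in the unit
  ball the corresponding point then moves along a straight line with direction
  \<open>\<tau> *\<^sub>R z + h\<close>, so the one-dimensional estimate applies to each z and is
  averaged over z. With h = 0 only the radius varies (\<open>Phi_diff_grad_bound\<close>), with
  \<tau> = 0 only the centre (\<open>finite_diff_Phi_grad_bound\<close>).\<close>

lemma ball_functional_mollified:
 fixes f :: "real ^ 'n::finite => real"
 assumes wg: "weak_grad_bound k f P" and \<epsilon>: "0 < \<epsilon>" and k: "0 < k"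
  and I: "finite I" and nodes: "\<And>i. i \<in> I ==> lo \<le> u i \<and> u i \<le> hi" and lohi: "lo \<le> hi"
  and moments: "\<And>m. m < k ==> (\<Sum>i\<in>I. w i * (u i - lo) ^ m) = 0"
  and R: "\<And>z. norm z < 1 ==> norm (\<tau> *\<^sub>R z + h) \<le> R" "0 \<le> R"
  and v: "\<And>v. lo \<le> v ==> v \<le> hi ==> 0 < s + v * \<tau> \<and> ball (x0 + v *\<^sub>R h) (s + v * \<tau>) \<subseteq> ball x r \<and> r \<le> \<kappa> * (s + v * \<tau>)"
  and r: "0 < r" "\<epsilon> * (2 * real CARD('n)) \<le> r" and \<kappa>: "0 \<le> \<kappa>"
 shows "ennreal \<bar>\<Sum>i\<in>I. w i * smear ballW (smear eta f \<epsilon>) (s + u i * \<tau>) (x0 + u i *\<^sub>R h)\<bar>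
   \<le> ennreal ((\<Sum>i\<in>I. \<bar>w i\<bar>) * (hi - lo) ^ (k - 1) * (real CARD('n) * R) ^ k * ((hi - lo) * \<kappa> ^ CARD('n)
     * (real (card (multi_indices k :: ('n => nat) set)) * 2 ^ CARD('n)))) * bavg P x (2 * r)"
proof -
 have f: "loc_int f" and [measurable]: "P \<in> borel_fun" using wg by (auto simp: weak_grad_bound_def)
 note Qm_measurable[measurable]
 let ?g = "smear eta f \<epsilon>"
 let ?A = "(\<Sum>i\<in>I. \<bar>w i\<bar>) * (hi - lo) ^ (k - 1)"
 have g: "loc_int ?g" by (rule loc_int_smear[OF avg_kernel_eta f \<epsilon>])
 have A0: "0 \<le> ?A" using lohi by (simp add: sum_nonneg)
 have pt: "x0 + u i *\<^sub>R h + (s + u i * \<tau>) *\<^sub>R z = (x0 + s *\<^sub>R z) + u i *\<^sub>R (\<tau> *\<^sub>R z + h)" for i z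
  by (simp add: algebra_simps)
 have int: "integrable lborel (\<lambda>z. ?g (x0 + u i *\<^sub>R h + (s + u i * \<tau>) *\<^sub>R z) * ballW z)" if "i \<in> I" for i
  using v[of "u i"] nodes[OF that] by (intro smear_integrable[OF avg_kernel_ballW g]) auto
 define S where "S z = (\<Sum>i\<in>I. w i * ?g ((x0 + s *\<^sub>R z) + u i *\<^sub>R (\<tau> *\<^sub>R z + h)))" for z
 have eq: "S z * ballW z = (\<Sum>i\<in>I. w i * (?g (x0 + u i *\<^sub>R h + (s + u i * \<tau>) *\<^sub>R z) * ballW z))" for z
  unfolding S_def pt sum_distrib_right by (simp add: mult.assoc)
 have Sint: "integrable lborel (\<lambda>z. S z * ballW z)" unfolding eq
  by (intro Bochner_Integration.integrable_sum integrable_mult_right int)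
 have "(\<Sum>i\<in>I. w i * smear ballW ?g (s + u i * \<tau>) (x0 + u i *\<^sub>R h)) = (\<integral>z. S z * ballW z \<partial>lborel)"
  unfolding smear_def[of ballW] eq using int by (subst Bochner_Integration.integral_sum) auto
 hence "ennreal \<bar>\<Sum>i\<in>I. w i * smear ballW ?g (s + u i * \<tau>) (x0 + u i *\<^sub>R h)\<bar> \<le> (\<integral>+ z. ennreal (norm (S z * ballW z)))"
  using integral_norm_bound_ennreal[OF Sint] by simp
 also have "\<dots> \<le> (\<integral>\<^sup>+z. ennreal (?A * (real CARD('n) * R) ^ k) * (\<integral>+ v. ennreal (ballW z) *
    Qm k \<epsilon> P ((x0 + v *\<^sub>R h) + (s + v * \<tau>) *\<^sub>R z) * indicator {lo..hi} v) \<partial>lborel)"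
 proof (intro nn_integral_mono)
  fix z :: "real^'n"
  show "ennreal (norm (S z * ballW z)) \<le> ennreal (?A * (real CARD('n) * R) ^ k) * (\<integral>+ v. ennreal (ballW z) *
    Qm k \<epsilon> P ((x0 + v *\<^sub>R h) + (s + v * \<tau>) *\<^sub>R z) * indicator {lo..hi} v)"
  proof (cases "norm z < 1")
   case False
   hence "ballW z = 0" by (simp add: ballW_def)
   thus ?thesis by simp
  next
   case True
   have W0: "ballW z \<ge> 0" using avg_kernelD(3)[OF avg_kernel_ballW] .
   have "ennreal \<bar>S z\<bar> \<le> ennreal (?A * (real CARD('n) * norm (\<tau> *\<^sub>R z + h)) ^ k)
    * (\<integral>+ v. Qm k \<epsilon> P ((x0 + s *\<^sub>R z) + v *\<^sub>R (\<tau> *\<^sub>R z + h)) * indicator {lo..hi} v)"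
    unfolding S_def by (rule mollified_functional_bound[where lo=lo and u=u and w=w, OF wg \<epsilon> k I nodes lohi moments])
   also have "\<dots> \<le> ennreal (?A * (real CARD('n) * R) ^ k)
    * (\<integral>+ v. Qm k \<epsilon> P ((x0 + s *\<^sub>R z) + v *\<^sub>R (\<tau> *\<^sub>R z + h)) * indicator {lo..hi} v)"
    using A0 R(1)[OF True] by (intro mult_right_mono ennreal_leI mult_left_mono power_mono) auto
   finally have "ennreal (ballW z) * ennreal \<bar>S z\<bar> \<le> ennreal (ballW z) * (ennreal (?A * (real CARD('n) * R) ^ k)
    * (\<integral>+ v. Qm k \<epsilon> P ((x0 + s *\<^sub>R z) + v *\<^sub>R (\<tau> *\<^sub>R z + h)) * indicator {lo..hi} v))"
    by (rule mult_left_mono) simp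
   also have "\<dots> = ennreal (?A * (real CARD('n) * R) ^ k) * (\<integral>+ v. ennreal (ballW z) * (Qm k \<epsilon> P ((x0 + s *\<^sub>R z) + v *\<^sub>R (\<tau> *\<^sub>R z + h)) * indicator {lo..hi} v))"
    by (subst nn_integral_cmult) (auto simp: mult_ac)
   also have "(\<lambda>v. ennreal (ballW z) * (Qm k \<epsilon> P ((x0 + s *\<^sub>R z) + v *\<^sub>R (\<tau> *\<^sub>R z + h)) * indicator {lo..hi} v))
    = (\<lambda>v. ennreal (ballW z) * Qm k \<epsilon> P ((x0 + v *\<^sub>R h) + (s + v * \<tau>) *\<^sub>R z) * indicator {lo..hi} v)"
    by (simp add: algebra_simps)
   finally show ?thesis using W0 by (simp add: abs_mult ennreal_mult' mult.commute)
  qed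
 qed
 also have "\<dots> = ennreal (?A * (real CARD('n) * R) ^ k) * (\<integral>\<^sup>+z. (\<integral>+ v. ennreal (ballW z) *
    Qm k \<epsilon> P ((x0 + v *\<^sub>R h) + (s + v * \<tau>) *\<^sub>R z) * indicator {lo..hi} v) \<partial>lborel)"
  by (rule nn_integral_cmult) measurable
 \<comment> \<open>After the exchange the inner integral is the mean of \<open>Qm\<close> over the
   ball with parameter v, which is comparable with the ball of radius r around x.\<close>
 also have "(\<integral>\<^sup>+z. (\<integral>+ v. ennreal (ballW z) *
    Qm k \<epsilon> P ((x0 + v *\<^sub>R h) + (s + v * \<tau>) *\<^sub>R z) * indicator {lo..hi} v) \<partial>lborel)
   = (\<integral>\<^sup>+v. (\<integral>+ z. ennreal (ballW z) *
    Qm k \<epsilon> P ((x0 + v *\<^sub>R h) + (s + v * \<tau>) *\<^sub>R z) * indicator {lo..hi} v) \<partial>lborel)"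
  by (rule lborel_pair.Fubini') measurable
 also have "\<dots> \<le> (\<integral>+ v. ennreal (\<kappa> ^ CARD('n)) * bavg (Qm k \<epsilon> P) x r * indicator {lo..hi} v)"
 proof (intro nn_integral_mono)
  fix v :: real
  have "(\<integral>+ z. ennreal (ballW z) * Qm k \<epsilon> P ((x0 + v *\<^sub>R h) + (s + v * \<tau>) *\<^sub>R z)) \<le> ennreal (\<kappa> ^ CARD('n)) * bavg (Qm k \<epsilon> P) x r"
   if "v \<in> {lo..hi}"
  proof -
   have vv: "0 < s + v * \<tau>" "ball (x0 + v *\<^sub>R h) (s + v * \<tau>) \<subseteq> ball x r" "r \<le> \<kappa> * (s + v * \<tau>)" using v[of v] that by auto
   have "(\<integral>+ z. ennreal (ballW z) * Qm k \<epsilon> P ((x0 + v *\<^sub>R h) + (s + v * \<tau>) *\<^sub>R z)) = bavg (Qm k \<epsilon> P) (x0 + v *\<^sub>R h) (s + v * \<tau>)"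
    by (rule ballW_nn_integral) (use vv in auto)
   also have "\<dots> \<le> ennreal (\<kappa> ^ CARD('n)) * bavg (Qm k \<epsilon> P) x r"
    using bavg_mono_ball[OF vv(1,2) r(1) vv(3), of "Qm k \<epsilon> P"] by simp
   finally show ?thesis .
  qed
  thus "(\<integral>+ z. ennreal (ballW z) * Qm k \<epsilon> P ((x0 + v *\<^sub>R h) + (s + v * \<tau>) *\<^sub>R z) * indicator {lo..hi} v)
   \<le> ennreal (\<kappa> ^ CARD('n)) * bavg (Qm k \<epsilon> P) x r * indicator {lo..hi} v"
   by (cases "v \<in> {lo..hi}") auto
 qed
 also have "\<dots> = ennreal (\<kappa> ^ CARD('n)) * bavg (Qm k \<epsilon> P) x r * ennreal (hi - lo)"
  using lohi by (subst nn_integral_cmult_indicator) auto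
 also have "\<dots> \<le> ennreal (\<kappa> ^ CARD('n)) * (ennreal (real (card (multi_indices k :: ('n => nat) set)) * 2 ^ CARD('n)) * bavg P x (2 * r)) * ennreal (hi - lo)"
  by (intro mult_right_mono mult_left_mono bavg_Qm r \<epsilon>) auto
 finally have "ennreal \<bar>\<Sum>i\<in>I. w i * smear ballW ?g (s + u i * \<tau>) (x0 + u i *\<^sub>R h)\<bar>
  \<le> ennreal (?A * (real CARD('n) * R) ^ k) * (ennreal (\<kappa> ^ CARD('n)) * (ennreal (real (card (multi_indices k :: ('n => nat) set)) * 2 ^ CARD('n)) * bavg P x (2 * r)) * ennreal (hi - lo))"
  by (simp add: mult_left_mono)
 also have "\<dots> = (ennreal (?A * (real CARD('n) * R) ^ k) * (ennreal (hi - lo) * ennreal (\<kappa> ^ CARD('n)) * ennreal (real (card (multi_indices k :: ('n => nat) set)) * 2 ^ CARD('n)))) * bavg P x (2 * r)"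
  by (simp only: mult_ac)
 finally show ?thesis using A0 R(2) lohi \<kappa> by (simp add: ennreal_mult[symmetric])
qed

text \<open>L1 convergence of the mollifications on the ball carries over to the means over
  it.\<close>

lemma ball_average_mollified_tendsto:
 fixes f :: "real ^ 'n::finite => real"
 assumes f: "loc_int f" and t: "0 < t"
 shows "((\<lambda>\<epsilon>. smear ballW (smear eta f \<epsilon>) t y) \<longlongrightarrow> smear ballW f t y) (at_right 0)"
proof (rule tendstoI)
 fix e :: real assume e: "e > 0"
 note loc_int_measurable[OF f, measurable]
 have [measurable]: "(eta :: real ^ 'n => real) \<in> borel_fun" using avg_kernelD(1)[OF avg_kernel_eta] .
 define m where "m = measure lborel (ball y t)"
 have m: "m > 0" "emeasure lborel (ball y t) = ennreal m"
  using t emeasure_ball_pos_finite[OF t, of y] by (auto simp: m_def content_ball_pos emeasure_eq_ennreal_measure)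
 obtain \<rho> where \<rho>: "ball y t \<subseteq> ball 0 \<rho>" using bounded_subset_ballD[OF bounded_ball] by blast
 obtain d where d: "d > 0" "\<And>\<epsilon>. 0 < \<epsilon> ==> \<epsilon> < d ==> (\<integral>+ x. ennreal \<bar>smear eta f \<epsilon> x - f x\<bar> * indicator (ball 0 \<rho>) x) \<le> ennreal (e / 2 * m)"
  using smear_L1_loc[OF avg_kernel_eta f, of "e / 2 * m" \<rho>] e m by auto
 have "dist (smear ballW (smear eta f \<epsilon>) t y) (smear ballW f t y) < e" if \<epsilon>: "0 < \<epsilon>" "\<epsilon> < d" for \<epsilon>
 proof -
  let ?g = "smear eta f \<epsilon>"
  have g: "loc_int ?g" by (rule loc_int_smear[OF avg_kernel_eta f \<epsilon>(1)])
  have i: "integrable lborel (\<lambda>z. ?g (y + t *\<^sub>R z) * ballW z)" "integrable lborel (\<lambda>z. f (y + t *\<^sub>R z) * ballW z)"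
   using t by (auto intro!: smear_integrable avg_kernel_ballW f g)
  have "smear ballW ?g t y - smear ballW f t y = (\<integral>z. ?g (y + t *\<^sub>R z) * ballW z - f (y + t *\<^sub>R z) * ballW z \<partial>lborel)"
   unfolding smear_def[of ballW] using i by simp
  also have "ennreal \<bar>\<dots>\<bar> \<le> (\<integral>+ z. ennreal (norm (?g (y + t *\<^sub>R z) * ballW z - f (y + t *\<^sub>R z) * ballW z)))"
   using integral_norm_bound_ennreal[OF Bochner_Integration.integrable_diff[OF i]] by simp
  also have "\<dots> = (\<integral>+ z. ennreal (ballW z) * ennreal \<bar>?g (y + t *\<^sub>R z) - f (y + t *\<^sub>R z)\<bar>)"
  proof (intro nn_integral_cong)
   fix z :: "real^'n"
   have W: "0 \<le> ballW z" using avg_kernelD(3)[OF avg_kernel_ballW] .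
   have "\<bar>?g (y + t *\<^sub>R z) * ballW z - f (y + t *\<^sub>R z) * ballW z\<bar> = ballW z * \<bar>?g (y + t *\<^sub>R z) - f (y + t *\<^sub>R z)\<bar>"
    using W unfolding left_diff_distrib[symmetric] abs_mult by simp
   thus "ennreal (norm (?g (y + t *\<^sub>R z) * ballW z - f (y + t *\<^sub>R z) * ballW z)) = ennreal (ballW z) * ennreal \<bar>?g (y + t *\<^sub>R z) - f (y + t *\<^sub>R z)\<bar>"
    using W by (simp add: ennreal_mult)
  qed
  also have "\<dots> = bavg (\<lambda>w. ennreal \<bar>?g w - f w\<bar>) y t"
   by (rule ballW_nn_integral[of "\<lambda>w. ennreal \<bar>?g w - f w\<bar>"]) (use t in auto)
  also have "\<dots> \<le> ennreal (e / 2 * m) / emeasure lborel (ball y t)" unfolding bavg_def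
  proof (rule divide_right_mono_ennreal, rule order_trans[OF _ d(2)[OF \<epsilon>]], rule nn_integral_mono)
   fix x
   show "ennreal \<bar>?g x - f x\<bar> * indicator (ball y t) x \<le> ennreal \<bar>?g x - f x\<bar> * indicator (ball 0 \<rho>) x"
    using \<rho> by (auto simp: indicator_def)
  qed
  also have "\<dots> = ennreal (e / 2)" using m e by (simp add: divide_ennreal)
  finally have "\<bar>smear ballW ?g t y - smear ballW f t y\<bar> \<le> e / 2" using e by simp
  thus ?thesis using e by (simp add: dist_real_def)
 qed
 thus "\<forall>\<^sub>F \<epsilon> in at_right 0. dist (smear ballW (smear eta f \<epsilon>) t y) (smear ballW f t y) < e"
  unfolding eventually_at_right_field using d(1) by blast
qed

text \<open>The constant for mollifications does not depend on \<epsilon>, so the estimate survives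
  the limit \<epsilon> to 0.\<close>

lemma ball_functional_bound:
 fixes f :: "real ^ 'n::finite => real"
 assumes wg: "weak_grad_bound k f P" and k: "0 < k"
  and I: "finite I" and nodes: "\<And>i. i \<in> I ==> lo \<le> u i \<and> u i \<le> hi" and lohi: "lo \<le> hi"
  and moments: "\<And>m. m < k ==> (\<Sum>i\<in>I. w i * (u i - lo) ^ m) = 0"
  and R: "\<And>z. norm z < 1 ==> norm (\<tau> *\<^sub>R z + h) \<le> R" "0 \<le> R"
  and v: "\<And>v. lo \<le> v ==> v \<le> hi ==> 0 < s + v * \<tau> \<and> ball (x0 + v *\<^sub>R h) (s + v * \<tau>) \<subseteq> ball x r \<and> r \<le> \<kappa> * (s + v * \<tau>)"
  and r: "0 < r" and \<kappa>: "0 \<le> \<kappa>"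
 shows "ennreal \<bar>\<Sum>i\<in>I. w i * smear ballW f (s + u i * \<tau>) (x0 + u i *\<^sub>R h)\<bar>
   \<le> ennreal ((\<Sum>i\<in>I. \<bar>w i\<bar>) * (hi - lo) ^ (k - 1) * (real CARD('n) * R) ^ k * ((hi - lo) * \<kappa> ^ CARD('n)
     * (real (card (multi_indices k :: ('n => nat) set)) * 2 ^ CARD('n)))) * bavg P x (2 * r)" (is "_ \<le> ?K")
proof (rule tendsto_upperbound)
 have f: "loc_int f" using wg by (simp add: weak_grad_bound_def)
 show "((\<lambda>\<epsilon>. ennreal \<bar>\<Sum>i\<in>I. w i * smear ballW (smear eta f \<epsilon>) (s + u i * \<tau>) (x0 + u i *\<^sub>R h)\<bar>)
  \<longlongrightarrow> ennreal \<bar>\<Sum>i\<in>I. w i * smear ballW f (s + u i * \<tau>) (x0 + u i *\<^sub>R h)\<bar>) (at_right 0)"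
  using nodes v by (intro tendsto_intros ball_average_mollified_tendsto f) auto
 have "\<forall>\<^sub>F \<epsilon> in at_right 0. \<epsilon> \<in> {0<..<r / (2 * real CARD('n))}"
  using r by (intro eventually_at_rightI[of 0 "r / (2 * real CARD('n))"]) auto
 thus "\<forall>\<^sub>F \<epsilon> in at_right 0. ennreal \<bar>\<Sum>i\<in>I. w i * smear ballW (smear eta f \<epsilon>) (s + u i * \<tau>) (x0 + u i *\<^sub>R h)\<bar> \<le> ?K"
 proof eventually_elim
  case (elim \<epsilon>)
  hence "0 < \<epsilon>" "\<epsilon> * (2 * real CARD('n)) \<le> r" by (auto simp: field_simps)
  thus ?case using ball_functional_mollified[where lo=lo and u=u and w=w and s=s and \<tau>=\<tau>, OF wg _ k I nodes lohi moments R v r _ \<kappa>] by blast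
 qed
qed simp

text \<open>The coefficients make \<open>Phi k f t\<close> reproduce polynomials of degree less than \<open>k\<close>, so that its variation
 between two scales is controlled by the derivatives of order \<open>k\<close>.\<close>

definition Phi :: "nat => ('a::euclidean_space => real) => real => 'a => real" where
 "Phi k f t y = (\<Sum>j=1..k. ccoef k j * smear ballW f (real j * t) y)"

lemma Phi_diff_grad_bound:
 assumes k: "0 < k"
 obtains C where "0 < C" "\<And>(f::real^'n::finite => real) P y t. weak_grad_bound k f P ==> 0 < t ==>
  ennreal \<bar>Phi k f (t / 2) y - Phi k f t y\<bar> \<le> ennreal (C * t ^ k) * bavg P y (2 * real k * t)"
proof -
 \<comment> \<open>The pair (j, True) stands for the radius j t / 2 with coefficient
   \<open>ccoef k j\<close>, and (j, False) for the radius j t with the opposite sign. Both families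
   reproduce polynomials of degree below k at u = 0, so the moments around lo = 1/2 cancel.\<close>
 define w where "w i = (if snd i then ccoef k (fst i) else - ccoef k (fst i))" for i :: "nat \<times> bool"
 define u where "u i = (if snd i then real (fst i) / 2 else real (fst i))" for i :: "nat \<times> bool"
 define I where "I = {1..k} \<times> (UNIV :: bool set)"
 have sumI: "(\<Sum>i\<in>I. F i) = (\<Sum>j=1..k. F (j, True) + F (j, False))" for F :: "nat \<times> bool => real"
  unfolding I_def by (subst sum.cartesian_product') (simp add: UNIV_bool add.commute)
 define C0 where "C0 = (\<Sum>i\<in>I. \<bar>w i\<bar>) * (real k - 1/2) ^ (k - 1) * real CARD('n) ^ k * ((real k - 1/2) * (2 * real k) ^ CARD('n)
     * (real (card (multi_indices k :: ('n => nat) set)) * 2 ^ CARD('n)))"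
 have C0: "C0 \<ge> 0" using k unfolding C0_def by (intro mult_nonneg_nonneg sum_nonneg zero_le_power) auto
 have moments: "(\<Sum>i\<in>I. w i * (u i - 1/2) ^ m) = 0" if "m < k" for m
  using ccoef_moment[OF that, of "-1/2" "1/2"] ccoef_moment[OF that, of "-1/2" 1]
  unfolding sumI by (simp add: w_def u_def sum_subtractf algebra_simps)
 show ?thesis
 proof (rule that[of "C0 + 1"])
  show "0 < C0 + 1" using C0 by simp
  fix f :: "real^'n => real" and P y and t :: real assume wg: "weak_grad_bound k f P" and t: "0 < t"
  have "ennreal \<bar>\<Sum>i\<in>I. w i * smear ballW f (0 + u i * t) (y + u i *\<^sub>R 0)\<bar>
   \<le> ennreal ((\<Sum>i\<in>I. \<bar>w i\<bar>) * (real k - 1/2) ^ (k - 1) * (real CARD('n) * t) ^ k * ((real k - 1/2) * (2 * real k) ^ CARD('n)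
     * (real (card (multi_indices k :: ('n => nat) set)) * 2 ^ CARD('n)))) * bavg P y (2 * (real k * t))"
  proof (rule ball_functional_bound[where w=w and u=u and s=0 and \<tau>=t and h=0, OF wg k])
   show "finite I" by (simp add: I_def)
   show "1 / 2 \<le> u i \<and> u i \<le> real k" if "i \<in> I" for i using that by (auto simp: I_def u_def)
   show "norm (t *\<^sub>R z + 0) \<le> t" if "norm z < 1" for z :: "real^'n"
    using that t by (simp add: mult_left_le)
   fix v :: real assume v: "1 / 2 \<le> v" "v \<le> real k"
   have "v * t \<le> real k * t" using v t by (intro mult_right_mono) auto
   moreover have "real k * t * 1 \<le> real k * t * (2 * v)" using v t by (intro mult_left_mono) auto
   ultimately show "0 < 0 + v * t \<and> ball (y + v *\<^sub>R 0) (0 + v * t) \<subseteq> ball y (real k * t) \<and> real k * t \<le> 2 * real k * (0 + v * t)"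
    using v t by (auto intro!: subset_ball simp: mult_ac)
  qed (use k t moments in auto)
  also have "(\<Sum>i\<in>I. w i * smear ballW f (0 + u i * t) (y + u i *\<^sub>R 0)) = Phi k f (t / 2) y - Phi k f t y"
   unfolding sumI Phi_def by (simp add: w_def u_def sum_subtractf)
  also have "(\<Sum>i\<in>I. \<bar>w i\<bar>) * (real k - 1/2) ^ (k - 1) * (real CARD('n) * t) ^ k * ((real k - 1/2) * (2 * real k) ^ CARD('n)
     * (real (card (multi_indices k :: ('n => nat) set)) * 2 ^ CARD('n))) = C0 * t ^ k"
   unfolding C0_def power_mult_distrib by (simp only: mult_ac)
  finally have "ennreal \<bar>Phi k f (t / 2) y - Phi k f t y\<bar> \<le> ennreal (C0 * t ^ k) * bavg P y (2 * (real k * t))" .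
  also have "\<dots> \<le> ennreal ((C0 + 1) * t ^ k) * bavg P y (2 * (real k * t))"
   using t by (intro mult_right_mono ennreal_leI) auto
  finally show "ennreal \<bar>Phi k f (t / 2) y - Phi k f t y\<bar> \<le> ennreal ((C0 + 1) * t ^ k) * bavg P y (2 * real k * t)"
   by (simp add: mult.assoc)
 qed
qed

text \<open>For each j the radius j R stays fixed while the centres x + i h carry the weights of the
  k-th difference, whose moments vanish; the results are summed with the coefficients of
  \<open>Phi\<close>.\<close>

lemma finite_diff_Phi_grad_bound:
 assumes k: "0 < k"
 obtains C where "0 < C" "\<And>(f::real^'n::finite => real) P x h R. weak_grad_bound k f P ==> 0 < R ==> norm h \<le> R ==>
  ennreal \<bar>finite_diff k h (Phi k f R) x\<bar> \<le> ennreal (C * R ^ k) * bavg P x (4 * real k * R)"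
proof -
 define w where "w i = (-1) ^ (k - i) * real (k choose i)" for i
 define C0 where "C0 = (\<Sum>i=0..k. \<bar>w i\<bar>) * real k ^ (k - 1) * real CARD('n) ^ k * (real k * (2 * real k) ^ CARD('n)
     * (real (card (multi_indices k :: ('n => nat) set)) * 2 ^ CARD('n)))"
 have C0: "C0 \<ge> 0" unfolding C0_def by (intro mult_nonneg_nonneg sum_nonneg zero_le_power) auto
 define C where "C = (\<Sum>j=1..k. \<bar>ccoef k j\<bar>) * C0"
 have C: "C \<ge> 0" unfolding C_def using C0 by (intro mult_nonneg_nonneg sum_nonneg) auto
 have moments: "(\<Sum>i=0..k. w i * (real i - 0) ^ m) = 0" if "m < k" for m
  using alternating_binomial_moment[OF that, of 0 1] by (simp add: w_def)
 show ?thesis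
 proof (rule that[of "C + 1"])
  show "0 < C + 1" using C by simp
  fix f :: "real^'n => real" and P and x h :: "real^'n" and R :: real
  assume wg: "weak_grad_bound k f P" and R: "0 < R" and h: "norm h \<le> R"
  define T where "T j = (\<Sum>i=0..k. w i * smear ballW f (real j * R) (x + real i *\<^sub>R h))" for j
  have T: "ennreal \<bar>T j\<bar> \<le> ennreal (C0 * R ^ k) * bavg P x (2 * (2 * real k * R))" if j: "j \<in> {1..k}" for j
  proof -
   have "ennreal \<bar>\<Sum>i=0..k. w i * smear ballW f (real j * R + real i * 0) (x + real i *\<^sub>R h)\<bar>
    \<le> ennreal ((\<Sum>i=0..k. \<bar>w i\<bar>) * (real k - 0) ^ (k - 1) * (real CARD('n) * R) ^ k * ((real k - 0) * (2 * real k) ^ CARD('n)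
     * (real (card (multi_indices k :: ('n => nat) set)) * 2 ^ CARD('n)))) * bavg P x (2 * (2 * real k * R))"
   proof (rule ball_functional_bound[where w=w and u=real and s="real j * R" and \<tau>=0 and h=h, OF wg k])
    show "norm (0 *\<^sub>R z + h) \<le> R" if "norm z < 1" for z :: "real^'n" using h by simp
    fix v :: real assume v: "0 \<le> v" "v \<le> real k"
    have "dist (x + v *\<^sub>R h) x + real j * R \<le> 2 * real k * R"
    proof -
     have "dist (x + v *\<^sub>R h) x = v * norm h" using v by (simp add: dist_norm)
     also have "\<dots> \<le> real k * R" using v h by (intro mult_mono) auto
     finally have "dist (x + v *\<^sub>R h) x \<le> real k * R" .
     moreover have "real j * R \<le> real k * R" using j R by simp
     ultimately show ?thesis by simp
    qed
    hence "ball (x + v *\<^sub>R h) (real j * R + v * 0) \<subseteq> ball x (2 * real k * R)"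
     by (simp add: ball_subset_ball_iff)
    moreover have "2 * real k * R * 1 \<le> 2 * real k * R * real j" using j R by (intro mult_left_mono) auto
    ultimately show "0 < real j * R + v * 0 \<and> ball (x + v *\<^sub>R h) (real j * R + v * 0) \<subseteq> ball x (2 * real k * R)
     \<and> 2 * real k * R \<le> 2 * real k * (real j * R + v * 0)" using j R by (simp add: mult_ac)
   qed (use k R moments in auto)
   also have "(\<Sum>i=0..k. \<bar>w i\<bar>) * (real k - 0) ^ (k - 1) * (real CARD('n) * R) ^ k * ((real k - 0) * (2 * real k) ^ CARD('n)
     * (real (card (multi_indices k :: ('n => nat) set)) * 2 ^ CARD('n))) = C0 * R ^ k"
    unfolding C0_def power_mult_distrib diff_zero by (simp only: mult_ac)
   finally show ?thesis by (simp add: T_def)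
  qed
  have "finite_diff k h (Phi k f R) x = (\<Sum>j=1..k. ccoef k j * T j)"
   unfolding finite_diff_def Phi_def T_def w_def sum_distrib_left
   by (subst sum.swap) (intro sum.cong refl, simp only: mult_ac)
  hence "ennreal \<bar>finite_diff k h (Phi k f R) x\<bar> \<le> ennreal (\<Sum>j=1..k. \<bar>ccoef k j\<bar> * \<bar>T j\<bar>)"
   using sum_abs[of "\<lambda>j. ccoef k j * T j" "{1..k}"] by (intro ennreal_leI) (simp add: abs_mult)
  also have "\<dots> = (\<Sum>j=1..k. ennreal \<bar>ccoef k j\<bar> * ennreal \<bar>T j\<bar>)"
   by (subst sum_ennreal[symmetric]) (auto simp: ennreal_mult)
  also have "\<dots> \<le> (\<Sum>j=1..k. ennreal \<bar>ccoef k j\<bar> * (ennreal (C0 * R ^ k) * bavg P x (2 * (2 * real k * R))))"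
   by (intro sum_mono mult_left_mono T) auto
  also have "\<dots> = (\<Sum>j=1..k. ennreal \<bar>ccoef k j\<bar>) * (ennreal (C0 * R ^ k) * bavg P x (2 * (2 * real k * R)))"
   by (rule sum_distrib_right[symmetric])
  also have "(\<Sum>j=1..k. ennreal \<bar>ccoef k j\<bar>) = ennreal (\<Sum>j=1..k. \<bar>ccoef k j\<bar>)" by (rule sum_ennreal) simp
  also have "ennreal (\<Sum>j=1..k. \<bar>ccoef k j\<bar>) * (ennreal (C0 * R ^ k) * bavg P x (2 * (2 * real k * R))) = ennreal (C * R ^ k) * bavg P x (2 * (2 * real k * R))"
   unfolding C_def mult.assoc[symmetric] using C0 R by (subst ennreal_mult[symmetric]) (auto simp: sum_nonneg mult.assoc)
  also have "\<dots> \<le> ennreal ((C + 1) * R ^ k) * bavg P x (2 * (2 * real k * R))"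
   using R by (intro mult_right_mono ennreal_leI) auto
  finally show "ennreal \<bar>finite_diff k h (Phi k f R) x\<bar> \<le> ennreal ((C + 1) * R ^ k) * bavg P x (4 * real k * R)"
   by (simp add: mult.assoc)
 qed
qed

section \<open>Bounds by the mean oscillation of f\<close>

lemma loc_int_diff_const:
 fixes f :: "'a::euclidean_space => real"
 assumes f: "loc_int f" shows "loc_int (\<lambda>x. f x - c)"
proof -
 note loc_int_measurable[OF f, measurable]
 have "(\<integral>+ x. ennreal \<bar>f x - c\<bar> * indicator (ball 0 r) x) < \<infinity>" for r
 proof -
  have "(\<integral>+ x. ennreal \<bar>f x - c\<bar> * indicator (ball 0 r) x)
   \<le> (\<integral>+ x. ennreal \<bar>f x\<bar> * indicator (ball 0 r) x + ennreal \<bar>c\<bar> * indicator (ball 0 r) x)"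
   by (intro nn_integral_mono) (auto simp: indicator_def simp flip: ennreal_plus)
  also have "\<dots> = (\<integral>+ x. ennreal \<bar>f x\<bar> * indicator (ball 0 r) x) + ennreal \<bar>c\<bar> * emeasure lborel (ball (0::'a) r)"
   by (subst nn_integral_add) (auto simp: nn_integral_cmult_indicator)
  also have "\<dots> < \<infinity>" using f emeasure_lborel_ball_finite[of "0::'a" r] by (simp add: loc_int_def ennreal_mult_less_top)
  finally show ?thesis .
 qed
 thus ?thesis by (simp add: loc_int_def)
qed

lemma ball_average_diff_const:
 fixes f :: "'a::euclidean_space => real"
 assumes f: "loc_int f" and \<sigma>: "0 < \<sigma>" "ball y \<sigma> \<subseteq> ball x r" "0 < r" "r \<le> \<kappa> * \<sigma>"
 shows "ennreal \<bar>smear ballW f \<sigma> y - c\<bar> \<le> ennreal (\<kappa> ^ DIM('a)) * bavg (\<lambda>w. ennreal \<bar>f w - c\<bar>) x r"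
proof -
 note loc_int_measurable[OF f, measurable]
 have "smear ballW f \<sigma> y - c = smear ballW (\<lambda>x. f x - c) \<sigma> y"
  using smear_integrable[OF avg_kernel_ballW f, of \<sigma> y] \<sigma>(1) avg_kernelD(5,6)[OF avg_kernel_ballW, where 'a='a]
  by (simp add: smear_def left_diff_distrib)
 hence "ennreal \<bar>smear ballW f \<sigma> y - c\<bar> \<le> (\<integral>+ z. ennreal (ballW z) * ennreal \<bar>f (y + \<sigma> *\<^sub>R z) - c\<bar>)"
  using abs_smear_le[OF avg_kernel_ballW loc_int_diff_const[OF f], of \<sigma> c y] \<sigma>(1) by simp
 also have "\<dots> = bavg (\<lambda>w. ennreal \<bar>f w - c\<bar>) y \<sigma>"
  by (rule ballW_nn_integral[of "\<lambda>w. ennreal \<bar>f w - c\<bar>"]) (use \<sigma> in auto)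
 also have "\<dots> \<le> ennreal (\<kappa> ^ DIM('a)) * bavg (\<lambda>w. ennreal \<bar>f w - c\<bar>) x r" by (rule bavg_mono_ball[OF \<sigma>])
 finally show ?thesis .
qed

lemma Phi_diff_const:
 assumes "0 < k" shows "Phi k f t y - c = (\<Sum>j=1..k. ccoef k j * (smear ballW f (real j * t) y - c))"
 using ccoef_sum[OF assms] by (simp add: Phi_def right_diff_distrib sum_subtractf sum_distrib_right[symmetric])

lemma Phi_osc_bound:
 fixes f :: "real^'n::finite => real"
 assumes k: "0 < k" and f: "loc_int f" and t: "0 < t" and y: "dist y x + real k * t \<le> r" "r \<le> \<kappa> * t"
 shows "ennreal \<bar>Phi k f t y - c\<bar> \<le> ennreal ((\<Sum>j=1..k. \<bar>ccoef k j\<bar>) * \<kappa> ^ CARD('n)) * bavg (\<lambda>w. ennreal \<bar>f w - c\<bar>) x r"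
proof -
 let ?B = "bavg (\<lambda>w. ennreal \<bar>f w - c\<bar>) x r"
 have kt: "0 < real k * t" using k t by simp
 have r: "0 < r" using y(1) kt zero_le_dist[of y x] by linarith
 have \<kappa>: "0 < \<kappa>" using y(2) r t by (smt (verit) zero_less_mult_pos2)
 have 1: "ennreal \<bar>smear ballW f (real j * t) y - c\<bar> \<le> ennreal (\<kappa> ^ CARD('n)) * ?B" if j: "j \<in> {1..k}" for j
 proof -
  have "real j * t \<le> real k * t" using j t by simp
  hence "ball y (real j * t) \<subseteq> ball x r" using y(1) by (simp add: ball_subset_ball_iff)
  moreover have "\<kappa> * t * 1 \<le> \<kappa> * t * real j" using j t \<kappa> by (intro mult_left_mono) auto
  hence "r \<le> \<kappa> * (real j * t)" using y(2) by (simp add: mult_ac)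
  moreover have "0 < real j * t" using j t by simp
  ultimately show ?thesis using ball_average_diff_const[OF f, of "real j * t" y x r \<kappa> c] r by simp
 qed
 have "ennreal \<bar>Phi k f t y - c\<bar> \<le> ennreal (\<Sum>j=1..k. \<bar>ccoef k j\<bar> * \<bar>smear ballW f (real j * t) y - c\<bar>)"
  unfolding Phi_diff_const[OF k]
  using sum_abs[of "\<lambda>j. ccoef k j * (smear ballW f (real j * t) y - c)" "{1..k}"] by (intro ennreal_leI) (simp add: abs_mult)
 also have "\<dots> = (\<Sum>j=1..k. ennreal \<bar>ccoef k j\<bar> * ennreal \<bar>smear ballW f (real j * t) y - c\<bar>)"
  by (subst sum_ennreal[symmetric]) (auto simp: ennreal_mult)
 also have "\<dots> \<le> (\<Sum>j=1..k. ennreal \<bar>ccoef k j\<bar> * (ennreal (\<kappa> ^ CARD('n)) * ?B))"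
  by (intro sum_mono mult_left_mono 1) auto
 also have "\<dots> = (\<Sum>j=1..k. ennreal \<bar>ccoef k j\<bar>) * (ennreal (\<kappa> ^ CARD('n)) * ?B)"
  by (rule sum_distrib_right[symmetric])
 also have "(\<Sum>j=1..k. ennreal \<bar>ccoef k j\<bar>) = ennreal (\<Sum>j=1..k. \<bar>ccoef k j\<bar>)" by (rule sum_ennreal) simp
 finally show ?thesis using \<kappa> by (simp add: ennreal_mult sum_nonneg mult.assoc)
qed

text \<open>The coefficients of \<open>Phi\<close> sum to 1, so a constant c may be subtracted from
  f. With c = 0 the bound is in terms of f itself, as required for X; with c adapted to the ball it
  is a mean oscillation, as required for BMO.\<close>

lemma Phi_diff_osc_bound:
 assumes k: "0 < k"
 obtains C where "0 < C" "\<And>(f::real^'n::finite => real) c y t. loc_int f ==> 0 < t ==>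
  ennreal \<bar>Phi k f (t / 2) y - Phi k f t y\<bar> \<le> ennreal C * bavg (\<lambda>w. ennreal \<bar>f w - c\<bar>) y (2 * real k * t)"
proof -
 define C where "C = (\<Sum>j=1..k. \<bar>ccoef k j\<bar>) * (4 * real k) ^ CARD('n)"
 have C: "C \<ge> 0" unfolding C_def by (intro mult_nonneg_nonneg sum_nonneg) auto
 show ?thesis
 proof (rule that[of "2 * C + 1"])
  show "0 < 2 * C + 1" using C by simp
  fix f :: "real^'n => real" and c y and t :: real assume f: "loc_int f" and t: "0 < t"
  let ?B = "bavg (\<lambda>w. ennreal \<bar>f w - c\<bar>) y (2 * real k * t)"
  have "ennreal \<bar>Phi k f (t / 2) y - Phi k f t y\<bar> \<le> ennreal \<bar>Phi k f (t / 2) y - c\<bar> + ennreal \<bar>Phi k f t y - c\<bar>"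
   by (simp flip: ennreal_plus)
  also have "\<dots> \<le> ennreal C * ?B + ennreal C * ?B" unfolding C_def
  proof (intro add_mono Phi_osc_bound[OF k f])
   show "dist y y + real k * (t / 2) \<le> 2 * real k * t" "dist y y + real k * t \<le> 2 * real k * t" "2 * real k * t \<le> 4 * real k * t"
    using t by (auto intro!: mult_right_mono)
  qed (use t in auto)
  also have "\<dots> = ennreal (2 * C) * ?B" using C by (simp add: distrib_right[symmetric] flip: ennreal_plus)
  also have "\<dots> \<le> ennreal (2 * C + 1) * ?B" by (intro mult_right_mono ennreal_leI) auto
  finally show "ennreal \<bar>Phi k f (t / 2) y - Phi k f t y\<bar> \<le> ennreal (2 * C + 1) * ?B" .
 qed
qed

text \<open>The weights of the difference sum to 0, so c may again be subtracted; all balls that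
  occur lie in the ball of radius 4 k R around x.\<close>

lemma finite_diff_Phi_osc_bound:
 assumes k: "0 < k"
 obtains C where "0 < C" "\<And>(f::real^'n::finite => real) c x h R. loc_int f ==> 0 < R ==> norm h \<le> R ==>
  ennreal \<bar>finite_diff k h (Phi k f R) x\<bar> \<le> ennreal C * bavg (\<lambda>w. ennreal \<bar>f w - c\<bar>) x (4 * real k * R)"
proof -
 define w where "w i = (-1) ^ (k - i) * real (k choose i)" for i
 define C0 where "C0 = (\<Sum>j=1..k. \<bar>ccoef k j\<bar>) * (4 * real k) ^ CARD('n)"
 have C0: "C0 \<ge> 0" unfolding C0_def by (intro mult_nonneg_nonneg sum_nonneg) auto
 define C where "C = (\<Sum>i=0..k. \<bar>w i\<bar>) * C0"
 have C: "C \<ge> 0" unfolding C_def using C0 by (intro mult_nonneg_nonneg sum_nonneg) auto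
 have w0: "(\<Sum>i=0..k. w i) = 0" using alternating_binomial_moment[of 0 k 0 1] k by (simp add: w_def)
 show ?thesis
 proof (rule that[of "C + 1"])
  show "0 < C + 1" using C by simp
  fix f :: "real^'n => real" and c and x h :: "real^'n" and R :: real assume f: "loc_int f" and R: "0 < R" and h: "norm h \<le> R"
  let ?B = "bavg (\<lambda>w. ennreal \<bar>f w - c\<bar>) x (4 * real k * R)"
  have "finite_diff k h (Phi k f R) x = (\<Sum>i=0..k. w i * (Phi k f R (x + real i *\<^sub>R h) - c))"
   using w0 by (simp add: finite_diff_def w_def right_diff_distrib sum_subtractf sum_distrib_right[symmetric])
  hence "ennreal \<bar>finite_diff k h (Phi k f R) x\<bar> \<le> ennreal (\<Sum>i=0..k. \<bar>w i\<bar> * \<bar>Phi k f R (x + real i *\<^sub>R h) - c\<bar>)"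
   using sum_abs[of "\<lambda>i. w i * (Phi k f R (x + real i *\<^sub>R h) - c)" "{0..k}"] by (intro ennreal_leI) (simp add: abs_mult)
  also have "\<dots> = (\<Sum>i=0..k. ennreal \<bar>w i\<bar> * ennreal \<bar>Phi k f R (x + real i *\<^sub>R h) - c\<bar>)"
   by (subst sum_ennreal[symmetric]) (auto simp: ennreal_mult)
  also have "\<dots> \<le> (\<Sum>i=0..k. ennreal \<bar>w i\<bar> * (ennreal C0 * ?B))" unfolding C0_def
  proof (intro sum_mono mult_left_mono Phi_osc_bound[OF k f R])
   fix i assume "i \<in> {0..k}"
   hence "real i * norm h \<le> real k * R" using h by (intro mult_mono) auto
   moreover have "real k * R \<ge> 0" using R by simp
   moreover have "dist (x + real i *\<^sub>R h) x = real i * norm h" by (simp add: dist_norm)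
   ultimately show "dist (x + real i *\<^sub>R h) x + real k * R \<le> 4 * real k * R" by linarith
  qed auto
  also have "\<dots> = (\<Sum>i=0..k. ennreal \<bar>w i\<bar>) * (ennreal C0 * ?B)" by (rule sum_distrib_right[symmetric])
  also have "(\<Sum>i=0..k. ennreal \<bar>w i\<bar>) = ennreal (\<Sum>i=0..k. \<bar>w i\<bar>)" by (rule sum_ennreal) simp
  also have "ennreal (\<Sum>i=0..k. \<bar>w i\<bar>) * (ennreal C0 * ?B) = ennreal C * ?B"
   unfolding C_def using C0 by (simp add: ennreal_mult sum_nonneg mult.assoc)
  also have "\<dots> \<le> ennreal (C + 1) * ?B" by (intro mult_right_mono ennreal_leI) auto
  finally show "ennreal \<bar>finite_diff k h (Phi k f R) x\<bar> \<le> ennreal (C + 1) * ?B" .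
 qed
qed

subsection \<open>The pointwise estimate\<close>

lemma Phi_measurable[measurable]:
 assumes [measurable]: "f \<in> borel_fun" shows "Phi k f t \<in> borel_fun"
 unfolding Phi_def[abs_def] by measurable

text \<open>Convergence along a subsequence that may depend on the point is all that is needed below, and it
 follows from convergence in \<open>L\<^sup>1\<close> on balls without Lebesgue's differentiation theorem.\<close>

definition good_point :: "nat => ('a::euclidean_space => real) => 'a => bool" where
 "good_point k f y \<longleftrightarrow> (\<exists>r::nat=>nat. strict_mono r \<and> (\<lambda>m. Phi k f ((1/2) ^ r m) y) \<longlonglongrightarrow> f y)"

lemma Phi_L1_loc:
 fixes f :: "'a::euclidean_space => real"
 assumes k: "0 < k" and f: "loc_int f" and e: "0 < e"
 shows "\<exists>d>0. \<forall>t. 0 < t \<and> t < d \<longrightarrow>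
  (\<integral>+ x. ennreal \<bar>Phi k f t x - f x\<bar> * indicator (ball 0 r) x) \<le> ennreal e"
proof -
 note loc_int_measurable[OF f, measurable]
 define S where "S = (\<Sum>j=1..k. \<bar>ccoef k j\<bar>) + 1"
 have S: "S > 0" unfolding S_def by (intro add_nonneg_pos sum_nonneg) auto
 obtain d where d: "d > 0" "\<And>t. 0 < t ==> t < d ==>
  (\<integral>+ x. ennreal \<bar>smear ballW f t x - f x\<bar> * indicator (ball 0 r) x) \<le> ennreal (e / S)"
  using smear_L1_loc[OF avg_kernel_ballW f, of "e / S" r] e S by auto
 have "(\<integral>+ x. ennreal \<bar>Phi k f t x - f x\<bar> * indicator (ball 0 r) x) \<le> ennreal e" if t: "0 < t" "t < d / real k" for t
 proof -
  have "(\<integral>+ x. ennreal \<bar>Phi k f t x - f x\<bar> * indicator (ball 0 r) x)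
   \<le> (\<integral>+ x. (\<Sum>j=1..k. ennreal \<bar>ccoef k j\<bar> * (ennreal \<bar>smear ballW f (real j * t) x - f x\<bar> * indicator (ball 0 r) x)))"
  proof (intro nn_integral_mono)
   fix x
   have "ennreal \<bar>Phi k f t x - f x\<bar> \<le> ennreal (\<Sum>j=1..k. \<bar>ccoef k j\<bar> * \<bar>smear ballW f (real j * t) x - f x\<bar>)"
    unfolding Phi_diff_const[OF k]
    using sum_abs[of "\<lambda>j. ccoef k j * (smear ballW f (real j * t) x - f x)" "{1..k}"] by (intro ennreal_leI) (simp add: abs_mult)
   also have "\<dots> = (\<Sum>j=1..k. ennreal \<bar>ccoef k j\<bar> * ennreal \<bar>smear ballW f (real j * t) x - f x\<bar>)"
    by (subst sum_ennreal[symmetric]) (auto simp: ennreal_mult)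
   finally show "ennreal \<bar>Phi k f t x - f x\<bar> * indicator (ball 0 r) x
    \<le> (\<Sum>j=1..k. ennreal \<bar>ccoef k j\<bar> * (ennreal \<bar>smear ballW f (real j * t) x - f x\<bar> * indicator (ball 0 r) x))"
    by (cases "x \<in> ball 0 r") auto
  qed
  also have "\<dots> = (\<Sum>j=1..k. ennreal \<bar>ccoef k j\<bar> * (\<integral>+ x. ennreal \<bar>smear ballW f (real j * t) x - f x\<bar> * indicator (ball 0 r) x))"
   by (subst nn_integral_sum) (auto simp: nn_integral_cmult)
  also have "\<dots> \<le> (\<Sum>j=1..k. ennreal \<bar>ccoef k j\<bar> * ennreal (e / S))"
  proof (intro sum_mono mult_left_mono d(2))
   fix j assume j: "j \<in> {1..k}"
   show "0 < real j * t" using j t by simp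
   have "real j * t \<le> real k * t" using j t by simp
   also have "\<dots> < d" using t k by (simp add: field_simps)
   finally show "real j * t < d" .
  qed auto
  also have "\<dots> = ennreal ((\<Sum>j=1..k. \<bar>ccoef k j\<bar>) * (e / S))"
  proof -
   have "(\<Sum>j=1..k. ennreal \<bar>ccoef k j\<bar> * ennreal (e / S)) = (\<Sum>j=1..k. ennreal (\<bar>ccoef k j\<bar> * (e / S)))"
    using e S by (intro sum.cong refl ennreal_mult[symmetric]) auto
   thus ?thesis using e S unfolding sum_distrib_right by (subst (asm) sum_ennreal) auto
  qed
  also have "\<dots> \<le> ennreal e"
  proof (rule ennreal_leI)
   have "(\<Sum>j=1..k. \<bar>ccoef k j\<bar>) * (e / S) \<le> S * (e / S)" using e S by (intro mult_right_mono) (auto simp: S_def)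
   thus "(\<Sum>j=1..k. \<bar>ccoef k j\<bar>) * (e / S) \<le> e" using S by simp
  qed
  finally show ?thesis .
 qed
 thus ?thesis using d(1) k by (intro exI[of _ "d / real k"]) auto
qed

lemma AE_good_point:
 fixes f :: "'a::euclidean_space => real"
 assumes k: "0 < k" and f: "loc_int f"
 shows "AE y in lborel. good_point k f y"
proof -
 note loc_int_measurable[OF f, measurable]
 have "AE y in lborel. y \<in> ball 0 (real N) \<longrightarrow> good_point k f y" for N
 proof -
  define D where "D n x = (Phi k f ((1/2) ^ n) x - f x) * indicator (ball 0 (real N)) x" for n x
  have [measurable]: "D n \<in> borel_fun" for n unfolding D_def by simp
  have Dn: "(\<integral>+ x. ennreal (norm (D n x))) = (\<integral>+ x. ennreal \<bar>Phi k f ((1/2) ^ n) x - f x\<bar> * indicator (ball 0 (real N)) x)" for n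
   by (intro nn_integral_cong) (auto simp: D_def indicator_def)
  have small: "\<exists>M. \<forall>n\<ge>M. (\<integral>+ x. ennreal (norm (D n x))) \<le> ennreal e" if e: "e > 0" for e
  proof -
   obtain d where d: "d > 0" "\<And>t. 0 < t ==> t < d ==>
    (\<integral>+ x. ennreal \<bar>Phi k f t x - f x\<bar> * indicator (ball 0 (real N)) x) \<le> ennreal e"
    using Phi_L1_loc[OF k f e] by blast
   obtain M where M: "(1/2::real) ^ M < d" using d(1) real_arch_pow_inv[of d "1/2"] by auto
   have "(1/2::real) ^ n < d" if "n \<ge> M" for n
   proof -
    have "(1/2::real) ^ n \<le> (1/2) ^ M" using that by (intro power_decreasing) auto
    thus ?thesis using M by linarith
   qed
   thus ?thesis using d(2) Dn by (intro exI[of _ M]) auto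
  qed
  \<comment> \<open>Only from index \<open>M0\<close> on are the differences known to be integrable,
    so the sequence starts there; the shift reappears in the subsequence.\<close>
  obtain M0 where M0: "\<And>n. n \<ge> M0 ==> (\<integral>+ x. ennreal (norm (D n x))) \<le> ennreal 1" using small[of 1] by auto
  have int: "integrable lborel (D (n + M0))" for n
   unfolding integrable_iff_bounded using M0[of "n + M0"] by (auto intro: le_less_trans)
  have lim: "(\<lambda>n. \<integral>x. norm (D (n + M0) x) \<partial>lborel) \<longlonglongrightarrow> 0"
  proof (rule LIMSEQ_I)
   fix e :: real assume e: "e > 0"
   obtain M where M: "\<And>n. n \<ge> M ==> (\<integral>+ x. ennreal (norm (D n x))) \<le> ennreal (e / 2)" using small[of "e/2"] e by auto
   have "norm ((\<integral>x. norm (D (n + M0) x) \<partial>lborel) - 0) < e" if "n \<ge> M" for n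
   proof -
    have "ennreal (\<integral>x. norm (D (n + M0) x) \<partial>lborel) = (\<integral>+ x. ennreal (norm (D (n + M0) x)))"
     using int[of n] by (subst nn_integral_eq_integral) auto
    also have "\<dots> \<le> ennreal (e / 2)" using that by (intro M) simp
    finally have "(\<integral>x. norm (D (n + M0) x) \<partial>lborel) \<le> e / 2" using e by simp
    thus ?thesis using e by simp
   qed
   thus "\<exists>M. \<forall>n\<ge>M. norm ((\<integral>x. norm (D (n + M0) x) \<partial>lborel) - 0) < e" by blast
  qed
  obtain r where r: "strict_mono r" "AE x in lborel. (\<lambda>n. D (r n + M0) x) \<longlonglongrightarrow> 0"
   using tendsto_L1_AE_subseq[OF int lim] by blast
  from r(2) show ?thesis
  proof eventually_elim
   case (elim x)
   show ?case
   proof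
    assume "x \<in> ball 0 (real N)"
    hence "(\<lambda>n. Phi k f ((1/2) ^ (r n + M0)) x - f x) \<longlonglongrightarrow> 0" using elim by (simp add: D_def)
    hence "(\<lambda>n. Phi k f ((1/2) ^ (r n + M0)) x) \<longlonglongrightarrow> f x" by (rule LIM_zero_cancel)
    moreover have "strict_mono (\<lambda>n. r n + M0)" using r(1) by (simp add: strict_mono_def)
    ultimately show "good_point k f x" unfolding good_point_def by blast
   qed
  qed
 qed
 hence "AE y in lborel. \<forall>N. y \<in> ball 0 (real N) \<longrightarrow> good_point k f y" unfolding AE_all_countable by blast
 thus ?thesis
 proof eventually_elim
  case (elim y)
  obtain N where "norm y < real N" using reals_Archimedean2 by blast
  thus ?case using elim by auto
 qed
qed

text \<open>R is a power of 2, so the scales R / 2^i eventually run through the scales (1/2)^m of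
  \<open>good_point\<close>. The partial sums that belong to the subsequence converge to f y -
  \<open>Phi k f R y\<close>; the series of absolute values may be infinite.\<close>

lemma good_point_telescope:
 fixes f :: "'a::euclidean_space => real" and j :: int
 assumes g: "good_point k f y" and R: "R = 2 powr real_of_int j"
 shows "ennreal \<bar>f y - Phi k f R y\<bar> \<le> (\<Sum>i. ennreal \<bar>Phi k f (R / 2 ^ i / 2) y - Phi k f (R / 2 ^ i) y\<bar>)"
  (is "_ \<le> ?S")
proof -
 obtain r where r: "strict_mono r" "(\<lambda>m. Phi k f ((1/2) ^ r m) y) \<longlonglongrightarrow> f y"
  using g unfolding good_point_def by blast
 have tele: "Phi k f (R / 2 ^ I) y - Phi k f R y = (\<Sum>i<I. Phi k f (R / 2 ^ i / 2) y - Phi k f (R / 2 ^ i) y)" for I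
  by (induction I) (auto simp: field_simps)
 have bound: "ennreal \<bar>Phi k f (R / 2 ^ I) y - Phi k f R y\<bar> \<le> ?S" for I
 proof -
  have "ennreal \<bar>Phi k f (R / 2 ^ I) y - Phi k f R y\<bar> \<le> ennreal (\<Sum>i<I. \<bar>Phi k f (R / 2 ^ i / 2) y - Phi k f (R / 2 ^ i) y\<bar>)"
   unfolding tele by (intro ennreal_leI sum_abs)
  also have "\<dots> = (\<Sum>i<I. ennreal \<bar>Phi k f (R / 2 ^ i / 2) y - Phi k f (R / 2 ^ i) y\<bar>)" by (rule sum_ennreal[symmetric]) simp
  also have "\<dots> \<le> ?S" by (rule sum_le_suminf) auto
  finally show ?thesis .
 qed
 show ?thesis
 proof (rule tendsto_upperbound)
  show "((\<lambda>m. ennreal \<bar>Phi k f ((1/2) ^ r m) y - Phi k f R y\<bar>) \<longlongrightarrow> ennreal \<bar>f y - Phi k f R y\<bar>) sequentially"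
   by (intro tendsto_intros r(2))
  show "\<forall>\<^sub>F m in sequentially. ennreal \<bar>Phi k f ((1/2) ^ r m) y - Phi k f R y\<bar> \<le> ?S"
   unfolding eventually_sequentially
  proof (intro exI allI impI)
   \<comment> \<open>From such m on the scale (1/2)^(r m) does not exceed R, so it equals R / 2^I
     for a natural number I.\<close>
   fix m assume m: "nat (- j) \<le> m"
   have "m \<le> r m" using r(1) by (rule seq_suble)
   define I where "I = nat (int (r m) + j)"
   have I: "int I = int (r m) + j" using m \<open>m \<le> r m\<close> by (simp add: I_def)
   hence jI: "real_of_int j = real I - real (r m)" by linarith
   have "(1/2) ^ r m = R / 2 ^ I"
    unfolding R jI by (simp add: powr_diff powr_realpow field_simps power_divide)
   thus "ennreal \<bar>Phi k f ((1/2) ^ r m) y - Phi k f R y\<bar> \<le> ?S" using bound by simp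
  qed
 qed simp
qed

text \<open>Every single term is at most the weighted sum S, so \<open>u i\<close> \<le> S^(1/q)
  b^i, and the geometric series adds these bounds up. The price is the constant 1/(1 - b), which
  depends only on \<mu> and q.\<close>

lemma weighted_sum_powr:
 fixes u :: "nat => real"
 assumes q: "1 \<le> q" and \<mu>: "0 < \<mu>" and u: "\<And>i. 0 \<le> u i" and F: "0 \<le> F" "ennreal F \<le> (\<Sum>i. ennreal (u i))"
 shows "ennreal (F powr q) \<le> ennreal ((1 / (1 - 2 powr (- \<mu> / q))) powr q) * (\<Sum>i. ennreal (2 powr (\<mu> * real i) * u i powr q))"
proof -
 define b where "b = 2 powr (- \<mu> / q)"
 have b: "0 < b" "b < 1" using q \<mu> by (auto simp: b_def powr_less_one)
 define S where "S = (\<Sum>i. ennreal (2 powr (\<mu> * real i) * u i powr q))"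
 show ?thesis
 proof (cases "S = \<infinity>")
  case True
  have "(1 / (1 - b)) powr q > 0" using b by simp
  thus ?thesis using True unfolding S_def b_def by (simp add: ennreal_mult_top)
 next
  case False
  then obtain S' where S': "S = ennreal S'" "S' \<ge> 0" by (cases S) auto
  have ui: "u i \<le> S' powr (1 / q) * b ^ i" for i
  proof -
   have "(\<Sum>i\<in>{i}. ennreal (2 powr (\<mu> * real i) * u i powr q)) \<le> S" unfolding S_def
    by (rule sum_le_suminf) auto
   hence "2 powr (\<mu> * real i) * u i powr q \<le> S'" using S' by simp
   hence 1: "(2 powr (\<mu> * real i) * u i powr q) powr (1 / q) \<le> S' powr (1 / q)"
    using q by (intro powr_mono2) auto
   have "(2 powr (\<mu> * real i) * u i powr q) powr (1 / q) = (2 powr (\<mu> * real i)) powr (1 / q) * (u i powr q) powr (1 / q)"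
    by (rule powr_mult)
   also have "(u i powr q) powr (1 / q) = u i" using q u[of i] by (subst powr_powr) simp
   also have "(2 powr (\<mu> * real i)) powr (1 / q) = 2 powr (\<mu> * real i / q)" by (subst powr_powr) simp
   finally have "2 powr (\<mu> * real i / q) * u i \<le> S' powr (1 / q)" using 1 by simp
   hence "2 powr (- (\<mu> * real i / q)) * (2 powr (\<mu> * real i / q) * u i) \<le> 2 powr (- (\<mu> * real i / q)) * S' powr (1 / q)"
    by (intro mult_left_mono) auto
   moreover have "2 powr (- (\<mu> * real i / q)) * (2 powr (\<mu> * real i / q) * u i) = u i"
    by (simp add: mult.assoc[symmetric] powr_add[symmetric])
   moreover have "2 powr (- (\<mu> * real i / q)) = b ^ i"
    unfolding b_def by (subst powr_realpow[symmetric], simp, subst powr_powr) simp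
   ultimately show ?thesis by (metis mult.commute)
  qed
  have "ennreal F \<le> (\<Sum>i. ennreal (S' powr (1 / q) * b ^ i))"
   by (rule order_trans[OF F(2)], rule suminf_le) (auto intro: ennreal_leI ui)
  also have "\<dots> = ennreal (S' powr (1 / q) * (1 / (1 - b)))"
   using b by (intro suminf_ennreal_eq sums_mult geometric_sums) auto
  finally have "F \<le> S' powr (1 / q) * (1 / (1 - b))" using b by simp
  hence "F powr q \<le> (S' powr (1 / q) * (1 / (1 - b))) powr q" using q F by (intro powr_mono2) auto
  also have "\<dots> = (S' powr (1 / q)) powr q * (1 / (1 - b)) powr q" by (rule powr_mult)
  also have "(S' powr (1 / q)) powr q = S'" using q S' by (subst powr_powr) simp
  also have "S' * (1 / (1 - b)) powr q = (1 / (1 - b)) powr q * S'" by (rule mult.commute)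
  finally have "ennreal (F powr q) \<le> ennreal ((1 / (1 - b)) powr q) * ennreal S'"
   by (subst ennreal_mult[symmetric]) (use S' in \<open>auto intro!: ennreal_leI\<close>)
  thus ?thesis using S' unfolding S_def b_def by simp
 qed
qed

text \<open>The sum is at most its largest term times the number of terms.\<close>

lemma sum_powr_le:
 fixes a :: "'i => real"
 assumes "finite I" "\<And>i. i \<in> I ==> 0 \<le> a i" "0 < q"
 shows "(\<Sum>i\<in>I. a i) powr q \<le> real (card I) powr q * (\<Sum>i\<in>I. a i powr q)"
proof (cases "I = {}")
 case False
 define m where "m = Max (a ` I)"
 have "m \<in> a ` I" unfolding m_def using False assms(1) by (intro Max_in) auto
 then obtain i0 where i0: "i0 \<in> I" "a i0 = m" by auto
 have le: "a i \<le> m" if "i \<in> I" for i unfolding m_def using that assms(1) by (intro Max_ge) auto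
 have m0: "m \<ge> 0" using i0 assms(2) by auto
 have "(\<Sum>i\<in>I. a i) \<le> real (card I) * m" using sum_mono[of I a "\<lambda>_. m"] le by simp
 hence "(\<Sum>i\<in>I. a i) powr q \<le> (real (card I) * m) powr q"
  using assms by (intro powr_mono2) (auto intro: sum_nonneg)
 also have "\<dots> = real (card I) powr q * a i0 powr q" using m0 i0 by (simp add: powr_mult)
 also have "\<dots> \<le> real (card I) powr q * (\<Sum>i\<in>I. a i powr q)"
  using i0 assms(1) by (intro mult_left_mono member_le_sum) auto
 finally show ?thesis .
qed simp

lemma powr_interpolate:
 fixes a X Y \<theta> :: real
 assumes "0 \<le> a" "a \<le> X" "a \<le> Y" "0 \<le> \<theta>" "\<theta> \<le> 1"
 shows "a \<le> X powr (1 - \<theta>) * Y powr \<theta>"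
proof (cases "a = 0")
 case False
 hence "a = a powr (1 - \<theta>) * a powr \<theta>" using assms by (simp add: powr_add[symmetric])
 also have "\<dots> \<le> X powr (1 - \<theta>) * Y powr \<theta>" using assms by (intro mult_mono powr_mono2) auto
 finally show ?thesis .
qed simp

text \<open>\<open>A\<close> and \<open>G\<close> are maximal functions of \<open>f\<close> and of its gradient at the fixed point \<open>x\<close>. At a nearby point
 \<open>y\<close> they are replaced by local averages, which costs the factors \<open>l powr i1\<close> and \<open>l powr i2\<close>.\<close>

definition scale_bounds :: "nat => ('a::euclidean_space => real) => 'a => real => real => real => real => real => ('a => ennreal) => ('a => ennreal) => bool" where
 "scale_bounds k f x A G i1 i2 K H1 H2 \<longleftrightarrow>
   H1 \<in> borel_fun \<and> H2 \<in> borel_fun \<and>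
   (\<forall>\<rho>>0. bavg H1 x \<rho> \<le> 1 \<and> bavg H2 x \<rho> \<le> 1) \<and>
   (\<forall>t>0. \<forall>y. \<forall>l\<ge>1. bavg H1 y (2 * real k * t) \<le> ennreal l \<longrightarrow> bavg H2 y (2 * real k * t) \<le> ennreal l \<longrightarrow>
    \<bar>Phi k f (t / 2) y - Phi k f t y\<bar> \<le> K * A * l powr i1 \<and>
    \<bar>Phi k f (t / 2) y - Phi k f t y\<bar> \<le> K * (t ^ k * G) * l powr i2)"

text \<open>The two bounds of \<open>scale_bounds\<close> enter through their geometric mean with
  weight \<theta>. The form A (t^k G / A)^\<theta> displays how the bound shrinks when t is
  halved.\<close>

lemma scale_bounds_interpolate:
 assumes sb: "scale_bounds k f x A G i1 i2 K H1 H2" and pos: "0 < A" "0 < G" "0 < K" "0 < t" and \<theta>: "0 \<le> \<theta>" "\<theta> \<le> 1"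
  and l: "1 \<le> l" "bavg H1 y (2 * real k * t) \<le> ennreal l" "bavg H2 y (2 * real k * t) \<le> ennreal l"
 shows "\<bar>Phi k f (t / 2) y - Phi k f t y\<bar> \<le> K * (A * (t ^ k * G / A) powr \<theta>) * l powr (i1 * (1 - \<theta>) + i2 * \<theta>)"
proof -
 have "\<bar>Phi k f (t / 2) y - Phi k f t y\<bar> \<le> (K * A * l powr i1) powr (1 - \<theta>) * (K * (t ^ k * G) * l powr i2) powr \<theta>"
  using sb pos l unfolding scale_bounds_def by (intro powr_interpolate \<theta>) auto
 also have "\<dots> = (K powr (1 - \<theta>) * K powr \<theta>) * (A powr (1 - \<theta>) * (t ^ k * G) powr \<theta>) * (l powr (i1 * (1 - \<theta>)) * l powr (i2 * \<theta>))"
 proof -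
  have "(K * A * l powr i1) powr (1 - \<theta>) = K powr (1 - \<theta>) * A powr (1 - \<theta>) * l powr (i1 * (1 - \<theta>))"
   by (simp only: powr_mult powr_powr)
  moreover have "(K * (t ^ k * G) * l powr i2) powr \<theta> = K powr \<theta> * (t ^ k * G) powr \<theta> * l powr (i2 * \<theta>)"
   by (simp only: powr_mult powr_powr)
  ultimately show ?thesis by (simp only: mult_ac)
 qed
 also have "K powr (1 - \<theta>) * K powr \<theta> = K" using pos by (simp add: powr_add[symmetric])
 also have "A powr (1 - \<theta>) * (t ^ k * G) powr \<theta> = A * (t ^ k * G / A) powr \<theta>"
 proof -
  have "(t ^ k * G / A) powr \<theta> = (t ^ k * G) powr \<theta> / A powr \<theta>" by (rule powr_divide)
  moreover have "A powr (1 - \<theta>) = A / A powr \<theta>" using pos by (simp add: powr_diff)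
  ultimately show ?thesis by simp
 qed
 also have "l powr (i1 * (1 - \<theta>)) * l powr (i2 * \<theta>) = l powr (i1 * (1 - \<theta>) + i2 * \<theta>)" by (simp add: powr_add)
 finally show ?thesis .
qed

lemma nn_integral_bavg_le:
 fixes H :: "'a::euclidean_space => ennreal"
 assumes [measurable]: "H \<in> borel_fun" and \<sigma>: "0 < \<sigma>"
 shows "(\<integral>+ y. bavg H y \<sigma> * indicator (ball x r) y) \<le> (\<integral>+ w. H w * indicator (ball x (r + \<sigma>)) w)"
proof -
 have "(\<integral>+ y. bavg H y \<sigma> * indicator (ball x r) y)
   = (\<integral>\<^sup>+y. (\<integral>+ z. ennreal (ballW z) * H (y + \<sigma> *\<^sub>R z)) * indicator (ball x r) y \<partial>lborel)"
  using ballW_nn_integral[of H \<sigma>] \<sigma> by simp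
 also have "\<dots> \<le> (\<integral>+ w. H w * indicator (ball x (r + \<sigma> * 1)) w)"
  by (rule nn_integral_smear_le[OF avg_kernel_ballW]) (use \<sigma> in \<open>auto simp: ballW_def indicator_def\<close>)
 finally show ?thesis by simp
qed

lemma bavg_measurable:
 fixes H :: "'a::euclidean_space => ennreal"
 assumes [measurable]: "H \<in> borel_fun" and \<sigma>: "0 < \<sigma>"
 shows "(\<lambda>y. bavg H y \<sigma>) \<in> borel_fun"
proof -
 have "(\<lambda>y. bavg H y \<sigma>) = (\<lambda>y. (\<integral>+ z. ennreal (ballW z) * H (y + \<sigma> *\<^sub>R z)))"
  using ballW_nn_integral[of H \<sigma>] \<sigma> by auto
 also have "\<dots> \<in> borel_fun" by measurable
 finally show ?thesis .
qed

lemma bavg_le_imp: "bavg H x r \<le> 1 ==> 0 < r ==> (\<integral>+ w. H w * indicator (ball x r) w) \<le> emeasure lborel (ball x r)"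
 for x :: "'a::euclidean_space"
proof -
 assume 1: "bavg H x r \<le> 1" and r: "0 < r"
 define m where "m = measure lborel (ball x r)"
 have m: "m > 0" "emeasure lborel (ball x r) = ennreal m"
  using r emeasure_ball_pos_finite[OF r, of x] by (auto simp: m_def content_ball_pos emeasure_eq_ennreal_measure)
 show ?thesis
 proof (cases "(\<integral>+ w. H w * indicator (ball x r) w)")
  case (real a)
  hence "ennreal (a / m) \<le> ennreal 1" using 1 m unfolding bavg_def by (simp add: divide_ennreal)
  hence "a / m \<le> 1" by (subst (asm) ennreal_le_iff) auto
  thus ?thesis using real m by (simp add: field_simps ennreal_leI)
 next
  case top
  thus ?thesis using 1 m unfolding bavg_def by (simp add: ennreal_top_divide top_unique)
 qed
qed

lemma emeasure_ball_unit:
 fixes y :: "'a::euclidean_space"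
 assumes "0 \<le> r" shows "emeasure lborel (ball y r) = ennreal (r ^ DIM('a) * measure lborel (ball (0::'a) 1))"
 using emeasure_ball_scale[of r 1 y "0::'a"] assms unit_ball_measure(2)[where 'a='a] by (simp add: ennreal_mult')

lemma indicator_mono_ennreal: "A \<subseteq> B ==> indicator A x \<le> (indicator B x :: ennreal)"
 by (auto simp: indicator_def)

lemma ennreal_add_thrice: "0 \<le> B ==> ennreal B + ennreal B + ennreal B = ennreal (3 * B)"
 by (simp flip: ennreal_plus)

text \<open>Around x the deviation of f from \<open>Phi k f R\<close> is a sum of variations at the
  scales R / 2^i. The q-th power of the variation at scale i may carry a power e of the local
  average l; one power of l is integrated, and the other max(e - 1, 0) powers are estimated by the
  largest possible l, of order 2^(i n). The hypothesis on \<theta> says that the gain 2^(-i k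
  \<theta> q) outweighs this loss.\<close>

lemma local_difference_bound:
 fixes i1 i2 \<theta> q K :: real
 assumes k: "0 < k" and q: "1 \<le> q" and \<theta>: "0 \<le> \<theta>" "\<theta> \<le> 1" and i: "0 \<le> i1" "0 \<le> i2" and K: "0 < K"
  and \<mu>: "real CARD('n) * max (q * (i1 * (1 - \<theta>) + i2 * \<theta>) - 1) 0 < real k * \<theta> * q"
 obtains C where "0 < C" "\<And>(f::real^'n::finite => real) x A G H1 H2 j R.
   loc_int f ==> good_point k f x ==> 0 < A ==> 0 < G ==> R = 2 powr real_of_int j ==>
   scale_bounds k f x A G i1 i2 K H1 H2 ==>
   (\<And>h. norm h \<le> R ==> \<bar>finite_diff k h (Phi k f R) x\<bar> \<le> K * A \<and> \<bar>finite_diff k h (Phi k f R) x\<bar> \<le> K * (R ^ k * G)) ==>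
   (\<integral>+ h. ennreal (\<bar>finite_diff k h f x\<bar> powr q) * indicator (ball 0 R) h)
    \<le> ennreal (C * R ^ CARD('n) * (A * (R ^ k * G / A) powr \<theta>) powr q)"
proof -
 define n where "n = CARD('n)"
 define e where "e = q * (i1 * (1 - \<theta>) + i2 * \<theta>)"
 define N where "N = max (e - 1) 0"
 define mu where "mu = real k * \<theta> * q - real n * N"
 have mu: "0 < mu" using \<mu> by (simp add: mu_def N_def e_def n_def)
 have N: "0 \<le> N" by (simp add: N_def)
 have e: "0 \<le> e" unfolding e_def using q i \<theta> by simp
 have "0 < real k * \<theta> * q" using \<mu> by (meson le_less_trans max.cobounded2 mult_nonneg_nonneg of_nat_0_le_iff)
 hence kt: "0 < real k * \<theta>" using q by (simp add: zero_less_mult_iff)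
 define m where "m = measure lborel (ball (0::real^'n) 1)"
 have m: "m > 0" unfolding m_def by (rule unit_ball_measure)
 have Eb: "emeasure lborel (ball y r) = ennreal (r ^ n * m)" if "0 \<le> r" for y :: "real^'n" and r
  using emeasure_ball_unit[OF that, of y] by (simp add: n_def m_def)
 define c1 where "c1 = 1 / (1 - 2 powr (- (real k * \<theta>)))"
 have "2 powr (- (real k * \<theta>)) < 1" using kt by (simp add: powr_less_one)
 hence c1: "c1 > 0" by (simp add: c1_def)
 define C1 where "C1 = K powr q * (2 powr (real n * N) * (3 * ((3 * real k) ^ n * m)))"
 have C1: "C1 > 0" using K k m by (simp add: C1_def)
 \<comment> \<open>\<open>mu\<close> is the net rate of decay in i. Half of it is spent as the
   weight in \<open>weighted_sum_powr\<close>; the other half makes the remaining series converge,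
   with sum \<open>c2\<close>.\<close>
 define D where "D = (1 / (1 - 2 powr (- (mu / 2) / q))) powr q"
 have "2 powr (- (mu / 2) / q) < 1" using mu q by (intro powr_less_one) auto
 hence D: "D > 0" unfolding D_def powr_gt_zero by (metis diff_gt_0_iff_gt divide_pos_pos less_numeral_extra(1) less_numeral_extra(3))
 define c2 where "c2 = 1 / (1 - 2 powr (- (mu / 2)))"
 have b2: "2 powr (- (mu / 2)) < 1" using mu by (intro powr_less_one) auto
 hence c2: "c2 > 0" by (simp add: c2_def)
 define E where "E = (K * c1) powr q * m + D * C1 * c2"
 have E: "E > 0" unfolding E_def using D C1 c2 m by (intro add_nonneg_pos) auto
 define S where "S = (\<Sum>j=0..k. real (k choose j) powr q)"
 have S: "S \<ge> 0" unfolding S_def by (intro sum_nonneg) auto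
 define C where "C = real (k + 2) powr q * (S * E + K powr q * m)"
 have C: "C > 0" unfolding C_def using S E K m by (intro mult_pos_pos add_nonneg_pos) auto
 show ?thesis
 proof (rule that[OF C])
  fix f :: "real^'n => real" and x A G H1 H2 R and j :: int
  assume f: "loc_int f" and gx: "good_point k f x" and A: "0 < A" and G: "0 < G" and Rj: "R = 2 powr real_of_int j"
   and sb: "scale_bounds k f x A G i1 i2 K H1 H2"
   and fd: "\<And>h. norm h \<le> R ==> \<bar>finite_diff k h (Phi k f R) x\<bar> \<le> K * A \<and> \<bar>finite_diff k h (Phi k f R) x\<bar> \<le> K * (R ^ k * G)"
  note loc_int_measurable[OF f, measurable]
  have [measurable]: "H1 \<in> borel_fun" "H2 \<in> borel_fun" using sb by (auto simp: scale_bounds_def)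
  have R: "R > 0" using Rj by simp
  define W where "W = A * (R ^ k * G / A) powr \<theta>"
  have W: "W > 0" using A G R by (simp add: W_def)
  define U where "U i y = \<bar>Phi k f (R / 2 ^ i / 2) y - Phi k f (R / 2 ^ i) y\<bar>" for i y
  have [measurable]: "U i \<in> borel_fun" for i unfolding U_def by measurable
  define F where "F y = \<bar>f y - Phi k f R y\<bar>" for y
  have [measurable]: "F \<in> borel_fun" unfolding F_def by measurable
  have Wi: "A * ((R / 2 ^ i) ^ k * G / A) powr \<theta> = W * 2 powr (- (real k * \<theta>) * real i)" for i
  proof -
   have "(R / 2 ^ i) ^ k * G / A = (R ^ k * G / A) * 2 powr (- (real i * real k))"
   proof -
    have "2 powr (- (real i * real k)) = inverse (2 ^ (i * k))"
     by (simp only: powr_minus of_nat_mult[symmetric] powr_realpow zero_less_numeral)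
    moreover have "(R / 2 ^ i) ^ k = R ^ k * inverse (2 ^ (i * k))"
     by (subst power_divide, subst power_mult, rule divide_inverse)
    ultimately show ?thesis by simp
   qed
   hence "((R / 2 ^ i) ^ k * G / A) powr \<theta> = (R ^ k * G / A) powr \<theta> * 2 powr (- (real i * real k) * \<theta>)"
    by (simp only: powr_mult powr_powr)
   thus ?thesis by (simp add: W_def mult_ac)
  qed
  have kR: "0 < real k * R" using k R by simp
  \<comment> \<open>At x itself all averages are at most 1, so l = 1 and the variations decay
    geometrically.\<close>
  have Ux: "U i x \<le> K * W * (2 powr (- (real k * \<theta>))) ^ i" for i
  proof -
   have "0 < 2 * real k * (R / 2 ^ i)" using k R by simp
   hence b: "bavg H1 x (2 * real k * (R / 2 ^ i)) \<le> ennreal 1" "bavg H2 x (2 * real k * (R / 2 ^ i)) \<le> ennreal 1"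
    using sb by (auto simp: scale_bounds_def)
   have "U i x \<le> K * (A * ((R / 2 ^ i) ^ k * G / A) powr \<theta>) * 1 powr (i1 * (1 - \<theta>) + i2 * \<theta>)"
    unfolding U_def by (rule scale_bounds_interpolate[OF sb A G K _ \<theta> _ b]) (use R in auto)
   also have "\<dots> = K * W * 2 powr (- (real k * \<theta>) * real i)" unfolding Wi by simp
   also have "2 powr (- (real k * \<theta>) * real i) = (2 powr (- (real k * \<theta>))) ^ i"
    by (subst powr_powr[symmetric], subst powr_realpow) auto
   finally show ?thesis .
  qed
  have Fx: "F x \<le> K * W * c1"
  proof -
   have "ennreal (F x) \<le> (\<Sum>i. ennreal (U i x))"
    unfolding F_def U_def by (rule good_point_telescope[OF gx Rj])
   also have "\<dots> \<le> (\<Sum>i. ennreal (K * W * (2 powr (- (real k * \<theta>))) ^ i))"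
    by (intro suminf_le ennreal_leI Ux) auto
   also have "\<dots> = ennreal (K * W * c1)" unfolding c1_def
    using K W kt by (intro suminf_ennreal_eq sums_mult geometric_sums) (auto simp: powr_less_one)
   finally show ?thesis using K W c1 by simp
  qed
  have UI: "(\<integral>+ y. ennreal (U i y powr q) * indicator (ball x (real k * R)) y)
   \<le> ennreal (C1 * R ^ n * W powr q * 2 powr (- mu * real i))" for i
  proof -
   define t where "t = R / 2 ^ i"
   have t: "0 < t" "t \<le> R" using R by (auto simp: t_def field_simps)
   \<comment> \<open>The ball of radius 2 k t around y lies in the ball of radius 3 k R around x,
     over which the averages are at most 1. The radii differ by at most the factor 2 2^i, so
     \<open>Lm\<close> bounds the averages at y.\<close>
   define Lm where "Lm = (2 * 2 ^ i :: real) ^ n"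
   have Lm: "Lm \<ge> 1" unfolding Lm_def by (intro one_le_power) (simp add: mult_ge1_I)
   define c where "c = (K * (W * 2 powr (- (real k * \<theta>) * real i))) powr q * Lm powr N"
   have c: "c \<ge> 0" by (simp add: c_def)
   define M where "M y = max 1 (max (bavg H1 y (2 * real k * t)) (bavg H2 y (2 * real k * t)))" for y
   have t2: "0 < 2 * real k * t" using k t by simp
   note bavg_measurable[OF \<open>H1 \<in> borel_fun\<close> t2, measurable] bavg_measurable[OF \<open>H2 \<in> borel_fun\<close> t2, measurable]
   have bH: "bavg H y (2 * real k * t) \<le> ennreal Lm" if y: "y \<in> ball x (real k * R)" and H: "\<And>\<rho>. 0 < \<rho> ==> bavg H x \<rho> \<le> 1" for H y
   proof -
    have "real k * t \<le> real k * R" using t by (intro mult_left_mono) auto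
    hence "ball y (2 * real k * t) \<subseteq> ball x (3 * real k * R)"
     using y by (simp add: ball_subset_ball_iff dist_commute)
    moreover have "3 * real k * R \<le> (2 * 2 ^ i) * (2 * real k * t)" using R by (simp add: t_def)
    ultimately have "bavg H y (2 * real k * t) \<le> ennreal ((2 * 2 ^ i) ^ DIM(real^'n)) * bavg H x (3 * real k * R)"
     using k R t2 by (intro bavg_mono_ball) auto
    also have "\<dots> \<le> ennreal ((2 * 2 ^ i) ^ DIM(real^'n)) * 1" using k R by (intro mult_left_mono H) auto
    finally show ?thesis by (simp add: Lm_def n_def)
   qed
   have U1: "ennreal (U i y powr q) \<le> ennreal c * M y" if y: "y \<in> ball x (real k * R)" for y
   proof -
    have "M y \<le> ennreal Lm" unfolding M_def using bH[OF y] sb Lm by (auto simp: scale_bounds_def ennreal_le_iff2)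
    then obtain l where l: "M y = ennreal l" "0 \<le> l" by (cases "M y") (auto simp: top_unique)
    have "ennreal 1 \<le> ennreal l" unfolding l(1)[symmetric] M_def by simp
    hence l1: "1 \<le> l" using l(2) by (simp add: ennreal_le_iff2)
    have lL: "l \<le> Lm" using \<open>M y \<le> ennreal Lm\<close> l Lm by simp
    have bl: "bavg H1 y (2 * real k * t) \<le> ennreal l" "bavg H2 y (2 * real k * t) \<le> ennreal l"
     unfolding l(1)[symmetric] M_def by (simp_all add: le_max_iff_disj)
    have "U i y \<le> K * (A * (t ^ k * G / A) powr \<theta>) * l powr (i1 * (1 - \<theta>) + i2 * \<theta>)"
     unfolding U_def t_def[symmetric] by (rule scale_bounds_interpolate[OF sb A G K t(1) \<theta> l1 bl])
    hence "U i y \<le> K * (W * 2 powr (- (real k * \<theta>) * real i)) * l powr (i1 * (1 - \<theta>) + i2 * \<theta>)"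
     unfolding t_def Wi .
    \<comment> \<open>One factor l is kept for the integral and the others are bounded by
      \<open>Lm\<close>. For e < 1 there are no others: N = 0, and l \<ge> 1 gives l^e \<le>
      l.\<close>
    moreover have le: "l powr e \<le> l * Lm powr N"
    proof (cases "e \<ge> 1")
     case True
     have "l powr e = l * l powr (e - 1)" using l1 by (simp add: powr_diff)
     also have "\<dots> \<le> l * Lm powr (e - 1)" using l1 lL True by (intro mult_left_mono powr_mono2) auto
     finally show ?thesis using True by (simp add: N_def)
    next
     case False
     have "l powr e \<le> l powr 1" using l1 False by (intro powr_mono) auto
     thus ?thesis using l1 False Lm by (simp add: N_def)
    qed
    ultimately have "U i y powr q \<le> (K * (W * 2 powr (- (real k * \<theta>) * real i)) * l powr (i1 * (1 - \<theta>) + i2 * \<theta>)) powr q"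
     using q by (intro powr_mono2) (auto simp: U_def)
    also have "\<dots> = (K * (W * 2 powr (- (real k * \<theta>) * real i))) powr q * l powr e"
    proof -
     have "(l powr (i1 * (1 - \<theta>) + i2 * \<theta>)) powr q = l powr e" by (simp add: powr_powr e_def mult.commute)
     thus ?thesis by (subst powr_mult) simp
    qed
    also have "\<dots> \<le> (K * (W * 2 powr (- (real k * \<theta>) * real i))) powr q * (l * Lm powr N)"
     by (intro mult_left_mono le) simp
    finally have "U i y powr q \<le> c * l" by (simp add: c_def mult_ac)
    thus ?thesis unfolding l(1) using l(2) c by (simp add: ennreal_mult[symmetric] ennreal_leI)
   qed
   \<comment> \<open>Averaging moves mass by at most 2 k t, so the integral stays below that of H
     over the ball of radius 3 k R, whatever the scale t.\<close>
   have HI: "(\<integral>+ y. bavg H y (2 * real k * t) * indicator (ball x (real k * R)) y) \<le> ennreal ((3 * real k * R) ^ n * m)"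
    if [measurable]: "H \<in> borel_fun" and H: "\<And>\<rho>. 0 < \<rho> ==> bavg H x \<rho> \<le> 1" for H
   proof -
    have "(\<integral>+ y. bavg H y (2 * real k * t) * indicator (ball x (real k * R)) y)
     \<le> (\<integral>+ w. H w * indicator (ball x (real k * R + 2 * real k * t)) w)"
     by (rule nn_integral_bavg_le) (use t2 in auto)
    also have "\<dots> \<le> (\<integral>+ w. H w * indicator (ball x (3 * real k * R)) w)"
    proof (intro nn_integral_mono mult_left_mono indicator_mono_ennreal subset_ball)
     have "real k * t \<le> real k * R" using t by (intro mult_left_mono) auto
     thus "real k * R + 2 * real k * t \<le> 3 * real k * R" by linarith
    qed auto
    also have "\<dots> \<le> emeasure lborel (ball x (3 * real k * R))" using k R by (intro bavg_le_imp H) auto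
    also have "\<dots> = ennreal ((3 * real k * R) ^ n * m)" using k R by (intro Eb) simp
    finally show ?thesis .
   qed
   have "(\<integral>+ y. ennreal (U i y powr q) * indicator (ball x (real k * R)) y)
    \<le> (\<integral>+ y. ennreal c * (indicator (ball x (real k * R)) y + bavg H1 y (2 * real k * t) * indicator (ball x (real k * R)) y
       + bavg H2 y (2 * real k * t) * indicator (ball x (real k * R)) y))"
   proof (intro nn_integral_mono)
    fix y
    show "ennreal (U i y powr q) * indicator (ball x (real k * R)) y \<le> ennreal c * (indicator (ball x (real k * R)) y + bavg H1 y (2 * real k * t) * indicator (ball x (real k * R)) y
       + bavg H2 y (2 * real k * t) * indicator (ball x (real k * R)) y)"
    proof (cases "y \<in> ball x (real k * R)")
     case True
     have "M y \<le> 1 + bavg H1 y (2 * real k * t) + bavg H2 y (2 * real k * t)"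
      unfolding M_def by (auto simp: max_def intro: add_increasing add_increasing2)
     hence "ennreal c * M y \<le> ennreal c * (1 + bavg H1 y (2 * real k * t) + bavg H2 y (2 * real k * t))" by (rule mult_left_mono) simp
     thus ?thesis using U1[OF True] True by (auto intro: order_trans)
    qed simp
   qed
   also have "\<dots> = ennreal c * (emeasure lborel (ball x (real k * R)) + (\<integral>+ y. bavg H1 y (2 * real k * t) * indicator (ball x (real k * R)) y)
       + (\<integral>+ y. bavg H2 y (2 * real k * t) * indicator (ball x (real k * R)) y))"
    by (simp add: nn_integral_cmult nn_integral_add)
   also have "\<dots> \<le> ennreal c * (ennreal ((3 * real k * R) ^ n * m) + ennreal ((3 * real k * R) ^ n * m) + ennreal ((3 * real k * R) ^ n * m))"
   proof (intro mult_left_mono add_mono HI)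
    have "emeasure lborel (ball x (real k * R)) \<le> emeasure lborel (ball x (3 * real k * R))"
    proof (intro emeasure_mono subset_ball)
     show "real k * R \<le> 3 * real k * R" using kR by linarith
    qed simp
    thus "emeasure lborel (ball x (real k * R)) \<le> ennreal ((3 * real k * R) ^ n * m)"
     using Eb[of "3 * real k * R" x] k R by simp
   qed (use sb in \<open>auto simp: scale_bounds_def\<close>)
   also have "\<dots> = ennreal (c * (3 * ((3 * real k * R) ^ n * m)))"
       proof -
    have B: "0 \<le> (3 * real k * R) ^ n * m" using m k R by simp
    have "ennreal ((3 * real k * R) ^ n * m) + ennreal ((3 * real k * R) ^ n * m) + ennreal ((3 * real k * R) ^ n * m) = ennreal (3 * ((3 * real k * R) ^ n * m))"
     using B by (rule ennreal_add_thrice)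
    thus ?thesis using c by (simp only: ennreal_mult')
   qed
   also have "c * (3 * ((3 * real k * R) ^ n * m)) = C1 * R ^ n * W powr q * 2 powr (- mu * real i)"
   proof -
    have "c = K powr q * W powr q * 2 powr (- (real k * \<theta>) * real i * q) * (2 powr (real n * N) * 2 powr (real i * real n * N))"
    proof -
     have "Lm = 2 ^ (Suc i * n)" unfolding Lm_def power_mult by simp
     also have "\<dots> = 2 powr real (Suc i * n)" by (simp only: powr_realpow zero_less_numeral)
     finally have "Lm powr N = 2 powr (real (Suc i * n) * N)" by (simp only: powr_powr)
     also have "\<dots> = 2 powr (real n * N + real i * real n * N)" by (simp add: algebra_simps)
     finally have "Lm powr N = 2 powr (real n * N) * 2 powr (real i * real n * N)" by (simp only: powr_add)
     thus ?thesis unfolding c_def by (simp only: powr_mult powr_powr mult.assoc)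
    qed
    moreover have "2 powr (- (real k * \<theta>) * real i * q) * 2 powr (real i * real n * N) = 2 powr (- mu * real i)"
     by (simp add: powr_add[symmetric] mu_def algebra_simps)
    ultimately have "c = K powr q * W powr q * 2 powr (real n * N) * 2 powr (- mu * real i)" by (simp add: mult_ac)
    thus ?thesis unfolding C1_def power_mult_distrib by (simp only: mult_ac)
   qed
   finally show ?thesis .
  qed
  have FI: "(\<integral>+ y. ennreal (F y powr q) * indicator (ball x (real k * R)) y) \<le> ennreal (D * C1 * c2 * R ^ n * W powr q)"
  proof -
   have "(\<integral>+ y. ennreal (F y powr q) * indicator (ball x (real k * R)) y)
    \<le> (\<integral>+ y. (\<Sum>i. ennreal D * (ennreal (2 powr (mu / 2 * real i)) * (ennreal (U i y powr q) * indicator (ball x (real k * R)) y))))"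
   proof (rule nn_integral_mono_AE)
    show "AE y in lborel. ennreal (F y powr q) * indicator (ball x (real k * R)) y
     \<le> (\<Sum>i. ennreal D * (ennreal (2 powr (mu / 2 * real i)) * (ennreal (U i y powr q) * indicator (ball x (real k * R)) y)))"
     using AE_good_point[OF k f]
    proof eventually_elim
     case (elim y)
     show ?case
     proof (cases "y \<in> ball x (real k * R)")
      case True
      have "ennreal (F y) \<le> (\<Sum>i. ennreal (U i y))" unfolding F_def U_def by (rule good_point_telescope[OF elim Rj])
      hence "ennreal (F y powr q) \<le> ennreal D * (\<Sum>i. ennreal (2 powr (mu / 2 * real i) * U i y powr q))"
       unfolding D_def by (intro weighted_sum_powr[OF q]) (use mu in \<open>auto simp: U_def F_def\<close>)
      thus ?thesis using True by (simp add: ennreal_mult)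
     qed simp
    qed
   qed
   also have "\<dots> = (\<Sum>i. ennreal D * (ennreal (2 powr (mu / 2 * real i)) * (\<integral>+ y. ennreal (U i y powr q) * indicator (ball x (real k * R)) y)))"
    by (subst nn_integral_suminf) (auto simp: nn_integral_cmult)
   also have "\<dots> \<le> (\<Sum>i. ennreal (D * (C1 * R ^ n * W powr q) * (2 powr (- (mu / 2))) ^ i))"
   proof (intro suminf_le)
    fix i
    have "ennreal D * (ennreal (2 powr (mu / 2 * real i)) * (\<integral>+ y. ennreal (U i y powr q) * indicator (ball x (real k * R)) y))
     \<le> ennreal D * (ennreal (2 powr (mu / 2 * real i)) * ennreal (C1 * R ^ n * W powr q * 2 powr (- mu * real i)))"
     by (intro mult_left_mono UI) auto
    also have "\<dots> = ennreal (D * (2 powr (mu / 2 * real i) * (C1 * R ^ n * W powr q * 2 powr (- mu * real i))))"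
     using D C1 R by (simp add: ennreal_mult)
    also have "D * (2 powr (mu / 2 * real i) * (C1 * R ^ n * W powr q * 2 powr (- mu * real i)))
     = D * (C1 * R ^ n * W powr q) * (2 powr (mu / 2 * real i) * 2 powr (- mu * real i))" by (simp only: mult_ac)
    also have "2 powr (mu / 2 * real i) * 2 powr (- mu * real i) = (2 powr (- (mu / 2))) ^ i"
     by (subst powr_realpow[symmetric], simp, subst powr_powr, subst powr_add[symmetric]) (simp add: algebra_simps)
    finally show "ennreal D * (ennreal (2 powr (mu / 2 * real i)) * (\<integral>+ y. ennreal (U i y powr q) * indicator (ball x (real k * R)) y))
     \<le> ennreal (D * (C1 * R ^ n * W powr q) * (2 powr (- (mu / 2))) ^ i)" .
   qed auto
   also have "\<dots> = ennreal (D * (C1 * R ^ n * W powr q) * c2)" unfolding c2_def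
    using D C1 R b2 by (intro suminf_ennreal_eq sums_mult geometric_sums) auto
   finally show ?thesis by (simp add: mult_ac)
  qed
  \<comment> \<open>For j = 0 the deviation is always evaluated at x, where \<open>Fx\<close>
    applies. For j \<ge> 1 the map from h to x + j h carries the ball of radius R to that of radius
    j R, and its Jacobian j^n is at least 1.\<close>
  have Fj: "(\<integral>+ h. ennreal (F (x + real j *\<^sub>R h) powr q) * indicator (ball 0 R) h) \<le> ennreal (E * R ^ n * W powr q)" if j: "j \<in> {0..k}" for j
  proof (cases "j = 0")
   case True
   have "(\<integral>+ h. ennreal (F (x + real j *\<^sub>R h) powr q) * indicator (ball 0 R) h) = ennreal (F x powr q) * ennreal (R ^ n * m)"
    using True R Eb[of R 0] by (simp add: nn_integral_cmult_indicator)
   also have "\<dots> \<le> ennreal ((K * W * c1) powr q) * ennreal (R ^ n * m)"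
    using Fx q by (intro mult_right_mono ennreal_leI powr_mono2) (auto simp: F_def)
   also have "\<dots> = ennreal ((K * W * c1) powr q * (R ^ n * m))" using R m by (simp add: ennreal_mult)
   also have "(K * W * c1) powr q * (R ^ n * m) = (K * c1) powr q * m * (R ^ n * W powr q)"
    by (simp only: powr_mult mult_ac)
   also have "ennreal \<dots> \<le> ennreal (E * (R ^ n * W powr q))"
    using R W D C1 c2 by (intro ennreal_leI mult_right_mono) (auto simp: E_def)
   finally show ?thesis by (simp add: mult.assoc)
  next
   case False
   hence j1: "1 \<le> j" "j \<le> k" using j by auto
   define Z where "Z y = ennreal (F y powr q) * indicator (ball x (real j * R)) y" for y
   have [measurable]: "Z \<in> borel_fun" unfolding Z_def by measurable
   have Zj: "Z (x + real j *\<^sub>R h) = ennreal (F (x + real j *\<^sub>R h) powr q) * indicator (ball 0 R) h" for h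
    using j1 by (auto simp: Z_def indicator_def dist_norm)
   have "(\<integral>+ h. Z (x + real j *\<^sub>R h)) \<le> ennreal (\<bar>real j\<bar> ^ DIM(real^'n)) * (\<integral>+ h. Z (x + real j *\<^sub>R h))"
   proof -
    have "ennreal 1 \<le> ennreal (\<bar>real j\<bar> ^ DIM(real^'n))" using j1 by (intro ennreal_leI one_le_power) auto
    from mult_right_mono[OF this, of "(\<integral>+ h. Z (x + real j *\<^sub>R h))"] show ?thesis by simp
   qed
   also have "\<dots> = (\<integral>+ y. Z y)"
    by (rule nn_integral_lborel_affine[symmetric]) (use j1 in auto)
   also have "\<dots> \<le> (\<integral>+ y. ennreal (F y powr q) * indicator (ball x (real k * R)) y)"
    unfolding Z_def using j1 R by (intro nn_integral_mono mult_left_mono indicator_mono_ennreal subset_ball) auto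
   also have "\<dots> \<le> ennreal (D * C1 * c2 * R ^ n * W powr q)" by (rule FI)
   also have "\<dots> \<le> ennreal (E * (R ^ n * W powr q))" unfolding mult.assoc[of _ "R ^ n"]
    using R m by (intro ennreal_leI mult_right_mono) (auto simp: E_def)
   finally show ?thesis by (simp add: Zj mult.assoc)
  qed
  have point: "\<bar>finite_diff k h f x\<bar> powr q \<le> real (k + 2) powr q *
    ((\<Sum>j=0..k. real (k choose j) powr q * F (x + real j *\<^sub>R h) powr q) + (K * W) powr q)" if h: "norm h \<le> R" for h
  proof -
   \<comment> \<open>The extra index k + 1 carries the contribution of \<open>Phi k f R\<close>
     itself, the others that of the deviation of f from it.\<close>
   define a where "a j = (if j \<le> k then real (k choose j) * F (x + real j *\<^sub>R h) else K * W)" for j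
   have a0: "0 \<le> a j" for j using K W by (auto simp: a_def F_def)
   have f1: "\<bar>finite_diff k h (Phi k f R) x\<bar> \<le> K * W"
   proof -
    have "\<bar>finite_diff k h (Phi k f R) x\<bar> \<le> (K * A) powr (1 - \<theta>) * (K * (R ^ k * G)) powr \<theta>"
     using fd[OF h] by (intro powr_interpolate \<theta>) auto
    also have "\<dots> = (K powr (1 - \<theta>) * K powr \<theta>) * (A powr (1 - \<theta>) * (R ^ k * G) powr \<theta>)"
     by (simp only: powr_mult mult_ac)
    also have "K powr (1 - \<theta>) * K powr \<theta> = K" using K by (simp add: powr_add[symmetric])
    also have "A powr (1 - \<theta>) * (R ^ k * G) powr \<theta> = W"
     unfolding W_def using A by (simp only: powr_divide) (simp add: powr_diff)
    finally show ?thesis .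
   qed
   have "finite_diff k h f x = (\<Sum>j=0..k. (-1) ^ (k - j) * real (k choose j) * (f (x + real j *\<^sub>R h) - Phi k f R (x + real j *\<^sub>R h)))
     + finite_diff k h (Phi k f R) x"
    by (simp add: finite_diff_def sum.distrib[symmetric] right_diff_distrib)
   hence "\<bar>finite_diff k h f x\<bar> \<le> \<bar>\<Sum>j=0..k. (-1) ^ (k - j) * real (k choose j) * (f (x + real j *\<^sub>R h) - Phi k f R (x + real j *\<^sub>R h))\<bar> + K * W"
    using f1 by linarith
   also have "\<bar>\<Sum>j=0..k. (-1) ^ (k - j) * real (k choose j) * (f (x + real j *\<^sub>R h) - Phi k f R (x + real j *\<^sub>R h))\<bar>
     \<le> (\<Sum>j=0..k. a j)"
    by (rule order_trans[OF sum_abs], rule sum_mono) (simp add: a_def F_def abs_mult power_abs)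
   finally have "\<bar>finite_diff k h f x\<bar> \<le> (\<Sum>j=0..Suc k. a j)" by (simp add: a_def)
   hence "\<bar>finite_diff k h f x\<bar> powr q \<le> (\<Sum>j=0..Suc k. a j) powr q" using q by (intro powr_mono2) auto
   also have "\<dots> \<le> real (card {0..Suc k}) powr q * (\<Sum>j=0..Suc k. a j powr q)"
    using a0 q by (intro sum_powr_le) auto
   also have "(\<Sum>j=0..Suc k. a j powr q) = (\<Sum>j=0..k. real (k choose j) powr q * F (x + real j *\<^sub>R h) powr q) + (K * W) powr q"
    by (simp add: a_def powr_mult)
   finally show ?thesis by simp
  qed
  have "(\<integral>+ h. ennreal (\<bar>finite_diff k h f x\<bar> powr q) * indicator (ball 0 R) h)
   \<le> (\<integral>+ h. ennreal (real (k + 2) powr q) * ((\<Sum>j=0..k. ennreal (real (k choose j) powr q) * (ennreal (F (x + real j *\<^sub>R h) powr q) * indicator (ball 0 R) h))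
     + ennreal ((K * W) powr q) * indicator (ball 0 R) h))"
  proof (intro nn_integral_mono)
   fix h
   show "ennreal (\<bar>finite_diff k h f x\<bar> powr q) * indicator (ball 0 R) h \<le>
     ennreal (real (k + 2) powr q) * ((\<Sum>j=0..k. ennreal (real (k choose j) powr q) * (ennreal (F (x + real j *\<^sub>R h) powr q) * indicator (ball 0 R) h))
     + ennreal ((K * W) powr q) * indicator (ball 0 R) h)"
   proof (cases "h \<in> ball 0 R")
    case True
    have "ennreal (\<bar>finite_diff k h f x\<bar> powr q) \<le> ennreal (real (k + 2) powr q *
      ((\<Sum>j=0..k. real (k choose j) powr q * F (x + real j *\<^sub>R h) powr q) + (K * W) powr q))"
     using True by (intro ennreal_leI point) simp
    also have "\<dots> = ennreal (real (k + 2) powr q) * ((\<Sum>j=0..k. ennreal (real (k choose j) powr q) * ennreal (F (x + real j *\<^sub>R h) powr q)) + ennreal ((K * W) powr q))"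
     by (subst ennreal_mult, simp, simp add: sum_nonneg, subst ennreal_plus, simp add: sum_nonneg, simp, subst sum_ennreal[symmetric], simp)
       (simp add: ennreal_mult)
    finally show ?thesis using True by simp
   qed simp
  qed
  also have "\<dots> = ennreal (real (k + 2) powr q) * ((\<Sum>j=0..k. ennreal (real (k choose j) powr q) * (\<integral>+ h. ennreal (F (x + real j *\<^sub>R h) powr q) * indicator (ball 0 R) h))
     + ennreal ((K * W) powr q) * emeasure lborel (ball (0::real^'n) R))"
   by (simp add: nn_integral_cmult nn_integral_add nn_integral_sum nn_integral_cmult_indicator)
  also have "\<dots> \<le> ennreal (real (k + 2) powr q) * ((\<Sum>j=0..k. ennreal (real (k choose j) powr q) * ennreal (E * R ^ n * W powr q))
     + ennreal ((K * W) powr q) * ennreal (R ^ n * m))"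
   using R by (intro mult_left_mono add_mono sum_mono Fj) (auto simp: Eb)
  also have "(\<Sum>j=0..k. ennreal (real (k choose j) powr q) * ennreal (E * R ^ n * W powr q)) = ennreal (S * (E * R ^ n * W powr q))"
  proof -
   have "(\<Sum>j=0..k. ennreal (real (k choose j) powr q) * ennreal (E * R ^ n * W powr q)) = (\<Sum>j=0..k. ennreal (real (k choose j) powr q * (E * R ^ n * W powr q)))"
    using E R by (intro sum.cong refl ennreal_mult[symmetric]) auto
   also have "\<dots> = ennreal (\<Sum>j=0..k. real (k choose j) powr q * (E * R ^ n * W powr q))"
    using E R by (intro sum_ennreal) auto
   finally show ?thesis by (simp only: S_def sum_distrib_right)
  qed
  also have "ennreal (real (k + 2) powr q) * (ennreal (S * (E * R ^ n * W powr q)) + ennreal ((K * W) powr q) * ennreal (R ^ n * m))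
    = ennreal (real (k + 2) powr q * (S * (E * R ^ n * W powr q) + (K * W) powr q * (R ^ n * m)))"
   using S E R m by (simp add: ennreal_mult ennreal_plus)
  also have "real (k + 2) powr q * (S * (E * R ^ n * W powr q) + (K * W) powr q * (R ^ n * m)) = C * R ^ n * W powr q"
   unfolding C_def powr_mult by (simp add: algebra_simps)
  finally show "(\<integral>+ h. ennreal (\<bar>finite_diff k h f x\<bar> powr q) * indicator (ball 0 R) h)
    \<le> ennreal (C * R ^ CARD('n) * (A * (R ^ k * G / A) powr \<theta>) powr q)" by (simp add: n_def W_def)
 qed
qed

section \<open>Summation over dyadic annuli in h\<close>

lemma ennreal_powr_mono: "a \<le> b ==> 0 \<le> r ==> ennreal_powr a r \<le> ennreal_powr b r"
 unfolding ennreal_powr_def by (cases a; cases b) (auto simp: top_unique intro!: ennreal_leI powr_mono2)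

lemma ennreal_powr_ennreal: "0 \<le> b ==> ennreal_powr (ennreal b) r = ennreal (b powr r)"
 by (simp add: ennreal_powr_def)

lemma finite_diff_measurable[measurable]:
 fixes f :: "real ^ 'n::finite => real"
 assumes [measurable]: "f \<in> borel_fun"
 shows "(\<lambda>h. finite_diff k h f x) \<in> borel_fun"
 unfolding finite_diff_def by measurable

text \<open>An annulus of radius R, estimated with parameter \<theta>, contributes a multiple of (R
  / L)^(k q (\<theta> - s)), so \<theta> = s would make all annuli contribute alike. Taking \<theta>
  = s - \<delta> for radii above L and \<theta> = s + \<delta> for radii up to L gives two geometric
  series. L = \<open>2 powr j0\<close> is the scale at which the two bounds A and L^k G
  agree.\<close>

lemma frac_diff_dyadic:
 fixes s q K i1 i2 :: real
 assumes k: "0 < k" and s: "0 < s" "s < 1" and q: "1 \<le> q" and i: "0 \<le> i1" "0 \<le> i2" and K: "0 < K"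
  and sub: "real CARD('n) * ((1 - s) * i1 + s * i2 - 1 / q) < s * real k"
 obtains C where "0 < C" "\<And>(f::real^'n::finite => real) x A G H1 H2 (j0::int).
   loc_int f ==> good_point k f x ==> 0 < G ==> A = G * (2 powr real_of_int j0) ^ k ==>
   scale_bounds k f x A G i1 i2 K H1 H2 ==>
   (\<And>R h. 0 < R ==> norm h \<le> R ==> \<bar>finite_diff k h (Phi k f R) x\<bar> \<le> K * A \<and> \<bar>finite_diff k h (Phi k f R) x\<bar> \<le> K * (R ^ k * G)) ==>
   frac_diff s k q f x \<le> ennreal (C * (A powr (1 - s) * G powr s))"
proof -
 define n where "n = CARD('n)"
 \<comment> \<open>Positivity of \<open>\<phi>\<close> is the hypothesis of
   \<open>local_difference_bound\<close>. At s it follows from \<open>sub\<close> multiplied by q,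
   and by continuity it persists near s.\<close>
 define \<phi> where "\<phi> \<theta> = real k * \<theta> * q - real n * max (q * (i1 * (1 - \<theta>) + i2 * \<theta>) - 1) 0" for \<theta>
 have phis: "\<phi> s > 0"
 proof -
  have "real n * (q * (i1 * (1 - s) + i2 * s) - 1) = q * (real n * ((1 - s) * i1 + s * i2 - 1 / q))"
   using q by (simp add: field_simps)
  also have "\<dots> < q * (s * real k)" using sub q by (intro mult_strict_left_mono) (auto simp: n_def)
  finally have "real n * (q * (i1 * (1 - s) + i2 * s) - 1) < real k * s * q" by (simp add: mult_ac)
  moreover have "0 < real k * s * q" using k s q by simp
  ultimately show ?thesis unfolding \<phi>_def by (auto simp: max_def)
 qed
 have "isCont \<phi> s" unfolding \<phi>_def by (intro continuous_intros)
 hence "\<forall>\<^sub>F \<theta> in at s. 0 < \<phi> \<theta>" unfolding isCont_def using phis by (rule order_tendstoD(1))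
 then obtain d where d0: "d > 0" "\<And>\<theta>. \<theta> \<noteq> s ==> dist \<theta> s < d ==> \<phi> \<theta> > 0"
  unfolding eventually_at by auto
 have d: "d > 0" "\<And>\<theta>. \<bar>\<theta> - s\<bar> < d ==> \<phi> \<theta> > 0"
  using d0 phis by (simp, metis dist_real_def)
 \<comment> \<open>Small enough for \<open>\<phi>\<close> to stay positive and for s - \<delta> and
   s + \<delta> to stay between 0 and 1.\<close>
 define \<delta> where "\<delta> = min (d / 2) (min (s / 2) ((1 - s) / 2))"
 have \<delta>: "0 < \<delta>" "\<delta> < d" "\<delta> < s" "\<delta> < 1 - s" using d(1) s by (auto simp: \<delta>_def min_def)
 have m1: "real CARD('n) * max (q * (i1 * (1 - (s - \<delta>)) + i2 * (s - \<delta>)) - 1) 0 < real k * (s - \<delta>) * q"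
  using d(2)[of "s - \<delta>"] \<delta> unfolding \<phi>_def n_def by simp
 have m2: "real CARD('n) * max (q * (i1 * (1 - (s + \<delta>)) + i2 * (s + \<delta>)) - 1) 0 < real k * (s + \<delta>) * q"
  using d(2)[of "s + \<delta>"] \<delta> unfolding \<phi>_def n_def by simp
 have t1: "0 \<le> s - \<delta>" "s - \<delta> \<le> 1" and t2: "0 \<le> s + \<delta>" "s + \<delta> \<le> 1" using s \<delta> by auto
 obtain Ca where Ca: "0 < Ca" "\<And>(f::real^'n::finite => real) x A G H1 H2 j R.
   loc_int f ==> good_point k f x ==> 0 < A ==> 0 < G ==> R = 2 powr real_of_int j ==>
   scale_bounds k f x A G i1 i2 K H1 H2 ==>
   (\<And>h. norm h \<le> R ==> \<bar>finite_diff k h (Phi k f R) x\<bar> \<le> K * A \<and> \<bar>finite_diff k h (Phi k f R) x\<bar> \<le> K * (R ^ k * G)) ==>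
   (\<integral>+ h. ennreal (\<bar>finite_diff k h f x\<bar> powr q) * indicator (ball 0 R) h)
    \<le> ennreal (Ca * R ^ CARD('n) * (A * (R ^ k * G / A) powr (s - \<delta>)) powr q)"
  by (rule local_difference_bound[OF k q t1 i K m1]) blast
 obtain Cb where Cb: "0 < Cb" "\<And>(f::real^'n::finite => real) x A G H1 H2 j R.
   loc_int f ==> good_point k f x ==> 0 < A ==> 0 < G ==> R = 2 powr real_of_int j ==>
   scale_bounds k f x A G i1 i2 K H1 H2 ==>
   (\<And>h. norm h \<le> R ==> \<bar>finite_diff k h (Phi k f R) x\<bar> \<le> K * A \<and> \<bar>finite_diff k h (Phi k f R) x\<bar> \<le> K * (R ^ k * G)) ==>
   (\<integral>+ h. ennreal (\<bar>finite_diff k h f x\<bar> powr q) * indicator (ball 0 R) h)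
    \<le> ennreal (Cb * R ^ CARD('n) * (A * (R ^ k * G / A) powr (s + \<delta>)) powr q)"
  by (rule local_difference_bound[OF k q t2 i K m2]) blast
 define \<gamma> where "\<gamma> = real n + s * real k * q"
 have \<gamma>: "\<gamma> > 0" unfolding \<gamma>_def using s k q by (simp add: n_def add_pos_pos)
 define b where "b = 2 powr (- (real k * q * \<delta>))"
 have b: "0 < b" "b < 1" using k q \<delta> by (auto simp: b_def powr_less_one)
 define c where "c = 1 / (1 - b)"
 have c: "c > 0" using b by (simp add: c_def)
 define C' where "C' = 2 powr \<gamma> * (Ca + Cb) * c"
 have C': "C' > 0" using Ca(1) Cb(1) c by (simp add: C'_def)
 show ?thesis
 proof (rule that[of "C' powr (1 / q)"])
  show "0 < C' powr (1 / q)" using C' by simp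
  fix f :: "real^'n => real" and x A G H1 H2 and j0 :: int
  assume f: "loc_int f" and gx: "good_point k f x" and G: "0 < G" and Aj: "A = G * (2 powr real_of_int j0) ^ k"
   and sb: "scale_bounds k f x A G i1 i2 K H1 H2"
   and fd: "\<And>R h. 0 < R ==> norm h \<le> R ==> \<bar>finite_diff k h (Phi k f R) x\<bar> \<le> K * A \<and> \<bar>finite_diff k h (Phi k f R) x\<bar> \<le> K * (R ^ k * G)"
  note loc_int_measurable[OF f, measurable]
  define L where "L = 2 powr real_of_int j0"
  have L: "L > 0" by (simp add: L_def)
  have A: "A > 0" using G L Aj by (simp add: L_def)
  \<comment> \<open>Every annulus contributes a multiple of Q; because A = G L^k, the power Q^(1/q)
    is A^(1-s) G^s.\<close>
  define Q where "Q = L powr (- (s * real k * q)) * A powr q"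
  have Q0: "Q \<ge> 0" by (simp add: Q_def)
  define D where "D h = ennreal (\<bar>finite_diff k h f x\<bar> powr q)" for h
  have [measurable]: "D \<in> borel_fun" unfolding D_def by measurable
  define T where "T R h = ennreal ((R / 2) powr (- \<gamma>)) * (D h * indicator (ball 0 R) h)" for R h
  have [measurable]: "T R \<in> borel_fun" for R unfolding T_def by measurable
  have Rk: "(L * 2 powr real_of_int p) ^ k * G / A = 2 powr (real_of_int p * real k)" for p
   unfolding Aj L_def[symmetric] power_mult_distrib using G L
   by (simp add: powr_powr[symmetric] powr_realpow)
  have val: "(R / 2) powr (- \<gamma>) * (C0 * R ^ n * (A * (R ^ k * G / A) powr \<theta>) powr q)
    = 2 powr \<gamma> * C0 * Q * 2 powr (real_of_int p * (real k * q * (\<theta> - s)))"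
   if R: "R = L * 2 powr real_of_int p" for R p C0 \<theta>
  proof -
   have Rp: "R > 0" using R L by simp
   have "(R / 2) powr (- \<gamma>) = R powr (- \<gamma>) / 2 powr (- \<gamma>)" by (rule powr_divide)
   also have "\<dots> = R powr (- \<gamma>) * 2 powr \<gamma>" by (simp add: powr_minus divide_inverse)
   also have "R powr (- \<gamma>) = R powr (- real n) * R powr (- (s * real k * q))"
    by (subst powr_add[symmetric]) (simp add: \<gamma>_def)
   finally have f1: "(R / 2) powr (- \<gamma>) = R powr (- real n) * R powr (- (s * real k * q)) * 2 powr \<gamma>" .
   have f2: "R powr (- real n) * R ^ n = 1" using Rp by (simp add: powr_minus powr_realpow)
   have f3: "R powr (- (s * real k * q)) = L powr (- (s * real k * q)) * 2 powr (real_of_int p * (- (s * real k * q)))"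
    unfolding R by (simp only: powr_mult powr_powr)
   have f4: "(A * (R ^ k * G / A) powr \<theta>) powr q = A powr q * 2 powr (real_of_int p * real k * \<theta> * q)"
    unfolding R Rk by (simp only: powr_mult powr_powr)
   have f5: "2 powr (real_of_int p * (- (s * real k * q))) * 2 powr (real_of_int p * real k * \<theta> * q)
     = 2 powr (real_of_int p * (real k * q * (\<theta> - s)))"
    by (simp add: powr_add[symmetric] algebra_simps)
   have "(R / 2) powr (- \<gamma>) * (C0 * R ^ n * (A * (R ^ k * G / A) powr \<theta>) powr q)
    = (R powr (- real n) * (L powr (- (s * real k * q)) * 2 powr (real_of_int p * (- (s * real k * q)))) * 2 powr \<gamma>)
      * (C0 * R ^ n * (A powr q * 2 powr (real_of_int p * real k * \<theta> * q)))"
    by (simp only: f1 f3 f4)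
   also have "\<dots> = (R powr (- real n) * R ^ n) * (2 powr \<gamma> * C0 * (L powr (- (s * real k * q)) * A powr q)
      * (2 powr (real_of_int p * (- (s * real k * q))) * 2 powr (real_of_int p * real k * \<theta> * q)))"
    by (simp only: mult_ac)
   finally show ?thesis unfolding f2 f5 Q_def by simp
  qed
  have TI: "(\<integral>+ h. T R h) = ennreal ((R / 2) powr (- \<gamma>)) * (\<integral>+ h. D h * indicator (ball 0 R) h)" for R
   unfolding T_def by (rule nn_integral_cmult) measurable
  have T1: "(\<integral>+ h. T (L * 2 ^ Suc i) h) \<le> ennreal (2 powr \<gamma> * Ca * Q * b ^ i)" for i
  proof -
   define R where "R = L * 2 powr real_of_int (int (Suc i))"
   have R: "L * 2 ^ Suc i = R" unfolding R_def by (simp only: of_int_of_nat_eq powr_realpow zero_less_numeral)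
   have Rj: "R = 2 powr real_of_int (j0 + int (Suc i))" unfolding R_def L_def by (simp only: of_int_add powr_add)
   have R0: "R > 0" using Rj by simp
   have "(\<integral>+ h. T R h) \<le> ennreal ((R / 2) powr (- \<gamma>)) * ennreal (Ca * R ^ CARD('n) * (A * (R ^ k * G / A) powr (s - \<delta>)) powr q)"
    unfolding TI D_def by (intro mult_left_mono Ca(2)[OF f gx A G Rj sb] fd R0) auto
   also have "\<dots> = ennreal ((R / 2) powr (- \<gamma>) * (Ca * R ^ n * (A * (R ^ k * G / A) powr (s - \<delta>)) powr q))"
    using Ca(1) R0 by (simp add: ennreal_mult n_def)
   also have "\<dots> = ennreal (2 powr \<gamma> * Ca * Q * 2 powr (real_of_int (int (Suc i)) * (real k * q * ((s - \<delta>) - s))))"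
    by (simp only: val[OF R_def])
   also have "\<dots> \<le> ennreal (2 powr \<gamma> * Ca * Q * b ^ i)"
   proof (intro ennreal_leI mult_left_mono)
    have "b ^ i = 2 powr (real i * (real k * q * (- \<delta>)))"
     unfolding b_def by (subst powr_realpow[symmetric], simp, subst powr_powr) (simp add: mult_ac)
    moreover have "real_of_int (int (Suc i)) * (real k * q * (s - \<delta> - s)) \<le> real i * (real k * q * (- \<delta>))"
     using k q \<delta> by (simp add: algebra_simps)
    ultimately show "2 powr (real_of_int (int (Suc i)) * (real k * q * (s - \<delta> - s))) \<le> b ^ i"
     by (simp only: powr_mono one_le_numeral)
   qed (use Ca(1) Q0 in auto)
   finally show ?thesis unfolding R .
  qed
  have T2: "(\<integral>+ h. T (L / 2 ^ i) h) \<le> ennreal (2 powr \<gamma> * Cb * Q * b ^ i)" for i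
  proof -
   define R where "R = L * 2 powr real_of_int (- int i)"
   have R: "L / 2 ^ i = R" unfolding R_def by (simp add: powr_minus powr_realpow divide_inverse)
   have Rj: "R = 2 powr real_of_int (j0 + (- int i))" unfolding R_def L_def by (simp only: of_int_add powr_add)
   have R0: "R > 0" using Rj by simp
   have "(\<integral>+ h. T R h) \<le> ennreal ((R / 2) powr (- \<gamma>)) * ennreal (Cb * R ^ CARD('n) * (A * (R ^ k * G / A) powr (s + \<delta>)) powr q)"
    unfolding TI D_def by (intro mult_left_mono Cb(2)[OF f gx A G Rj sb] fd R0) auto
   also have "\<dots> = ennreal ((R / 2) powr (- \<gamma>) * (Cb * R ^ n * (A * (R ^ k * G / A) powr (s + \<delta>)) powr q))"
    using Cb(1) R0 by (simp add: ennreal_mult n_def)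
   also have "\<dots> = ennreal (2 powr \<gamma> * Cb * Q * 2 powr (real_of_int (- int i) * (real k * q * ((s + \<delta>) - s))))"
    by (simp only: val[OF R_def])
   also have "2 powr (real_of_int (- int i) * (real k * q * ((s + \<delta>) - s))) = b ^ i"
    unfolding b_def by (subst powr_realpow[symmetric], simp, subst powr_powr) (simp add: mult_ac)
   finally show ?thesis unfolding R .
  qed
  \<comment> \<open>A nonzero h lies in one annulus R/2 \<le> |h| < R with R = L 2^(p+1); p \<ge> 0
    belongs to the first series and p < 0 to the second.\<close>
  have cover: "ennreal (\<bar>finite_diff k h f x\<bar> powr q / norm h powr \<gamma>) \<le> (\<Sum>i. T (L * 2 ^ Suc i) h) + (\<Sum>i. T (L / 2 ^ i) h)" for h
  proof (cases "h = 0")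
   case False
   have one: "ennreal (\<bar>finite_diff k h f x\<bar> powr q / norm h powr \<gamma>) \<le> T R h" if R: "0 < R" "R / 2 \<le> norm h" "norm h < R" for R
   proof -
    have "norm h powr (- \<gamma>) \<le> (R / 2) powr (- \<gamma>)" using R \<gamma> by (intro powr_mono2') auto
    hence "norm h powr (- \<gamma>) * \<bar>finite_diff k h f x\<bar> powr q \<le> (R / 2) powr (- \<gamma>) * \<bar>finite_diff k h f x\<bar> powr q"
     by (rule mult_right_mono) simp
    moreover have "\<bar>finite_diff k h f x\<bar> powr q / norm h powr \<gamma> = norm h powr (- \<gamma>) * \<bar>finite_diff k h f x\<bar> powr q"
     by (simp only: powr_minus divide_inverse mult.commute)
    ultimately have "\<bar>finite_diff k h f x\<bar> powr q / norm h powr \<gamma> \<le> (R / 2) powr (- \<gamma>) * \<bar>finite_diff k h f x\<bar> powr q"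
     by simp
    hence "ennreal (\<bar>finite_diff k h f x\<bar> powr q / norm h powr \<gamma>) \<le> ennreal ((R / 2) powr (- \<gamma>) * \<bar>finite_diff k h f x\<bar> powr q)"
     by (rule ennreal_leI)
    also have "\<dots> = T R h" using R by (simp add: T_def D_def ennreal_mult)
    finally show ?thesis .
   qed
   define p where "p = \<lfloor>log 2 (norm h / L)\<rfloor>"
   have hL: "norm h / L > 0" using False L by simp
   have "2 powr real_of_int p \<le> norm h / L" "norm h / L < 2 powr (real_of_int p + 1)"
    using hL by (simp_all add: p_def powr_le_iff less_powr_iff)
   hence p: "L * 2 powr real_of_int p \<le> norm h" "norm h < L * 2 powr (real_of_int p + 1)"
    using L by (simp_all add: field_simps)
   show ?thesis
   proof (cases "p \<ge> 0")
    case True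
    then obtain i where i: "p = int i" using nonneg_int_cases by blast
    have e: "L * 2 powr real_of_int p = L * 2 ^ Suc i / 2" "L * 2 powr (real_of_int p + 1) = L * 2 ^ Suc i"
     by (simp_all add: i powr_add powr_realpow)
    have "ennreal (\<bar>finite_diff k h f x\<bar> powr q / norm h powr \<gamma>) \<le> T (L * 2 ^ Suc i) h"
     using p L unfolding e by (intro one) auto
    also have "\<dots> = (\<Sum>i\<in>{i}. T (L * 2 ^ Suc i) h)" by simp
    also have "\<dots> \<le> (\<Sum>i. T (L * 2 ^ Suc i) h)" by (rule sum_le_suminf) auto
    also have "\<dots> \<le> (\<Sum>i. T (L * 2 ^ Suc i) h) + (\<Sum>i. T (L / 2 ^ i) h)" by simp
    finally show ?thesis .
   next
    case False
    define i where "i = nat (- p - 1)"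
    have i: "real_of_int p = - real i - 1" using False by (simp add: i_def)
    have p1: "real_of_int p + 1 = - real i" using i by simp
    have p2: "2 powr (real_of_int p + 1) = 1 / 2 ^ i"
     unfolding p1 by (simp add: powr_minus powr_realpow inverse_eq_divide)
    have p3: "2 powr real_of_int p = 2 powr (real_of_int p + 1) / 2" by (simp add: powr_add)
    have e: "L * 2 powr real_of_int p = L / 2 ^ i / 2" "L * 2 powr (real_of_int p + 1) = L / 2 ^ i"
     unfolding p3 p2 by simp_all
    have "ennreal (\<bar>finite_diff k h f x\<bar> powr q / norm h powr \<gamma>) \<le> T (L / 2 ^ i) h"
     using p L unfolding e by (intro one) auto
    also have "\<dots> = (\<Sum>i\<in>{i}. T (L / 2 ^ i) h)" by simp
    also have "\<dots> \<le> (\<Sum>i. T (L / 2 ^ i) h)" by (rule sum_le_suminf) auto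
    also have "\<dots> \<le> (\<Sum>i. T (L * 2 ^ Suc i) h) + (\<Sum>i. T (L / 2 ^ i) h)" by simp
    finally show ?thesis .
   qed
  \<comment> \<open>At h = 0 the integrand is 0, because \<open>0 powr \<gamma>\<close> is 0 and so
    is division by 0.\<close>
  qed (use \<gamma> in simp)
  have geo: "(\<Sum>i. ennreal (B * b ^ i)) = ennreal (B * c)" if "B \<ge> 0" for B
   unfolding c_def using b that by (intro suminf_ennreal_eq sums_mult geometric_sums) auto
  have "(\<integral>\<^sup>+h. ennreal (\<bar>finite_diff k h f x\<bar> powr q / norm h powr (real CARD('n) + s * real k * q)) \<partial>lebesgue)
   = (\<integral>+ h. ennreal (\<bar>finite_diff k h f x\<bar> powr q / norm h powr \<gamma>))"
   by (simp add: nn_integral_completion \<gamma>_def n_def)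
  also have "\<dots> \<le> (\<integral>+ h. (\<Sum>i. T (L * 2 ^ Suc i) h) + (\<Sum>i. T (L / 2 ^ i) h))"
   by (intro nn_integral_mono cover)
  also have "\<dots> = (\<Sum>i. (\<integral>+ h. T (L * 2 ^ Suc i) h)) + (\<Sum>i. (\<integral>+ h. T (L / 2 ^ i) h))"
   by (subst nn_integral_add) (auto simp: nn_integral_suminf)
  also have "\<dots> \<le> (\<Sum>i. ennreal (2 powr \<gamma> * Ca * Q * b ^ i)) + (\<Sum>i. ennreal (2 powr \<gamma> * Cb * Q * b ^ i))"
   by (intro add_mono suminf_le T1 T2) auto
  also have "\<dots> = ennreal (2 powr \<gamma> * Ca * Q * c) + ennreal (2 powr \<gamma> * Cb * Q * c)"
   using Ca(1) Cb(1) Q0 by (simp add: geo)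
  also have "\<dots> = ennreal (2 powr \<gamma> * Ca * Q * c + 2 powr \<gamma> * Cb * Q * c)"
   using Ca(1) Cb(1) Q0 c by (intro ennreal_plus[symmetric]) auto
  also have "2 powr \<gamma> * Ca * Q * c + 2 powr \<gamma> * Cb * Q * c = C' * Q"
   by (simp add: C'_def algebra_simps)
  finally have "frac_diff s k q f x \<le> ennreal_powr (ennreal (C' * Q)) (1 / q)"
   unfolding frac_diff_def using q by (intro ennreal_powr_mono) auto
  also have "\<dots> = ennreal ((C' * Q) powr (1 / q))" using C' Q0 by (intro ennreal_powr_ennreal) simp
  also have "(C' * Q) powr (1 / q) = C' powr (1 / q) * Q powr (1 / q)" by (rule powr_mult)
  also have "Q powr (1 / q) = L powr (- (s * real k)) * A"
   unfolding Q_def using q A by (simp add: powr_mult powr_powr)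
  also have "L powr (- (s * real k)) * A = A powr (1 - s) * G powr s"
  proof -
   have "A powr s = G powr s * L powr (s * real k)"
    unfolding Aj L_def[symmetric] using L by (simp add: powr_mult powr_realpow[symmetric] powr_powr mult.commute)
   hence "L powr (- (s * real k)) * A powr s = G powr s" using L by (simp add: powr_minus)
   moreover have "A = A powr (1 - s) * A powr s" using A by (simp add: powr_add[symmetric])
   ultimately show ?thesis by (metis mult.assoc mult.commute)
  qed
  finally show "frac_diff s k q f x \<le> ennreal (C' powr (1 / q) * (A powr (1 - s) * G powr s))" .
 qed
qed

lemma scale_bounds_mono:
 assumes "scale_bounds k f x A G i1 i2 K H1 H2" "A \<le> A'" "0 \<le> K"
 shows "scale_bounds k f x A' G i1 i2 K H1 H2"
 using assms unfolding scale_bounds_def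
 by (auto intro: order_trans[OF _ mult_right_mono[OF mult_left_mono[OF \<open>A \<le> A'\<close> \<open>0 \<le> K\<close>]]])

text \<open>The balance scale (A / G)^(1/k) is rounded up to a power of 2. This enlarges A by at
  most the factor 2^k, and the assumed bounds remain true for a larger A.\<close>

lemma frac_diff_pointwise:
 fixes s q K i1 i2 :: real
 assumes k: "0 < k" and s: "0 < s" "s < 1" and q: "1 \<le> q" and i: "0 \<le> i1" "0 \<le> i2" and K: "0 < K"
  and sub: "real CARD('n) * ((1 - s) * i1 + s * i2 - 1 / q) < s * real k"
 obtains C where "0 < C" "\<And>(f::real^'n::finite => real) x A G H1 H2.
   loc_int f ==> good_point k f x ==> 0 < A ==> 0 < G ==>
   scale_bounds k f x A G i1 i2 K H1 H2 ==>
   (\<And>R h. 0 < R ==> norm h \<le> R ==> \<bar>finite_diff k h (Phi k f R) x\<bar> \<le> K * A \<and> \<bar>finite_diff k h (Phi k f R) x\<bar> \<le> K * (R ^ k * G)) ==>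
   frac_diff s k q f x \<le> ennreal (C * (A powr (1 - s) * G powr s))"
proof -
 obtain C where C: "0 < C" "\<And>(f::real^'n::finite => real) x A G H1 H2 (j0::int).
   loc_int f ==> good_point k f x ==> 0 < G ==> A = G * (2 powr real_of_int j0) ^ k ==>
   scale_bounds k f x A G i1 i2 K H1 H2 ==>
   (\<And>R h. 0 < R ==> norm h \<le> R ==> \<bar>finite_diff k h (Phi k f R) x\<bar> \<le> K * A \<and> \<bar>finite_diff k h (Phi k f R) x\<bar> \<le> K * (R ^ k * G)) ==>
   frac_diff s k q f x \<le> ennreal (C * (A powr (1 - s) * G powr s))"
  by (rule frac_diff_dyadic[OF k s q i K sub]) blast
 show ?thesis
 proof (rule that[of "C * (2 ^ k) powr (1 - s)"])
  show "0 < C * (2 ^ k) powr (1 - s)" using C(1) by simp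
  fix f :: "real^'n => real" and x A G H1 H2
  assume f: "loc_int f" and gx: "good_point k f x" and A: "0 < A" and G: "0 < G"
   and sb: "scale_bounds k f x A G i1 i2 K H1 H2"
   and fd: "\<And>R h. 0 < R ==> norm h \<le> R ==> \<bar>finite_diff k h (Phi k f R) x\<bar> \<le> K * A \<and> \<bar>finite_diff k h (Phi k f R) x\<bar> \<le> K * (R ^ k * G)"
  define l where "l = log 2 (A / G) / real k"
  define A' where "A' = G * (2 powr real_of_int \<lceil>l\<rceil>) ^ k"
  have lk: "(2 powr l) ^ k = A / G" using A G k by (simp add: l_def powr_power)
  have "(2 powr l) ^ k \<le> (2 powr real_of_int \<lceil>l\<rceil>) ^ k" by (intro power_mono powr_mono) auto
  hence AA: "A \<le> A'" unfolding lk A'_def using G by (simp add: field_simps)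
  have "real_of_int \<lceil>l\<rceil> \<le> l + 1" by linarith
  hence "(2 powr real_of_int \<lceil>l\<rceil>) ^ k \<le> (2 powr (l + 1)) ^ k" by (intro power_mono powr_mono) auto
  also have "\<dots> = 2 ^ k * (A / G)" by (simp add: powr_add power_mult_distrib lk)
  finally have A'2: "A' \<le> 2 ^ k * A" unfolding A'_def using G by (simp add: field_simps)
  have "frac_diff s k q f x \<le> ennreal (C * (A' powr (1 - s) * G powr s))"
  proof (rule C(2)[OF f gx G A'_def scale_bounds_mono[OF sb AA]])
   fix R :: real and h :: "real^'n" assume "0 < R" "norm h \<le> R"
   moreover have "K * A \<le> K * A'" using AA K by simp
   ultimately show "\<bar>finite_diff k h (Phi k f R) x\<bar> \<le> K * A' \<and> \<bar>finite_diff k h (Phi k f R) x\<bar> \<le> K * (R ^ k * G)"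
    using fd[of R h] by linarith
  qed (use K in simp)
  also have "\<dots> \<le> ennreal (C * ((2 ^ k * A) powr (1 - s) * G powr s))"
   using C(1) A'2 A AA s by (intro ennreal_leI mult_left_mono mult_right_mono powr_mono2) auto
  finally show "frac_diff s k q f x \<le> ennreal (C * (2 ^ k) powr (1 - s) * (A powr (1 - s) * G powr s))"
   by (simp add: powr_mult mult_ac)
 qed
qed

section \<open>From averages of powers to the two bounds at every scale\<close>

lemma bavg_affine:
 fixes H :: "'a::euclidean_space => ennreal"
 assumes [measurable]: "H \<in> borel_fun" and \<rho>: "0 < \<rho>"
 shows "bavg (\<lambda>w. a + b * H w) y \<rho> = a + b * bavg H y \<rho>"
proof -
 have 1: "(\<integral>+ z. ennreal (ballW (z::'a))) = 1" by (rule avg_kernelD(4)[OF avg_kernel_ballW])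
 have "bavg (\<lambda>w. a + b * H w) y \<rho> = (\<integral>+ z. ennreal (ballW z) * (a + b * H (y + \<rho> *\<^sub>R z)))"
  using ballW_nn_integral[of "\<lambda>w. a + b * H w" \<rho> y] \<rho> by simp
 also have "\<dots> = (\<integral>+ z. a * ennreal (ballW z) + b * (ennreal (ballW z) * H (y + \<rho> *\<^sub>R z)))"
  by (intro nn_integral_cong) (simp only: distrib_left mult_ac)
 also have "\<dots> = a * (\<integral>+ z. ennreal (ballW (z::'a))) + b * (\<integral>+ z. ennreal (ballW z) * H (y + \<rho> *\<^sub>R z))"
  by (subst nn_integral_add) (auto simp: nn_integral_cmult)
 also have "\<dots> = a + b * bavg H y \<rho>" using ballW_nn_integral[of H \<rho> y] \<rho> 1 by simp
 finally show ?thesis .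
qed

lemma bavg_mono: "(\<And>w. H w \<le> H' w) ==> bavg H y \<rho> \<le> bavg H' y \<rho>"
 unfolding bavg_def by (intro divide_right_mono_ennreal nn_integral_mono mult_right_mono) auto

text \<open>Jensen's inequality up to a factor 2, from \<open>u \<le> \<mu> + \<mu>\<^sup>1\<^sup>-\<^sup>r u\<^sup>r\<close>.\<close>

lemma bavg_jensen:
 fixes u :: "'a::euclidean_space => real"
 assumes [measurable]: "u \<in> borel_fun" and u: "\<And>w. 0 \<le> u w" and \<rho>: "0 < \<rho>" and B: "0 < B" and r: "1 \<le> r" and l: "1 \<le> l"
  and le: "bavg (\<lambda>w. ennreal ((u w / B) powr r)) y \<rho> \<le> ennreal l"
 shows "bavg (\<lambda>w. ennreal (u w)) y \<rho> \<le> ennreal (2 * B * l powr (1 / r))"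
proof -
 \<comment> \<open>With \<mu>^r = l the averaged bounds of the two terms of the elementary
   inequality become equal.\<close>
 define \<mu> where "\<mu> = l powr (1 / r)"
 have \<mu>: "\<mu> > 0" using l by (simp add: \<mu>_def)
 have \<mu>r: "\<mu> powr r = l" using l r by (simp add: \<mu>_def powr_powr)
 have pt: "u w \<le> B * \<mu> + B * \<mu> powr (1 - r) * (u w / B) powr r" for w
 proof (cases "u w / B \<le> \<mu>")
  case True
  hence "u w \<le> B * \<mu>" using B by (simp add: field_simps)
  moreover have "0 \<le> B * \<mu> powr (1 - r) * (u w / B) powr r" using B by simp
  ultimately show ?thesis by linarith
 next
  case False
  define v where "v = u w / B"
  have v: "v > \<mu>" using False by (simp add: v_def)
  hence v0: "v > 0" using \<mu> by simp
  have "v = v powr (1 - r) * v powr r" using v0 by (simp add: powr_add[symmetric])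
  also have "\<dots> \<le> \<mu> powr (1 - r) * v powr r" using v \<mu> r by (intro mult_right_mono powr_mono2') auto
  finally have "B * v \<le> B * (\<mu> powr (1 - r) * v powr r)" using B by (intro mult_left_mono) auto
  hence "u w \<le> B * \<mu> powr (1 - r) * v powr r" using B by (simp add: v_def mult.assoc)
  thus ?thesis using B \<mu> unfolding v_def by (simp add: add_increasing)
 qed
 have "bavg (\<lambda>w. ennreal (u w)) y \<rho> \<le> bavg (\<lambda>w. ennreal (B * \<mu>) + ennreal (B * \<mu> powr (1 - r)) * ennreal ((u w / B) powr r)) y \<rho>"
 proof (rule bavg_mono)
  fix w
  have "ennreal (u w) \<le> ennreal (B * \<mu> + B * \<mu> powr (1 - r) * (u w / B) powr r)" by (rule ennreal_leI[OF pt])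
  also have "\<dots> = ennreal (B * \<mu>) + ennreal (B * \<mu> powr (1 - r)) * ennreal ((u w / B) powr r)"
   using B \<mu> by (simp add: ennreal_plus ennreal_mult)
  finally show "ennreal (u w) \<le> ennreal (B * \<mu>) + ennreal (B * \<mu> powr (1 - r)) * ennreal ((u w / B) powr r)" .
 qed
 also have "\<dots> = ennreal (B * \<mu>) + ennreal (B * \<mu> powr (1 - r)) * bavg (\<lambda>w. ennreal ((u w / B) powr r)) y \<rho>"
  by (rule bavg_affine[OF _ \<rho>]) measurable
 also have "\<dots> \<le> ennreal (B * \<mu>) + ennreal (B * \<mu> powr (1 - r)) * ennreal l"
  by (intro add_left_mono mult_left_mono le) simp
 also have "\<dots> = ennreal (B * \<mu> + B * \<mu> powr (1 - r) * l)" using B \<mu> l by (simp add: ennreal_plus ennreal_mult)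
 also have "B * \<mu> powr (1 - r) * l = B * \<mu>" using \<mu> unfolding \<mu>r[symmetric] by (simp add: powr_diff)
 finally show ?thesis by (simp add: \<mu>_def mult.assoc)
qed

text \<open>The size of f enters only through its mean oscillation relative to an auxiliary
  \<open>H1\<close>. This covers two settings: \<open>H1\<close> = (|f| / A)^r1 with c = 0 and i1 =
  1/r1, and, for BMO, \<open>H1\<close> = 0 with i1 = 0. The factor 2 is that of
  \<open>bavg_jensen\<close>.\<close>

lemma scale_bounds_intro:
 fixes i1 r2 :: real
 assumes k: "0 < k" and r2: "1 \<le> r2"
 obtains K where "0 < K" "\<And>(f::real^'n::finite => real) p x A G H1.
  weak_grad_bound k f (\<lambda>w. ennreal (p w)) ==> p \<in> borel_fun ==> (\<And>w. 0 \<le> p w) ==> 0 < A ==> 0 < G ==>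
  H1 \<in> borel_fun ==> (\<And>\<rho>. 0 < \<rho> ==> bavg H1 x \<rho> \<le> 1) ==>
  (\<And>\<rho> y l. 0 < \<rho> ==> 1 \<le> l ==> bavg H1 y \<rho> \<le> ennreal l ==> \<exists>c. bavg (\<lambda>w. ennreal \<bar>f w - c\<bar>) y \<rho> \<le> ennreal (2 * A * l powr i1)) ==>
  (\<And>\<rho>. 0 < \<rho> ==> bavg (\<lambda>w. ennreal ((p w / G) powr r2)) x \<rho> \<le> 1) ==>
  scale_bounds k f x A G i1 (1 / r2) K H1 (\<lambda>w. ennreal ((p w / G) powr r2)) \<and>
  (\<forall>R h. 0 < R \<longrightarrow> norm h \<le> R \<longrightarrow> \<bar>finite_diff k h (Phi k f R) x\<bar> \<le> K * A \<and> \<bar>finite_diff k h (Phi k f R) x\<bar> \<le> K * (R ^ k * G))"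
proof -
 obtain C1 where C1: "0 < C1" "\<And>(f::real^'n => real) c y t. loc_int f ==> 0 < t ==>
  ennreal \<bar>Phi k f (t / 2) y - Phi k f t y\<bar> \<le> ennreal C1 * bavg (\<lambda>w. ennreal \<bar>f w - c\<bar>) y (2 * real k * t)"
  by (rule Phi_diff_osc_bound[OF k]) blast
 obtain C2 where C2: "0 < C2" "\<And>(f::real^'n => real) P y t. weak_grad_bound k f P ==> 0 < t ==>
  ennreal \<bar>Phi k f (t / 2) y - Phi k f t y\<bar> \<le> ennreal (C2 * t ^ k) * bavg P y (2 * real k * t)"
  by (rule Phi_diff_grad_bound[OF k]) blast
 obtain C3 where C3: "0 < C3" "\<And>(f::real^'n => real) c x h R. loc_int f ==> 0 < R ==> norm h \<le> R ==>
  ennreal \<bar>finite_diff k h (Phi k f R) x\<bar> \<le> ennreal C3 * bavg (\<lambda>w. ennreal \<bar>f w - c\<bar>) x (4 * real k * R)"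
  by (rule finite_diff_Phi_osc_bound[OF k]) blast
 obtain C4 where C4: "0 < C4" "\<And>(f::real^'n => real) P x h R. weak_grad_bound k f P ==> 0 < R ==> norm h \<le> R ==>
  ennreal \<bar>finite_diff k h (Phi k f R) x\<bar> \<le> ennreal (C4 * R ^ k) * bavg P x (4 * real k * R)"
  by (rule finite_diff_Phi_grad_bound[OF k]) blast
 define K where "K = 2 * (C1 + C2 + C3 + C4)"
 have K: "K > 0" "2 * C1 \<le> K" "2 * C2 \<le> K" "2 * C3 \<le> K" "2 * C4 \<le> K" using C1(1) C2(1) C3(1) C4(1) by (auto simp: K_def)
 show ?thesis
 proof (rule that[OF K(1)])
  fix f :: "real^'n => real" and p x and A G :: real and H1
  assume wg: "weak_grad_bound k f (\<lambda>w. ennreal (p w))" and pm[measurable]: "p \<in> borel_fun" and p0: "\<And>w. 0 \<le> p w"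
   and A: "0 < A" and G: "0 < G" and H1m[measurable]: "H1 \<in> borel_fun" and H1: "\<And>\<rho>. 0 < \<rho> ==> bavg H1 x \<rho> \<le> 1"
   and osc: "\<And>\<rho> y l. 0 < \<rho> ==> 1 \<le> l ==> bavg H1 y \<rho> \<le> ennreal l ==> \<exists>c. bavg (\<lambda>w. ennreal \<bar>f w - c\<bar>) y \<rho> \<le> ennreal (2 * A * l powr i1)"
   and H2: "\<And>\<rho>. 0 < \<rho> ==> bavg (\<lambda>w. ennreal ((p w / G) powr r2)) x \<rho> \<le> 1"
  have f: "loc_int f" using wg by (simp add: weak_grad_bound_def)
  have bnd: "v \<le> K * X" if "ennreal v \<le> ennreal Ci * b" "b \<le> ennreal (2 * X)" "0 < Ci" "2 * Ci \<le> K" "0 \<le> X" for v Ci X b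
  proof -
   have "ennreal v \<le> ennreal Ci * ennreal (2 * X)" using that by (meson mult_left_mono order_trans zero_le)
   also have "\<dots> = ennreal (Ci * (2 * X))" using that by (simp add: ennreal_mult)
   finally have "v \<le> 2 * Ci * X" using that by (simp add: ennreal_le_iff mult_ac)
   also have "\<dots> \<le> K * X" using that by (intro mult_right_mono) auto
   finally show ?thesis .
  qed
  have 1: "\<bar>Phi k f (t / 2) y - Phi k f t y\<bar> \<le> K * A * l powr i1" "\<bar>Phi k f (t / 2) y - Phi k f t y\<bar> \<le> K * (t ^ k * G) * l powr (1 / r2)"
   if t: "0 < t" and l: "1 \<le> l" "bavg H1 y (2 * real k * t) \<le> ennreal l" "bavg (\<lambda>w. ennreal ((p w / G) powr r2)) y (2 * real k * t) \<le> ennreal l" for t y l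
  proof -
   have kt: "0 < 2 * real k * t" using k t by simp
   obtain c where "bavg (\<lambda>w. ennreal \<bar>f w - c\<bar>) y (2 * real k * t) \<le> ennreal (2 * (A * l powr i1))"
    using osc[OF kt l(1,2)] by (auto simp: mult.assoc)
   from bnd[OF C1(2)[OF f t] this C1(1) K(2)] A show "\<bar>Phi k f (t / 2) y - Phi k f t y\<bar> \<le> K * A * l powr i1"
    by (simp add: mult.assoc)
   have 2: "bavg (\<lambda>w. ennreal (p w)) y (2 * real k * t) \<le> ennreal (2 * (G * l powr (1 / r2)))"
    using bavg_jensen[OF pm p0 kt G r2 l(1,3)] by (simp add: mult.assoc)
   have "ennreal \<bar>Phi k f (t / 2) y - Phi k f t y\<bar> \<le> ennreal C2 * (ennreal (t ^ k) * bavg (\<lambda>w. ennreal (p w)) y (2 * real k * t))"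
    using C2(2)[OF wg t, of y] C2(1) t by (simp add: ennreal_mult mult.assoc)
   moreover have "ennreal (t ^ k) * bavg (\<lambda>w. ennreal (p w)) y (2 * real k * t) \<le> ennreal (t ^ k) * ennreal (2 * (G * l powr (1 / r2)))"
    by (intro mult_left_mono 2) simp
   hence "ennreal (t ^ k) * bavg (\<lambda>w. ennreal (p w)) y (2 * real k * t) \<le> ennreal (2 * (t ^ k * (G * l powr (1 / r2))))"
    using t G by (simp add: ennreal_mult[symmetric] mult_ac)
   ultimately show "\<bar>Phi k f (t / 2) y - Phi k f t y\<bar> \<le> K * (t ^ k * G) * l powr (1 / r2)"
    using bnd[OF _ _ C2(1) K(3), of "\<bar>Phi k f (t / 2) y - Phi k f t y\<bar>" _ "t ^ k * (G * l powr (1 / r2))"] t G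
    by (simp add: mult.assoc)
  qed
  have 2: "\<bar>finite_diff k h (Phi k f R) x\<bar> \<le> K * A" "\<bar>finite_diff k h (Phi k f R) x\<bar> \<le> K * (R ^ k * G)"
   if R: "0 < R" and h: "norm h \<le> R" for R h
  proof -
   have kR: "0 < 4 * real k * R" using k R by simp
   have one: "(1::ennreal) = ennreal 1" by simp
   obtain c where "bavg (\<lambda>w. ennreal \<bar>f w - c\<bar>) x (4 * real k * R) \<le> ennreal (2 * A)"
    using osc[OF kR, of 1 x] H1[OF kR] by auto
   from bnd[OF C3(2)[OF f R h] this C3(1) K(4)] A show "\<bar>finite_diff k h (Phi k f R) x\<bar> \<le> K * A" by simp
   have 2: "bavg (\<lambda>w. ennreal (p w)) x (4 * real k * R) \<le> ennreal (2 * G)"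
    using bavg_jensen[OF pm p0 kR G r2, of 1 x] H2[OF kR] by simp
   have "ennreal \<bar>finite_diff k h (Phi k f R) x\<bar> \<le> ennreal C4 * (ennreal (R ^ k) * bavg (\<lambda>w. ennreal (p w)) x (4 * real k * R))"
    using C4(2)[OF wg R h, of x] C4(1) R by (simp add: ennreal_mult mult.assoc)
   moreover have "ennreal (R ^ k) * bavg (\<lambda>w. ennreal (p w)) x (4 * real k * R) \<le> ennreal (R ^ k) * ennreal (2 * G)"
    by (intro mult_left_mono 2) simp
   hence "ennreal (R ^ k) * bavg (\<lambda>w. ennreal (p w)) x (4 * real k * R) \<le> ennreal (2 * (R ^ k * G))"
    using R G by (simp add: ennreal_mult[symmetric] mult_ac)
   ultimately show "\<bar>finite_diff k h (Phi k f R) x\<bar> \<le> K * (R ^ k * G)"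
    using bnd[OF _ _ C4(1) K(5), of "\<bar>finite_diff k h (Phi k f R) x\<bar>" _ "R ^ k * G"] R G by simp
  qed
  show "scale_bounds k f x A G i1 (1 / r2) K H1 (\<lambda>w. ennreal ((p w / G) powr r2)) \<and>
  (\<forall>R h. 0 < R \<longrightarrow> norm h \<le> R \<longrightarrow> \<bar>finite_diff k h (Phi k f R) x\<bar> \<le> K * A \<and> \<bar>finite_diff k h (Phi k f R) x\<bar> \<le> K * (R ^ k * G))"
   unfolding scale_bounds_def using H1 H2 1 2 by (auto intro: order_trans)
 qed
qed

lemma frac_diff_pointwise_Lp:
 fixes s q r1 r2 :: real
 assumes k: "0 < k" and s: "0 < s" "s < 1" and q: "1 \<le> q" and r: "1 \<le> r1" "1 \<le> r2"
  and sub: "real CARD('n) * ((1 - s) / r1 + s / r2 - 1 / q) < s * real k"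
 obtains C where "0 < C" "\<And>(f::real^'n::finite => real) p x A G.
   weak_grad_bound k f (\<lambda>w. ennreal (p w)) ==> p \<in> borel_fun ==> (\<And>w. 0 \<le> p w) ==> good_point k f x ==> 0 < A ==> 0 < G ==>
   (\<And>\<rho>. 0 < \<rho> ==> bavg (\<lambda>w. ennreal ((\<bar>f w\<bar> / A) powr r1)) x \<rho> \<le> 1) ==>
   (\<And>\<rho>. 0 < \<rho> ==> bavg (\<lambda>w. ennreal ((p w / G) powr r2)) x \<rho> \<le> 1) ==>
   frac_diff s k q f x \<le> ennreal (C * (A powr (1 - s) * G powr s))"
proof -
 obtain K where K: "0 < K" "\<And>(f::real^'n::finite => real) p x A G H1.
  weak_grad_bound k f (\<lambda>w. ennreal (p w)) ==> p \<in> borel_fun ==> (\<And>w. 0 \<le> p w) ==> 0 < A ==> 0 < G ==>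
  H1 \<in> borel_fun ==> (\<And>\<rho>. 0 < \<rho> ==> bavg H1 x \<rho> \<le> 1) ==>
  (\<And>\<rho> y l. 0 < \<rho> ==> 1 \<le> l ==> bavg H1 y \<rho> \<le> ennreal l ==> \<exists>c. bavg (\<lambda>w. ennreal \<bar>f w - c\<bar>) y \<rho> \<le> ennreal (2 * A * l powr (1 / r1))) ==>
  (\<And>\<rho>. 0 < \<rho> ==> bavg (\<lambda>w. ennreal ((p w / G) powr r2)) x \<rho> \<le> 1) ==>
  scale_bounds k f x A G (1 / r1) (1 / r2) K H1 (\<lambda>w. ennreal ((p w / G) powr r2)) \<and>
  (\<forall>R h. 0 < R \<longrightarrow> norm h \<le> R \<longrightarrow> \<bar>finite_diff k h (Phi k f R) x\<bar> \<le> K * A \<and> \<bar>finite_diff k h (Phi k f R) x\<bar> \<le> K * (R ^ k * G))"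
  by (rule scale_bounds_intro[OF k r(2)]) blast
 have i: "0 \<le> 1 / r1" "0 \<le> 1 / r2" using r by auto
 have sub': "real CARD('n) * ((1 - s) * (1 / r1) + s * (1 / r2) - 1 / q) < s * real k" using sub by simp
 obtain C where C: "0 < C" "\<And>(f::real^'n::finite => real) x A G H1 H2.
   loc_int f ==> good_point k f x ==> 0 < A ==> 0 < G ==>
   scale_bounds k f x A G (1 / r1) (1 / r2) K H1 H2 ==>
   (\<And>R h. 0 < R ==> norm h \<le> R ==> \<bar>finite_diff k h (Phi k f R) x\<bar> \<le> K * A \<and> \<bar>finite_diff k h (Phi k f R) x\<bar> \<le> K * (R ^ k * G)) ==>
   frac_diff s k q f x \<le> ennreal (C * (A powr (1 - s) * G powr s))"
  by (rule frac_diff_pointwise[OF k s q i K(1) sub']) blast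
 show ?thesis
 proof (rule that[OF C(1)])
  fix f :: "real^'n => real" and p x and A G :: real
  assume wg: "weak_grad_bound k f (\<lambda>w. ennreal (p w))" and pm: "p \<in> borel_fun" and p0: "\<And>w. 0 \<le> p w"
   and gx: "good_point k f x" and A: "0 < A" and G: "0 < G"
   and H1: "\<And>\<rho>. 0 < \<rho> ==> bavg (\<lambda>w. ennreal ((\<bar>f w\<bar> / A) powr r1)) x \<rho> \<le> 1"
   and H2: "\<And>\<rho>. 0 < \<rho> ==> bavg (\<lambda>w. ennreal ((p w / G) powr r2)) x \<rho> \<le> 1"
  have f: "loc_int f" using wg by (simp add: weak_grad_bound_def)
  note loc_int_measurable[OF f, measurable]
  have H1m: "(\<lambda>w. ennreal ((\<bar>f w\<bar> / A) powr r1)) \<in> borel_fun" by measurable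
  have af: "(\<lambda>w. \<bar>f w\<bar>) \<in> borel_fun" by measurable
  have osc: "\<exists>c. bavg (\<lambda>w. ennreal \<bar>f w - c\<bar>) y \<rho> \<le> ennreal (2 * A * l powr (1 / r1))"
   if "0 < \<rho>" "1 \<le> l" "bavg (\<lambda>w. ennreal ((\<bar>f w\<bar> / A) powr r1)) y \<rho> \<le> ennreal l" for \<rho> y l
   using bavg_jensen[OF af _ that(1) A r(1) that(2,3)] by (intro exI[of _ 0]) simp
  have "scale_bounds k f x A G (1 / r1) (1 / r2) K (\<lambda>w. ennreal ((\<bar>f w\<bar> / A) powr r1)) (\<lambda>w. ennreal ((p w / G) powr r2)) \<and>
   (\<forall>R h. 0 < R \<longrightarrow> norm h \<le> R \<longrightarrow> \<bar>finite_diff k h (Phi k f R) x\<bar> \<le> K * A \<and> \<bar>finite_diff k h (Phi k f R) x\<bar> \<le> K * (R ^ k * G))"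
   by (rule K(2)[OF wg pm p0 A G H1m H1 osc H2])
  thus "frac_diff s k q f x \<le> ennreal (C * (A powr (1 - s) * G powr s))"
   using C(2)[OF f gx A G] by blast
 qed
qed

text \<open>In BMO the oscillation is bounded alike on all balls, not only on those around x, so
  passing from x to y costs nothing: i1 = 0, which corresponds to r1 = infinity.\<close>

lemma frac_diff_pointwise_BMO:
 fixes s q r2 :: real
 assumes k: "0 < k" and s: "0 < s" "s < 1" and q: "1 \<le> q" and r: "1 \<le> r2"
  and sub: "real CARD('n) * (s / r2 - 1 / q) < s * real k"
 obtains C where "0 < C" "\<And>(f::real^'n::finite => real) p x A G.
   weak_grad_bound k f (\<lambda>w. ennreal (p w)) ==> p \<in> borel_fun ==> (\<And>w. 0 \<le> p w) ==> good_point k f x ==> 0 < A ==> 0 < G ==>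
   (\<And>\<rho> y. 0 < \<rho> ==> \<exists>c. bavg (\<lambda>w. ennreal \<bar>f w - c\<bar>) y \<rho> \<le> ennreal A) ==>
   (\<And>\<rho>. 0 < \<rho> ==> bavg (\<lambda>w. ennreal ((p w / G) powr r2)) x \<rho> \<le> 1) ==>
   frac_diff s k q f x \<le> ennreal (C * (A powr (1 - s) * G powr s))"
proof -
 obtain K where K: "0 < K" "\<And>(f::real^'n::finite => real) p x A G H1.
  weak_grad_bound k f (\<lambda>w. ennreal (p w)) ==> p \<in> borel_fun ==> (\<And>w. 0 \<le> p w) ==> 0 < A ==> 0 < G ==>
  H1 \<in> borel_fun ==> (\<And>\<rho>. 0 < \<rho> ==> bavg H1 x \<rho> \<le> 1) ==>
  (\<And>\<rho> y l. 0 < \<rho> ==> 1 \<le> l ==> bavg H1 y \<rho> \<le> ennreal l ==> \<exists>c. bavg (\<lambda>w. ennreal \<bar>f w - c\<bar>) y \<rho> \<le> ennreal (2 * A * l powr 0)) ==>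
  (\<And>\<rho>. 0 < \<rho> ==> bavg (\<lambda>w. ennreal ((p w / G) powr r2)) x \<rho> \<le> 1) ==>
  scale_bounds k f x A G 0 (1 / r2) K H1 (\<lambda>w. ennreal ((p w / G) powr r2)) \<and>
  (\<forall>R h. 0 < R \<longrightarrow> norm h \<le> R \<longrightarrow> \<bar>finite_diff k h (Phi k f R) x\<bar> \<le> K * A \<and> \<bar>finite_diff k h (Phi k f R) x\<bar> \<le> K * (R ^ k * G))"
  by (rule scale_bounds_intro[OF k r, of 0]) blast
 have i: "0 \<le> (0::real)" "0 \<le> 1 / r2" using r by auto
 have sub': "real CARD('n) * ((1 - s) * 0 + s * (1 / r2) - 1 / q) < s * real k" using sub by simp
 obtain C where C: "0 < C" "\<And>(f::real^'n::finite => real) x A G H1 H2.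
   loc_int f ==> good_point k f x ==> 0 < A ==> 0 < G ==>
   scale_bounds k f x A G 0 (1 / r2) K H1 H2 ==>
   (\<And>R h. 0 < R ==> norm h \<le> R ==> \<bar>finite_diff k h (Phi k f R) x\<bar> \<le> K * A \<and> \<bar>finite_diff k h (Phi k f R) x\<bar> \<le> K * (R ^ k * G)) ==>
   frac_diff s k q f x \<le> ennreal (C * (A powr (1 - s) * G powr s))"
  by (rule frac_diff_pointwise[OF k s q i K(1) sub']) blast
 show ?thesis
 proof (rule that[OF C(1)])
  fix f :: "real^'n => real" and p x and A G :: real
  assume wg: "weak_grad_bound k f (\<lambda>w. ennreal (p w))" and pm: "p \<in> borel_fun" and p0: "\<And>w. 0 \<le> p w"
   and gx: "good_point k f x" and A: "0 < A" and G: "0 < G"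
   and osc: "\<And>\<rho> y. 0 < \<rho> ==> \<exists>c. bavg (\<lambda>w. ennreal \<bar>f w - c\<bar>) y \<rho> \<le> ennreal A"
   and H2: "\<And>\<rho>. 0 < \<rho> ==> bavg (\<lambda>w. ennreal ((p w / G) powr r2)) x \<rho> \<le> 1"
  have f: "loc_int f" using wg by (simp add: weak_grad_bound_def)
  have osc': "\<exists>c. bavg (\<lambda>w. ennreal \<bar>f w - c\<bar>) y \<rho> \<le> ennreal (2 * A * l powr 0)" if \<rho>: "0 < \<rho>" and l: "1 \<le> l" for \<rho> y and l :: real
  proof -
   obtain c where "bavg (\<lambda>w. ennreal \<bar>f w - c\<bar>) y \<rho> \<le> ennreal A" using osc[OF \<rho>] by blast
   also have "ennreal A \<le> ennreal (2 * A * l powr 0)" using A l by (intro ennreal_leI) simp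
   finally show ?thesis by blast
  qed
  have "scale_bounds k f x A G 0 (1 / r2) K (\<lambda>_. 0) (\<lambda>w. ennreal ((p w / G) powr r2)) \<and>
   (\<forall>R h. 0 < R \<longrightarrow> norm h \<le> R \<longrightarrow> \<bar>finite_diff k h (Phi k f R) x\<bar> \<le> K * A \<and> \<bar>finite_diff k h (Phi k f R) x\<bar> \<le> K * (R ^ k * G))"
   by (rule K(2)[OF wg pm p0 A G _ _ osc' H2]) (auto simp: bavg_def)
  thus "frac_diff s k q f x \<le> ennreal (C * (A powr (1 - s) * G powr s))"
   using C(2)[OF f gx A G] by blast
 qed
qed

subsection \<open>Borel representatives\<close>

lemma L0_borel_rep:
 assumes "f \<in> L0"
 obtains f' where "f' \<in> borel_fun" "AE x in lborel. f x = f' x"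
 using completion_ex_borel_measurable_real[of f lborel] assms unfolding L0_def by auto

lemma L0_cong_AE: "f \<in> L0 ==> AE x in lborel. f x = g x ==> g \<in> L0"
 unfolding L0_def by (rule borel_measurable_AE) (auto simp: AE_completion_iff)

lemma borel_imp_L0: "f \<in> borel_fun ==> f \<in> L0"
 unfolding L0_def by (rule measurable_completion) simp

lemma L1_locD: "f \<in> L1_loc ==> f \<in> L0"
 by (simp add: L1_loc_def)

lemma nn_integral_bounded_rep:
 fixes f f' :: "real ^ 'n::finite => real"
 assumes "AE x in lborel. f x = f' x"
 shows "(\<integral>+ x. ennreal \<bar>f x\<bar> * indicator B x) = (\<integral>+ x. ennreal \<bar>f' x\<bar> * indicator B x)"
 by (rule nn_integral_cong_AE) (use assms in \<open>auto elim: eventually_mono\<close>)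

lemma L1_loc_iff_loc_int:
 fixes f f' :: "real ^ 'n::finite => real"
 assumes f: "f \<in> L0" and f': "f' \<in> borel_fun" and ae: "AE x in lborel. f x = f' x"
 shows "f \<in> L1_loc \<longleftrightarrow> loc_int f'"
proof
 assume L: "f \<in> L1_loc"
 have "(\<integral>+ x. ennreal \<bar>f' x\<bar> * indicator (ball 0 r) x) < \<infinity>" for r
 proof -
  have "set_integrable lebesgue (cball 0 r) f" using L by (simp add: L1_loc_def)
  hence "(\<integral>\<^sup>+x. ennreal (norm (indicator (cball 0 r) x *\<^sub>R f x)) \<partial>lebesgue) < \<infinity>"
   unfolding set_integrable_def integrable_iff_bounded by blast
  hence 1: "(\<integral>+ x. ennreal (norm (indicator (cball 0 r) x *\<^sub>R f x))) < \<infinity>"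
   by (simp only: nn_integral_completion)
  have "(\<integral>+ x. ennreal \<bar>f' x\<bar> * indicator (ball 0 r) x) = (\<integral>+ x. ennreal \<bar>f x\<bar> * indicator (ball 0 r) x)"
   by (rule nn_integral_bounded_rep[OF ae, symmetric])
  also have "\<dots> \<le> (\<integral>+ x. ennreal (norm (indicator (cball 0 r) x *\<^sub>R f x)))"
   by (intro nn_integral_mono) (auto simp: indicator_def)
  finally show ?thesis using 1 by (rule le_less_trans)
 qed
 thus "loc_int f'" using f' by (simp add: loc_int_def)
next
 assume l: "loc_int f'"
 have "set_integrable lebesgue K f" if K: "compact K" for K
 proof -
  have [measurable]: "f \<in> borel_measurable lebesgue" using f by (simp add: L0_def)
  have [measurable]: "K \<in> sets lebesgue" using K by (simp add: lmeasurable_compact fmeasurableD)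
  have "(\<integral>\<^sup>+x. ennreal (norm (indicator K x *\<^sub>R f x)) \<partial>lebesgue) = (\<integral>+ x. ennreal (norm (indicator K x *\<^sub>R f x)))"
   by (rule nn_integral_completion)
  also have "\<dots> = (\<integral>+ x. ennreal \<bar>f x\<bar> * indicator K x)"
   by (intro nn_integral_cong) (auto simp: indicator_def)
  also have "\<dots> = (\<integral>+ x. ennreal \<bar>f' x\<bar> * indicator K x)" by (rule nn_integral_bounded_rep[OF ae])
  also have "\<dots> < \<infinity>" by (rule loc_int_bounded[OF l compact_imp_bounded[OF K]])
  finally show ?thesis unfolding set_integrable_def integrable_iff_bounded by simp
 qed
 thus "f \<in> L1_loc" using f by (simp add: L1_loc_def)
qed

lemma integral_rep:
 fixes f f' \<phi> :: "real ^ 'n::finite => real"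
 assumes "f \<in> L0" and [measurable]: "f' \<in> borel_fun" "\<phi> \<in> borel_fun" and ae: "AE x in lborel. f x = f' x"
 shows "(\<integral>x. f x * \<phi> x \<partial>lebesgue) = (\<integral>x. f' x * \<phi> x \<partial>lborel)"
proof -
 have [measurable]: "f \<in> borel_measurable lebesgue" "f' \<in> borel_measurable lebesgue" "\<phi> \<in> borel_measurable lebesgue"
  using assms by (auto simp: L0_def intro: measurable_completion)
 have "AE x in lebesgue. f x = f' x" using ae by (simp add: AE_completion_iff)
 hence "(\<integral>x. f x * \<phi> x \<partial>lebesgue) = (\<integral>x. f' x * \<phi> x \<partial>lebesgue)"
  by (intro integral_cong_AE) (auto elim: eventually_mono)
 also have "\<dots> = (\<integral>x. f' x * \<phi> x \<partial>lborel)" by (rule integral_completion) measurable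
 finally show ?thesis .
qed

lemma smooth_foldr_measurable:
 assumes "smooth \<phi>" shows "foldr partial_deriv is \<phi> \<in> borel_fun"
 using assms unfolding smooth_def
 by (intro borel_measurable_continuous_onI continuous_at_imp_continuous_on ballI differentiable_imp_continuous_within) auto

lemma smooth_multi_deriv_measurable: "smooth \<phi> ==> multi_deriv \<alpha> \<phi> \<in> borel_fun"
 unfolding multi_deriv_def by (rule smooth_foldr_measurable)

lemma smooth_measurable: "smooth \<phi> ==> \<phi> \<in> borel_fun"
 using smooth_foldr_measurable[of \<phi> "[]"] by simp

lemma weak_grad_bound_rep:
 fixes f f' p :: "real ^ 'n::finite => real"
 assumes f: "f \<in> L1_loc" and f': "f' \<in> borel_fun" "AE x in lborel. f x = f' x"
  and w: "\<And>\<alpha>. \<alpha> \<in> multi_indices k ==> has_weak_deriv f \<alpha> (w \<alpha>)"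
  and p: "p \<in> borel_fun" and le: "\<And>\<alpha>. \<alpha> \<in> multi_indices k ==> AE x in lborel. \<bar>w \<alpha> x\<bar> \<le> p x"
 shows "weak_grad_bound k f' (\<lambda>x. ennreal (p x))"
 unfolding weak_grad_bound_def
proof (intro conjI ballI)
 show "loc_int f'" using L1_loc_iff_loc_int[OF L1_locD[OF f] f'] f by simp
 show "(\<lambda>x. ennreal (p x)) \<in> borel_fun" using p by simp
 fix \<beta> :: "'n => nat" assume \<beta>: "\<beta> \<in> multi_indices k"
 have wL: "w \<beta> \<in> L1_loc" using w[OF \<beta>] by (simp add: has_weak_deriv_def)
 obtain g where g: "g \<in> borel_fun" "AE x in lborel. w \<beta> x = g x" using L0_borel_rep[OF L1_locD[OF wL]] by blast
 have "loc_int g" using L1_loc_iff_loc_int[OF L1_locD[OF wL] g] wL by simp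
 moreover have "AE x in lborel. ennreal \<bar>g x\<bar> \<le> ennreal (p x)"
  using g(2) le[OF \<beta>] by eventually_elim (auto intro: ennreal_leI)
 moreover have "(\<integral>x. f' x * multi_deriv \<beta> \<phi> x \<partial>lborel) = (-1) ^ k * (\<integral>x. g x * \<phi> x \<partial>lborel)" if \<phi>: "test_function \<phi>" for \<phi>
 proof -
  have sm: "smooth \<phi>" using \<phi> by (simp add: test_function_def)
  have "(\<integral>x. f' x * multi_deriv \<beta> \<phi> x \<partial>lborel) = (\<integral>x. f x * multi_deriv \<beta> \<phi> x \<partial>lebesgue)"
   by (rule integral_rep[symmetric, OF L1_locD[OF f] f'(1) smooth_multi_deriv_measurable[OF sm] f'(2)])
  also have "\<dots> = (-1) ^ k * (\<integral>x. w \<beta> x * \<phi> x \<partial>lebesgue)"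
   using w[OF \<beta>] \<phi> \<beta> by (simp add: has_weak_deriv_def multi_indices_def)
  also have "(\<integral>x. w \<beta> x * \<phi> x \<partial>lebesgue) = (\<integral>x. g x * \<phi> x \<partial>lborel)"
   by (rule integral_rep[OF L1_locD[OF wL] g(1) smooth_measurable[OF sm] g(2)])
  finally show ?thesis .
 qed
 ultimately show "\<exists>g. loc_int g \<and> (AE x in lborel. ennreal \<bar>g x\<bar> \<le> ennreal (p x)) \<and>
   (\<forall>\<phi>. test_function \<phi> \<longrightarrow> (\<integral>x. f' x * multi_deriv \<beta> \<phi> x \<partial>lborel) = (-1) ^ k * (\<integral>x. g x * \<phi> x \<partial>lborel))" by blast
qed

text \<open>Mollifying the difference of two weak derivatives gives zero at every scale.\<close>

lemma weak_deriv_unique: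
 fixes f :: "real ^ 'n::finite => real"
 assumes g1: "has_weak_deriv f \<alpha> g1" and g2: "has_weak_deriv f \<alpha> g2"
 shows "AE x in lborel. g1 x = g2 x"
proof -
 have L: "g1 \<in> L1_loc" "g2 \<in> L1_loc" using g1 g2 by (auto simp: has_weak_deriv_def)
 obtain h1 where h1: "h1 \<in> borel_fun" "AE x in lborel. g1 x = h1 x" using L0_borel_rep[OF L1_locD[OF L(1)]] by blast
 obtain h2 where h2: "h2 \<in> borel_fun" "AE x in lborel. g2 x = h2 x" using L0_borel_rep[OF L1_locD[OF L(2)]] by blast
 have l: "loc_int h1" "loc_int h2"
  using L1_loc_iff_loc_int[OF L1_locD[OF L(1)] h1] L1_loc_iff_loc_int[OF L1_locD[OF L(2)] h2] L by auto
 have eq: "(\<integral>x. h1 x * \<phi> x \<partial>lborel) = (\<integral>x. h2 x * \<phi> x \<partial>lborel)" if \<phi>: "test_function \<phi>" for \<phi>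
 proof -
  have \<phi>m: "\<phi> \<in> borel_fun" using \<phi> smooth_measurable by (auto simp: test_function_def)
  have "(-1) ^ (\<Sum>i\<in>UNIV. \<alpha> i) * (\<integral>x. g1 x * \<phi> x \<partial>lebesgue) = (-1) ^ (\<Sum>i\<in>UNIV. \<alpha> i) * (\<integral>x. g2 x * \<phi> x \<partial>lebesgue)"
   using g1 g2 \<phi> unfolding has_weak_deriv_def by metis
  hence "(\<integral>x. g1 x * \<phi> x \<partial>lebesgue) = (\<integral>x. g2 x * \<phi> x \<partial>lebesgue)" by simp
  thus ?thesis using integral_rep[OF L1_locD[OF L(1)] h1(1) \<phi>m h1(2)] integral_rep[OF L1_locD[OF L(2)] h2(1) \<phi>m h2(2)] by simp
 qed
 have sm: "smear eta h1 \<epsilon> y = smear eta h2 \<epsilon> y" if \<epsilon>: "0 < \<epsilon>" for \<epsilon> y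
  using eq[OF test_function_bump[OF \<epsilon>, of y "\<lambda>_. 0"]]
  unfolding eta_smear[OF l(1) \<epsilon>] eta_smear[OF l(2) \<epsilon>] bump_translate[of \<epsilon> y] by simp
 have [measurable]: "h1 \<in> borel_fun" "h2 \<in> borel_fun" using h1 h2 by auto
 have [measurable]: "(eta :: real ^ 'n => real) \<in> borel_fun" using avg_kernelD(1)[OF avg_kernel_eta] .
 have zero: "(\<integral>+ x. ennreal \<bar>h1 x - h2 x\<bar> * indicator (ball 0 r) x) = 0" for r
 proof -
  have small: "(\<integral>+ x. ennreal \<bar>h1 x - h2 x\<bar> * indicator (ball 0 r) x) \<le> ennreal e" if e: "0 < e" for e
  proof -
   obtain d1 where d1: "d1 > 0" "\<And>t. 0 < t ==> t < d1 ==> (\<integral>+ x. ennreal \<bar>smear eta h1 t x - h1 x\<bar> * indicator (ball 0 r) x) \<le> ennreal (e / 2)"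
    using smear_L1_loc[OF avg_kernel_eta l(1), of "e / 2" r] e by auto
   obtain d2 where d2: "d2 > 0" "\<And>t. 0 < t ==> t < d2 ==> (\<integral>+ x. ennreal \<bar>smear eta h2 t x - h2 x\<bar> * indicator (ball 0 r) x) \<le> ennreal (e / 2)"
    using smear_L1_loc[OF avg_kernel_eta l(2), of "e / 2" r] e by auto
   define t where "t = min d1 d2 / 2"
   have t: "0 < t" "t < d1" "t < d2" using d1(1) d2(1) by (auto simp: t_def)
   have "(\<integral>+ x. ennreal \<bar>h1 x - h2 x\<bar> * indicator (ball 0 r) x)
    \<le> (\<integral>+ x. ennreal \<bar>smear eta h1 t x - h1 x\<bar> * indicator (ball 0 r) x + ennreal \<bar>smear eta h2 t x - h2 x\<bar> * indicator (ball 0 r) x)"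
   proof (intro nn_integral_mono)
    fix x :: "real^'n"
    have "\<bar>h1 x - h2 x\<bar> \<le> \<bar>smear eta h1 t x - h1 x\<bar> + \<bar>smear eta h2 t x - h2 x\<bar>" using sm[OF t(1), of x] by linarith
    hence "ennreal \<bar>h1 x - h2 x\<bar> \<le> ennreal \<bar>smear eta h1 t x - h1 x\<bar> + ennreal \<bar>smear eta h2 t x - h2 x\<bar>"
     by (simp add: ennreal_leI flip: ennreal_plus)
    thus "ennreal \<bar>h1 x - h2 x\<bar> * indicator (ball 0 r) x
     \<le> ennreal \<bar>smear eta h1 t x - h1 x\<bar> * indicator (ball 0 r) x + ennreal \<bar>smear eta h2 t x - h2 x\<bar> * indicator (ball 0 r) x"
     by (cases "x \<in> ball 0 r") auto
   qed
   also have "\<dots> = (\<integral>+ x. ennreal \<bar>smear eta h1 t x - h1 x\<bar> * indicator (ball 0 r) x) + (\<integral>+ x. ennreal \<bar>smear eta h2 t x - h2 x\<bar> * indicator (ball 0 r) x)"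
    by (rule nn_integral_add) auto
   also have "\<dots> \<le> ennreal (e / 2) + ennreal (e / 2)" by (intro add_mono d1 d2 t)
   also have "\<dots> = ennreal e" using e by (simp flip: ennreal_plus)
   finally show ?thesis .
  qed
  have "(\<integral>+ x. ennreal \<bar>h1 x - h2 x\<bar> * indicator (ball 0 r) x) \<le> 0"
  proof (rule ennreal_le_epsilon)
   fix e :: real assume "0 < e"
   from small[OF this] show "(\<integral>+ x. ennreal \<bar>h1 x - h2 x\<bar> * indicator (ball 0 r) x) \<le> 0 + ennreal e" by simp
  qed
  thus ?thesis by simp
 qed
 have "AE x in lborel. x \<in> ball 0 (real N) \<longrightarrow> h1 x = h2 x" for N
 proof -
  have "AE x in lborel. ennreal \<bar>h1 x - h2 x\<bar> * indicator (ball 0 (real N)) x = 0"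
   using zero[of "real N"] by (subst (asm) nn_integral_0_iff_AE) auto
  thus ?thesis by eventually_elim auto
 qed
 hence "AE x in lborel. \<forall>N. x \<in> ball 0 (real N) \<longrightarrow> h1 x = h2 x" unfolding AE_all_countable by blast
 thus ?thesis using h1(2) h2(2)
 proof eventually_elim
  case (elim x)
  obtain N where "norm x < real N" using reals_Archimedean2 by blast
  thus ?case using elim by auto
 qed
qed

text \<open>For j \<ge> 1 and any x, preimages of null sets under h to x + j h are null, so the
  values agree for almost every h. The term j = 0 restricts x to the points where f and f'
  agree.\<close>

lemma frac_diff_cong_AE:
 fixes f f' :: "real ^ 'n::finite => real"
 assumes ae: "AE x in lborel. f x = f' x"
 shows "AE x in lborel. frac_diff s k q f x = frac_diff s k q f' x"
 using ae
proof eventually_elim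
 case (elim x)
 have "AE h in lborel. f (x + real j *\<^sub>R h) = f' (x + real j *\<^sub>R h)" for j
 proof (cases "j = 0")
  case False
  thus ?thesis using AE_lborel_affine[OF _ ae, of "real j" x] by simp
 qed (simp add: elim)
 hence "AE h in lborel. \<forall>j. f (x + real j *\<^sub>R h) = f' (x + real j *\<^sub>R h)" unfolding AE_all_countable by blast
 hence "AE h in lborel. finite_diff k h f x = finite_diff k h f' x"
  by eventually_elim (simp add: finite_diff_def)
 thus ?case unfolding frac_diff_def nn_integral_completion
  by (intro arg_cong[where f="\<lambda>z. ennreal_powr z _"] nn_integral_cong_AE) (auto elim: eventually_mono)
qed

lemma ennreal_powr_measurable[measurable]:
 assumes [measurable]: "F \<in> borel_measurable M" shows "(\<lambda>x. ennreal_powr (F x) r) \<in> borel_measurable M"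
 unfolding ennreal_powr_def by measurable

lemma frac_diff_measurable:
 fixes f :: "real ^ 'n::finite => real"
 assumes [measurable]: "f \<in> borel_fun" shows "frac_diff s k q f \<in> borel_fun"
 unfolding frac_diff_def[abs_def] nn_integral_completion finite_diff_def by measurable

lemma frac_diff_L0:
 assumes "f \<in> L0" shows "(\<lambda>x. enn2real (frac_diff s k q f x)) \<in> L0"
proof -
 obtain f' where f': "f' \<in> borel_fun" "AE x in lborel. f x = f' x" using L0_borel_rep[OF assms] by blast
 note frac_diff_measurable[OF f'(1), measurable]
 have "(\<lambda>x. enn2real (frac_diff s k q f' x)) \<in> L0" by (rule borel_imp_L0) measurable
 moreover have "AE x in lborel. enn2real (frac_diff s k q f' x) = enn2real (frac_diff s k q f x)"
  using frac_diff_cong_AE[OF f'(2), of s k q] by eventually_elim simp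
 ultimately show ?thesis by (rule L0_cong_AE)
qed

subsection \<open>Function norms\<close>

lemma bfn_dest:
 assumes "banach_function_norm_over \<S> N"
 shows bfn_scale: "\<And>c f. f \<in> L0 ==> N (\<lambda>x. c * f x) = ennreal \<bar>c\<bar> * N f"
  and bfn_triangle: "\<And>f g. f \<in> L0 ==> g \<in> L0 ==> N (\<lambda>x. f x + g x) \<le> N f + N g"
  and bfn_mono: "\<And>f g. f \<in> L0 ==> g \<in> L0 ==> AE x in lborel. \<bar>g x\<bar> \<le> \<bar>f x\<bar> ==> N g \<le> N f"
 using assms unfolding banach_function_norm_over_def is_banach_norm_def AE_completion_iff by auto

lemma ball_bfs_imp_bfn: "ball_banach_function_space N ==> banach_function_norm_over {ball x r |x r. 0 < r} N"
 by (simp add: ball_banach_function_space_def)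

lemma bfs_imp_ball_bfs: "banach_function_space N ==> ball_banach_function_space N"
proof -
 assume N: "banach_function_space N"
 have "{ball x r |x r. 0 < r} \<subseteq> lmeasurable" by (auto simp: lmeasurable_ball)
 thus ?thesis using N unfolding banach_function_space_def ball_banach_function_space_def banach_function_norm_over_def by blast
qed

lemma space_ofD: "f \<in> space_of N ==> f \<in> L0" "f \<in> space_of N ==> N f < \<infinity>"
 by (auto simp: space_of_def)

lemma space_of_real:
 assumes "f \<in> space_of N" obtains u where "0 \<le> u" "N f = ennreal u"
 using space_ofD(2)[OF assms] by (cases "N f") auto

lemma bfn_abs_sum:
 assumes N: "banach_function_norm_over \<S> N" and I: "finite I" and g: "\<And>i. i \<in> I ==> g i \<in> space_of N"
 shows "(\<lambda>x. \<Sum>i\<in>I. \<bar>g i x\<bar>) \<in> space_of N"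
 using I g
proof (induction I rule: finite_induct)
 case empty
 have z: "(\<lambda>_. 0) \<in> L0" by (rule borel_imp_L0) simp
 have "N (\<lambda>x. 0 * 0) = ennreal \<bar>0\<bar> * N (\<lambda>_. 0)" using bfn_scale[OF N z, of 0] .
 hence "N (\<lambda>_. 0) = 0" by simp
 thus ?case using z by (simp add: space_of_def)
next
 case (insert i I)
 have gi: "g i \<in> space_of N" and S: "(\<lambda>x. \<Sum>i\<in>I. \<bar>g i x\<bar>) \<in> space_of N" using insert by auto
 have ag: "(\<lambda>x. \<bar>g i x\<bar>) \<in> L0" using space_ofD(1)[OF gi] by (simp add: L0_def)
 have "N (\<lambda>x. \<bar>g i x\<bar>) \<le> N (g i)" by (rule bfn_mono[OF N space_ofD(1)[OF gi] ag]) simp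
 hence "N (\<lambda>x. \<bar>g i x\<bar> + (\<Sum>i\<in>I. \<bar>g i x\<bar>)) \<le> N (g i) + N (\<lambda>x. \<Sum>i\<in>I. \<bar>g i x\<bar>)"
  using bfn_triangle[OF N ag space_ofD(1)[OF S]] by (meson add_right_mono order_trans)
 also have "\<dots> < \<infinity>" using space_ofD(2)[OF gi] space_ofD(2)[OF S] by simp
 finally have "N (\<lambda>x. \<bar>g i x\<bar> + (\<Sum>i\<in>I. \<bar>g i x\<bar>)) < \<infinity>" .
 moreover have "(\<lambda>x. \<bar>g i x\<bar> + (\<Sum>i\<in>I. \<bar>g i x\<bar>)) \<in> L0"
  using ag space_ofD(1)[OF S] unfolding L0_def by simp
 ultimately show ?case using insert.hyps by (simp add: space_of_def)
qed

lemma grad_norm_bounds: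
 fixes f :: "real ^ 'n::finite => real"
 shows "\<alpha> \<in> multi_indices k ==> \<bar>weak_deriv \<alpha> f x\<bar> \<le> grad_norm k f x"
  and "grad_norm k f x \<le> (\<Sum>\<alpha>\<in>multi_indices k. \<bar>weak_deriv \<alpha> f x\<bar>)" and "0 \<le> grad_norm k f x"
proof -
 let ?M = "multi_indices k :: ('n => nat) set"
 show "\<bar>weak_deriv \<alpha> f x\<bar> \<le> grad_norm k f x" if "\<alpha> \<in> ?M"
 proof -
  have "(weak_deriv \<alpha> f x)\<^sup>2 \<le> (\<Sum>\<alpha>\<in>?M. (weak_deriv \<alpha> f x)\<^sup>2)"
   using that by (intro member_le_sum finite_multi_indices) auto
  hence "sqrt ((weak_deriv \<alpha> f x)\<^sup>2) \<le> grad_norm k f x" unfolding grad_norm_def by (rule real_sqrt_le_mono)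
  thus ?thesis by simp
 qed
 show "grad_norm k f x \<le> (\<Sum>\<alpha>\<in>?M. \<bar>weak_deriv \<alpha> f x\<bar>)"
  using L2_set_le_sum_abs[of "\<lambda>\<alpha>. weak_deriv \<alpha> f x" ?M] by (simp add: grad_norm_def L2_set_def)
 show "0 \<le> grad_norm k f x" by (simp add: grad_norm_def sum_nonneg)
qed

lemma homogeneous_sobolev_weak_deriv:
 assumes "f \<in> homogeneous_sobolev k N" "\<alpha> \<in> multi_indices k"
 shows "has_weak_deriv f \<alpha> (weak_deriv \<alpha> f)"
 using assms someI_ex[of "has_weak_deriv f \<alpha>"] unfolding homogeneous_sobolev_def weak_deriv_def by blast

lemma grad_norm_L0:
 fixes f :: "real ^ 'n::finite => real"
 assumes "\<And>\<alpha>. \<alpha> \<in> multi_indices k ==> has_weak_deriv f \<alpha> (weak_deriv \<alpha> f)"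
 shows "grad_norm k f \<in> L0"
proof -
 have [measurable]: "weak_deriv \<alpha> f \<in> borel_measurable lebesgue" if "\<alpha> \<in> multi_indices k" for \<alpha>
  using assms[OF that] by (simp add: has_weak_deriv_def L1_loc_def L0_def)
 have S: "(\<lambda>x. \<Sum>\<alpha>\<in>multi_indices k. (weak_deriv \<alpha> f x)\<^sup>2) \<in> borel_measurable lebesgue"
  by (intro borel_measurable_sum borel_measurable_power) auto
 have "sqrt \<in> borel_fun"
  by (intro borel_measurable_continuous_onI continuous_on_real_sqrt continuous_on_id)
 from measurable_compose[OF S this] show ?thesis unfolding L0_def grad_norm_def[abs_def] .
qed

text \<open>The representative picked by \<open>weak_deriv\<close> need not be the one lying in the
  space, but \<open>weak_deriv_unique\<close> identifies them almost everywhere.\<close>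

lemma grad_norm_space:
 fixes f :: "real ^ 'n::finite => real"
 assumes N: "banach_function_norm_over \<S> N" and f: "f \<in> homogeneous_sobolev k N"
 shows "grad_norm k f \<in> space_of N"
proof -
 let ?M = "multi_indices k :: ('n => nat) set"
 have "\<forall>\<alpha>\<in>?M. \<exists>g. has_weak_deriv f \<alpha> g \<and> g \<in> space_of N" using f by (simp add: homogeneous_sobolev_def)
 then obtain g where g: "\<And>\<alpha>. \<alpha> \<in> ?M ==> has_weak_deriv f \<alpha> (g \<alpha>)" "\<And>\<alpha>. \<alpha> \<in> ?M ==> g \<alpha> \<in> space_of N" by metis
 note wd = homogeneous_sobolev_weak_deriv[OF f]
 have L: "grad_norm k f \<in> L0" by (rule grad_norm_L0[OF wd])
 have S: "(\<lambda>x. \<Sum>\<alpha>\<in>?M. \<bar>g \<alpha> x\<bar>) \<in> space_of N" by (rule bfn_abs_sum[OF N finite_multi_indices g(2)])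
 have "AE x in lborel. \<forall>\<alpha>\<in>?M. weak_deriv \<alpha> f x = g \<alpha> x"
  using weak_deriv_unique[OF wd g(1)] by (subst AE_finite_all[OF finite_multi_indices]) auto
 hence "AE x in lborel. \<bar>grad_norm k f x\<bar> \<le> \<bar>\<Sum>\<alpha>\<in>?M. \<bar>g \<alpha> x\<bar>\<bar>"
 proof eventually_elim
  case (elim x)
  have "grad_norm k f x \<le> (\<Sum>\<alpha>\<in>?M. \<bar>weak_deriv \<alpha> f x\<bar>)" by (rule grad_norm_bounds)
  also have "\<dots> = (\<Sum>\<alpha>\<in>?M. \<bar>g \<alpha> x\<bar>)" using elim by (intro sum.cong) auto
  finally show ?case using grad_norm_bounds(3)[of k f x] by (simp add: sum_nonneg)
 qed
 hence "N (grad_norm k f) \<le> N (\<lambda>x. \<Sum>\<alpha>\<in>?M. \<bar>g \<alpha> x\<bar>)" by (rule bfn_mono[OF N space_ofD(1)[OF S] L])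
 thus ?thesis using L space_ofD(2)[OF S] by (simp add: space_of_def)
qed

section \<open>The maximal function and the Boyd index\<close>

lemma emeasure_lebesgue_ball: "emeasure lebesgue (ball x r) = emeasure lborel (ball x r)"
 by (simp add: emeasure_completion main_part_sets)

lemma bavg_le_maximal:
 fixes g :: "real ^ 'n::finite => real"
 assumes "0 < \<rho>" shows "bavg (\<lambda>w. ennreal \<bar>g w\<bar>) x \<rho> \<le> maximal_function g x"
 unfolding maximal_function_def bavg_def nn_integral_completion emeasure_lebesgue_ball
 by (intro Sup_upper CollectI exI[of _ x] exI[of _ \<rho>] conjI) (use assms in auto)

text \<open>The maximal function is uncentred, so each of its superlevel sets is a union of open
  balls.\<close>

lemma maximal_function_measurable:
 fixes g :: "real ^ 'n::finite => real"
 shows "maximal_function g \<in> borel_fun"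
proof (rule borel_measurableI_greater)
 fix y :: ennreal
 define F where "F c r = (\<integral>\<^sup>+y\<in>ball c r. ennreal \<bar>g y\<bar> \<partial>lebesgue) / emeasure lebesgue (ball c r)" for c r
 have "{x. y < maximal_function g x} = (\<Union>(c, r)\<in>{(c, r). 0 < r \<and> y < F c r}. ball c r)"
 proof (intro set_eqI iffI)
  fix x assume "x \<in> {x. y < maximal_function g x}"
  then obtain z where "z \<in> {F c r |c r. 0 < r \<and> x \<in> ball c r}" "y < z"
   unfolding maximal_function_def F_def[symmetric] less_Sup_iff by blast
  thus "x \<in> (\<Union>(c, r)\<in>{(c, r). 0 < r \<and> y < F c r}. ball c r)" by blast
 next
  fix x assume "x \<in> (\<Union>(c, r)\<in>{(c, r). 0 < r \<and> y < F c r}. ball c r)"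
  then obtain c r where "0 < r" "y < F c r" "x \<in> ball c r" by blast
  hence "\<exists>z\<in>{F c r |c r. 0 < r \<and> x \<in> ball c r}. y < z" by blast
  thus "x \<in> {x. y < maximal_function g x}"
   unfolding maximal_function_def F_def[symmetric] less_Sup_iff by blast
 qed
 also have "open \<dots>" by auto
 finally show "{x \<in> space borel. y < maximal_function g x} \<in> sets borel" by simp
qed

lemma maximal_function_cong_AE:
 fixes g g' :: "real ^ 'n::finite => real"
 assumes "AE x in lborel. \<bar>g x\<bar> = \<bar>g' x\<bar>" shows "maximal_function g = maximal_function g'"
proof -
 have "(\<integral>\<^sup>+y\<in>ball c r. ennreal \<bar>g y\<bar> \<partial>lebesgue) = (\<integral>\<^sup>+y\<in>ball c r. ennreal \<bar>g' y\<bar> \<partial>lebesgue)" for c r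
  unfolding nn_integral_completion using assms by (intro nn_integral_cong_AE) (auto elim: eventually_mono)
 thus ?thesis unfolding maximal_function_def by (intro ext) simp
qed

text \<open>The index is a supremum that need not be attained, so all one gets is some admissible
  exponent beyond any given r below it.\<close>

lemma boyd_index_obtain:
 assumes "lower_boyd_index N = ereal p" "1 < p" "r < p"
 obtains r' where "r < r'" "1 < r'" "maximal_bounded_on (convexification (1 / r') N)"
proof -
 \<comment> \<open>The maximum with 1 rules out the element 1 that was adjoined to the set of
   exponents.\<close>
 have "ereal (max r 1) < lower_boyd_index N" using assms by simp
 then obtain a where a: "a \<in> {ereal p |p. 1 < p \<and> ball_banach_function_space (convexification (1 / p) N) \<and>
            maximal_bounded_on (convexification (1 / p) N)} \<union> {1}" "ereal (max r 1) < a"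
  unfolding lower_boyd_index_def less_Sup_iff by blast
 hence "a \<noteq> 1" by (auto simp: one_ereal_def)
 thus ?thesis using a that by auto
qed

text \<open>\<open>enn2real\<close> sends infinity to 0. For members of a space covered by
  \<open>maximal_power_bound\<close> this happens only on a null set.\<close>

definition maximal_power :: "real => (real ^ 'n::finite => real) => real ^ 'n => real" where
 "maximal_power r f x = enn2real (maximal_function (\<lambda>y. \<bar>f y\<bar> powr r) x) powr (1 / r)"

text \<open>|f|^r lies in the convexification with exponent 1/r, where its norm is the r-th power of
  that of f. Boundedness of M there, followed by an r-th root, is the claim for N.\<close>

lemma maximal_power_bound:
 fixes N :: "'n::finite fnorm"
 assumes N: "banach_function_norm_over \<S> N" and r: "1 < r" and mb: "maximal_bounded_on (convexification (1 / r) N)"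
 obtains C where "0 < C" "\<And>f. f \<in> space_of N ==> AE x in lborel. maximal_function (\<lambda>y. \<bar>f y\<bar> powr r) x < \<infinity>"
  "\<And>f. f \<in> space_of N ==> maximal_power r f \<in> space_of N"
  "\<And>f. f \<in> space_of N ==> N (maximal_power r f) \<le> ennreal C * N f"
proof -
 let ?V = "convexification (1 / r) N"
 obtain C where C: "0 < C" "\<And>f. f \<in> space_of ?V ==> extended_norm ?V (maximal_function f) \<le> ennreal C * ?V f"
  using mb unfolding maximal_bounded_on_def by blast
 have main: "(AE x in lborel. maximal_function (\<lambda>y. \<bar>f y\<bar> powr r) x < \<infinity>) \<and> maximal_power r f \<in> space_of N \<and>
   N (maximal_power r f) \<le> ennreal (C powr (1 / r)) * N f" if f: "f \<in> space_of N" for f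
 proof -
  obtain u where u: "0 \<le> u" "N f = ennreal u" using space_of_real[OF f] by blast
  let ?g = "\<lambda>y. \<bar>f y\<bar> powr r"
  have fL: "f \<in> L0" by (rule space_ofD(1)[OF f])
  have afL: "(\<lambda>y. \<bar>f y\<bar>) \<in> L0" using fL by (simp add: L0_def)
  have gL: "?g \<in> L0" using fL unfolding L0_def by measurable
  have "N (\<lambda>y. \<bar>f y\<bar>) = N f"
   by (intro antisym bfn_mono[OF N fL afL] bfn_mono[OF N afL fL]) auto
  moreover have "(\<lambda>x. \<bar>?g x\<bar> powr (1 / r)) = (\<lambda>y. \<bar>f y\<bar>)" using r by (auto simp: powr_powr)
  ultimately have Vg: "?V ?g = ennreal (u powr r)"
   unfolding convexification_def using u by (simp add: ennreal_powr_ennreal)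
  hence "?g \<in> space_of ?V" using gL by (simp add: space_of_def)
  hence ex: "extended_norm ?V (maximal_function ?g) \<le> ennreal C * ennreal (u powr r)" using C(2) Vg by metis
  also have "\<dots> = ennreal (C * u powr r)" using C(1) by (simp add: ennreal_mult)
  finally have ex: "extended_norm ?V (maximal_function ?g) \<le> ennreal (C * u powr r)" .
  hence fin: "extended_norm ?V (maximal_function ?g) < \<infinity>" using le_less_trans ennreal_less_top by (metis infinity_ennreal_def)
  hence ae: "AE x in lebesgue. maximal_function ?g x < \<infinity>" unfolding extended_norm_def by (auto split: if_splits)
  have mpL: "maximal_power r f \<in> L0"
  proof (rule borel_imp_L0)
   note maximal_function_measurable[of ?g, measurable]
   show "maximal_power r f \<in> borel_fun" unfolding maximal_power_def[abs_def] by measurable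
  qed
  have "extended_norm ?V (maximal_function ?g) = ennreal_powr (N (maximal_power r f)) r"
   using ae unfolding extended_norm_def convexification_def maximal_power_def[abs_def] by simp
  hence le: "ennreal_powr (N (maximal_power r f)) r \<le> ennreal (C * u powr r)" using ex by simp
  then obtain v where v: "0 \<le> v" "N (maximal_power r f) = ennreal v"
   unfolding ennreal_powr_def by (cases "N (maximal_power r f)") (auto simp: top_unique split: if_splits)
  have "v powr r \<le> C * u powr r" using le C(1) unfolding v(2) by (simp add: ennreal_powr_ennreal v(1))
  hence "(v powr r) powr (1 / r) \<le> (C * u powr r) powr (1 / r)" using r by (intro powr_mono2) auto
  hence "v \<le> C powr (1 / r) * u" using r u(1) v(1) by (simp add: powr_powr powr_mult)
  hence "N (maximal_power r f) \<le> ennreal (C powr (1 / r)) * N f"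
   unfolding v(2) u(2) using u(1) by (simp add: ennreal_mult[symmetric] ennreal_leI)
  moreover have "maximal_power r f \<in> space_of N" using mpL v(2) by (simp add: space_of_def)
  ultimately show ?thesis using ae by (simp add: AE_completion_iff)
 qed
 show ?thesis by (rule that[of "C powr (1 / r)"]) (use main C(1) in auto)
qed

text \<open>Averages of |f|^r are at most the maximal function, which is at most A^r. The strict
  inequality gives A > 0 even where the maximal function vanishes.\<close>

lemma bavg_power_le_1:
 fixes f :: "real ^ 'n::finite => real"
 assumes [measurable]: "f \<in> borel_fun" and fin: "maximal_function (\<lambda>y. \<bar>f y\<bar> powr r) x < \<infinity>"
  and A: "maximal_power r f x < A" and \<rho>: "0 < \<rho>" and r: "1 \<le> r"
 shows "bavg (\<lambda>w. ennreal ((\<bar>f w\<bar> / A) powr r)) x \<rho> \<le> 1"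
proof -
 obtain a where a: "0 \<le> a" "maximal_function (\<lambda>y. \<bar>f y\<bar> powr r) x = ennreal a"
  using fin by (cases "maximal_function (\<lambda>y. \<bar>f y\<bar> powr r) x") auto
 have aA: "a powr (1 / r) < A" using A a by (simp add: maximal_power_def)
 have A0: "A > 0" using aA powr_ge_zero[of a "1 / r"] by linarith
 have "(a powr (1 / r)) powr r \<le> A powr r" using aA r by (intro powr_mono2) auto
 hence "a \<le> A powr r" using a(1) r by (simp add: powr_powr)
 have "bavg (\<lambda>w. ennreal ((\<bar>f w\<bar> / A) powr r)) x \<rho> = bavg (\<lambda>w. 0 + ennreal (A powr (- r)) * ennreal \<bar>\<bar>f w\<bar> powr r\<bar>) x \<rho>"
 proof -
  have "(\<bar>f w\<bar> / A) powr r = A powr (- r) * \<bar>\<bar>f w\<bar> powr r\<bar>" for w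
   unfolding powr_divide powr_minus abs_of_nonneg[OF powr_ge_zero] by (simp add: divide_inverse mult.commute)
  thus ?thesis by (simp add: ennreal_mult')
 qed
 also have "\<dots> = 0 + ennreal (A powr (- r)) * bavg (\<lambda>w. ennreal \<bar>\<bar>f w\<bar> powr r\<bar>) x \<rho>"
  by (rule bavg_affine[OF _ \<rho>]) measurable
 also have "\<dots> \<le> 0 + ennreal (A powr (- r)) * ennreal a"
  using bavg_le_maximal[OF \<rho>, of "\<lambda>y. \<bar>f y\<bar> powr r" x] a(2) by (intro add_left_mono mult_left_mono) auto
 also have "\<dots> = ennreal (A powr (- r) * a)" using a(1) by (simp add: ennreal_mult)
 also have "\<dots> \<le> ennreal (A powr (- r) * A powr r)" using \<open>a \<le> A powr r\<close> by (intro ennreal_leI mult_left_mono) auto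
 also have "\<dots> = 1" using A0 by (simp add: powr_minus)
 finally show ?thesis .
qed

text \<open>The pointwise estimates divide by A and G, but maximal functions and the BMO norm may be
  0. The estimates are therefore applied to all larger A and G, and continuity of powers with
  positive exponent gives the limit.\<close>

lemma le_powr_limit:
 fixes F :: ennreal
 assumes le: "\<And>A G. a < A ==> b < G ==> F \<le> ennreal (C * (A powr (1 - s) * G powr s))"
  and ab: "0 \<le> a" "0 \<le> b" and s: "0 < s" "s < 1"
 shows "F \<le> ennreal (C * (a powr (1 - s) * b powr s))"
proof (rule tendsto_lowerbound)
 have t: "((\<lambda>\<epsilon>. (c + \<epsilon>) powr e) \<longlongrightarrow> c powr e) (at_right 0)" if "0 \<le> c" "0 < e" for c e :: real
 proof (rule tendsto_powr')
  have "((\<lambda>\<epsilon>. c + \<epsilon>) \<longlongrightarrow> c + 0) (at_right 0)" by (intro tendsto_intros)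
  thus "((\<lambda>\<epsilon>. c + \<epsilon>) \<longlongrightarrow> c) (at_right 0)" by simp
  have "\<forall>\<^sub>F \<epsilon> in at_right (0::real). 0 < \<epsilon>" by (rule eventually_at_right_less)
  hence "\<forall>\<^sub>F \<epsilon> in at_right 0. 0 \<le> c + \<epsilon>" by eventually_elim (use that in simp)
  thus "c \<noteq> 0 \<or> 0 < e \<and> (\<forall>\<^sub>F \<epsilon> in at_right 0. 0 \<le> c + \<epsilon>)" using that by blast
 qed auto
 show "((\<lambda>\<epsilon>. ennreal (C * ((a + \<epsilon>) powr (1 - s) * (b + \<epsilon>) powr s))) \<longlongrightarrow> ennreal (C * (a powr (1 - s) * b powr s))) (at_right 0)"
  by (intro tendsto_ennrealI tendsto_mult tendsto_const t ab) (use s in auto)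
 have "\<forall>\<^sub>F \<epsilon> in at_right 0. 0 < (\<epsilon>::real)" by (rule eventually_at_right_less)
 thus "\<forall>\<^sub>F \<epsilon> in at_right 0. F \<le> ennreal (C * ((a + \<epsilon>) powr (1 - s) * (b + \<epsilon>) powr s))"
  by eventually_elim (rule le, auto)
qed simp

subsection \<open>The interpolation inequalities\<close>

text \<open>1/(1/p + \<delta>) lies below p, so the supremum defining the index provides an
  admissible r beyond it.\<close>

lemma boyd_exponent:
 assumes "lower_boyd_index N = ereal p" "1 < p" "0 < \<delta>"
 obtains r where "1 < r" "1 / r < 1 / p + \<delta>" "maximal_bounded_on (convexification (1 / r) N)"
proof -
 have pos: "0 < 1 / p + \<delta>" using assms by (simp add: add_pos_pos)
 have "1 / (1 / p + \<delta>) < 1 / (1 / p)" using assms pos by (intro divide_strict_left_mono mult_pos_pos) auto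
 hence "1 / (1 / p + \<delta>) < p" by simp
 then obtain r where r: "1 / (1 / p + \<delta>) < r" "1 < r" "maximal_bounded_on (convexification (1 / r) N)"
  using boyd_index_obtain[OF assms(1,2)] by blast
 have "1 / r < 1 / p + \<delta>" using r(1,2) pos by (simp add: field_simps)
 thus ?thesis using that r by blast
qed

lemma maximal_power_cong_AE:
 assumes "AE x in lborel. \<bar>f x\<bar> = \<bar>f' x\<bar>"
 shows "maximal_power r f = maximal_power r f'" "maximal_function (\<lambda>y. \<bar>f y\<bar> powr r) = maximal_function (\<lambda>y. \<bar>f' y\<bar> powr r)"
proof -
 show "maximal_function (\<lambda>y. \<bar>f y\<bar> powr r) = maximal_function (\<lambda>y. \<bar>f' y\<bar> powr r)"
  using assms by (intro maximal_function_cong_AE) (auto elim: eventually_mono)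
 thus "maximal_power r f = maximal_power r f'" by (intro ext) (simp add: maximal_power_def)
qed

lemma sobolev_borel_setup:
 fixes f :: "real ^ 'n::finite => real"
 assumes N: "banach_function_norm_over \<S> Y" and f: "f \<in> homogeneous_sobolev k Y"
 obtains f' p where "f' \<in> borel_fun" "AE x in lborel. f x = f' x" "p \<in> borel_fun" "\<And>x. 0 \<le> p x"
  "AE x in lborel. grad_norm k f x = p x" "weak_grad_bound k f' (\<lambda>x. ennreal (p x))"
proof -
 have fL: "f \<in> L1_loc" using f by (simp add: homogeneous_sobolev_def)
 obtain f' where f': "f' \<in> borel_fun" "AE x in lborel. f x = f' x" using L0_borel_rep[OF L1_locD[OF fL]] by blast
 obtain g' where g': "g' \<in> borel_fun" "AE x in lborel. grad_norm k f x = g' x"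
  using L0_borel_rep[OF space_ofD(1)[OF grad_norm_space[OF N f]]] by blast
 define p where "p x = \<bar>g' x\<bar>" for x
 have p: "p \<in> borel_fun" unfolding p_def using g'(1) by simp
 have pe: "AE x in lborel. grad_norm k f x = p x"
  using g'(2)
 proof eventually_elim
  case (elim x)
  thus ?case using grad_norm_bounds(3)[of k f x] by (simp add: p_def)
 qed
 have "weak_grad_bound k f' (\<lambda>x. ennreal (p x))"
 proof (rule weak_grad_bound_rep[OF fL f' homogeneous_sobolev_weak_deriv[OF f] p])
  fix \<alpha> :: "'n => nat" assume \<alpha>: "\<alpha> \<in> multi_indices k"
  show "AE x in lborel. \<bar>weak_deriv \<alpha> f x\<bar> \<le> p x" using pe
  proof eventually_elim
   case (elim x)
   thus ?case using grad_norm_bounds(1)[OF \<alpha>, of f x] by simp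
  qed
 qed
 thus ?thesis using that f' p pe by (simp add: p_def)
qed

lemma ennreal_powr_scale:
 assumes "0 < c" "v \<le> ennreal c * w" "0 \<le> r" "w < \<infinity>"
 shows "ennreal_powr v r \<le> ennreal (c powr r) * ennreal_powr w r"
proof -
 obtain u where u: "0 \<le> u" "w = ennreal u" using assms(4) by (cases w) auto
 have "ennreal_powr v r \<le> ennreal_powr (ennreal (c * u)) r"
  using assms u by (intro ennreal_powr_mono) (auto simp: ennreal_mult)
 also have "\<dots> = ennreal ((c * u) powr r)" using assms u by (intro ennreal_powr_ennreal) simp
 also have "\<dots> = ennreal (c powr r) * ennreal_powr w r"
  using assms u by (simp add: ennreal_powr_ennreal powr_mult ennreal_mult)
 finally show ?thesis .
qed

lemma bfn_scaled_space:
 assumes N: "banach_function_norm_over \<S> N" and f: "f \<in> space_of N"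
 shows "(\<lambda>x. c * f x) \<in> space_of N"
proof -
 have "N (\<lambda>x. c * f x) < \<infinity>" using bfn_scale[OF N space_ofD(1)[OF f], of c] space_ofD(2)[OF f] by (simp add: ennreal_mult_less_top)
 moreover have "(\<lambda>x. c * f x) \<in> L0" using space_ofD(1)[OF f] by (simp add: L0_def)
 ultimately show ?thesis by (simp add: space_of_def)
qed

lemma interpolation_calderon:
 fixes X Y :: "'n::finite fnorm"
 assumes k: "1 \<le> k" and s: "0 < s" "s < 1" and q: "1 \<le> q"
  and bX: "ball_banach_function_space X" and bY: "ball_banach_function_space Y"
  and pX: "lower_boyd_index X = ereal pX" "1 < pX" and pY: "lower_boyd_index Y = ereal pY" "1 < pY"
  and sub: "real CARD('n) * ((1 - s) / pX + s / pY - 1 / q) < s * real k"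
 shows "\<exists>C>0. \<forall>f \<in> space_of X \<inter> homogeneous_sobolev k Y.
       extended_norm (calderon_lozanovskii s X Y) (frac_diff s k q f)
       \<le> ennreal C * ennreal_powr (X f) (1 - s) * ennreal_powr (Y (grad_norm k f)) s"
proof -
 note NX = ball_bfs_imp_bfn[OF bX] and NY = ball_bfs_imp_bfn[OF bY]
 define n where "n = real CARD('n)"
 have n: "n > 0" by (simp add: n_def)
 \<comment> \<open>The slack of the strict inequality, divided by n. The weights 1 - s and s sum to
   1, so the condition survives when 1/r1 and 1/r2 exceed 1/pX and 1/pY by less than
   \<delta>.\<close>
 define \<delta> where "\<delta> = (s * real k - n * ((1 - s) / pX + s / pY - 1 / q)) / n"
 have \<delta>: "\<delta> > 0" unfolding \<delta>_def using sub n by (intro divide_pos_pos) (auto simp: n_def)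
 obtain r1 where r1: "1 < r1" "1 / r1 < 1 / pX + \<delta>" "maximal_bounded_on (convexification (1 / r1) X)"
  by (rule boyd_exponent[OF pX \<delta>]) blast
 obtain r2 where r2: "1 < r2" "1 / r2 < 1 / pY + \<delta>" "maximal_bounded_on (convexification (1 / r2) Y)"
  by (rule boyd_exponent[OF pY \<delta>]) blast
 have "(1 - s) / r1 + s / r2 < (1 - s) / pX + s / pY + \<delta>"
 proof -
  have "(1 - s) * (1 / r1) < (1 - s) * (1 / pX + \<delta>)" using r1 s by (intro mult_strict_left_mono) auto
  moreover have "s * (1 / r2) < s * (1 / pY + \<delta>)" using r2 s by (intro mult_strict_left_mono) auto
  ultimately show ?thesis by (simp add: algebra_simps)
 qed
 hence "n * ((1 - s) / r1 + s / r2 - 1 / q) < n * (((1 - s) / pX + s / pY - 1 / q) + \<delta>)" using n by (intro mult_strict_left_mono) auto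
 also have "\<dots> = s * real k" unfolding \<delta>_def using n by (simp add: distrib_left)
 finally have sub': "real CARD('n) * ((1 - s) / r1 + s / r2 - 1 / q) < s * real k" by (simp add: n_def)
 have k0: "0 < k" using k by simp
 have r1': "1 \<le> r1" and r2': "1 \<le> r2" using r1 r2 by auto
 obtain C0 where C0: "0 < C0" "\<And>(f::real^'n::finite => real) p x A G.
   weak_grad_bound k f (\<lambda>w. ennreal (p w)) ==> p \<in> borel_fun ==> (\<And>w. 0 \<le> p w) ==> good_point k f x ==> 0 < A ==> 0 < G ==>
   (\<And>\<rho>. 0 < \<rho> ==> bavg (\<lambda>w. ennreal ((\<bar>f w\<bar> / A) powr r1)) x \<rho> \<le> 1) ==>
   (\<And>\<rho>. 0 < \<rho> ==> bavg (\<lambda>w. ennreal ((p w / G) powr r2)) x \<rho> \<le> 1) ==>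
   frac_diff s k q f x \<le> ennreal (C0 * (A powr (1 - s) * G powr s))"
  by (rule frac_diff_pointwise_Lp[OF k0 s q r1' r2' sub']) blast
 obtain CX where CX: "0 < CX" "\<And>f. f \<in> space_of X ==> AE x in lborel. maximal_function (\<lambda>y. \<bar>f y\<bar> powr r1) x < \<infinity>"
  "\<And>f. f \<in> space_of X ==> maximal_power r1 f \<in> space_of X" "\<And>f. f \<in> space_of X ==> X (maximal_power r1 f) \<le> ennreal CX * X f"
  by (rule maximal_power_bound[OF NX r1(1,3)]) blast
 obtain CY where CY: "0 < CY" "\<And>f. f \<in> space_of Y ==> AE x in lborel. maximal_function (\<lambda>y. \<bar>f y\<bar> powr r2) x < \<infinity>"
  "\<And>f. f \<in> space_of Y ==> maximal_power r2 f \<in> space_of Y" "\<And>f. f \<in> space_of Y ==> Y (maximal_power r2 f) \<le> ennreal CY * Y f"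
  by (rule maximal_power_bound[OF NY r2(1,3)]) blast
 define C where "C = (C0 * CX) powr (1 - s) * (C0 * CY) powr s"
 have C: "C > 0" using C0(1) CX(1) CY(1) by (simp add: C_def)
 show ?thesis
 proof (intro exI conjI ballI)
  show "0 < C" by (rule C)
  fix f assume "f \<in> space_of X \<inter> homogeneous_sobolev k Y"
  hence fX: "f \<in> space_of X" and fY: "f \<in> homogeneous_sobolev k Y" by auto
  have gY: "grad_norm k f \<in> space_of Y" by (rule grad_norm_space[OF NY fY])
  obtain f' p where f': "f' \<in> borel_fun" "AE x in lborel. f x = f' x" and p: "p \<in> borel_fun" "\<And>x. 0 \<le> p x"
   "AE x in lborel. grad_norm k f x = p x" and wg: "weak_grad_bound k f' (\<lambda>x. ennreal (p x))"
   by (rule sobolev_borel_setup[OF NY fY]) blast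
  have mf: "maximal_power r1 f = maximal_power r1 f'" "maximal_function (\<lambda>y. \<bar>f y\<bar> powr r1) = maximal_function (\<lambda>y. \<bar>f' y\<bar> powr r1)"
  proof -
   have "AE x in lborel. \<bar>f x\<bar> = \<bar>f' x\<bar>" using f'(2) by eventually_elim simp
   from maximal_power_cong_AE[OF this] show "maximal_power r1 f = maximal_power r1 f'"
    "maximal_function (\<lambda>y. \<bar>f y\<bar> powr r1) = maximal_function (\<lambda>y. \<bar>f' y\<bar> powr r1)" by blast+
  qed
  have mg: "maximal_power r2 (grad_norm k f) = maximal_power r2 p" "maximal_function (\<lambda>y. \<bar>grad_norm k f y\<bar> powr r2) = maximal_function (\<lambda>y. \<bar>p y\<bar> powr r2)"
  proof -
   have "AE x in lborel. \<bar>grad_norm k f x\<bar> = \<bar>p x\<bar>" using p(3) by eventually_elim simp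
   from maximal_power_cong_AE[OF this] show "maximal_power r2 (grad_norm k f) = maximal_power r2 p"
    "maximal_function (\<lambda>y. \<bar>grad_norm k f y\<bar> powr r2) = maximal_function (\<lambda>y. \<bar>p y\<bar> powr r2)" by blast+
  qed
  have lf: "loc_int f'" using wg by (simp add: weak_grad_bound_def)
  have main: "AE x in lborel. frac_diff s k q f x \<le> ennreal (C0 * (maximal_power r1 f x powr (1 - s) * maximal_power r2 (grad_norm k f) x powr s))"
   using frac_diff_cong_AE[OF f'(2), of s k q] AE_good_point[OF k0 lf] CX(2)[OF fX] CY(2)[OF gY]
  proof eventually_elim
   case (elim x)
   have "frac_diff s k q f' x \<le> ennreal (C0 * (maximal_power r1 f' x powr (1 - s) * maximal_power r2 p x powr s))"
   proof (rule le_powr_limit[OF _ _ _ s])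
    show "0 \<le> maximal_power r1 f' x" "0 \<le> maximal_power r2 p x" by (simp_all add: maximal_power_def)
    fix A G assume A: "maximal_power r1 f' x < A" and G: "maximal_power r2 p x < G"
    have "0 < A" "0 < G" using A G \<open>0 \<le> maximal_power r1 f' x\<close> \<open>0 \<le> maximal_power r2 p x\<close> by linarith+
    moreover have "bavg (\<lambda>w. ennreal ((\<bar>f' w\<bar> / A) powr r1)) x \<rho> \<le> 1" if "0 < \<rho>" for \<rho>
     using bavg_power_le_1[OF f'(1) _ A that r1'] elim(3) mf(2) by simp
    moreover have "bavg (\<lambda>w. ennreal ((p w / G) powr r2)) x \<rho> \<le> 1" if "0 < \<rho>" for \<rho>
     using bavg_power_le_1[OF p(1) _ G that r2'] elim(4) mg(2) p(2) by simp
    ultimately show "frac_diff s k q f' x \<le> ennreal (C0 * (A powr (1 - s) * G powr s))"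
     by (intro C0(2)[OF wg p(1,2) elim(2)])
   qed
   thus ?case using elim(1) mf(1) mg(1) by simp
  qed
  \<comment> \<open>Both factors carry the full constant, as C0^(1-s) C0^s = C0. The pair F, G is
    then admissible in the infimum that defines the product norm.\<close>
  define F where "F x = C0 * maximal_power r1 f x" for x
  define G where "G x = C0 * maximal_power r2 (grad_norm k f) x" for x
  have FX: "F \<in> space_of X" unfolding F_def by (rule bfn_scaled_space[OF NX CX(3)[OF fX]])
  have GY: "G \<in> space_of Y" unfolding G_def by (rule bfn_scaled_space[OF NY CY(3)[OF gY]])
  have XF: "X F \<le> ennreal (C0 * CX) * X f"
  proof -
   have "X F = ennreal C0 * X (maximal_power r1 f)"
    unfolding F_def using bfn_scale[OF NX space_ofD(1)[OF CX(3)[OF fX]], of C0] C0(1) by simp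
   also have "\<dots> \<le> ennreal C0 * (ennreal CX * X f)" by (intro mult_left_mono CX(4)[OF fX]) simp
   finally show ?thesis using C0(1) CX(1) by (simp add: ennreal_mult mult.assoc)
  qed
  have YG: "Y G \<le> ennreal (C0 * CY) * Y (grad_norm k f)"
  proof -
   have "Y G = ennreal C0 * Y (maximal_power r2 (grad_norm k f))"
    unfolding G_def using bfn_scale[OF NY space_ofD(1)[OF CY(3)[OF gY]], of C0] C0(1) by simp
   also have "\<dots> \<le> ennreal C0 * (ennreal CY * Y (grad_norm k f))" by (intro mult_left_mono CY(4)[OF gY]) simp
   finally show ?thesis using C0(1) CY(1) by (simp add: ennreal_mult mult.assoc)
  qed
  have dom: "AE x in lebesgue. \<bar>enn2real (frac_diff s k q f x)\<bar> \<le> \<bar>F x\<bar> powr (1 - s) * \<bar>G x\<bar> powr s"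
   unfolding AE_completion_iff using main
  proof eventually_elim
   case (elim x)
   let ?a = "maximal_power r1 f x" and ?b = "maximal_power r2 (grad_norm k f) x"
   have "0 \<le> ?a" "0 \<le> ?b" by (simp_all add: maximal_power_def)
   hence "\<bar>F x\<bar> powr (1 - s) * \<bar>G x\<bar> powr s = (C0 powr (1 - s) * C0 powr s) * (?a powr (1 - s) * ?b powr s)"
    using C0(1) by (simp add: F_def G_def abs_mult powr_mult mult_ac)
   also have "C0 powr (1 - s) * C0 powr s = C0" using C0(1) by (simp add: powr_add[symmetric])
   finally have "\<bar>F x\<bar> powr (1 - s) * \<bar>G x\<bar> powr s = C0 * (?a powr (1 - s) * ?b powr s)" .
   moreover have "enn2real (frac_diff s k q f x) \<le> C0 * (?a powr (1 - s) * ?b powr s)"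
    using elim C0(1) by (intro enn2real_leI) auto
   ultimately show ?case by simp
  qed
  have fin: "AE x in lebesgue. frac_diff s k q f x < \<infinity>"
   unfolding AE_completion_iff using main
  proof eventually_elim
   case (elim x)
   thus ?case using ennreal_less_top le_less_trans by (metis infinity_ennreal_def)
  qed
  have "extended_norm (calderon_lozanovskii s X Y) (frac_diff s k q f) = calderon_lozanovskii s X Y (\<lambda>x. enn2real (frac_diff s k q f x))"
   using fin by (simp add: extended_norm_def)
  also have "\<dots> \<le> ennreal_powr (X F) (1 - s) * ennreal_powr (Y G) s"
   unfolding calderon_lozanovskii_def using FX GY dom by (intro Inf_lower) blast
  also have "\<dots> \<le> (ennreal ((C0 * CX) powr (1 - s)) * ennreal_powr (X f) (1 - s)) * (ennreal ((C0 * CY) powr s) * ennreal_powr (Y (grad_norm k f)) s)"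
   using C0(1) CX(1) CY(1) s space_ofD(2)[OF fX] space_ofD(2)[OF gY]
   by (intro mult_mono ennreal_powr_scale XF YG) auto
  also have "\<dots> = ennreal C * ennreal_powr (X f) (1 - s) * ennreal_powr (Y (grad_norm k f)) s"
   unfolding C_def by (simp add: ennreal_mult mult_ac)
  finally show "extended_norm (calderon_lozanovskii s X Y) (frac_diff s k q f)
       \<le> ennreal C * ennreal_powr (X f) (1 - s) * ennreal_powr (Y (grad_norm k f)) s" .
 qed
qed

text \<open>The ball lies in the cube of side 2 \<rho> around y, whose volume is larger by the
  factor 2^n / m, with m the volume of the unit ball. Since the infimum over c is strictly below A,
  some c stays below A.\<close>

lemma bmo_ball_oscillation:
 fixes f f' :: "real ^ 'n::finite => real"
 assumes ae: "AE x in lborel. f x = f' x" and A: "bmo_norm f < ennreal A" "0 < A" and \<rho>: "0 < \<rho>"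
 shows "\<exists>c. bavg (\<lambda>w. ennreal \<bar>f' w - c\<bar>) y \<rho> \<le> ennreal (2 ^ CARD('n) / measure lborel (ball (0::real^'n) 1) * A)"
proof -
 define m where "m = measure lborel (ball (0::real^'n) 1)"
 have m: "m > 0" unfolding m_def by (rule unit_ball_measure)
 define a where "a = y - \<rho> *\<^sub>R One"
 let ?Q = "cbox a (a + (2 * \<rho>) *\<^sub>R One)"
 have EQ: "emeasure lebesgue ?Q = ennreal ((2 * \<rho>) ^ CARD('n))"
 proof -
  have "emeasure lebesgue ?Q = emeasure lborel ?Q" by (simp add: emeasure_completion main_part_sets)
  also have "\<dots> = ennreal (\<Prod>b\<in>Basis. (a + (2 * \<rho>) *\<^sub>R One - a) \<bullet> b)"
   by (rule emeasure_lborel_cbox) (use \<rho> in \<open>simp add: inner_add_left\<close>)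
  also have "(\<Prod>b\<in>Basis. (a + (2 * \<rho>) *\<^sub>R One - a) \<bullet> b) = (2 * \<rho>) ^ CARD('n)" by simp
  finally show ?thesis .
 qed
 have "(INF c. (\<integral>\<^sup>+x\<in>?Q. ennreal \<bar>f x - c\<bar> \<partial>lebesgue) / emeasure lebesgue ?Q) \<le> bmo_norm f"
  unfolding bmo_norm_def by (rule SUP_upper2[of "(a, 2 * \<rho>)"]) (use \<rho> in auto)
 hence "(INF c. (\<integral>\<^sup>+x\<in>?Q. ennreal \<bar>f x - c\<bar> \<partial>lebesgue) / emeasure lebesgue ?Q) < ennreal A" using A(1) by (rule le_less_trans)
 then obtain c where c: "(\<integral>\<^sup>+x\<in>?Q. ennreal \<bar>f x - c\<bar> \<partial>lebesgue) / emeasure lebesgue ?Q < ennreal A"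
  unfolding INF_less_iff by blast
 define J where "J = (\<integral>\<^sup>+x\<in>?Q. ennreal \<bar>f x - c\<bar> \<partial>lebesgue)"
 have J: "J \<le> ennreal (A * (2 * \<rho>) ^ CARD('n))"
 proof (cases J)
  case (real j)
  have "ennreal (j / (2 * \<rho>) ^ CARD('n)) < ennreal A"
   using c \<rho> real unfolding J_def[symmetric] EQ by (simp add: divide_ennreal)
  moreover have "0 \<le> j / (2 * \<rho>) ^ CARD('n)" using real \<rho> by simp
  ultimately have "j / (2 * \<rho>) ^ CARD('n) < A" by (simp only: ennreal_less_iff)
  hence "j \<le> A * (2 * \<rho>) ^ CARD('n)" using \<rho> by (simp add: pos_divide_less_eq)
  thus ?thesis using real by (simp add: ennreal_leI)
 next
  case top
  thus ?thesis using c \<rho> unfolding J_def[symmetric] EQ by (simp add: ennreal_top_divide)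
 qed
 have sub: "ball y \<rho> \<subseteq> ?Q"
 proof
  fix x assume x: "x \<in> ball y \<rho>"
  have "\<bar>(x - y) \<bullet> b\<bar> \<le> \<rho>" if "b \<in> Basis" for b
   using Basis_le_norm[OF that, of "x - y"] x by (simp add: dist_norm norm_minus_commute)
  hence "a \<bullet> b \<le> x \<bullet> b \<and> x \<bullet> b \<le> (a + (2 * \<rho>) *\<^sub>R One) \<bullet> b" if "b \<in> Basis" for b
   using that by (force simp: a_def inner_diff_left inner_add_left abs_le_iff)
  thus "x \<in> ?Q" by (simp add: mem_box)
 qed
 have "(\<integral>+ w. ennreal \<bar>f' w - c\<bar> * indicator (ball y \<rho>) w) \<le> (\<integral>+ w. ennreal \<bar>f w - c\<bar> * indicator ?Q w)"
  by (rule nn_integral_mono_AE) (use ae sub in \<open>auto elim!: eventually_mono simp: indicator_def\<close>)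
 also have "\<dots> = J" unfolding J_def nn_integral_completion ..
 finally have "bavg (\<lambda>w. ennreal \<bar>f' w - c\<bar>) y \<rho> \<le> ennreal (A * (2 * \<rho>) ^ CARD('n)) / ennreal (\<rho> ^ CARD('n) * m)"
  unfolding bavg_def using J emeasure_ball_unit[of \<rho> y] \<rho> by (simp add: m_def divide_right_mono_ennreal order_trans)
 also have "\<dots> = ennreal (A * (2 * \<rho>) ^ CARD('n) / (\<rho> ^ CARD('n) * m))" using A(2) \<rho> m by (intro divide_ennreal) auto
 also have "A * (2 * \<rho>) ^ CARD('n) / (\<rho> ^ CARD('n) * m) = 2 ^ CARD('n) / m * A"
  using \<rho> by (simp add: power_mult_distrib)
 finally show ?thesis unfolding m_def by blast
qed

lemma interpolation_BMO:
 fixes Y :: "'n::finite fnorm"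
 assumes k: "1 \<le> k" and s: "0 < s" "s < 1" and q: "1 \<le> q"
  and bY: "ball_banach_function_space Y" and pY: "lower_boyd_index Y = ereal pY" "1 < pY"
  and sub: "real CARD('n) * (s / pY - 1 / q) < s * real k"
 shows "\<exists>C>0. \<forall>f \<in> BMO \<inter> homogeneous_sobolev k Y.
       extended_norm (convexification (1 / s) Y) (frac_diff s k q f)
       \<le> ennreal C * ennreal_powr (bmo_norm f) (1 - s) * ennreal_powr (Y (grad_norm k f)) s"
proof -
 note NY = ball_bfs_imp_bfn[OF bY]
 define n where "n = real CARD('n)"
 have n: "n > 0" by (simp add: n_def)
 define \<delta> where "\<delta> = (s * real k - n * (s / pY - 1 / q)) / n"
 have \<delta>: "\<delta> > 0" unfolding \<delta>_def using sub n by (intro divide_pos_pos) (auto simp: n_def)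
 obtain r2 where r2: "1 < r2" "1 / r2 < 1 / pY + \<delta>" "maximal_bounded_on (convexification (1 / r2) Y)"
  by (rule boyd_exponent[OF pY \<delta>]) blast
 have "s / r2 < s / pY + \<delta>"
 proof -
  have "s * (1 / r2) < s * (1 / pY + \<delta>)" using r2 s by (intro mult_strict_left_mono) auto
  also have "\<dots> \<le> s / pY + \<delta>" using s \<delta> by (simp add: distrib_left mult_left_le_one_le)
  finally show ?thesis by simp
 qed
 hence "n * (s / r2 - 1 / q) < n * ((s / pY - 1 / q) + \<delta>)" using n by (intro mult_strict_left_mono) auto
 also have "\<dots> = s * real k" unfolding \<delta>_def using n by (simp add: distrib_left)
 finally have sub': "real CARD('n) * (s / r2 - 1 / q) < s * real k" by (simp add: n_def)
 have k0: "0 < k" using k by simp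
 have r2': "1 \<le> r2" using r2 by auto
 obtain C0 where C0: "0 < C0" "\<And>(f::real^'n::finite => real) p x A G.
   weak_grad_bound k f (\<lambda>w. ennreal (p w)) ==> p \<in> borel_fun ==> (\<And>w. 0 \<le> p w) ==> good_point k f x ==> 0 < A ==> 0 < G ==>
   (\<And>\<rho> y. 0 < \<rho> ==> \<exists>c. bavg (\<lambda>w. ennreal \<bar>f w - c\<bar>) y \<rho> \<le> ennreal A) ==>
   (\<And>\<rho>. 0 < \<rho> ==> bavg (\<lambda>w. ennreal ((p w / G) powr r2)) x \<rho> \<le> 1) ==>
   frac_diff s k q f x \<le> ennreal (C0 * (A powr (1 - s) * G powr s))"
  by (rule frac_diff_pointwise_BMO[OF k0 s q r2' sub']) blast
 obtain CY where CY: "0 < CY" "\<And>f. f \<in> space_of Y ==> AE x in lborel. maximal_function (\<lambda>y. \<bar>f y\<bar> powr r2) x < \<infinity>"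
  "\<And>f. f \<in> space_of Y ==> maximal_power r2 f \<in> space_of Y" "\<And>f. f \<in> space_of Y ==> Y (maximal_power r2 f) \<le> ennreal CY * Y f"
  by (rule maximal_power_bound[OF NY r2(1,3)]) blast
 define \<kappa> where "\<kappa> = 2 ^ CARD('n) / measure lborel (ball (0::real^'n) 1)"
 have \<kappa>: "\<kappa> > 0" using unit_ball_measure(1)[where 'a="real^'n"] by (simp add: \<kappa>_def)
 define D where "D = C0 * \<kappa> powr (1 - s)"
 have D: "D > 0" using C0(1) \<kappa> by (simp add: D_def)
 define C where "C = D * CY powr s"
 have C: "C > 0" using D CY(1) by (simp add: C_def)
 show ?thesis
 proof (intro exI conjI ballI)
  show "0 < C" by (rule C)
  fix f assume "f \<in> BMO \<inter> homogeneous_sobolev k Y"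
  hence fB: "f \<in> L1_loc" "bmo_norm f < \<infinity>" and fY: "f \<in> homogeneous_sobolev k Y" by (auto simp: BMO_def)
  obtain b where b: "0 \<le> b" "bmo_norm f = ennreal b" using fB(2) by (cases "bmo_norm f") auto
  have gY: "grad_norm k f \<in> space_of Y" by (rule grad_norm_space[OF NY fY])
  obtain f' p where f': "f' \<in> borel_fun" "AE x in lborel. f x = f' x" and p: "p \<in> borel_fun" "\<And>x. 0 \<le> p x"
   "AE x in lborel. grad_norm k f x = p x" and wg: "weak_grad_bound k f' (\<lambda>x. ennreal (p x))"
   by (rule sobolev_borel_setup[OF NY fY]) blast
  have mg: "maximal_power r2 (grad_norm k f) = maximal_power r2 p" "maximal_function (\<lambda>y. \<bar>grad_norm k f y\<bar> powr r2) = maximal_function (\<lambda>y. \<bar>p y\<bar> powr r2)"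
  proof -
   have "AE x in lborel. \<bar>grad_norm k f x\<bar> = \<bar>p x\<bar>" using p(3) by eventually_elim simp
   from maximal_power_cong_AE[OF this] show "maximal_power r2 (grad_norm k f) = maximal_power r2 p"
    "maximal_function (\<lambda>y. \<bar>grad_norm k f y\<bar> powr r2) = maximal_function (\<lambda>y. \<bar>p y\<bar> powr r2)" by blast+
  qed
  have lf: "loc_int f'" using wg by (simp add: weak_grad_bound_def)
  have main: "AE x in lborel. frac_diff s k q f x \<le> ennreal (D * (b powr (1 - s) * maximal_power r2 (grad_norm k f) x powr s))"
   using frac_diff_cong_AE[OF f'(2), of s k q] AE_good_point[OF k0 lf] CY(2)[OF gY]
  proof eventually_elim
   case (elim x)
   have "frac_diff s k q f' x \<le> ennreal (D * (b powr (1 - s) * maximal_power r2 p x powr s))"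
   proof (rule le_powr_limit[OF _ _ _ s])
    show "0 \<le> b" by (rule b)
    show "0 \<le> maximal_power r2 p x" by (simp add: maximal_power_def)
    fix A G assume A: "b < A" and G: "maximal_power r2 p x < G"
    have A0: "0 < A" and G0: "0 < G" using A G b(1) \<open>0 \<le> maximal_power r2 p x\<close> by linarith+
    have bA: "bmo_norm f < ennreal A" using A b by (simp add: ennreal_less_iff)
    have "frac_diff s k q f' x \<le> ennreal (C0 * ((\<kappa> * A) powr (1 - s) * G powr s))"
    proof (rule C0(2)[OF wg p(1,2) elim(2)])
     show "0 < \<kappa> * A" "0 < G" using \<kappa> A0 G0 by auto
     show "\<exists>c. bavg (\<lambda>w. ennreal \<bar>f' w - c\<bar>) y \<rho> \<le> ennreal (\<kappa> * A)" if "0 < \<rho>" for \<rho> y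
      unfolding \<kappa>_def by (rule bmo_ball_oscillation[OF f'(2) bA A0 that])
     show "bavg (\<lambda>w. ennreal ((p w / G) powr r2)) x \<rho> \<le> 1" if "0 < \<rho>" for \<rho>
      using bavg_power_le_1[OF p(1) _ G that r2'] elim(3) mg(2) p(2) by simp
    qed
    thus "frac_diff s k q f' x \<le> ennreal (D * (A powr (1 - s) * G powr s))" by (simp add: D_def powr_mult mult_ac)
   qed
   thus ?case using elim(1) mg(1) by simp
  qed
  have fin: "AE x in lebesgue. frac_diff s k q f x < \<infinity>"
   unfolding AE_completion_iff using main
  proof eventually_elim
   case (elim x)
   thus ?case using ennreal_less_top le_less_trans by (metis infinity_ennreal_def)
  qed
  let ?H = "\<lambda>x. enn2real (frac_diff s k q f x)"
  \<comment> \<open>Raised to the power 1/s, the pointwise bound becomes linear in the maximal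
    function of the gradient, with this factor, so the norm of Y applies directly; the exponent s in
    the convexification undoes the power.\<close>
  define c where "c = (D * b powr (1 - s)) powr (1 / s)"
  have HL: "?H \<in> L0" by (rule frac_diff_L0[OF L1_locD[OF fB(1)]])
  have HL': "(\<lambda>x. \<bar>?H x\<bar> powr (1 / s)) \<in> L0" using HL unfolding L0_def by measurable
  note mpY = CY(3)[OF gY]
  have "AE x in lborel. \<bar>\<bar>?H x\<bar> powr (1 / s)\<bar> \<le> \<bar>c * maximal_power r2 (grad_norm k f) x\<bar>"
   using main
  proof eventually_elim
   case (elim x)
   let ?g = "maximal_power r2 (grad_norm k f) x"
   have g0: "0 \<le> ?g" by (simp add: maximal_power_def)
   have "?H x \<le> D * (b powr (1 - s) * ?g powr s)" using elim D by (intro enn2real_leI) auto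
   hence "?H x powr (1 / s) \<le> (D * b powr (1 - s) * ?g powr s) powr (1 / s)" using s by (intro powr_mono2) (auto simp: mult.assoc)
   also have "\<dots> = c * ?g" unfolding c_def using s g0 by (simp only: powr_mult powr_powr) simp
   finally show ?case using g0 by (simp add: c_def)
  qed
  hence "Y (\<lambda>x. \<bar>?H x\<bar> powr (1 / s)) \<le> Y (\<lambda>x. c * maximal_power r2 (grad_norm k f) x)"
   by (rule bfn_mono[OF NY space_ofD(1)[OF bfn_scaled_space[OF NY mpY]] HL'])
  also have "\<dots> = ennreal c * Y (maximal_power r2 (grad_norm k f))"
   using bfn_scale[OF NY space_ofD(1)[OF mpY], of c] by (simp add: c_def)
  also have "\<dots> \<le> ennreal c * (ennreal CY * Y (grad_norm k f))" by (intro mult_left_mono CY(4)[OF gY]) simp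
  finally have YH: "Y (\<lambda>x. \<bar>?H x\<bar> powr (1 / s)) \<le> ennreal c * (ennreal CY * Y (grad_norm k f))" .
  obtain v where v: "0 \<le> v" "Y (grad_norm k f) = ennreal v" using space_of_real[OF gY] by blast
  have "extended_norm (convexification (1 / s) Y) (frac_diff s k q f) = ennreal_powr (Y (\<lambda>x. \<bar>?H x\<bar> powr (1 / s))) s"
   using fin by (simp add: extended_norm_def convexification_def)
  also have "\<dots> \<le> ennreal_powr (ennreal (c * (CY * v))) s"
   using YH v s CY(1) by (intro ennreal_powr_mono) (auto simp: ennreal_mult c_def)
  also have "\<dots> = ennreal ((c * (CY * v)) powr s)" using v CY(1) by (intro ennreal_powr_ennreal) (auto simp: c_def)
  also have "(c * (CY * v)) powr s = C * b powr (1 - s) * v powr s"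
  proof -
   have "c powr s = D * b powr (1 - s)" unfolding c_def using s D by (simp add: powr_powr)
   thus ?thesis by (simp add: powr_mult C_def mult_ac)
  qed
  also have "ennreal (C * b powr (1 - s) * v powr s) = ennreal C * ennreal_powr (bmo_norm f) (1 - s) * ennreal_powr (Y (grad_norm k f)) s"
   unfolding b(2) v(2) using C b(1) v(1) by (simp add: ennreal_powr_ennreal ennreal_mult)
  finally show "extended_norm (convexification (1 / s) Y) (frac_diff s k q f)
       \<le> ennreal C * ennreal_powr (bmo_norm f) (1 - s) * ennreal_powr (Y (grad_norm k f)) s" .
 qed
qed

subsection \<open>Extremal functions\<close>

text \<open>Half-open, so that the 3^n translates by l v, with v in \<open>shifts\<close>, tile
  \<open>hull3\<close> without overlap.\<close>

definition hcube :: "real ^ 'n::finite => real => (real ^ 'n) set" where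
 "hcube c l = {x. \<forall>i. c $ i \<le> x $ i \<and> x $ i < c $ i + l}"

definition shifts :: "(real ^ 'n::finite) set" where
 "shifts = {v. \<forall>i. v $ i \<in> {-1, 0, 1}}"

definition hull3 :: "real ^ 'n::finite => real => (real ^ 'n) set" where
 "hull3 c l = {x. \<forall>i. c $ i - l \<le> x $ i \<and> x $ i < c $ i + 2 * l}"

lemma hcube_measurable[measurable]: "hcube c l \<in> sets borel"
proof -
 have "hcube c l = (\<Inter>i. {x. c $ i \<le> x $ i} \<inter> {x. x $ i < c $ i + l})" by (auto simp: hcube_def)
 also have "\<dots> \<in> sets borel" by measurable
 finally show ?thesis .
qed

lemma emeasure_hcube:
 fixes c :: "real ^ 'n::finite"
 assumes "0 < l" shows "emeasure lborel (hcube c l) = ennreal (l ^ CARD('n))"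
proof (rule antisym)
 define d where "d = (\<chi> i. c $ i + l)"
 have le: "\<And>b. b \<in> Basis ==> c \<bullet> b \<le> d \<bullet> b" using assms by (auto simp: d_def Basis_vec_def inner_axis)
 have P: "(\<Prod>b\<in>Basis. (d - c) \<bullet> b) = l ^ CARD('n)"
 proof -
  have "(\<Prod>b\<in>Basis. (d - c) \<bullet> b) = (\<Prod>b\<in>(Basis :: (real^'n) set). l)"
   by (rule prod.cong) (auto simp: d_def Basis_vec_def inner_axis)
  thus ?thesis by simp
 qed
 have "emeasure lborel (hcube c l) \<le> emeasure lborel (cbox c d)"
  by (intro emeasure_mono) (auto simp: hcube_def d_def mem_box_cart less_imp_le)
 thus "emeasure lborel (hcube c l) \<le> ennreal (l ^ CARD('n))" using emeasure_lborel_cbox[OF le] P by simp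
 have "emeasure lborel (box c d) \<le> emeasure lborel (hcube c l)"
  by (intro emeasure_mono) (auto simp: hcube_def d_def mem_box_cart less_imp_le)
 thus "ennreal (l ^ CARD('n)) \<le> emeasure lborel (hcube c l)" using emeasure_lborel_box[OF le] P by simp
qed

lemma finite_shifts: "finite (shifts :: (real ^ 'n::finite) set)"
proof -
 have "shifts \<subseteq> (\<lambda>g. \<chi> i. g i) ` (PiE UNIV (\<lambda>_. {-1, 0, 1}) :: ('n => real) set)"
 proof
  fix v :: "real^'n" assume "v \<in> shifts"
  hence "(\<lambda>i. v $ i) \<in> PiE UNIV (\<lambda>_. {-1, 0, 1})" by (auto simp: shifts_def)
  moreover have "v = (\<chi> i. v $ i)" by simp
  ultimately show "v \<in> (\<lambda>g. \<chi> i. g i) ` (PiE UNIV (\<lambda>_. {-1, 0, 1}) :: ('n => real) set)" by blast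
 qed
 moreover have "finite (PiE UNIV (\<lambda>_. {-1, 0, 1}) :: ('n => real) set)" by (intro finite_PiE) auto
 ultimately show ?thesis using finite_surj by blast
qed

lemma hull3_cover:
 assumes "0 < l" "x \<in> hull3 c l" shows "\<exists>v\<in>shifts. x \<in> hcube (c + l *\<^sub>R v) l"
proof
 define v where "v = (\<chi> i. if x $ i < c $ i then -1 else if x $ i < c $ i + l then 0 else (1::real))"
 show "v \<in> shifts" by (auto simp: shifts_def v_def)
 have "x $ i < 2 * l + c $ i" for i using assms(2) by (simp add: hull3_def add.commute)
 thus "x \<in> hcube (c + l *\<^sub>R v) l" using assms by (auto simp: hcube_def hull3_def v_def)
qed

lemma hcube_subset_hull3:
 assumes "0 < l" "v \<in> shifts" shows "hcube (c + l *\<^sub>R v) l \<subseteq> hull3 c l"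
proof
 fix x assume x: "x \<in> hcube (c + l *\<^sub>R v) l"
 have "c $ i - l \<le> x $ i \<and> x $ i < c $ i + 2 * l" for i
 proof -
  have "v $ i = -1 \<or> v $ i = 0 \<or> v $ i = 1" using assms(2) by (auto simp: shifts_def)
  moreover have "c $ i + l * v $ i \<le> x $ i" "x $ i < c $ i + l * v $ i + l" using x by (auto simp: hcube_def)
  ultimately show ?thesis using assms(1) by auto
 qed
 thus "x \<in> hull3 c l" by (simp add: hull3_def)
qed

lemma zero_in_shifts: "0 \<in> shifts"
 by (simp add: shifts_def)

lemma hull3_diameter:
 fixes x y :: "real ^ 'n::finite"
 assumes "x \<in> hull3 c l" "y \<in> hull3 c l" shows "norm (x - y) \<le> 3 * real CARD('n) * l"
proof -
 have "norm (x - y) \<le> (\<Sum>i\<in>UNIV. \<bar>(x - y) $ i\<bar>)" by (rule norm_le_l1_cart)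
 also have "\<dots> \<le> (\<Sum>i\<in>(UNIV::'n set). 3 * l)"
 proof (intro sum_mono)
  fix i
  have "c $ i - l \<le> x $ i" "x $ i < c $ i + 2 * l" "c $ i - l \<le> y $ i" "y $ i < c $ i + 2 * l"
   using assms by (auto simp: hull3_def)
  thus "\<bar>(x - y) $ i\<bar> \<le> 3 * l" by (simp add: abs_le_iff)
 qed
 finally show ?thesis by simp
qed

lemma bump_support_hull3: "bump l c \<alpha> x \<noteq> 0 ==> 0 < l ==> x \<in> hull3 c l"
 using bump_support[of l c \<alpha> x] by (auto simp: hull3_def intro: less_imp_le)

text \<open>All centres lie on one coordinate axis with gaps of at least (M + 3) L, where L is the
  sum of the sides. The two hulls use up at most 2 L + L of a gap, so their coordinates still differ
  by more than M L.\<close>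

lemma separated_centers:
 fixes l :: "'j => real"
 assumes J: "finite J" and l: "\<And>j. j \<in> J ==> 0 < l j" and M: "0 \<le> M"
 obtains c :: "'j => real ^ 'n::finite" where
  "\<And>j j' x y. j \<in> J ==> j' \<in> J ==> j \<noteq> j' ==> x \<in> hull3 (c j) (l j) ==> y \<in> hull3 (c j') (l j') ==> M * l j < norm (x - y)"
proof -
 obtain pos :: "'j => nat" where pos: "inj_on pos J" using finite_imp_inj_to_nat_seg[OF J] by blast
 define L where "L = (\<Sum>j\<in>J. l j)"
 have lL: "l j \<le> L" if "j \<in> J" for j unfolding L_def using that J l by (intro member_le_sum) (auto intro: less_imp_le)
 define D where "D = (M + 3) * L"
 obtain i0 :: 'n where True by blast
 define c where "c j = (real (pos j) * D) *\<^sub>R axis i0 (1::real)" for j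
 have ci: "c j $ i0 = real (pos j) * D" for j by (simp add: c_def axis_def)
 have key: "M * L < y $ i0 - x $ i0" if "j \<in> J" "j' \<in> J" "pos j < pos j'" "x \<in> hull3 (c j) (l j)" "y \<in> hull3 (c j') (l j')" for j j' x y
 proof -
  have L0: "0 < L" using lL[OF that(1)] l[OF that(1)] by linarith
  have D0: "0 \<le> D" unfolding D_def using M L0 by simp
  have "real (pos j) + 1 \<le> real (pos j')" using that(3) by simp
  hence "(real (pos j) + 1) * D \<le> real (pos j') * D" using D0 by (intro mult_right_mono) auto
  moreover have "x $ i0 < real (pos j) * D + 2 * l j" using that(4) by (auto simp: hull3_def ci[symmetric])
  moreover have "real (pos j') * D - l j' \<le> y $ i0" using that(5) by (auto simp: hull3_def ci[symmetric])
  ultimately have "D - l j' - 2 * l j < y $ i0 - x $ i0" by (simp add: algebra_simps)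
  moreover have "D - l j' - 2 * l j \<ge> M * L" unfolding D_def using lL[OF that(1)] lL[OF that(2)] by (simp add: algebra_simps)
  ultimately show ?thesis by linarith
 qed
 show ?thesis
 proof (rule that[of c])
  fix j j' x y assume *: "j \<in> J" "j' \<in> J" "j \<noteq> j'" "x \<in> hull3 (c j) (l j)" "y \<in> hull3 (c j') (l j')"
  have "pos j \<noteq> pos j'" using pos * by (auto dest: inj_onD)
  hence "M * L < \<bar>(x - y) $ i0\<bar>"
   using key[OF *(1,2) _ *(4,5)] key[OF *(2,1) _ *(5,4)] by (cases "pos j < pos j'") (auto simp: abs_if not_less)
  moreover have "\<bar>(x - y) $ i0\<bar> \<le> norm (x - y)" by (rule component_le_norm_cart)
  moreover have "M * l j \<le> M * L" using lL[OF *(1)] M by (intro mult_left_mono)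
  ultimately show "M * l j < norm (x - y)" by linarith
 qed
qed

text \<open>Let r be the side of the cube containing x and 3 n r < |h| < 6 n r. Every point x + i h
  with 1 \<le> i \<le> k has left the hull of that cube, whose diameter is at most 3 n r, and by the
  separation has not reached another hull. So the difference at x is f x up to sign, and f x is at
  least a fixed multiple of the height.\<close>

lemma bump_sum_frac_diff_lower:
 fixes s q :: real
 assumes k: "0 < k" and s: "0 < s" and q: "1 \<le> q"
 obtains C where "0 < C" "\<And>(J::'j set) a l (c :: 'j => real ^ 'n::finite) j x.
   finite J ==> (\<And>j. j \<in> J ==> 0 < l j) ==> (\<And>j. j \<in> J ==> 0 \<le> a j) ==>
   (\<And>j j' x y. j \<in> J ==> j' \<in> J ==> j \<noteq> j' ==> x \<in> hull3 (c j) (l j) ==> y \<in> hull3 (c j') (l j') ==> 6 * real CARD('n) * real k * l j < norm (x - y)) ==>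
   j \<in> J ==> x \<in> hcube (c j) (l j) ==>
   ennreal (C * (a j * l j powr (- (s * real k)))) \<le> frac_diff s k q (\<lambda>x. \<Sum>j\<in>J. a j * bump (l j) (c j) (\<lambda>_. 0) x) x"
proof -
 define n where "n = real CARD('n)"
 have n: "n \<ge> 1" unfolding n_def by (simp add: Suc_leI)
 define e0 where "e0 = exp (- 1 / 2 :: real) ^ CARD('n)"
 have e0: "e0 > 0" by (simp add: e0_def)
 define m where "m = measure lborel (ball (0::real^'n) 1)"
 have m: "m > 0" unfolding m_def by (rule unit_ball_measure)
 define \<gamma> where "\<gamma> = n + s * real k * q"
 have \<gamma>: "\<gamma> > 0" unfolding \<gamma>_def using n s k q by (intro add_pos_pos mult_pos_pos) auto
 \<comment> \<open>The factors are the lower bound e0 of a bump on its core, the least weight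
   |h|^(-\<gamma>) on the annulus, and a lower bound for the volume of the annulus, each taken for r
   = 1. The powers of r combine to r^(-s k q).\<close>
 define C1 where "C1 = e0 powr q * (6 * n) powr (- \<gamma>) * ((3 * n) ^ CARD('n) * m)"
 have C1: "C1 > 0" using e0 n m by (simp add: C1_def)
 show ?thesis
 proof (rule that[of "C1 powr (1 / q)"])
  show "0 < C1 powr (1 / q)" using C1 by simp
  fix J :: "'j set" and a l :: "'j => real" and c :: "'j => real^'n" and j x
  assume J: "finite J" and l: "\<And>j. j \<in> J ==> 0 < l j" and a: "\<And>j. j \<in> J ==> 0 \<le> a j"
   and sep: "\<And>j j' x y. j \<in> J ==> j' \<in> J ==> j \<noteq> j' ==> x \<in> hull3 (c j) (l j) ==> y \<in> hull3 (c j') (l j') ==> 6 * real CARD('n) * real k * l j < norm (x - y)"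
   and j: "j \<in> J" and x: "x \<in> hcube (c j) (l j)"
  let ?f = "\<lambda>x. \<Sum>j\<in>J. a j * bump (l j) (c j) (\<lambda>_. 0) x"
  define r where "r = l j"
  have r: "r > 0" unfolding r_def by (rule l[OF j])
  have xh: "x \<in> hull3 (c j) r" using hcube_subset_hull3[OF r zero_in_shifts, of "c j"] x by (auto simp: r_def)
  have fx: "e0 * a j \<le> ?f x"
  proof -
   have "e0 * a j \<le> bump (l j) (c j) (\<lambda>_. 0) x * a j"
    unfolding e0_def using x a[OF j] l[OF j] by (intro mult_right_mono bump_0_lower) (auto simp: hcube_def less_imp_le)
   also have "\<dots> = a j * bump (l j) (c j) (\<lambda>_. 0) x" by (rule mult.commute)
   also have "\<dots> \<le> ?f x" using J j a l by (intro member_le_sum) (auto intro!: mult_nonneg_nonneg bump_0_nonneg)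
   finally show ?thesis .
  qed
  have far: "?f (x + real i *\<^sub>R h) = 0" if i: "i \<in> {1..k}" and h: "3 * n * r < norm h" "norm h < 6 * n * r" for i h
  proof (rule sum.neutral, rule ballI)
   fix j' assume j': "j' \<in> J"
   let ?y = "x + real i *\<^sub>R h"
   have ny: "norm (x - ?y) = real i * norm h" by simp
   show "a j' * bump (l j') (c j') (\<lambda>_. 0) ?y = 0"
   proof (rule ccontr)
    assume "a j' * bump (l j') (c j') (\<lambda>_. 0) ?y \<noteq> 0"
    hence y: "?y \<in> hull3 (c j') (l j')" using bump_support_hull3 l[OF j'] by fastforce
    show False
    proof (cases "j' = j")
     case True
     have "norm (x - ?y) \<le> 3 * n * r" unfolding n_def using y True xh by (intro hull3_diameter) (auto simp: r_def)
     moreover have "1 * norm h \<le> real i * norm h" using i by (intro mult_right_mono) auto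
     ultimately show False using h ny by linarith
    next
     case False
     have "6 * n * real k * r < norm (x - ?y)" unfolding n_def r_def
      using sep[OF j j' _ _ y, of x] False xh by (auto simp: r_def)
     moreover have "real i * norm h \<le> real k * (6 * n * r)" using i h by (intro mult_mono) auto
     ultimately show False unfolding ny by (simp add: mult_ac)
    qed
   qed
  qed
  have fd: "e0 * a j \<le> \<bar>finite_diff k h ?f x\<bar>" if h: "3 * n * r < norm h" "norm h < 6 * n * r" for h
  proof -
   have "{0..k} = insert 0 {1..k}" by auto
   hence "finite_diff k h ?f x = (-1) ^ k * ?f x + (\<Sum>i\<in>{1..k}. (-1) ^ (k - i) * real (k choose i) * ?f (x + real i *\<^sub>R h))"
    by (simp add: finite_diff_def)
   also have "(\<Sum>i\<in>{1..k}. (-1) ^ (k - i) * real (k choose i) * ?f (x + real i *\<^sub>R h)) = 0"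
    by (rule sum.neutral) (simp add: far[OF _ h])
   finally have "\<bar>finite_diff k h ?f x\<bar> = \<bar>?f x\<bar>" by (simp add: abs_mult power_abs)
   thus ?thesis using fx by linarith
  qed
  define w where "w = (e0 * a j) powr q * (6 * n * r) powr (- \<gamma>)"
  have w0: "w \<ge> 0" by (simp add: w_def)
  let ?A = "ball (0::real^'n) (6 * n * r) - cball 0 (3 * n * r)"
  have nr: "0 < 3 * n * r" using n r by simp
  \<comment> \<open>Doubling the radius at least doubles the volume, so the annulus is at least as
    large as the ball inside it.\<close>
  have EA: "ennreal ((3 * n * r) ^ CARD('n) * m) \<le> emeasure lborel ?A"
  proof -
   have b: "emeasure lborel (ball (0::real^'n) (6 * n * r)) = ennreal ((6 * n * r) ^ CARD('n) * m)"
    using emeasure_ball_unit[of "6 * n * r" "0::real^'n"] nr by (simp add: m_def)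
   have cb: "emeasure lborel (cball (0::real^'n) (3 * n * r)) = ennreal ((3 * n * r) ^ CARD('n) * m)"
   proof -
    have "emeasure lborel (cball (0::real^'n) (3 * n * r)) = emeasure lborel (ball (0::real^'n) (3 * n * r))"
     using nr emeasure_cball[of "3 * n * r" "0::real^'n"] emeasure_ball[of "3 * n * r" "0::real^'n"] by simp
    thus ?thesis using emeasure_ball_unit[of "3 * n * r" "0::real^'n"] nr by (simp add: m_def)
   qed
   have "emeasure lborel ?A = emeasure lborel (ball (0::real^'n) (6 * n * r)) - emeasure lborel (cball (0::real^'n) (3 * n * r))"
    using nr by (intro emeasure_Diff) (auto simp: cb)
   also have "\<dots> = ennreal ((6 * n * r) ^ CARD('n) * m - (3 * n * r) ^ CARD('n) * m)"
    unfolding b cb using nr m by (intro ennreal_minus) simp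
   finally have EA: "emeasure lborel ?A = ennreal ((6 * n * r) ^ CARD('n) * m - (3 * n * r) ^ CARD('n) * m)" .
   have "(6 * n * r) ^ CARD('n) = 2 ^ CARD('n) * (3 * n * r) ^ CARD('n)" unfolding power_mult_distrib[symmetric] by (rule arg_cong[where f = "\<lambda>z. z ^ CARD('n)"]) simp
   moreover have "2 * (3 * n * r) ^ CARD('n) \<le> 2 ^ CARD('n) * (3 * n * r) ^ CARD('n)"
    using nr power_increasing[of 1 "CARD('n)" "2::real"] by (intro mult_right_mono) (auto simp: Suc_leI)
   ultimately have "2 * (3 * n * r) ^ CARD('n) * m \<le> (6 * n * r) ^ CARD('n) * m" using m by (intro mult_right_mono) auto
   hence "(3 * n * r) ^ CARD('n) * m \<le> (6 * n * r) ^ CARD('n) * m - (3 * n * r) ^ CARD('n) * m" by linarith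
   thus ?thesis unfolding EA by (rule ennreal_leI)
  qed
  have "ennreal w * ennreal ((3 * n * r) ^ CARD('n) * m) \<le> ennreal w * emeasure lborel ?A"
   by (intro mult_left_mono EA) simp
  also have "\<dots> = (\<integral>+ h. ennreal w * indicator ?A h)" by (rule nn_integral_cmult_indicator[symmetric]) simp
  also have "\<dots> \<le> (\<integral>+ h. ennreal (\<bar>finite_diff k h ?f x\<bar> powr q / norm h powr (real CARD('n) + s * real k * q)))"
  proof (intro nn_integral_mono)
   fix h :: "real^'n"
   show "ennreal w * indicator ?A h \<le> ennreal (\<bar>finite_diff k h ?f x\<bar> powr q / norm h powr (real CARD('n) + s * real k * q))"
   proof (cases "h \<in> ?A")
    case True
    hence h: "3 * n * r < norm h" "norm h < 6 * n * r" by auto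
    have "(e0 * a j) powr q \<le> \<bar>finite_diff k h ?f x\<bar> powr q" using fd[OF h] a[OF j] e0 q by (intro powr_mono2) auto
    moreover have "(6 * n * r) powr (- \<gamma>) \<le> norm h powr (- \<gamma>)" using h nr \<gamma> by (intro powr_mono2') auto
    ultimately have "w \<le> \<bar>finite_diff k h ?f x\<bar> powr q * norm h powr (- \<gamma>)" unfolding w_def by (intro mult_mono) auto
    also have "\<dots> = \<bar>finite_diff k h ?f x\<bar> powr q / norm h powr (real CARD('n) + s * real k * q)"
     by (simp only: \<gamma>_def n_def powr_minus divide_inverse)
    finally show ?thesis using True by (simp add: ennreal_leI)
   qed simp
  qed
  finally have I: "ennreal (w * ((3 * n * r) ^ CARD('n) * m)) \<le> (\<integral>\<^sup>+h. ennreal (\<bar>finite_diff k h ?f x\<bar> powr q / norm h powr (real CARD('n) + s * real k * q)) \<partial>lebesgue)"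
   using w0 nr m unfolding nn_integral_completion by (simp add: ennreal_mult)
  have "w * ((3 * n * r) ^ CARD('n) * m) = C1 * (a j * r powr (- (s * real k))) powr q"
  proof -
   have "r powr (- \<gamma>) * r ^ CARD('n) = r powr (- (s * real k) * q)"
   proof -
    have "r powr (- \<gamma>) * r ^ CARD('n) = r powr (- \<gamma>) * r powr n" using r by (simp add: n_def powr_realpow)
    also have "\<dots> = r powr (- (s * real k) * q)" by (subst powr_add[symmetric]) (simp add: \<gamma>_def)
    finally show ?thesis .
   qed
   moreover have "w * ((3 * n * r) ^ CARD('n) * m) = C1 * (a j powr q * (r powr (- \<gamma>) * r ^ CARD('n)))"
    unfolding w_def C1_def powr_mult power_mult_distrib by (simp only: mult_ac)
   ultimately show ?thesis by (simp add: powr_mult powr_powr)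
  qed
  hence "ennreal_powr (ennreal (C1 * (a j * r powr (- (s * real k))) powr q)) (1 / q) \<le> frac_diff s k q ?f x"
   unfolding frac_diff_def using I q by (intro ennreal_powr_mono) auto
  moreover have "ennreal_powr (ennreal (C1 * (a j * r powr (- (s * real k))) powr q)) (1 / q) = ennreal (C1 powr (1 / q) * (a j * r powr (- (s * real k))))"
   using C1 q a[OF j] by (subst ennreal_powr_ennreal) (auto simp: powr_mult powr_powr)
  ultimately show "ennreal (C1 powr (1 / q) * (a j * l j powr (- (s * real k)))) \<le> frac_diff s k q ?f x"
   by (simp add: r_def)
 qed
qed

lemma bump_sum_weak_deriv:
 fixes c :: "'j => real ^ 'n::finite"
 assumes J: "finite J" and l: "\<And>j. j \<in> J ==> 0 < l j"
 shows "has_weak_deriv (\<lambda>x. \<Sum>j\<in>J. a j * bump (l j) (c j) (\<lambda>_. 0) x) \<alpha> (\<lambda>x. \<Sum>j\<in>J. a j * bump (l j) (c j) \<alpha> x)"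
  and "(\<lambda>x. \<Sum>j\<in>J. a j * bump (l j) (c j) \<alpha> x) \<in> L1_loc"
proof -
 have m: "(\<lambda>x. \<Sum>j\<in>J. a j * bump (l j) (c j) \<beta> x) \<in> borel_fun" for \<beta>
  using l by (intro borel_measurable_sum borel_measurable_times) auto
 have lint: "loc_int (\<lambda>x. \<Sum>j\<in>J. a j * bump (l j) (c j) \<beta> x)" for \<beta>
 proof -
  have "integrable lborel (\<lambda>x. \<Sum>j\<in>J. a j * bump (l j) (c j) \<beta> x)"
   using l by (intro Bochner_Integration.integrable_sum integrable_mult_right bump_integrable)
  hence fin: "(\<integral>+ x. ennreal (norm (\<Sum>j\<in>J. a j * bump (l j) (c j) \<beta> x))) < \<infinity>"
   unfolding integrable_iff_bounded by blast
  have "(\<integral>+ x. ennreal \<bar>\<Sum>j\<in>J. a j * bump (l j) (c j) \<beta> x\<bar> * indicator (ball 0 r) x) < \<infinity>" for r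
   by (rule le_less_trans[OF nn_integral_mono fin]) (auto simp: indicator_def)
  thus ?thesis using m by (simp add: loc_int_def)
 qed
 show L: "(\<lambda>x. \<Sum>j\<in>J. a j * bump (l j) (c j) \<alpha> x) \<in> L1_loc" for \<alpha>
  using L1_loc_iff_loc_int[OF borel_imp_L0[OF m[of \<alpha>]] m[of \<alpha>]] lint[of \<alpha>] by simp
 show "has_weak_deriv (\<lambda>x. \<Sum>j\<in>J. a j * bump (l j) (c j) (\<lambda>_. 0) x) \<alpha> (\<lambda>x. \<Sum>j\<in>J. a j * bump (l j) (c j) \<alpha> x)"
  unfolding has_weak_deriv_def
 proof (intro conjI allI impI L)
  fix \<phi> :: "real^'n => real" assume \<phi>: "test_function \<phi>"
  have sm: "smooth \<phi>" using \<phi> by (simp add: test_function_def)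
  have cont: "continuous_on UNIV (foldr partial_deriv is \<phi>)" for "is"
   using sm unfolding smooth_def by (intro continuous_at_imp_continuous_on ballI differentiable_imp_continuous_within) auto
  have int: "integrable lborel (\<lambda>x. bump (l j) (c j) \<beta> x * g x)" if "j \<in> J" "continuous_on UNIV g" for j \<beta> and g :: "real^'n => real"
  proof -
   have b: "bounded {x. bump (l j) (c j) \<beta> x * g x \<noteq> 0}"
    by (rule bounded_subset[OF bounded_bump_support[OF l[OF that(1)], of "c j" \<beta>]]) auto
   have ct: "continuous_on UNIV (\<lambda>x. bump (l j) (c j) \<beta> x * g x)" by (intro continuous_intros bump_continuous l that)
   obtain B where B: "\<And>x. \<bar>bump (l j) (c j) \<beta> x * g x\<bar> \<le> B" using continuous_compact_support_bounded[OF ct b] by blast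
   have "integrable lborel (\<lambda>x. 1 * (bump (l j) (c j) \<beta> x * g x))"
    by (rule loc_int_mult_integrable[OF loc_int_1 borel_measurable_continuous_onI[OF ct] b B])
   thus ?thesis by simp
  qed
  have cm: "continuous_on UNIV (multi_deriv \<alpha> \<phi>)" unfolding multi_deriv_def by (rule cont)
  have c0: "continuous_on UNIV \<phi>" using cont[of "[]"] by simp
  have "(\<integral>x. (\<Sum>j\<in>J. a j * bump (l j) (c j) (\<lambda>_. 0) x) * multi_deriv \<alpha> \<phi> x \<partial>lebesgue)
   = (\<integral>x. (\<Sum>j\<in>J. a j * bump (l j) (c j) (\<lambda>_. 0) x) * multi_deriv \<alpha> \<phi> x \<partial>lborel)"
   by (rule integral_rep[OF borel_imp_L0[OF m] m smooth_multi_deriv_measurable[OF sm]]) simp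
  also have "\<dots> = (\<integral>x. (\<Sum>j\<in>J. a j * (bump (l j) (c j) (\<lambda>_. 0) x * multi_deriv \<alpha> \<phi> x)) \<partial>lborel)"
   by (simp only: sum_distrib_right mult.assoc)
  also have "\<dots> = (\<Sum>j\<in>J. a j * (\<integral>x. bump (l j) (c j) (\<lambda>_. 0) x * multi_deriv \<alpha> \<phi> x \<partial>lborel))"
   using int[OF _ cm] by (subst Bochner_Integration.integral_sum) auto
  also have "\<dots> = (\<Sum>j\<in>J. a j * ((-1) ^ (\<Sum>i\<in>UNIV. \<alpha> i) * (\<integral>x. bump (l j) (c j) \<alpha> x * \<phi> x \<partial>lborel)))"
   using bump_weak_deriv_lborel[OF l sm] by (intro sum.cong) auto
  also have "\<dots> = (-1) ^ (\<Sum>i\<in>UNIV. \<alpha> i) * (\<Sum>j\<in>J. a j * (\<integral>x. bump (l j) (c j) \<alpha> x * \<phi> x \<partial>lborel))"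
   by (simp only: sum_distrib_left mult_ac)
  also have "(\<Sum>j\<in>J. a j * (\<integral>x. bump (l j) (c j) \<alpha> x * \<phi> x \<partial>lborel)) = (\<integral>x. (\<Sum>j\<in>J. a j * (bump (l j) (c j) \<alpha> x * \<phi> x)) \<partial>lborel)"
   using int[OF _ c0] by (subst Bochner_Integration.integral_sum) auto
  also have "\<dots> = (\<integral>x. (\<Sum>j\<in>J. a j * bump (l j) (c j) \<alpha> x) * \<phi> x \<partial>lborel)"
   by (simp only: sum_distrib_right mult.assoc)
  also have "\<dots> = (\<integral>x. (\<Sum>j\<in>J. a j * bump (l j) (c j) \<alpha> x) * \<phi> x \<partial>lebesgue)"
   by (rule integral_rep[symmetric, OF borel_imp_L0[OF m] m smooth_measurable[OF sm]]) simp
  finally show "(\<integral>x. (\<Sum>j\<in>J. a j * bump (l j) (c j) (\<lambda>_. 0) x) * multi_deriv \<alpha> \<phi> x \<partial>lebesgue)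
   = (-1) ^ (\<Sum>i\<in>UNIV. \<alpha> i) * (\<integral>x. (\<Sum>j\<in>J. a j * bump (l j) (c j) \<alpha> x) * \<phi> x \<partial>lebesgue)" .
 qed
qed

section \<open>Rearrangements of simple functions\<close>

lemma ri_bfn: "ri_banach_function_space N ==> banach_function_norm_over lmeasurable N"
 by (simp add: ri_banach_function_space_def banach_function_space_def)

lemma ri_simple_space:
 fixes N :: "'n::finite fnorm"
 assumes N: "ri_banach_function_space N" and I: "finite I"
  and E: "\<And>i. i \<in> I ==> E i \<in> sets borel" "\<And>i. i \<in> I ==> emeasure lborel (E i) < \<infinity>"
 shows "(\<lambda>x. \<Sum>i\<in>I. \<bar>a i * indicator (E i) x\<bar>) \<in> space_of N"
proof -
 note bN = ri_bfn[OF N]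
 show ?thesis
 proof (rule bfn_abs_sum[OF bN I], rule bfn_scaled_space[OF bN])
  fix i assume i: "i \<in> I"
  have "E i \<in> lmeasurable" using E[OF i] by (intro fmeasurableI) (auto simp: emeasure_completion main_part_sets)
  thus "indicator (E i) \<in> space_of N" using bN unfolding banach_function_norm_over_def by blast
 qed
qed

lemma emeasure_simple_superlevel:
 assumes I: "finite I" and a: "\<And>i. i \<in> I ==> 0 \<le> a i" and E: "\<And>i. i \<in> I ==> E i \<in> sets borel"
  and d: "disjoint_family_on E I" and \<alpha>: "0 < \<alpha>"
 shows "emeasure lebesgue {x. \<bar>\<Sum>i\<in>I. a i * indicator (E i) x\<bar> > (\<alpha>::real)} = (\<Sum>i\<in>{i\<in>I. \<alpha> < a i}. emeasure lborel (E i))"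
proof -
 have val: "(\<Sum>i\<in>I. a i * indicator (E i) x) = a i" if "i \<in> I" "x \<in> E i" for i x
 proof -
  have "(\<Sum>i'\<in>I. a i' * indicator (E i') x) = (\<Sum>i'\<in>I. if i' = i then a i else 0)"
   using d that by (intro sum.cong) (auto simp: disjoint_family_on_def indicator_def)
  thus ?thesis using I that by simp
 qed
 have "{x. \<bar>\<Sum>i\<in>I. a i * indicator (E i) x\<bar> > \<alpha>} = (\<Union>i\<in>{i\<in>I. \<alpha> < a i}. E i)"
 proof (intro set_eqI iffI)
  fix x assume x: "x \<in> {x. \<bar>\<Sum>i\<in>I. a i * indicator (E i) x\<bar> > \<alpha>}"
  hence "(\<Sum>i\<in>I. a i * indicator (E i) x) \<noteq> 0" using \<alpha> by auto
  then obtain i where i: "i \<in> I" "a i * indicator (E i) x \<noteq> 0" by (rule sum.not_neutral_contains_not_neutral)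
  hence "x \<in> E i" by (auto simp: indicator_def split: if_splits)
  thus "x \<in> (\<Union>i\<in>{i\<in>I. \<alpha> < a i}. E i)" using x val[OF i(1)] a[OF i(1)] i(1) by auto
 next
  fix x assume "x \<in> (\<Union>i\<in>{i\<in>I. \<alpha> < a i}. E i)"
  thus "x \<in> {x. \<bar>\<Sum>i\<in>I. a i * indicator (E i) x\<bar> > \<alpha>}" using val by (auto simp: abs_if)
 qed
 moreover have "(\<Union>i\<in>{i\<in>I. \<alpha> < a i}. E i) \<in> sets lborel" using E I by (intro sets.finite_UN) auto
 ultimately have "emeasure lebesgue {x. \<bar>\<Sum>i\<in>I. a i * indicator (E i) x\<bar> > \<alpha>} = emeasure lborel (\<Union>i\<in>{i\<in>I. \<alpha> < a i}. E i)"
  by (simp add: emeasure_completion[OF sets_completionI_sets] main_part_sets)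
 also have "\<dots> = (\<Sum>i\<in>{i\<in>I. \<alpha> < a i}. emeasure lborel (E i))"
  by (rule sum_emeasure[symmetric]) (use I E d in \<open>auto simp: disjoint_family_on_def\<close>)
 finally show ?thesis .
qed

lemma ri_norm_eq:
 assumes "ri_banach_function_space N" "f \<in> L0" "g \<in> space_of N"
  "\<And>\<alpha>. 0 < \<alpha> ==> emeasure lebesgue {x. \<bar>f x\<bar> > \<alpha>} = emeasure lebesgue {x. \<bar>g x\<bar> > \<alpha>}"
 shows "N f = N g"
proof -
 have "rearrangement_invariant N" using assms(1) by (simp add: ri_banach_function_space_def)
 from this[unfolded rearrangement_invariant_def, rule_format, OF assms(2,3)] assms(4) show ?thesis by blast
qed

text \<open>By disjointness the measure of a superlevel set is the sum of the measures of those sets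
  whose coefficient exceeds the level, so both functions are equimeasurable.\<close>

lemma ri_simple_eq:
 fixes N :: "'n::finite fnorm"
 assumes N: "ri_banach_function_space N" and I: "finite I" and a: "\<And>i. i \<in> I ==> 0 \<le> a i"
  and E: "\<And>i. i \<in> I ==> E i \<in> sets borel" "\<And>i. i \<in> I ==> emeasure lborel (E i) < \<infinity>" "disjoint_family_on E I"
  and E': "\<And>i. i \<in> I ==> E' i \<in> sets borel" "disjoint_family_on E' I" and eq: "\<And>i. i \<in> I ==> emeasure lborel (E' i) = emeasure lborel (E i)"
 shows "N (\<lambda>x. \<Sum>i\<in>I. a i * indicator (E' i) x) = N (\<lambda>x. \<Sum>i\<in>I. a i * indicator (E i) x)"
proof -
 have "(\<lambda>x. \<Sum>i\<in>I. a i * indicator (E i) x) = (\<lambda>x. \<Sum>i\<in>I. \<bar>a i * indicator (E i) x\<bar>)"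
  using a by (intro ext sum.cong) auto
 hence g: "(\<lambda>x. \<Sum>i\<in>I. a i * indicator (E i) x) \<in> space_of N" using ri_simple_space[OF N I E(1,2)] by simp
 have f: "(\<lambda>x. \<Sum>i\<in>I. a i * indicator (E' i) x) \<in> L0"
  by (rule borel_imp_L0) (use E' in \<open>intro borel_measurable_sum borel_measurable_times borel_measurable_indicator, auto\<close>)
 have "emeasure lebesgue {x. \<bar>\<Sum>i\<in>I. a i * indicator (E' i) x\<bar> > \<alpha>} = emeasure lebesgue {x. \<bar>\<Sum>i\<in>I. a i * indicator (E i) x\<bar> > \<alpha>}" if "\<alpha> > 0" for \<alpha> :: real
 proof -
  have 1: "emeasure lebesgue {x. \<bar>\<Sum>i\<in>I. a i * indicator (E' i) x\<bar> > \<alpha>} = (\<Sum>i\<in>{i\<in>I. \<alpha> < a i}. emeasure lborel (E' i))"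
   by (rule emeasure_simple_superlevel[OF I _ _ E'(2) that]) (auto simp: a E')
  have 2: "emeasure lebesgue {x. \<bar>\<Sum>i\<in>I. a i * indicator (E i) x\<bar> > \<alpha>} = (\<Sum>i\<in>{i\<in>I. \<alpha> < a i}. emeasure lborel (E i))"
   by (rule emeasure_simple_superlevel[OF I _ _ E(3) that]) (auto simp: a E)
  have 3: "(\<Sum>i\<in>{i\<in>I. \<alpha> < a i}. emeasure lborel (E' i)) = (\<Sum>i\<in>{i\<in>I. \<alpha> < a i}. emeasure lborel (E i))"
   by (rule sum.cong) (auto simp: eq)
  show ?thesis using 1 2 3 by (simp only:)
 qed
 thus ?thesis by (rule ri_norm_eq[OF N f g])
qed

text \<open>m is \<mu> / L^n rounded up. This quotient is at least 1, so rounding at most doubles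
  it, and l^n = \<mu> / m lies between L^n / 2 and L^n.\<close>

lemma equal_cubes:
 assumes "0 < (L::real)" "L ^ n \<le> \<mu>" "0 < n"
 obtains l m where "0 < l" "l \<le> L" "L \<le> 2 * l" "real m * l ^ n = \<mu>"
proof -
 define z where "z = \<mu> / L ^ n"
 have Ln: "0 < L ^ n" using assms by simp
 have z: "1 \<le> z" unfolding z_def using assms Ln by (simp add: field_simps)
 define m where "m = nat \<lceil>z\<rceil>"
 have m: "z \<le> real m" "real m \<le> 2 * z" unfolding m_def using z by linarith+
 have m0: "0 < real m" using m z by linarith
 have \<mu>: "\<mu> = z * L ^ n" unfolding z_def using less_imp_neq[OF Ln] by (metis nonzero_eq_divide_eq)
 define l where "l = root n (\<mu> / real m)"
 have p: "0 < \<mu> / real m" using \<mu> z Ln m0 by simp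
 have l0: "0 < l" unfolding l_def using p assms by simp
 have ln: "l ^ n = \<mu> / real m" unfolding l_def using p assms by simp
 show ?thesis
 proof (rule that[OF l0])
  show "real m * l ^ n = \<mu>" using m0 by (simp add: ln)
  have "z * L ^ n \<le> real m * L ^ n" using m(1) Ln by (intro mult_right_mono) auto
  hence "l ^ n \<le> L ^ n" using m0 unfolding ln \<mu> by (simp add: field_simps)
  thus "l \<le> L" using l0 assms by (intro power_le_imp_le_base[of l "n - 1"]) auto
  have "real m * L ^ n \<le> 2 * z * L ^ n" using m(2) Ln by (intro mult_right_mono) auto
  hence "L ^ n \<le> 2 * l ^ n" using m0 unfolding ln \<mu> by (simp add: field_simps)
  also have "2 * l ^ n \<le> 2 ^ n * l ^ n"
   using power_increasing[of 1 n "2::real"] assms l0 by (intro mult_right_mono) auto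
  also have "2 ^ n * l ^ n = (2 * l) ^ n" by (rule power_mult_distrib[symmetric])
  finally show "L \<le> 2 * l" using l0 assms by (intro power_le_imp_le_base[of L "n - 1"]) auto
 qed
qed

text \<open>The ideal side (t a_i / b_i)^(1/k) balances the height t a_i against the derivatives:
  \<open>l_lower\<close> keeps those of order k of size b_i, \<open>l_upper\<close> makes D f at
  least of size t^(1-s) a_i^(1-s) b_i^s. It is met only up to a factor 2, because m_i cubes of side
  \<open>l i\<close> must have exactly the measure of \<open>E i\<close> for rearrangement
  invariance to apply.\<close>

locale bump_configuration =
 fixes k :: nat and M :: real and I :: "'i set" and E :: "'i => (real ^ 'n::finite) set"
  and a b :: "'i => real" and t :: real and l :: "'i => real" and m :: "'i => nat"
  and c :: "'i \<times> nat => real ^ 'n"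
 assumes I: "finite I" and E: "\<And>i. i \<in> I ==> E i \<in> sets borel" and dE: "disjoint_family_on E I"
  and a: "\<And>i. i \<in> I ==> 0 < a i" and b: "\<And>i. i \<in> I ==> 0 < b i" and t: "0 < t"
  and l: "\<And>i. i \<in> I ==> 0 < l i"
  and l_upper: "\<And>i. i \<in> I ==> l i ^ k \<le> t * a i / b i"
  and l_lower: "\<And>i. i \<in> I ==> t * a i / b i \<le> 2 ^ k * l i ^ k"
  and vol: "\<And>i. i \<in> I ==> emeasure lborel (E i) = ennreal (real (m i) * l i ^ CARD('n))"
  and M: "0 \<le> M"
  and sep: "\<And>j j' x y. j \<in> Sigma I (\<lambda>i. {..<m i}) ==> j' \<in> Sigma I (\<lambda>i. {..<m i}) ==> j \<noteq> j' ==>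
    x \<in> hull3 (c j) (l (fst j)) ==> y \<in> hull3 (c j') (l (fst j')) ==> M * l (fst j) < norm (x - y)"

lemma bump_configuration_exists:
 fixes E :: "'i => (real ^ 'n::finite) set"
 assumes k: "0 < k" and I: "finite I" and E: "\<And>i. i \<in> I ==> E i \<in> sets borel" and dE: "disjoint_family_on E I"
  and a: "\<And>i. i \<in> I ==> 0 < a i" and b: "\<And>i. i \<in> I ==> 0 < b i" and M: "0 \<le> M"
  and vol: "\<And>i. i \<in> I ==> 0 < emeasure lborel (E i)" "\<And>i. i \<in> I ==> emeasure lborel (E i) < \<infinity>"
 obtains t l m and c :: "'i \<times> nat => real ^ 'n" where "bump_configuration k M I E a b t l m c"
proof -
 define \<mu> where "\<mu> i = enn2real (emeasure lborel (E i))" for i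
 have \<mu>E: "emeasure lborel (E i) = ennreal (\<mu> i)" if "i \<in> I" for i
  using vol(2)[OF that] by (simp add: \<mu>_def)
 have \<mu>: "0 < \<mu> i" if "i \<in> I" for i
  using vol(1)[OF that] unfolding \<mu>E[OF that] by (simp add: ennreal_less_zero_iff)
 define n where "n = real CARD('n)"
 have n: "0 < n" by (simp add: n_def)
 \<comment> \<open>A cube of side (t a_i / b_i)^(1/k) has volume at most \<open>\<mu> i\<close>
   exactly if t \<open>w i\<close> \<le> 1; the choice of t below ensures this for all i at
   once.\<close>
 define w where "w i = a i / (b i * \<mu> i powr (real k / n))" for i
 have w: "0 < w i" if "i \<in> I" for i using a[OF that] b[OF that] \<mu>[OF that] by (simp add: w_def)
 define t where "t = 1 / (sum w I + 1)"
 have W: "0 \<le> sum w I" using w by (intro sum_nonneg) (auto intro: less_imp_le)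
 have t0: "0 < t" using W by (simp add: t_def)
 define L where "L i = root k (t * a i / b i)" for i
 have p: "0 < t * a i / b i" if "i \<in> I" for i using t0 a[OF that] b[OF that] by simp
 have L0: "0 < L i" if "i \<in> I" for i using p[OF that] k by (simp add: L_def)
 have Lk: "L i ^ k = t * a i / b i" if "i \<in> I" for i using p[OF that] k by (simp add: L_def)
 have Ln: "L i ^ CARD('n) \<le> \<mu> i" if i: "i \<in> I" for i
 proof -
  have "w i \<le> sum w I" using w i I by (intro member_le_sum) (auto intro: less_imp_le)
  hence "t * w i \<le> 1" using W by (simp add: t_def field_simps)
  hence "t * a i / b i \<le> \<mu> i powr (real k / n)"
   using \<mu>[OF i] b[OF i] by (simp add: w_def field_simps)
  hence "L i powr real k \<le> \<mu> i powr (real k / n)" using Lk[OF i] L0[OF i] by (simp add: powr_realpow)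
  hence "(L i powr real k) powr (n / real k) \<le> (\<mu> i powr (real k / n)) powr (n / real k)"
   using n k by (intro powr_mono2) auto
  hence "L i powr n \<le> \<mu> i" using n k \<mu>[OF i] by (simp add: powr_powr)
  thus ?thesis using L0[OF i] by (simp add: n_def powr_realpow)
 qed
 have "\<exists>l m. 0 < l \<and> l \<le> L i \<and> L i \<le> 2 * l \<and> real m * l ^ CARD('n) = \<mu> i" if "i \<in> I" for i
  using equal_cubes[OF L0[OF that] Ln[OF that]] by (metis zero_less_card_finite)
 then obtain l m where lm: "\<And>i. i \<in> I ==> 0 < l i" "\<And>i. i \<in> I ==> l i \<le> L i" "\<And>i. i \<in> I ==> L i \<le> 2 * l i"
   "\<And>i. i \<in> I ==> real (m i) * l i ^ CARD('n) = \<mu> i" by metis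
 have fJ: "finite (Sigma I (\<lambda>i. {..<m i}))" using I by simp
 have lJ: "\<And>j. j \<in> Sigma I (\<lambda>i. {..<m i}) ==> 0 < l (fst j)" using lm(1) by auto
 show ?thesis
 proof (rule separated_centers[where l = "\<lambda>j. l (fst j)", OF fJ lJ M])
  fix c :: "'i \<times> nat => real ^ 'n"
  assume c: "\<And>j j' x y. j \<in> Sigma I (\<lambda>i. {..<m i}) ==> j' \<in> Sigma I (\<lambda>i. {..<m i}) ==> j \<noteq> j' ==>
    x \<in> hull3 (c j) (l (fst j)) ==> y \<in> hull3 (c j') (l (fst j')) ==> M * l (fst j) < norm (x - y)"
  show ?thesis
  proof (rule that[of t l m c], unfold_locales)
   fix i assume i: "i \<in> I"
   show "l i ^ k \<le> t * a i / b i" unfolding Lk[OF i, symmetric] using lm(1,2)[OF i] by (intro power_mono) auto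
   show "t * a i / b i \<le> 2 ^ k * l i ^ k"
    unfolding Lk[OF i, symmetric] power_mult_distrib[symmetric] using lm(3)[OF i] L0[OF i] by (intro power_mono) auto
   show "emeasure lborel (E i) = ennreal (real (m i) * l i ^ CARD('n))" by (simp add: \<mu>E[OF i] lm(4)[OF i])
  qed (use I E dE a b t0 lm(1) M c in auto)
 qed
qed

section \<open>The function carried by a configuration of cubes\<close>

context bump_configuration
begin

definition J where "J = Sigma I (\<lambda>i. {..<m i})"
text \<open>For each v in \<open>shifts\<close> these unions are disjoint in i and have the measures
  of the \<open>E i\<close>, so they are a rearrangement of that family. v = 0 gives the cores of
  the bumps, and all v together cover their supports.\<close>

definition cubes where "cubes v i = (\<Union>r<m i. hcube (c (i, r) + l i *\<^sub>R v) (l i))"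
definition fn where "fn x = (\<Sum>j\<in>J. (t * a (fst j)) * bump (l (fst j)) (c j) (\<lambda>_. 0) x)"

lemma J: "finite J" unfolding J_def using I by simp

lemma lJ: "j \<in> J ==> 0 < l (fst j)" using l by (auto simp: J_def)

lemma hull3_disjoint:
 assumes "j \<in> J" "j' \<in> J" "x \<in> hull3 (c j) (l (fst j))" "x \<in> hull3 (c j') (l (fst j'))" shows "j = j'"
proof (rule ccontr)
 assume "j \<noteq> j'"
 from sep[OF assms(1,2)[unfolded J_def] this assms(3,4)] have "M * l (fst j) < 0" by simp
 moreover have "0 \<le> M * l (fst j)" using M lJ[OF assms(1)] by simp
 ultimately show False by simp
qed

lemma cubes_hull3:
 assumes "i \<in> I" "v \<in> shifts" "r < m i" "x \<in> hcube (c (i, r) + l i *\<^sub>R v) (l i)"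
 shows "(i, r) \<in> J" "x \<in> hull3 (c (i, r)) (l (fst (i, r)))"
proof -
 show "(i, r) \<in> J" using assms by (simp add: J_def)
 show "x \<in> hull3 (c (i, r)) (l (fst (i, r)))"
  using hcube_subset_hull3[OF l[OF assms(1)] assms(2), of "c (i, r)"] assms(4) by auto
qed

lemma cubes_measurable: "cubes v i \<in> sets borel"
 unfolding cubes_def by (intro sets.finite_UN) auto

lemma hcubes_same:
 assumes "v \<in> shifts" "i \<in> I" "r < m i" "x \<in> hcube (c (i, r) + l i *\<^sub>R v) (l i)"
  "i' \<in> I" "r' < m i'" "x \<in> hcube (c (i', r') + l i' *\<^sub>R v) (l i')"
 shows "i = i' \<and> r = r'"
 using hull3_disjoint[OF cubes_hull3(1)[OF assms(2,1,3,4)] cubes_hull3(1)[OF assms(5,1,6,7)]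
  cubes_hull3(2)[OF assms(2,1,3,4)] cubes_hull3(2)[OF assms(5,1,6,7)]] by simp

lemma cubes_disjoint: "v \<in> shifts ==> disjoint_family_on (cubes v) I"
 unfolding disjoint_family_on_def cubes_def by (auto dest: hcubes_same)

lemma hcubes_disjoint:
 assumes "i \<in> I" "v \<in> shifts" shows "disjoint_family_on (\<lambda>r. hcube (c (i, r) + l i *\<^sub>R v) (l i)) {..<m i}"
 unfolding disjoint_family_on_def using assms by (auto dest: hcubes_same)

lemma emeasure_cubes:
 assumes "i \<in> I" "v \<in> shifts" shows "emeasure lborel (cubes v i) = emeasure lborel (E i)"
proof -
 have "emeasure lborel (cubes v i) = (\<Sum>r<m i. emeasure lborel (hcube (c (i, r) + l i *\<^sub>R v) (l i)))"
  unfolding cubes_def by (rule sum_emeasure[symmetric]) (use hcubes_disjoint[OF assms] in auto)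
 also have "\<dots> = (\<Sum>r<m i. ennreal (l i ^ CARD('n)))" by (simp add: emeasure_hcube[OF l[OF assms(1)]])
 also have "\<dots> = ennreal (real (m i) * l i ^ CARD('n))"
  using l[OF assms(1)] by (simp add: ennreal_mult ennreal_of_nat_eq_real_of_nat)
 finally show ?thesis using vol[OF assms(1)] by simp
qed

lemma indicator_cubes:
 assumes "i \<in> I" "v \<in> shifts"
 shows "indicator (cubes v i) x = (\<Sum>r<m i. indicator (hcube (c (i, r) + l i *\<^sub>R v) (l i)) x :: real)"
 unfolding cubes_def by (rule indicator_UN_disjoint) (use hcubes_disjoint[OF assms] in auto)

text \<open>Each hull is covered by the translates of its core; regrouping by shifts collects the
  translates into the sets \<open>cubes v i\<close>.\<close>

lemma hull3_sum_le_cubes: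
 assumes w: "\<And>i. i \<in> I ==> 0 \<le> w i"
 shows "(\<Sum>j\<in>J. w (fst j) * indicator (hull3 (c j) (l (fst j))) x) \<le> (\<Sum>v\<in>shifts. \<Sum>i\<in>I. w i * indicator (cubes v i) x :: real)"
proof -
 have "(\<Sum>j\<in>J. w (fst j) * indicator (hull3 (c j) (l (fst j))) x)
   \<le> (\<Sum>j\<in>J. w (fst j) * (\<Sum>v\<in>shifts. indicator (hcube (c j + l (fst j) *\<^sub>R v) (l (fst j))) x))"
 proof (intro sum_mono mult_left_mono)
  fix j assume j: "j \<in> J"
  show "0 \<le> w (fst j)" using j w by (auto simp: J_def)
  show "indicator (hull3 (c j) (l (fst j))) x \<le> (\<Sum>v\<in>shifts. indicator (hcube (c j + l (fst j) *\<^sub>R v) (l (fst j))) x :: real)"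
  proof (cases "x \<in> hull3 (c j) (l (fst j))")
   case True
   then obtain v where v: "v \<in> shifts" "x \<in> hcube (c j + l (fst j) *\<^sub>R v) (l (fst j))"
    using hull3_cover[OF lJ[OF j]] by blast
   have "indicator (hcube (c j + l (fst j) *\<^sub>R v) (l (fst j))) x \<le> (\<Sum>v\<in>shifts. indicator (hcube (c j + l (fst j) *\<^sub>R v) (l (fst j))) x :: real)"
    by (rule member_le_sum[OF v(1)]) (auto simp: finite_shifts)
   thus ?thesis using v(2) True by simp
  qed (simp add: sum_nonneg)
 qed
 also have "\<dots> = (\<Sum>v\<in>shifts. \<Sum>j\<in>J. w (fst j) * indicator (hcube (c j + l (fst j) *\<^sub>R v) (l (fst j))) x)"
  by (simp only: sum_distrib_left) (rule sum.swap)
 also have "\<dots> = (\<Sum>v\<in>shifts. \<Sum>i\<in>I. w i * indicator (cubes v i) x)"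
 proof (rule sum.cong[OF refl])
  fix v :: "real^'n" assume v: "v \<in> shifts"
  have "(\<Sum>j\<in>J. w (fst j) * indicator (hcube (c j + l (fst j) *\<^sub>R v) (l (fst j))) x)
    = (\<Sum>i\<in>I. \<Sum>r<m i. w i * indicator (hcube (c (i, r) + l i *\<^sub>R v) (l i)) x)"
   unfolding J_def by (subst sum.Sigma[OF I]) (auto simp: split_beta)
  also have "\<dots> = (\<Sum>i\<in>I. w i * indicator (cubes v i) x)"
   by (intro sum.cong refl) (simp add: indicator_cubes[OF _ v] sum_distrib_left)
  finally show "(\<Sum>j\<in>J. w (fst j) * indicator (hcube (c j + l (fst j) *\<^sub>R v) (l (fst j))) x) = (\<Sum>i\<in>I. w i * indicator (cubes v i) x)" .
 qed
 finally show ?thesis .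
qed

text \<open>The hulls have 3^n times the measure of the \<open>E i\<close>, so they are not a
  rearrangement of them. Split by shifts, they give one rearrangement of the simple function for
  each v; the triangle inequality adds these equal norms, whence the factor
  \<open>card shifts\<close>.\<close>

lemma norm_hull3_le:
 fixes N :: "'n fnorm"
 assumes N: "ri_banach_function_space N" and w: "\<And>i. i \<in> I ==> 0 \<le> w i" and D: "0 \<le> D" and g: "g \<in> L0"
  and le: "AE x in lborel. \<bar>g x\<bar> \<le> D * (\<Sum>j\<in>J. w (fst j) * indicator (hull3 (c j) (l (fst j))) x)"
 shows "N g \<le> ennreal (D * real (card (shifts :: (real^'n) set))) * N (\<lambda>x. \<Sum>i\<in>I. w i * indicator (E i) x)"
  and "g \<in> space_of N"
proof -
 note bN = ri_bfn[OF N]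
 have Efin: "emeasure lborel (E i) < \<infinity>" if "i \<in> I" for i using vol[OF that] by simp
 let ?G = "\<lambda>v x. \<Sum>i\<in>I. w i * indicator (cubes v i) x :: real"
 let ?S = "\<lambda>x. \<Sum>i\<in>I. w i * indicator (E i) x :: real"
 have G: "?G v \<in> L0" for v
  by (rule borel_imp_L0) (use cubes_measurable in \<open>intro borel_measurable_sum borel_measurable_times borel_measurable_indicator, auto\<close>)
 have GS: "N (?G v) = N ?S" if "v \<in> shifts" for v
  by (rule ri_simple_eq[OF N I w E Efin dE cubes_measurable cubes_disjoint[OF that] emeasure_cubes[OF _ that]])
 have Gs: "(\<lambda>x. \<Sum>v\<in>V. ?G v x) \<in> L0" for V
  using G unfolding L0_def by (rule borel_measurable_sum)
 have T: "N (\<lambda>x. \<Sum>v\<in>V. ?G v x) \<le> of_nat (card V) * N ?S" if "finite V" "V \<subseteq> shifts" for V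
  using that
 proof (induction V rule: finite_induct)
  case empty
  have z: "(\<lambda>_. 0) \<in> L0" by (rule borel_imp_L0) simp
  have "N (\<lambda>x. 0 * 0) = ennreal \<bar>0\<bar> * N (\<lambda>_. 0)" using bfn_scale[OF bN z, of 0] .
  thus ?case by simp
 next
  case (insert v V)
  have "N (\<lambda>x. \<Sum>v\<in>insert v V. ?G v x) = N (\<lambda>x. ?G v x + (\<Sum>v\<in>V. ?G v x))" using insert.hyps by simp
  also have "\<dots> \<le> N (?G v) + N (\<lambda>x. \<Sum>v\<in>V. ?G v x)" by (rule bfn_triangle[OF bN G Gs])
  also have "\<dots> \<le> N ?S + of_nat (card V) * N ?S" using insert GS by (intro add_mono) auto
  also have "\<dots> = of_nat (card (insert v V)) * N ?S" using insert.hyps by (simp add: distrib_right)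
  finally show ?case .
 qed
 have DG: "(\<lambda>x. D * (\<Sum>v\<in>shifts. ?G v x)) \<in> L0" using Gs[of shifts] unfolding L0_def by simp
 have "N g \<le> N (\<lambda>x. D * (\<Sum>v\<in>shifts. ?G v x))"
 proof (rule bfn_mono[OF bN DG g])
  show "AE x in lborel. \<bar>g x\<bar> \<le> \<bar>D * (\<Sum>v\<in>shifts. ?G v x)\<bar>"
   using le
  proof eventually_elim
   case (elim x)
   have "D * (\<Sum>j\<in>J. w (fst j) * indicator (hull3 (c j) (l (fst j))) x) \<le> D * (\<Sum>v\<in>shifts. ?G v x)"
    using D w by (intro mult_left_mono hull3_sum_le_cubes) auto
   thus ?case using elim by linarith
  qed
 qed
 also have "\<dots> = ennreal D * N (\<lambda>x. \<Sum>v\<in>shifts. ?G v x)" using bfn_scale[OF bN Gs, of D] D by simp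
 also have "\<dots> \<le> ennreal D * (of_nat (card (shifts :: (real^'n) set)) * N ?S)"
  by (intro mult_left_mono T finite_shifts) auto
 also have "\<dots> = ennreal (D * real (card (shifts :: (real^'n) set))) * N ?S"
  using D by (simp add: ennreal_mult ennreal_of_nat_eq_real_of_nat mult.assoc)
 finally show 1: "N g \<le> ennreal (D * real (card (shifts :: (real^'n) set))) * N ?S" .
 have "(\<lambda>x. \<Sum>i\<in>I. \<bar>w i * indicator (E i) x\<bar>) = ?S" using w by (intro ext sum.cong) auto
 moreover have "(\<lambda>x. \<Sum>i\<in>I. \<bar>w i * indicator (E i) x\<bar>) \<in> space_of N" by (rule ri_simple_space[OF N I]) (use E Efin in auto)
 ultimately have "?S \<in> space_of N" by (simp only:)
 hence "ennreal (D * real (card (shifts :: (real^'n) set))) * N ?S < \<infinity>"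
  by (auto simp: space_of_def ennreal_mult_less_top)
 thus "g \<in> space_of N" using 1 g by (auto simp: space_of_def)
qed

lemma bump_sum_bound:
 assumes K: "0 \<le> K" "\<And>l c (x::real^'n). 0 < l ==> \<bar>bump l c \<alpha> x\<bar> \<le> K * (1 / l) ^ (\<Sum>i\<in>UNIV. \<alpha> i)"
 shows "\<bar>\<Sum>j\<in>J. (t * a (fst j)) * bump (l (fst j)) (c j) \<alpha> x\<bar>
   \<le> K * (\<Sum>j\<in>J. (t * a (fst j) * (1 / l (fst j)) ^ (\<Sum>i\<in>UNIV. \<alpha> i)) * indicator (hull3 (c j) (l (fst j))) x)"
proof -
 have "\<bar>\<Sum>j\<in>J. (t * a (fst j)) * bump (l (fst j)) (c j) \<alpha> x\<bar> \<le> (\<Sum>j\<in>J. \<bar>(t * a (fst j)) * bump (l (fst j)) (c j) \<alpha> x\<bar>)"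
  by (rule sum_abs)
 also have "\<dots> \<le> (\<Sum>j\<in>J. K * ((t * a (fst j) * (1 / l (fst j)) ^ (\<Sum>i\<in>UNIV. \<alpha> i)) * indicator (hull3 (c j) (l (fst j))) x))"
 proof (rule sum_mono)
  fix j assume j: "j \<in> J"
  have ta: "0 < t * a (fst j)" using j t a by (auto simp: J_def)
  show "\<bar>(t * a (fst j)) * bump (l (fst j)) (c j) \<alpha> x\<bar> \<le> K * ((t * a (fst j) * (1 / l (fst j)) ^ (\<Sum>i\<in>UNIV. \<alpha> i)) * indicator (hull3 (c j) (l (fst j))) x)"
  proof (cases "x \<in> hull3 (c j) (l (fst j))")
   case True
   have "\<bar>(t * a (fst j)) * bump (l (fst j)) (c j) \<alpha> x\<bar> = t * a (fst j) * \<bar>bump (l (fst j)) (c j) \<alpha> x\<bar>"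
    by (simp only: abs_mult[of "t * a (fst j)"] abs_of_pos[OF ta])
   also have "\<dots> \<le> t * a (fst j) * (K * (1 / l (fst j)) ^ (\<Sum>i\<in>UNIV. \<alpha> i))"
    using ta by (intro mult_left_mono K lJ j) auto
   also have "\<dots> = K * ((t * a (fst j) * (1 / l (fst j)) ^ (\<Sum>i\<in>UNIV. \<alpha> i)) * indicator (hull3 (c j) (l (fst j))) x)"
    using True by simp
   finally show ?thesis .
  next
   case False
   hence "bump (l (fst j)) (c j) \<alpha> x = 0" using bump_support_hull3 lJ[OF j] by blast
   thus ?thesis using False by simp
  qed
 qed
 finally show ?thesis by (simp only: sum_distrib_left)
qed

lemma fn_borel: "fn \<in> borel_fun"
 unfolding fn_def[abs_def] using lJ by (intro borel_measurable_sum borel_measurable_times borel_measurable_continuous_onI bump_continuous continuous_on_const)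

lemma fn_bound:
 assumes K: "0 \<le> K" "\<And>l c (x::real^'n). 0 < l ==> \<bar>bump l c (\<lambda>_. 0) x\<bar> \<le> K"
 shows "\<bar>fn x\<bar> \<le> (K * t) * (\<Sum>j\<in>J. a (fst j) * indicator (hull3 (c j) (l (fst j))) x)"
 using bump_sum_bound[of K "\<lambda>_. 0" x] K by (simp add: fn_def sum_distrib_left mult_ac)

lemma fn_space:
 fixes N :: "'n fnorm"
 assumes N: "ri_banach_function_space N" and K: "0 \<le> K" "\<And>l c (x::real^'n). 0 < l ==> \<bar>bump l c (\<lambda>_. 0) x\<bar> \<le> K"
 shows "N fn \<le> ennreal (K * t * real (card (shifts :: (real^'n) set))) * N (\<lambda>x. \<Sum>i\<in>I. a i * indicator (E i) x)"
  and "fn \<in> space_of N"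
proof -
 have a0: "\<And>i. i \<in> I ==> 0 \<le> a i" using a by (auto intro: less_imp_le)
 have Kt: "0 \<le> K * t" using K t by simp
 have le: "AE x in lborel. \<bar>fn x\<bar> \<le> (K * t) * (\<Sum>j\<in>J. a (fst j) * indicator (hull3 (c j) (l (fst j))) x)"
  using fn_bound[OF K] by simp
 note * = norm_hull3_le[OF N a0 Kt borel_imp_L0[OF fn_borel] le]
 show "N fn \<le> ennreal (K * t * real (card (shifts :: (real^'n) set))) * N (\<lambda>x. \<Sum>i\<in>I. a i * indicator (E i) x)"
  by (rule *(1))
 show "fn \<in> space_of N" by (rule *(2))
qed

lemma fn_grad:
 fixes N :: "'n fnorm"
 assumes N: "ri_banach_function_space N" and K: "\<And>\<alpha>. 0 \<le> K \<alpha>"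
  "\<And>\<alpha> l c (x::real^'n). 0 < l ==> \<bar>bump l c \<alpha> x\<bar> \<le> K \<alpha> * (1 / l) ^ (\<Sum>i\<in>UNIV. \<alpha> i)"
 shows "N (grad_norm k fn) \<le> ennreal ((\<Sum>\<alpha>\<in>multi_indices k. K \<alpha> * 2 ^ k) * real (card (shifts :: (real^'n) set))) * N (\<lambda>x. \<Sum>i\<in>I. b i * indicator (E i) x)"
  and "fn \<in> homogeneous_sobolev k N"
proof -
 let ?D = "\<lambda>\<alpha> x. \<Sum>j\<in>J. (t * a (fst j)) * bump (l (fst j)) (c j) \<alpha> x"
 let ?H = "\<lambda>x. \<Sum>j\<in>J. b (fst j) * indicator (hull3 (c j) (l (fst j))) x :: real"
 have b0: "\<And>i. i \<in> I ==> 0 \<le> b i" using b by (auto intro: less_imp_le)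
 have wd: "has_weak_deriv fn \<alpha> (?D \<alpha>)" for \<alpha>
  unfolding fn_def[abs_def] by (rule bump_sum_weak_deriv(1)[OF J lJ])
 have L1: "?D \<alpha> \<in> L1_loc" for \<alpha> by (rule bump_sum_weak_deriv(2)[OF J lJ])
 have D_le: "\<bar>?D \<alpha> x\<bar> \<le> (K \<alpha> * 2 ^ k) * ?H x" if \<alpha>: "\<alpha> \<in> multi_indices k" for \<alpha> x
 proof -
  have s: "(\<Sum>i\<in>UNIV. \<alpha> i) = k" using \<alpha> by (simp add: multi_indices_def)
  have "\<bar>?D \<alpha> x\<bar> \<le> K \<alpha> * (\<Sum>j\<in>J. (t * a (fst j) * (1 / l (fst j)) ^ k) * indicator (hull3 (c j) (l (fst j))) x)"
   using bump_sum_bound[OF K(1) K(2), of \<alpha> x] unfolding s .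
  also have "\<dots> \<le> K \<alpha> * (\<Sum>j\<in>J. (2 ^ k * b (fst j)) * indicator (hull3 (c j) (l (fst j))) x)"
  proof (intro mult_left_mono sum_mono mult_right_mono K(1))
   fix j assume "j \<in> J"
   hence i: "fst j \<in> I" by (auto simp: J_def)
   \<comment> \<open>A k-th derivative of a bump of height t a and side l has size t a / l^k, which
     \<open>l_lower\<close> compares with b.\<close>
   have "t * a (fst j) \<le> 2 ^ k * l (fst j) ^ k * b (fst j)" using l_lower[OF i] b[OF i] by (simp add: field_simps)
   thus "t * a (fst j) * (1 / l (fst j)) ^ k \<le> 2 ^ k * b (fst j)" using l[OF i] by (simp add: field_simps)
  qed simp
  also have "\<dots> = (K \<alpha> * 2 ^ k) * ?H x" by (simp add: sum_distrib_left mult_ac)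
  finally show ?thesis .
 qed
 have "?D \<alpha> \<in> space_of N" if \<alpha>: "\<alpha> \<in> multi_indices k" for \<alpha>
 proof (rule norm_hull3_le(2)[OF N b0])
  show "0 \<le> K \<alpha> * 2 ^ k" using K by simp
  show "?D \<alpha> \<in> L0" by (rule L1_locD[OF L1])
  show "AE x in lborel. \<bar>?D \<alpha> x\<bar> \<le> (K \<alpha> * 2 ^ k) * ?H x" using D_le[OF \<alpha>] by simp
 qed
 moreover have "fn \<in> L1_loc" using L1[of "\<lambda>_. 0"] unfolding fn_def[abs_def] .
 ultimately show hs: "fn \<in> homogeneous_sobolev k N" using wd unfolding homogeneous_sobolev_def by blast
 note gw = homogeneous_sobolev_weak_deriv[OF hs]
 show "N (grad_norm k fn) \<le> ennreal ((\<Sum>\<alpha>\<in>multi_indices k. K \<alpha> * 2 ^ k) * real (card (shifts :: (real^'n) set))) * N (\<lambda>x. \<Sum>i\<in>I. b i * indicator (E i) x)"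
 proof (rule norm_hull3_le(1)[OF N b0])
  show "0 \<le> (\<Sum>\<alpha>\<in>multi_indices k. K \<alpha> * 2 ^ k)" using K by (intro sum_nonneg) auto
  show "grad_norm k fn \<in> L0" by (rule grad_norm_L0[OF gw])
  have "AE x in lborel. \<forall>\<alpha>\<in>multi_indices k. weak_deriv \<alpha> fn x = ?D \<alpha> x"
   using weak_deriv_unique[OF gw wd] by (subst AE_finite_all[OF finite_multi_indices]) auto
  thus "AE x in lborel. \<bar>grad_norm k fn x\<bar> \<le> (\<Sum>\<alpha>\<in>multi_indices k. K \<alpha> * 2 ^ k) * ?H x"
  proof eventually_elim
   case (elim x)
   have "\<bar>grad_norm k fn x\<bar> \<le> (\<Sum>\<alpha>\<in>multi_indices k. \<bar>weak_deriv \<alpha> fn x\<bar>)"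
    using grad_norm_bounds(2,3)[of k fn x] by simp
   also have "\<dots> \<le> (\<Sum>\<alpha>\<in>multi_indices k. (K \<alpha> * 2 ^ k) * ?H x)" using elim D_le by (intro sum_mono) auto
   also have "\<dots> = (\<Sum>\<alpha>\<in>multi_indices k. K \<alpha> * 2 ^ k) * ?H x" by (rule sum_distrib_right[symmetric])
   finally show ?case .
  qed
 qed
qed

text \<open>The oscillation is estimated with c = 0 by the sup norm. The hulls are disjoint and the
  heights satisfy a_i \<le> 1, so the sup norm is at most K t.\<close>

lemma fn_bmo:
 assumes K: "0 \<le> K" "\<And>l c (x::real^'n). 0 < l ==> \<bar>bump l c (\<lambda>_. 0) x\<bar> \<le> K" and a1: "\<And>i. i \<in> I ==> a i \<le> 1"
 shows "bmo_norm fn \<le> ennreal (K * t)"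
proof -
 have "(\<Sum>j\<in>J. a (fst j) * indicator (hull3 (c j) (l (fst j))) x) \<le> (1::real)" for x
 proof (cases "\<exists>j\<in>J. x \<in> hull3 (c j) (l (fst j))")
  case True
  then obtain j where j: "j \<in> J" "x \<in> hull3 (c j) (l (fst j))" by blast
  have "(\<Sum>j\<in>J. a (fst j) * indicator (hull3 (c j) (l (fst j))) x) = (\<Sum>j'\<in>J. if j' = j then a (fst j) else 0)"
  proof (rule sum.cong[OF refl])
   fix j' assume j': "j' \<in> J"
   show "a (fst j') * indicator (hull3 (c j') (l (fst j'))) x = (if j' = j then a (fst j) else 0)"
   proof (cases "j' = j")
    case False
    hence "x \<notin> hull3 (c j') (l (fst j'))" using hull3_disjoint[OF j(1) j' j(2)] by blast
    thus ?thesis using False by simp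
   qed (use j in simp)
  qed
  also have "\<dots> = a (fst j)" using J j by simp
  also have "\<dots> \<le> 1" using a1 j(1) by (auto simp: J_def)
  finally show ?thesis .
 next
  case False
  hence "(\<Sum>j\<in>J. a (fst j) * indicator (hull3 (c j) (l (fst j))) x) = 0" by (intro sum.neutral) auto
  thus ?thesis by simp
 qed
 hence bd: "\<bar>fn x\<bar> \<le> K * t" for x
  using fn_bound[OF K, of x] mult_left_mono[of _ 1 "K * t"] K(1) t by (fastforce intro: order_trans)
 show ?thesis unfolding bmo_norm_def
 proof (rule SUP_least, clarify)
  fix x0 :: "real^'n" and r :: real assume r: "0 < r"
  let ?Q = "cbox x0 (x0 + r *\<^sub>R One)"
  have le: "\<And>b. b \<in> Basis ==> x0 \<bullet> b \<le> (x0 + r *\<^sub>R One) \<bullet> b" using r by (simp add: inner_add_left)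
  have Q: "emeasure lebesgue ?Q = ennreal (r ^ DIM(real^'n))"
   using emeasure_lborel_cbox[OF le] r by (simp add: emeasure_completion main_part_sets)
  have "(\<integral>\<^sup>+x\<in>?Q. ennreal \<bar>fn x - 0\<bar> \<partial>lebesgue) \<le> (\<integral>\<^sup>+x. ennreal (K * t) * indicator ?Q x \<partial>lebesgue)"
   using bd by (intro nn_integral_mono) (auto simp: indicator_def ennreal_leI)
  also have "\<dots> = ennreal (K * t) * emeasure lebesgue ?Q" by (rule nn_integral_cmult_indicator) simp
  finally have "(\<integral>\<^sup>+x\<in>?Q. ennreal \<bar>fn x - 0\<bar> \<partial>lebesgue) / emeasure lebesgue ?Q \<le> ennreal (K * t)"
   unfolding Q using r by (intro divide_le_posI_ennreal) (auto simp: mult.commute ennreal_less_zero_iff)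
  thus "(INF c. (\<integral>\<^sup>+x\<in>?Q. ennreal \<bar>fn x - c\<bar> \<partial>lebesgue) / emeasure lebesgue ?Q) \<le> ennreal (K * t)"
   by (rule INF_lower2[OF UNIV_I])
 qed
qed

text \<open>On the cores D f is at least of order t a l^(-s k), and l^k \<le> t a / b turns this
  into t^(1-s) a^(1-s) b^s. The cores rearrange the family \<open>E\<close>, so the norm may be
  computed over \<open>E\<close>. Unless D f is finite almost everywhere, the right side is
  infinite.\<close>

lemma fn_frac_diff_lower:
 assumes s: "0 < s" and C: "0 < C" "\<And>j x. j \<in> J ==> x \<in> hcube (c j) (l (fst j)) ==>
   ennreal (C * (t * a (fst j) * l (fst j) powr (- (s * real k)))) \<le> frac_diff s k q fn x"
  and q: "1 \<le> q"
  and N: "ri_banach_function_space N"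
 shows "N (\<lambda>x. \<Sum>i\<in>I. a i powr (1 - s) * b i powr s * indicator (E i) x) * ennreal (C * t powr (1 - s))
   \<le> extended_norm N (frac_diff s k q fn)"
proof (cases "AE x in lebesgue. frac_diff s k q fn x < \<infinity>")
 case True
 note bN = ri_bfn[OF N]
 have Efin: "emeasure lborel (E i) < \<infinity>" if "i \<in> I" for i using vol[OF that] by simp
 let ?w = "\<lambda>i. a i powr (1 - s) * b i powr s"
 let ?S = "\<lambda>A x. \<Sum>i\<in>I. ?w i * indicator (A i) x :: real"
 have eq: "N (?S (cubes 0)) = N (?S E)"
  by (rule ri_simple_eq[OF N I _ E Efin dE cubes_measurable cubes_disjoint[OF zero_in_shifts] emeasure_cubes[OF _ zero_in_shifts]]) simp
 have SL: "?S (cubes 0) \<in> L0"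
  by (rule borel_imp_L0) (use cubes_measurable in \<open>intro borel_measurable_sum borel_measurable_times borel_measurable_indicator, auto\<close>)
 have C0: "0 \<le> C * t powr (1 - s)" using C by simp
 have pt: "ennreal (C * t powr (1 - s) * ?S (cubes 0) x) \<le> frac_diff s k q fn x" for x
 proof (cases "\<exists>i\<in>I. x \<in> cubes 0 i")
  case True
  then obtain i where i: "i \<in> I" "x \<in> cubes 0 i" by blast
  then obtain r where r: "r < m i" "x \<in> hcube (c (i, r)) (l i)" by (auto simp: cubes_def)
  have ir: "(i, r) \<in> J" using i r by (simp add: J_def)
  have "?S (cubes 0) x = (\<Sum>i'\<in>I. if i' = i then ?w i else 0)"
   using cubes_disjoint[OF zero_in_shifts] i by (intro sum.cong) (auto simp: disjoint_family_on_def indicator_def)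
  hence S: "?S (cubes 0) x = ?w i" using I i(1) by simp
  have "(t * a i / b i) powr (- s) \<le> (l i ^ k) powr (- s)"
   using l_upper[OF i(1)] l[OF i(1)] s by (intro powr_mono2') auto
  also have "(l i ^ k) powr (- s) = l i powr (- (s * real k))"
   using l[OF i(1)] by (simp add: powr_realpow[symmetric] powr_powr mult.commute)
  finally have "C * (t * a i * (t * a i / b i) powr (- s)) \<le> C * (t * a i * l i powr (- (s * real k)))"
   using C t a[OF i(1)] by (intro mult_left_mono) auto
  moreover have "t * a i * (t * a i / b i) powr (- s) = t powr (1 - s) * ?w i"
  proof -
   have p1: "z * z powr (- s) = z powr (1 - s)" if "0 < z" for z :: real
    using powr_add[of z 1 "- s"] that by simp
   have "(t * a i / b i) powr (- s) = t powr (- s) * a i powr (- s) * b i powr s"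
    using t a[OF i(1)] b[OF i(1)] by (simp add: powr_mult powr_divide powr_minus_divide)
   hence "t * a i * (t * a i / b i) powr (- s) = (t * t powr (- s)) * ((a i * a i powr (- s)) * b i powr s)"
    by (simp only: mult_ac)
   thus ?thesis unfolding p1[OF t] p1[OF a[OF i(1)]] .
  qed
  ultimately have "C * t powr (1 - s) * ?S (cubes 0) x \<le> C * (t * a i * l i powr (- (s * real k)))"
   unfolding S by (simp add: mult.assoc)
  hence "ennreal (C * t powr (1 - s) * ?S (cubes 0) x) \<le> ennreal (C * (t * a i * l i powr (- (s * real k))))"
   by (rule ennreal_leI)
  also have "\<dots> \<le> frac_diff s k q fn x" using C(2)[OF ir, of x] r(2) by simp
  finally show ?thesis .
 next
  case False
  hence "?S (cubes 0) x = 0" by (intro sum.neutral) auto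
  thus ?thesis by simp
 qed
 have fL: "(\<lambda>x. enn2real (frac_diff s k q fn x)) \<in> L0"
  using frac_diff_L0[OF borel_imp_L0[OF fn_borel]] by simp
 have "N (?S E) * ennreal (C * t powr (1 - s)) = N (\<lambda>x. C * t powr (1 - s) * ?S (cubes 0) x)"
  by (rule trans[OF mult.commute bfn_scale[OF bN SL, of "C * t powr (1 - s)", unfolded abs_of_nonneg[OF C0] eq, symmetric]])
 also have "\<dots> \<le> N (\<lambda>x. enn2real (frac_diff s k q fn x))"
 proof (rule bfn_mono[OF bN fL])
  show "(\<lambda>x. C * t powr (1 - s) * ?S (cubes 0) x) \<in> L0"
   unfolding L0_def by (rule borel_measurable_times[OF borel_measurable_const SL[unfolded L0_def]])
  show "AE x in lborel. \<bar>C * t powr (1 - s) * ?S (cubes 0) x\<bar> \<le> \<bar>enn2real (frac_diff s k q fn x)\<bar>"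
   using True unfolding AE_completion_iff
  proof eventually_elim
   case (elim x)
   have S0: "0 \<le> C * t powr (1 - s) * ?S (cubes 0) x" by (rule mult_nonneg_nonneg[OF C0 sum_nonneg]) simp
   have "enn2real (ennreal (C * t powr (1 - s) * ?S (cubes 0) x)) \<le> enn2real (frac_diff s k q fn x)"
    by (rule enn2real_mono[OF pt]) (use elim in simp)
   thus ?case using S0 by simp
  qed
 qed
 finally show ?thesis using True by (simp add: extended_norm_def)
qed (simp add: extended_norm_def)

end

text \<open>The factor \<open>t\<close> shrinks the bumps; it is arbitrarily small, but the interpolation inequality is
 homogeneous in it.\<close>

definition extremal :: "real => nat => real => real => (real ^ 'n::finite => real) => (real ^ 'n => real) => (real ^ 'n => real) => bool" where
 "extremal s k q K F G H \<longleftrightarrow> (\<exists>t>0. \<exists>f\<in>L1_loc.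
   (\<forall>N. ri_banach_function_space N \<longrightarrow> f \<in> space_of N \<and> N f \<le> ennreal (K * t) * N F) \<and>
   (\<forall>N. ri_banach_function_space N \<longrightarrow> f \<in> homogeneous_sobolev k N \<and> N (grad_norm k f) \<le> ennreal K * N G) \<and>
   (\<forall>N. ri_banach_function_space N \<longrightarrow> N H * ennreal (t powr (1 - s)) \<le> ennreal K * extended_norm N (frac_diff s k q f)) \<and>
   ((\<forall>x. F x \<le> 1) \<longrightarrow> bmo_norm f \<le> ennreal (K * t)))"

lemma extremal_function:
 fixes s q :: real
 assumes k: "0 < k" and s: "0 < s" and q: "1 \<le> q"
 shows "\<exists>K>0. \<forall>(I :: 'i set) (E :: 'i => (real ^ 'n::finite) set) a b.
  finite I \<and> disjoint_family_on E I \<and>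
  (\<forall>i\<in>I. E i \<in> sets borel \<and> 0 < a i \<and> 0 < b i \<and> 0 < emeasure lborel (E i) \<and> emeasure lborel (E i) < \<infinity>) \<longrightarrow>
  extremal s k q K (\<lambda>x. \<Sum>i\<in>I. a i * indicator (E i) x) (\<lambda>x. \<Sum>i\<in>I. b i * indicator (E i) x)
   (\<lambda>x. \<Sum>i\<in>I. a i powr (1 - s) * b i powr s * indicator (E i) x)"
proof -
 let ?M = "6 * real CARD('n) * real k"
 let ?c = "real (card (shifts :: (real^'n) set))"
 obtain C where C: "0 < C" "\<And>(J::('i \<times> nat) set) a l (c :: 'i \<times> nat => real ^ 'n::finite) j x.
   finite J ==> (\<And>j. j \<in> J ==> 0 < l j) ==> (\<And>j. j \<in> J ==> 0 \<le> a j) ==>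
   (\<And>j j' x y. j \<in> J ==> j' \<in> J ==> j \<noteq> j' ==> x \<in> hull3 (c j) (l j) ==> y \<in> hull3 (c j') (l j') ==> 6 * real CARD('n) * real k * l j < norm (x - y)) ==>
   j \<in> J ==> x \<in> hcube (c j) (l j) ==>
   ennreal (C * (a j * l j powr (- (s * real k)))) \<le> frac_diff s k q (\<lambda>x. \<Sum>j\<in>J. a j * bump (l j) (c j) (\<lambda>_. 0) x) x"
  using bump_sum_frac_diff_lower[OF k s q, where 'j = "'i \<times> nat" and 'n = 'n] by blast
 have "\<forall>\<alpha> :: 'n => nat. \<exists>K>0. \<forall>l c x. 0 < l \<longrightarrow> \<bar>bump l c \<alpha> x\<bar> \<le> K * (1 / l) ^ (\<Sum>i\<in>UNIV. \<alpha> i)"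
  using bump_bounded by metis
 then obtain B :: "('n => nat) => real" where B: "\<And>\<alpha>. 0 < B \<alpha>" "\<And>\<alpha> l c x. 0 < l ==> \<bar>bump l c \<alpha> x\<bar> \<le> B \<alpha> * (1 / l) ^ (\<Sum>i\<in>UNIV. \<alpha> i)"
  by metis
 have B0: "\<And>\<alpha>. 0 \<le> B \<alpha>" using B(1) by (auto intro: less_imp_le)
 have B1: "\<And>l c (x::real^'n). 0 < l ==> \<bar>bump l c (\<lambda>_. 0) x\<bar> \<le> B (\<lambda>_. 0)" using B(2)[where \<alpha> = "\<lambda>_. 0"] by simp
 define K1 where "K1 = B (\<lambda>_. 0)"
 define K2 where "K2 = (\<Sum>\<alpha>\<in>multi_indices k. B \<alpha> * 2 ^ k) * ?c"
 \<comment> \<open>One constant dominating those of all clauses; it is fixed before the simple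
   functions and does not depend on them.\<close>
 define K where "K = K1 * ?c + K1 + K2 + 1 / C"
 have K1: "0 < K1" using B(1) by (simp add: K1_def)
 have K2: "0 \<le> K2" unfolding K2_def using B0 by (intro mult_nonneg_nonneg sum_nonneg) auto
 have K1c: "0 \<le> K1 * ?c" using K1 by simp
 have iC: "0 < 1 / C" using C(1) by simp
 have Kle: "K1 * ?c \<le> K" "K1 \<le> K" "K2 \<le> K" "1 / C \<le> K" "0 < K" using K1 K2 K1c iC unfolding K_def by linarith+
 show ?thesis
 proof (intro exI[of _ K] conjI Kle(5) allI impI)
  fix I :: "'i set" and E :: "'i => (real ^ 'n) set" and a b :: "'i => real"
  assume "finite I \<and> disjoint_family_on E I \<and>
   (\<forall>i\<in>I. E i \<in> sets borel \<and> 0 < a i \<and> 0 < b i \<and> 0 < emeasure lborel (E i) \<and> emeasure lborel (E i) < \<infinity>)"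
  hence *: "finite I" "\<And>i. i \<in> I ==> E i \<in> sets borel" "disjoint_family_on E I" "\<And>i. i \<in> I ==> 0 < a i" "\<And>i. i \<in> I ==> 0 < b i"
   "\<And>i. i \<in> I ==> 0 < emeasure lborel (E i)" "\<And>i. i \<in> I ==> emeasure lborel (E i) < \<infinity>" by auto
  have M: "0 \<le> ?M" by simp
  obtain t l m and c :: "'i \<times> nat => real ^ 'n" where "bump_configuration k ?M I E a b t l m c"
   using bump_configuration_exists[where a = a and b = b and E = E, OF k *(1-5) M *(6,7)] by blast
  then interpret bump_configuration k ?M I E a b t l m c .
  have L1: "fn \<in> L1_loc" using bump_sum_weak_deriv(2)[OF J lJ] unfolding fn_def[abs_def] .
  have taJ: "\<And>j. j \<in> J ==> 0 \<le> t * a (fst j)" using t a by (auto simp: J_def intro!: mult_nonneg_nonneg less_imp_le)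
  have low: "ennreal (C * (t * a (fst j) * l (fst j) powr (- (s * real k)))) \<le> frac_diff s k q fn x"
   if "j \<in> J" "x \<in> hcube (c j) (l (fst j))" for j x
   unfolding fn_def[abs_def] by (rule C(2)[where J = J and c = c and a = "\<lambda>j. t * a (fst j)" and l = "\<lambda>j. l (fst j)", OF J lJ taJ sep[folded J_def] that])
  have 1: "f1 \<in> space_of N \<and> N f1 \<le> ennreal (K * t) * N (\<lambda>x. \<Sum>i\<in>I. a i * indicator (E i) x)"
   if N: "ri_banach_function_space N" and f1: "f1 = fn" for N f1
  proof -
   have "K1 * t * ?c \<le> K * t" using mult_right_mono[OF Kle(1), of t] t by (simp add: mult_ac)
   thus ?thesis using fn_space[OF N B0 B1] unfolding f1 K1_def
    by (meson ennreal_leI mult_right_mono order_trans zero_le)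
  qed
  have 2: "N (grad_norm k fn) \<le> ennreal K * N (\<lambda>x. \<Sum>i\<in>I. b i * indicator (E i) x)"
   if N: "ri_banach_function_space N" for N
   using order_trans[OF fn_grad(1)[OF N B0 B(2)] mult_right_mono[OF ennreal_leI[OF Kle(3)[unfolded K2_def]]]] by simp
  have 3: "N (\<lambda>x. \<Sum>i\<in>I. a i powr (1 - s) * b i powr s * indicator (E i) x) * ennreal (t powr (1 - s))
      \<le> ennreal K * extended_norm N (frac_diff s k q fn)" (is "?X * _ \<le> _ * ?Y") if N: "ri_banach_function_space N" for N
  proof -
   have "?X * ennreal (t powr (1 - s)) = ennreal (1 / C) * (?X * ennreal (C * t powr (1 - s)))"
   proof -
    have "ennreal (t powr (1 - s)) = ennreal (1 / C) * ennreal (C * t powr (1 - s))"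
     using C(1) by (subst ennreal_mult[symmetric]) auto
    thus ?thesis by (simp add: mult_ac)
   qed
   also have "\<dots> \<le> ennreal K * ?Y"
    using fn_frac_diff_lower[OF s C(1) low q N] Kle(4) by (intro mult_mono ennreal_leI) auto
   finally show ?thesis .
  qed
  let ?F = "\<lambda>x. \<Sum>i\<in>I. a i * indicator (E i) x :: real"
  have 4: "bmo_norm fn \<le> ennreal (K * t)" if F1: "\<forall>x. ?F x \<le> 1"
  proof -
   have a1: "a i \<le> 1" if i: "i \<in> I" for i
   proof -
    have "E i \<noteq> {}" using *(6)[OF i] by auto
    then obtain x where x: "x \<in> E i" by blast
    have "a i * indicator (E i) x \<le> ?F x"
     using *(4) by (intro member_le_sum i *(1)) (auto intro: mult_nonneg_nonneg less_imp_le)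
    thus ?thesis using F1[rule_format, of x] x by simp
   qed
   have "bmo_norm fn \<le> ennreal (K1 * t)" unfolding K1_def by (rule fn_bmo[OF B0 B1 a1])
   also have "\<dots> \<le> ennreal (K * t)" using Kle(2) t by (intro ennreal_leI mult_right_mono) auto
   finally show ?thesis .
  qed
  show "extremal s k q K ?F (\<lambda>x. \<Sum>i\<in>I. b i * indicator (E i) x)
   (\<lambda>x. \<Sum>i\<in>I. a i powr (1 - s) * b i powr s * indicator (E i) x)"
   unfolding extremal_def
  proof (intro exI[of _ t] conjI t bexI[OF _ L1] allI impI)
   fix N :: "'n fnorm" assume N: "ri_banach_function_space N"
   show "fn \<in> space_of N" using 1[OF N refl] by blast
   show "N fn \<le> ennreal (K * t) * N ?F" using 1[OF N refl] by blast
   show "fn \<in> homogeneous_sobolev k N" by (rule fn_grad(2)[OF N B0 B(2)])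
   show "N (grad_norm k fn) \<le> ennreal K * N (\<lambda>x. \<Sum>i\<in>I. b i * indicator (E i) x)" by (rule 2[OF N])
   show "N (\<lambda>x. \<Sum>i\<in>I. a i powr (1 - s) * b i powr s * indicator (E i) x) * ennreal (t powr (1 - s))
      \<le> ennreal K * extended_norm N (frac_diff s k q fn)" by (rule 3[OF N])
  next
   assume "\<forall>x. ?F x \<le> 1" thus "bmo_norm fn \<le> ennreal (K * t)" by (rule 4)
  qed
 qed
qed

subsection \<open>Optimality\<close>

text \<open>At a point x only the summand with index (F x, G x) can survive. If this pair is not in
  I, then outside a null set one of the two values is 0, and so is \<open>\<phi>\<close>
  there.\<close>

lemma simple_sum_indicator:
 fixes F G :: "real ^ 'n::finite => real"
 assumes F: "\<And>x. 0 \<le> F x" and G: "\<And>x. 0 \<le> G x" and I: "finite I" "I \<subseteq> {0<..} \<times> {0<..}"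
  and full: "AE x in lborel. 0 < F x \<longrightarrow> 0 < G x \<longrightarrow> (F x, G x) \<in> I"
  and \<phi>: "\<And>u v. u = 0 \<or> v = 0 ==> \<phi> u v = 0"
 shows "AE x in lborel. (\<Sum>i\<in>I. \<phi> (fst i) (snd i) * indicator {x. F x = fst i \<and> G x = snd i} x) = (\<phi> (F x) (G x) :: real)"
 using full
proof eventually_elim
 case (elim x)
 have S: "(\<Sum>i\<in>I. \<phi> (fst i) (snd i) * indicator {x. F x = fst i \<and> G x = snd i} x) = (\<Sum>i\<in>I. if i = (F x, G x) then \<phi> (F x) (G x) else 0)"
  by (intro sum.cong) (auto simp: indicator_def)
 show ?case
 proof (cases "(F x, G x) \<in> I")
  case True thus ?thesis unfolding S using I(1) by simp
 next
  case False
  hence "F x = 0 \<or> G x = 0" using elim F[of x] G[of x] by force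
  hence "\<phi> (F x) (G x) = 0" by (rule \<phi>)
  thus ?thesis unfolding S using I(1) False by simp
 qed
qed

lemma simple_sum_indicator_le:
 fixes F G :: "real ^ 'n::finite => real"
 assumes F: "\<And>x. 0 \<le> F x" "\<And>x. 0 \<le> G x" and I: "finite I"
 shows "(\<Sum>i\<in>I. fst i * indicator {x. F x = fst i \<and> G x = snd i} x) \<le> F x"
  and "(\<Sum>i\<in>I. snd i * indicator {x. F x = fst i \<and> G x = snd i} x) \<le> G x"
proof -
 have "(\<Sum>i\<in>I. fst i * indicator {x. F x = fst i \<and> G x = snd i} x) = (\<Sum>i\<in>I. if i = (F x, G x) then F x else 0)"
  by (intro sum.cong) (auto simp: indicator_def)
 thus "(\<Sum>i\<in>I. fst i * indicator {x. F x = fst i \<and> G x = snd i} x) \<le> F x" using I F by simp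
 have "(\<Sum>i\<in>I. snd i * indicator {x. F x = fst i \<and> G x = snd i} x) = (\<Sum>i\<in>I. if i = (F x, G x) then G x else 0)"
  by (intro sum.cong) (auto simp: indicator_def)
 thus "(\<Sum>i\<in>I. snd i * indicator {x. F x = fst i \<and> G x = snd i} x) \<le> G x" using I F by simp
qed

text \<open>The sets are the joint level sets of F and G on which both are positive; elsewhere
  F^(1-s) G^s vanishes. Null sets among them are dropped, since cubes cannot replace them, and the
  bounded support of F makes the others of finite measure. Dropping pieces only lowers F and G,
  which keeps the upper bounds.\<close>

lemma extremal_function_simple:
 fixes s q :: real
 assumes k: "0 < k" and s: "0 < s" "s < 1" and q: "1 \<le> q"
 shows "\<exists>K>0. \<forall>(F :: real ^ 'n::finite => real) G r. simple_function lborel F \<and> simple_function lborel G \<and>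
  (\<forall>x. 0 \<le> F x) \<and> (\<forall>x. 0 \<le> G x) \<and> (\<forall>x. r \<le> norm x \<longrightarrow> F x = 0) \<longrightarrow>
  extremal s k q K F G (\<lambda>x. F x powr (1 - s) * G x powr s)"
proof -
 obtain K where K0: "0 < K" and K: "\<forall>(I :: (real \<times> real) set) (E :: real \<times> real => (real ^ 'n) set) a b.
  finite I \<and> disjoint_family_on E I \<and>
  (\<forall>i\<in>I. E i \<in> sets borel \<and> 0 < a i \<and> 0 < b i \<and> 0 < emeasure lborel (E i) \<and> emeasure lborel (E i) < \<infinity>) \<longrightarrow>
  extremal s k q K (\<lambda>x. \<Sum>i\<in>I. a i * indicator (E i) x) (\<lambda>x. \<Sum>i\<in>I. b i * indicator (E i) x)
   (\<lambda>x. \<Sum>i\<in>I. a i powr (1 - s) * b i powr s * indicator (E i) x)"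
  using extremal_function[OF k s(1) q, where 'i = "real \<times> real" and 'n = 'n] by blast
 show ?thesis
 proof (intro exI[of _ K] conjI K0 allI impI)
  fix F G :: "real ^ 'n => real" and r
  assume "simple_function lborel F \<and> simple_function lborel G \<and>
   (\<forall>x. 0 \<le> F x) \<and> (\<forall>x. 0 \<le> G x) \<and> (\<forall>x. r \<le> norm x \<longrightarrow> F x = 0)"
  hence sF: "simple_function lborel F" and sG: "simple_function lborel G" and F0: "\<And>x. 0 \<le> F x" and G0: "\<And>x. 0 \<le> G x"
   and supp: "\<And>x. r \<le> norm x ==> F x = 0" by auto
  have Fm[measurable]: "F \<in> borel_fun" using borel_measurable_simple_function[OF sF] by simp
  have Gm[measurable]: "G \<in> borel_fun" using borel_measurable_simple_function[OF sG] by simp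
  define E where "E i = {x. F x = fst i \<and> G x = snd i}" for i :: "real \<times> real"
  have Em: "E i \<in> sets borel" for i unfolding E_def by measurable
  have Em': "E i \<in> sets lborel" for i using Em by simp
  define V where "V = (range F \<times> range G) \<inter> ({0<..} \<times> {0<..})"
  define I where "I = {i \<in> V. 0 < emeasure lborel (E i)}"
  have fin: "finite (range F)" "finite (range G)" using sF sG by (auto simp: simple_function_def)
  have fV: "finite V" unfolding V_def using fin by blast
  have fI: "finite I" unfolding I_def using fV by simp
  have posI: "I \<subseteq> {0<..} \<times> {0<..}" by (auto simp: I_def V_def)
  have Efin: "emeasure lborel (E i) < \<infinity>" if "i \<in> I" for i
  proof -
   have "E i \<subseteq> ball 0 r" using that posI supp by (fastforce simp: E_def not_le)
   hence "emeasure lborel (E i) \<le> emeasure lborel (ball (0::real^'n) r)" by (intro emeasure_mono) auto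
   also have "\<dots> < \<infinity>" using emeasure_lborel_ball_finite by blast
   finally show ?thesis .
  qed
  have full: "AE x in lborel. 0 < F x \<longrightarrow> 0 < G x \<longrightarrow> (F x, G x) \<in> I"
  proof -
   have "AE x in lborel. \<forall>i\<in>V - I. x \<notin> E i"
   proof (subst AE_finite_all)
    show "finite (V - I)" using fV by simp
    have "AE x in lborel. x \<notin> E i" if "i \<in> V - I" for i
    proof -
     have "emeasure lborel (E i) = 0" using that by (simp add: I_def)
     hence "E i \<in> null_sets lborel" by (rule null_setsI[OF _ Em'])
     thus ?thesis by (rule AE_not_in)
    qed
    thus "\<forall>i\<in>V - I. AE x in lborel. x \<notin> E i" by blast
   qed
   thus ?thesis
   proof eventually_elim
    case (elim x)
    show ?case
    proof (intro impI, rule ccontr)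
     assume "0 < F x" "0 < G x" "(F x, G x) \<notin> I"
     hence "(F x, G x) \<in> V - I" by (auto simp: V_def)
     hence "x \<notin> E (F x, G x)" using elim by blast
     thus False by (simp add: E_def)
    qed
   qed
  qed
  have dE: "disjoint_family_on E I" by (auto simp: disjoint_family_on_def E_def prod_eq_iff)
  let ?F = "\<lambda>x. \<Sum>i\<in>I. fst i * indicator (E i) x :: real" and ?G = "\<lambda>x. \<Sum>i\<in>I. snd i * indicator (E i) x :: real"
  let ?H = "\<lambda>x. \<Sum>i\<in>I. fst i powr (1 - s) * snd i powr s * indicator (E i) x :: real"
  have "extremal s k q K ?F ?G ?H"
   by (rule K[rule_format]) (use fI dE Em Efin posI in \<open>auto simp: I_def\<close>)
  then obtain t f where t: "0 < t" and f: "f \<in> L1_loc"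
   and f1: "\<And>N. ri_banach_function_space N ==> f \<in> space_of N \<and> N f \<le> ennreal (K * t) * N ?F"
   and f2: "\<And>N. ri_banach_function_space N ==> f \<in> homogeneous_sobolev k N \<and> N (grad_norm k f) \<le> ennreal K * N ?G"
   and f3: "\<And>N. ri_banach_function_space N ==> N ?H * ennreal (t powr (1 - s))
      \<le> ennreal K * extended_norm N (frac_diff s k q f)"
   and f4: "(\<forall>x. ?F x \<le> 1) ==> bmo_norm f \<le> ennreal (K * t)"
   unfolding extremal_def by blast
  have SL: "(\<lambda>x. \<Sum>i\<in>I. w i * indicator (E i) x) \<in> L0" for w :: "real \<times> real => real"
   by (rule borel_imp_L0) (use Em in \<open>intro borel_measurable_sum borel_measurable_times borel_measurable_indicator, auto\<close>)
  have L: "F \<in> L0" "G \<in> L0" by (auto intro: borel_imp_L0)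
  have leF: "N (\<lambda>x. \<Sum>i\<in>I. fst i * indicator (E i) x) \<le> N F" if "ri_banach_function_space N" for N
  proof (rule bfn_mono[OF ri_bfn[OF that] L(1) SL], rule AE_I2)
   fix x
   have "0 \<le> (\<Sum>i\<in>I. fst i * indicator (E i) x)" using posI by (intro sum_nonneg) (fastforce simp: indicator_def)
   thus "\<bar>\<Sum>i\<in>I. fst i * indicator (E i) x\<bar> \<le> \<bar>F x\<bar>"
    using simple_sum_indicator_le(1)[of F G I x, OF F0 G0 fI] F0[of x] unfolding E_def by simp
  qed
  have leG: "N (\<lambda>x. \<Sum>i\<in>I. snd i * indicator (E i) x) \<le> N G" if "ri_banach_function_space N" for N
  proof (rule bfn_mono[OF ri_bfn[OF that] L(2) SL], rule AE_I2)
   fix x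
   have "0 \<le> (\<Sum>i\<in>I. snd i * indicator (E i) x)" using posI by (intro sum_nonneg) (fastforce simp: indicator_def)
   thus "\<bar>\<Sum>i\<in>I. snd i * indicator (E i) x\<bar> \<le> \<bar>G x\<bar>"
    using simple_sum_indicator_le(2)[of F G I x, OF F0 G0 fI] G0[of x] unfolding E_def by simp
  qed
  have geH: "N (\<lambda>x. F x powr (1 - s) * G x powr s) \<le> N (\<lambda>x. \<Sum>i\<in>I. fst i powr (1 - s) * snd i powr s * indicator (E i) x)"
   if "ri_banach_function_space N" for N
  proof (rule bfn_mono[OF ri_bfn[OF that] SL])
   show "(\<lambda>x. F x powr (1 - s) * G x powr s) \<in> L0" by (rule borel_imp_L0) measurable
   have "AE x in lborel. (\<Sum>i\<in>I. fst i powr (1 - s) * snd i powr s * indicator (E i) x) = F x powr (1 - s) * G x powr s"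
    using simple_sum_indicator[of F G I "\<lambda>u v. u powr (1 - s) * v powr s", OF F0 G0 fI posI full] s unfolding E_def by auto
   thus "AE x in lborel. \<bar>F x powr (1 - s) * G x powr s\<bar> \<le> \<bar>\<Sum>i\<in>I. fst i powr (1 - s) * snd i powr s * indicator (E i) x\<bar>"
    by eventually_elim simp
  qed
  show "extremal s k q K F G (\<lambda>x. F x powr (1 - s) * G x powr s)" unfolding extremal_def
  proof (intro exI[of _ t] conjI t bexI[OF _ f] allI impI)
   fix N :: "'n fnorm" assume N: "ri_banach_function_space N"
   show "f \<in> space_of N" using f1[OF N] by blast
   show "f \<in> homogeneous_sobolev k N" using f2[OF N] by blast
   show "N f \<le> ennreal (K * t) * N F" by (rule order_trans[OF conjunct2[OF f1[OF N]] mult_left_mono[OF leF[OF N]]]) simp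
   show "N (grad_norm k f) \<le> ennreal K * N G" by (rule order_trans[OF conjunct2[OF f2[OF N]] mult_left_mono[OF leG[OF N]]]) simp
   show "N (\<lambda>x. F x powr (1 - s) * G x powr s) * ennreal (t powr (1 - s)) \<le> ennreal K * extended_norm N (frac_diff s k q f)"
    by (rule order_trans[OF mult_right_mono[OF geH[OF N]] f3[OF N]]) simp
  next
   assume "\<forall>x. F x \<le> 1"
   hence "\<forall>x. ?F x \<le> 1"
    using simple_sum_indicator_le(1)[of F G I, OF F0 G0 fI] unfolding E_def by (blast intro: order_trans)
   thus "bmo_norm f \<le> ennreal (K * t)" by (rule f4)
  qed
 qed
qed

lemma simple_function_approx:
 fixes u :: "real ^ 'n::finite => real"
 assumes u: "u \<in> borel_fun" "\<And>x. 0 \<le> u x"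
 obtains F where "\<And>m::nat. simple_function lborel (F m)" "\<And>m x. 0 \<le> F m x" "\<And>m x. F m x \<le> u x"
  "\<And>m x. real m \<le> norm x ==> F m x = 0" "\<And>x. incseq (\<lambda>m. F m x)" "\<And>x. (\<lambda>m. F m x) \<longlonglongrightarrow> u x"
proof -
 have "u \<in> borel_measurable lborel" using u by simp
 then obtain f where f: "incseq f" "\<And>i. simple_function lborel (f i)" "\<And>x. bdd_above (range (\<lambda>i. f i x))"
  "\<And>i x. 0 \<le> f i x" "u = (SUP i. f i)"
  using borel_measurable_implies_simple_function_sequence_real[of u lborel] u(2) by blast
 have ux: "u x = (SUP i. f i x)" for x unfolding f(5) by (simp add: image_image)
 have inc: "incseq (\<lambda>i. f i x)" for x using f(1) by (auto simp: incseq_def le_fun_def)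
 have lim: "(\<lambda>i. f i x) \<longlonglongrightarrow> u x" for x unfolding ux by (rule LIMSEQ_incseq_SUP[OF f(3) inc])
 have le: "f i x \<le> u x" for i x unfolding ux by (rule cSUP_upper[OF UNIV_I f(3)])
 let ?F = "\<lambda>m x. f m x * indicator (ball 0 (real m)) x"
 show ?thesis
 proof (rule that[of ?F])
  fix m show "simple_function lborel (?F m)" by (intro simple_function_mult f(2) simple_function_indicator) auto
 next
  fix m x show "0 \<le> ?F m x" using f(4) by simp
 next
  fix m x show "?F m x \<le> u x" using le u(2) by (simp add: indicator_def)
 next
  fix m and x :: "real^'n" assume "real m \<le> norm x" thus "?F m x = 0" by simp
 next
  fix x
  show "incseq (\<lambda>m. ?F m x)"
  proof (unfold incseq_def, intro allI impI)
   fix m n :: nat assume "m \<le> n"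
   thus "?F m x \<le> ?F n x" using incseqD[OF inc[of x]] f(4)[of n x] by (auto simp: indicator_def)
  qed
 next
  fix x :: "real^'n"
  have "eventually (\<lambda>m. norm x < real m) sequentially"
   using eventually_gt_at_top[of "nat \<lceil>norm x\<rceil>"] by eventually_elim linarith
  hence "eventually (\<lambda>m. f m x = ?F m x) sequentially" by eventually_elim simp
  from Lim_transform_eventually[OF lim this] show "(\<lambda>m. ?F m x) \<longlonglongrightarrow> u x" .
 qed
qed

text \<open>Increasing simple approximations F and G, of bounded support, make F^(1-s) G^s increase
  to f^(1-s) g^s. The Fatou property passes the bound to the limit, and monotonicity of the norm
  passes it on to h.\<close>

lemma norm_le_of_simple:
 fixes f g h :: "real ^ 'n::finite => real"
 assumes B: "banach_function_norm_over \<S> B" and s: "0 < s" "s < 1"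
  and f: "f \<in> borel_fun" "\<And>x. 0 \<le> f x" and g: "g \<in> borel_fun" "\<And>x. 0 \<le> g x"
  and bound: "\<And>F G r. simple_function lborel F ==> simple_function lborel G ==> (\<And>x. 0 \<le> F x) ==> (\<And>x. 0 \<le> G x) ==>
   (\<And>x. F x \<le> f x) ==> (\<And>x. G x \<le> g x) ==> (\<And>x. r \<le> norm x ==> F x = 0) ==> B (\<lambda>x. F x powr (1 - s) * G x powr s) \<le> R"
  and h: "h \<in> L0" "AE x in lborel. \<bar>h x\<bar> \<le> f x powr (1 - s) * g x powr s"
 shows "B h \<le> R"
proof -
 obtain F where F: "\<And>m::nat. simple_function lborel (F m)" "\<And>m x. 0 \<le> F m x" "\<And>m x. F m x \<le> f x"
  "\<And>m x. real m \<le> norm x ==> F m x = 0" "\<And>x. incseq (\<lambda>m. F m x)" "\<And>x. (\<lambda>m. F m x) \<longlonglongrightarrow> f x"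
  using simple_function_approx[OF f] by blast
 obtain G where G: "\<And>m::nat. simple_function lborel (G m)" "\<And>m x. 0 \<le> G m x" "\<And>m x. G m x \<le> g x"
  "\<And>m x. real m \<le> norm x ==> G m x = 0" "\<And>x. incseq (\<lambda>m. G m x)" "\<And>x. (\<lambda>m. G m x) \<longlonglongrightarrow> g x"
  using simple_function_approx[OF g] by blast
 let ?h = "\<lambda>m x. F m x powr (1 - s) * G m x powr s"
 let ?H = "\<lambda>x. f x powr (1 - s) * g x powr s"
 have FG[measurable]: "F m \<in> borel_fun" "G m \<in> borel_fun" for m
  using borel_measurable_simple_function[OF F(1)] borel_measurable_simple_function[OF G(1)] by simp_all
 have hL: "?h m \<in> L0" for m by (rule borel_imp_L0) measurable
 note f(1)[measurable] g(1)[measurable]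
 have HL: "?H \<in> L0" by (rule borel_imp_L0) measurable
 have inc: "incseq (\<lambda>m. ?h m x)" for x
  unfolding incseq_def using F(2) G(2) s incseqD[OF F(5)[of x]] incseqD[OF G(5)[of x]]
  by (intro allI impI mult_mono powr_mono2) auto
 have lim: "(\<lambda>m. ?h m x) \<longlonglongrightarrow> ?H x" for x
  using F(2) G(2) s by (intro tendsto_mult tendsto_powr' F(6) G(6) tendsto_const) auto
 have "(\<lambda>m. B (?h m)) \<longlonglongrightarrow> B ?H"
 proof -
  have "\<forall>F::nat => real ^ 'n => real. \<forall>f\<in>L0. (\<forall>m. F m \<in> L0) \<and>
    (AE x in lebesgue. (\<forall>m. 0 \<le> F m x) \<and> incseq (\<lambda>m. F m x) \<and> (\<lambda>m. F m x) \<longlonglongrightarrow> f x)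
    \<longrightarrow> incseq (\<lambda>m. B (F m)) \<and> (\<lambda>m. B (F m)) \<longlonglongrightarrow> B f"
   using B unfolding banach_function_norm_over_def by blast
  from this[rule_format, OF HL, of ?h] show ?thesis using hL inc lim by simp
 qed
 moreover have "B (?h m) \<le> R" for m by (rule bound[OF F(1) G(1) F(2) G(2) F(3) G(3) F(4)])
 ultimately have "B ?H \<le> R" by (intro LIMSEQ_le_const2) auto
 moreover have "B h \<le> B ?H" by (rule bfn_mono[OF B HL h(1)]) (use h(2) in \<open>eventually_elim, simp\<close>)
 ultimately show ?thesis by (rule order_trans[rotated])
qed

lemma abs_borel_rep:
 assumes "f \<in> L0" obtains f' where "f' \<in> borel_fun" "\<And>x. 0 \<le> f' x" "AE x in lborel. f' x = \<bar>f x\<bar>"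
proof -
 obtain g where g: "g \<in> borel_fun" "AE x in lborel. f x = g x" using L0_borel_rep[OF assms] by blast
 show ?thesis
 proof (rule that[of "\<lambda>x. \<bar>g x\<bar>"])
  show "(\<lambda>x. \<bar>g x\<bar>) \<in> borel_fun" using g(1) by simp
  show "AE x in lborel. \<bar>g x\<bar> = \<bar>f x\<bar>" using g(2) by eventually_elim simp
 qed simp
qed

text \<open>D is neither 0 nor infinite, so dividing by it and multiplying back is
  reversible.\<close>

lemma ennreal_le_mult_Inf:
 assumes D: "0 < D" and le: "\<And>z. z \<in> Z ==> (b::ennreal) \<le> ennreal D * z" shows "b \<le> ennreal D * Inf Z"
proof -
 have D': "0 < ennreal D" "ennreal D \<noteq> 0" "ennreal D \<noteq> top" using D by auto
 have "b / ennreal D \<le> Inf Z" using le D' by (intro Inf_greatest divide_le_posI_ennreal) auto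
 hence "ennreal D * (b / ennreal D) \<le> ennreal D * Inf Z" by (intro mult_left_mono) auto
 moreover have "ennreal D * (b / ennreal D) = b"
  using mult_divide_eq_ennreal[OF D'(2,3), of b] by (simp add: ennreal_times_divide mult.commute)
 ultimately show ?thesis by simp
qed

lemma ennreal_powr_finite: "a < \<infinity> ==> ennreal_powr a r < \<infinity>"
 by (auto simp: ennreal_powr_def)

lemma extended_norm_finite_space:
 assumes "f \<in> L0" "extended_norm N (frac_diff s k q f) < \<infinity>"
 shows "AE x in lebesgue. frac_diff s k q f x < \<infinity>" "(\<lambda>x. enn2real (frac_diff s k q f x)) \<in> space_of N"
  "N (\<lambda>x. enn2real (frac_diff s k q f x)) = extended_norm N (frac_diff s k q f)"
proof -
 show 1: "AE x in lebesgue. frac_diff s k q f x < \<infinity>"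
  using assms(2) unfolding extended_norm_def by (rule contrapos_pp) simp
 show 2: "N (\<lambda>x. enn2real (frac_diff s k q f x)) = extended_norm N (frac_diff s k q f)"
  using 1 by (simp add: extended_norm_def)
 show "(\<lambda>x. enn2real (frac_diff s k q f x)) \<in> space_of N"
  using frac_diff_L0[OF assms(1)] assms(2) 2 by (simp add: space_of_def)
qed

text \<open>The finite bound R makes D f finite almost everywhere, so its real-valued version is a
  member of the space A and the embedding applies to it.\<close>

lemma embedding_extended_norm:
 assumes emb: "\<forall>f\<in>space_of A. B f \<le> ennreal C * A f" and C: "0 < C" and f: "f \<in> L0"
  and le: "extended_norm A (frac_diff s k q f) \<le> R" and R: "R < \<infinity>"
 shows "extended_norm B (frac_diff s k q f) \<le> ennreal C * R"
proof -
 have fin: "extended_norm A (frac_diff s k q f) < \<infinity>" using le R by (rule le_less_trans)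
 note * = extended_norm_finite_space[OF f fin]
 have "extended_norm B (frac_diff s k q f) = B (\<lambda>x. enn2real (frac_diff s k q f x))"
  using *(1) by (simp add: extended_norm_def)
 also have "\<dots> \<le> ennreal C * A (\<lambda>x. enn2real (frac_diff s k q f x))" by (rule emb[rule_format, OF *(2)])
 also have "\<dots> \<le> ennreal C * R" unfolding *(3) using le by (rule mult_left_mono) simp
 finally show ?thesis .
qed

text \<open>A majorant |f|^(1-s) |g|^s of h is approximated from below by simple pairs. The extremal
  function of a pair, put into the assumed inequality, bounds F^(1-s) G^s in B by the norms of f and
  g; the infimum over all majorants is the norm of the product space.\<close>

lemma optimality_calderon:
 fixes X Y B :: "'n::finite fnorm"
 assumes k: "0 < k" and s: "0 < s" "s < 1" and q: "1 \<le> q"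
  and X: "ri_banach_function_space X" and Y: "ri_banach_function_space Y" and B: "ri_banach_function_space B"
  and C: "0 < C" "\<And>f. f \<in> space_of X ==> f \<in> homogeneous_sobolev k Y ==>
    extended_norm B (frac_diff s k q f) \<le> ennreal C * ennreal_powr (X f) (1 - s) * ennreal_powr (Y (grad_norm k f)) s"
 shows "continuously_embedded (calderon_lozanovskii s X Y) B"
proof -
 note NX = ri_bfn[OF X] and NY = ri_bfn[OF Y] and NB = ri_bfn[OF B]
 obtain K where K0: "0 < K" and K: "\<forall>(F :: real ^ 'n => real) G r. simple_function lborel F \<and> simple_function lborel G \<and>
  (\<forall>x. 0 \<le> F x) \<and> (\<forall>x. 0 \<le> G x) \<and> (\<forall>x. r \<le> norm x \<longrightarrow> F x = 0) \<longrightarrow>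
  extremal s k q K F G (\<lambda>x. F x powr (1 - s) * G x powr s)"
  using extremal_function_simple[OF k s q, where 'n = 'n] by (elim exE conjE)
 \<comment> \<open>One K comes from the lower bound for D u, C from the assumed inequality, and the
   other K = K^(1-s) K^s from the bounds for u and its gradient.\<close>
 define D where "D = K * C * K"
 have D: "0 < D" using K0 C by (simp add: D_def)
 have key: "B h \<le> ennreal D * (ennreal_powr (X f) (1 - s) * ennreal_powr (Y g) s)"
  if h: "h \<in> L0" and f: "f \<in> space_of X" and g: "g \<in> space_of Y" and le: "AE x in lebesgue. \<bar>h x\<bar> \<le> \<bar>f x\<bar> powr (1 - s) * \<bar>g x\<bar> powr s" for h f g
 proof -
  obtain f' where f': "f' \<in> borel_fun" "\<And>x. 0 \<le> f' x" "AE x in lborel. f' x = \<bar>f x\<bar>"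
   using abs_borel_rep[OF space_ofD(1)[OF f]] by blast
  obtain g' where g': "g' \<in> borel_fun" "\<And>x. 0 \<le> g' x" "AE x in lborel. g' x = \<bar>g x\<bar>"
   using abs_borel_rep[OF space_ofD(1)[OF g]] by blast
  have le': "AE x in lborel. \<bar>h x\<bar> \<le> f' x powr (1 - s) * g' x powr s"
   using le[unfolded AE_completion_iff] f'(3) g'(3) by eventually_elim simp
  show ?thesis
  proof (rule norm_le_of_simple[OF NB s f'(1,2) g'(1,2) _ h le'])
   fix F G r
   assume *: "simple_function lborel F" "simple_function lborel G" "\<And>x. 0 \<le> F x" "\<And>x. 0 \<le> G x"
    "\<And>x. F x \<le> f' x" "\<And>x. G x \<le> g' x" "\<And>x. r \<le> norm x ==> F x = 0"
   have m: "F \<in> L0" "G \<in> L0" using borel_measurable_simple_function[OF *(1)] borel_measurable_simple_function[OF *(2)]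
    by (auto intro: borel_imp_L0)
   have "AE x in lborel. \<bar>F x\<bar> \<le> \<bar>f x\<bar>" using f'(3)
   proof eventually_elim
    case (elim x) thus ?case using *(3)[of x] *(5)[of x] by simp
   qed
   hence XF: "X F \<le> X f"
    by (rule bfn_mono[OF NX space_ofD(1)[OF f] m(1)])
   have "AE x in lborel. \<bar>G x\<bar> \<le> \<bar>g x\<bar>" using g'(3)
   proof eventually_elim
    case (elim x) thus ?case using *(4)[of x] *(6)[of x] by simp
   qed
   hence YG: "Y G \<le> Y g"
    by (rule bfn_mono[OF NY space_ofD(1)[OF g] m(2)])
   have XYfin: "X f < \<infinity>" "Y g < \<infinity>" using f g by (auto simp: space_of_def)
   have "extremal s k q K F G (\<lambda>x. F x powr (1 - s) * G x powr s)"
    by (rule K[rule_format]) (use *(1-4,7) in auto)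
   then obtain t u where t: "0 < t" and u1: "u \<in> space_of X" "X u \<le> ennreal (K * t) * X F"
    and u2: "u \<in> homogeneous_sobolev k Y" "Y (grad_norm k u) \<le> ennreal K * Y G"
    and u3: "B (\<lambda>x. F x powr (1 - s) * G x powr s) * ennreal (t powr (1 - s)) \<le> ennreal K * extended_norm B (frac_diff s k q u)"
    using X Y B unfolding extremal_def by blast
   have e1: "ennreal_powr (X u) (1 - s) \<le> ennreal ((K * t) powr (1 - s)) * ennreal_powr (X f) (1 - s)"
    by (rule ennreal_powr_scale[OF _ order_trans[OF u1(2) mult_left_mono[OF XF]]]) (use K0 t s XYfin in auto)
   have e2: "ennreal_powr (Y (grad_norm k u)) s \<le> ennreal (K powr s) * ennreal_powr (Y g) s"
    by (rule ennreal_powr_scale[OF _ order_trans[OF u2(2) mult_left_mono[OF YG]]]) (use K0 s XYfin in auto)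
   let ?P = "ennreal_powr (X f) (1 - s)" and ?Q = "ennreal_powr (Y g) s"
   have "B (\<lambda>x. F x powr (1 - s) * G x powr s) * ennreal (t powr (1 - s)) \<le> ennreal K * extended_norm B (frac_diff s k q u)" by (rule u3)
   also have "\<dots> \<le> ennreal K * (ennreal C * ennreal_powr (X u) (1 - s) * ennreal_powr (Y (grad_norm k u)) s)"
    by (intro mult_left_mono C(2) u1(1) u2(1)) simp
   also have "\<dots> \<le> ennreal K * (ennreal C * (ennreal ((K * t) powr (1 - s)) * ?P) * (ennreal (K powr s) * ?Q))"
    using e1 e2 by (intro mult_mono order_refl) auto
   also have "\<dots> = (ennreal K * ennreal C * ennreal ((K * t) powr (1 - s)) * ennreal (K powr s)) * (?P * ?Q)" by (simp only: mult_ac)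
   also have "ennreal K * ennreal C * ennreal ((K * t) powr (1 - s)) * ennreal (K powr s) = ennreal D * ennreal (t powr (1 - s))"
   proof -
    have "K powr (1 - s) * K powr s = K" using K0 by (simp add: powr_add[symmetric])
    hence "K * C * (K * t) powr (1 - s) * K powr s = D * t powr (1 - s)"
     unfolding powr_mult D_def by (metis (no_types) mult.assoc mult.commute)
    thus ?thesis using K0 C t D by (simp add: ennreal_mult[symmetric])
   qed
   finally have "ennreal (t powr (1 - s)) * B (\<lambda>x. F x powr (1 - s) * G x powr s) \<le> ennreal (t powr (1 - s)) * (ennreal D * (?P * ?Q))"
    by (simp only: mult_ac)
   thus "B (\<lambda>x. F x powr (1 - s) * G x powr s) \<le> ennreal D * (?P * ?Q)"
    using t by (subst (asm) ennreal_mult_le_mult_iff) auto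
  qed
 qed
 have B_le: "B h \<le> ennreal D * calderon_lozanovskii s X Y h" if "h \<in> space_of (calderon_lozanovskii s X Y)" for h
  unfolding calderon_lozanovskii_def
  by (rule ennreal_le_mult_Inf[OF D]) (use key[OF space_ofD(1)[OF that]] in blast)
 have "space_of (calderon_lozanovskii s X Y) \<subseteq> space_of B"
 proof
  fix h assume h: "h \<in> space_of (calderon_lozanovskii s X Y)"
  have "ennreal D * calderon_lozanovskii s X Y h < \<infinity>" using space_ofD(2)[OF h] by (simp add: ennreal_mult_less_top)
  thus "h \<in> space_of B" using B_le[OF h] space_ofD(1)[OF h] by (auto simp: space_of_def intro: le_less_trans)
 qed
 thus ?thesis unfolding continuously_embedded_def using D B_le by blast
qed

text \<open>BMO takes the place of X with the constant function 1 as first factor: |h| = 1^(1-s)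
  (|h|^(1/s))^s. The simple approximations satisfy F \<le> 1, so their extremal functions have BMO
  norm at most K t, as the homogeneity in t requires.\<close>

lemma optimality_BMO:
 fixes Y B :: "'n::finite fnorm"
 assumes k: "0 < k" and s: "0 < s" "s < 1" and q: "1 \<le> q"
  and Y: "ri_banach_function_space Y" and B: "ri_banach_function_space B"
  and C: "0 < C" "\<And>f. f \<in> BMO ==> f \<in> homogeneous_sobolev k Y ==>
    extended_norm B (frac_diff s k q f) \<le> ennreal C * ennreal_powr (bmo_norm f) (1 - s) * ennreal_powr (Y (grad_norm k f)) s"
 shows "continuously_embedded (convexification (1 / s) Y) B"
proof -
 note NY = ri_bfn[OF Y] and NB = ri_bfn[OF B]
 obtain K where K0: "0 < K" and K: "\<forall>(F :: real ^ 'n => real) G r. simple_function lborel F \<and> simple_function lborel G \<and>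
  (\<forall>x. 0 \<le> F x) \<and> (\<forall>x. 0 \<le> G x) \<and> (\<forall>x. r \<le> norm x \<longrightarrow> F x = 0) \<longrightarrow>
  extremal s k q K F G (\<lambda>x. F x powr (1 - s) * G x powr s)"
  using extremal_function_simple[OF k s q, where 'n = 'n] by (elim exE conjE)
 define D where "D = K * C * K"
 have D: "0 < D" using K0 C by (simp add: D_def)
 have B_le: "B h \<le> ennreal D * convexification (1 / s) Y h" if h: "h \<in> space_of (convexification (1 / s) Y)" for h
 proof -
  let ?g = "\<lambda>x. \<bar>h x\<bar> powr (1 / s)"
  have hL: "h \<in> L0" by (rule space_ofD(1)[OF h])
  have gL: "?g \<in> L0" using hL unfolding L0_def by measurable
  have conv: "convexification (1 / s) Y h = ennreal_powr (Y ?g) s" by (simp add: convexification_def)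
  have Yfin: "Y ?g < \<infinity>" using space_ofD(2)[OF h] unfolding conv by (auto simp: ennreal_powr_def less_top split: if_splits)
  obtain g' where g': "g' \<in> borel_fun" "\<And>x. 0 \<le> g' x" "AE x in lborel. g' x = \<bar>?g x\<bar>"
   using abs_borel_rep[OF gL] by blast
  have le': "AE x in lborel. \<bar>h x\<bar> \<le> 1 powr (1 - s) * g' x powr s"
   using g'(3) by eventually_elim (use s in \<open>simp add: powr_powr\<close>)
  show ?thesis unfolding conv
  proof (rule norm_le_of_simple[OF NB s _ _ g'(1,2) _ hL le'])
   fix F G :: "real^'n => real" and r
   assume *: "simple_function lborel F" "simple_function lborel G" "\<And>x. 0 \<le> F x" "\<And>x. 0 \<le> G x"
    "\<And>x. F x \<le> 1" "\<And>x. G x \<le> g' x" "\<And>x. r \<le> norm x ==> F x = 0"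
   have m: "G \<in> L0" using borel_measurable_simple_function[OF *(2)] by (auto intro: borel_imp_L0)
   have "AE x in lborel. \<bar>G x\<bar> \<le> \<bar>?g x\<bar>" using g'(3)
   proof eventually_elim
    case (elim x) thus ?case using *(4)[of x] *(6)[of x] by simp
   qed
   hence YG: "Y G \<le> Y ?g"
    by (rule bfn_mono[OF NY gL m])
   have "extremal s k q K F G (\<lambda>x. F x powr (1 - s) * G x powr s)"
    by (rule K[rule_format]) (use *(1-4,7) in auto)
   then obtain t u where t: "0 < t" and u1: "u \<in> L1_loc" "bmo_norm u \<le> ennreal (K * t)"
    and u2: "u \<in> homogeneous_sobolev k Y" "Y (grad_norm k u) \<le> ennreal K * Y G"
    and u3: "B (\<lambda>x. F x powr (1 - s) * G x powr s) * ennreal (t powr (1 - s)) \<le> ennreal K * extended_norm B (frac_diff s k q u)"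
    using Y B *(5) unfolding extremal_def by blast
   have uB: "u \<in> BMO" using u1 by (auto simp: BMO_def intro: le_less_trans)
   have e1: "ennreal_powr (bmo_norm u) (1 - s) \<le> ennreal ((K * t) powr (1 - s))"
    using ennreal_powr_mono[OF u1(2), of "1 - s"] K0 t s by (simp add: ennreal_powr_ennreal)
   have e2: "ennreal_powr (Y (grad_norm k u)) s \<le> ennreal (K powr s) * ennreal_powr (Y ?g) s"
    by (rule ennreal_powr_scale[OF _ order_trans[OF u2(2) mult_left_mono[OF YG]]]) (use K0 s Yfin in auto)
   let ?Q = "ennreal_powr (Y ?g) s"
   have "B (\<lambda>x. F x powr (1 - s) * G x powr s) * ennreal (t powr (1 - s)) \<le> ennreal K * extended_norm B (frac_diff s k q u)" by (rule u3)
   also have "\<dots> \<le> ennreal K * (ennreal C * ennreal_powr (bmo_norm u) (1 - s) * ennreal_powr (Y (grad_norm k u)) s)"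
    by (intro mult_left_mono C(2) uB u2(1)) simp
   also have "\<dots> \<le> ennreal K * (ennreal C * ennreal ((K * t) powr (1 - s)) * (ennreal (K powr s) * ?Q))"
    using e1 e2 by (intro mult_mono order_refl) auto
   also have "\<dots> = (ennreal K * ennreal C * ennreal ((K * t) powr (1 - s)) * ennreal (K powr s)) * ?Q" by (simp only: mult_ac)
   also have "ennreal K * ennreal C * ennreal ((K * t) powr (1 - s)) * ennreal (K powr s) = ennreal D * ennreal (t powr (1 - s))"
   proof -
    have "K powr (1 - s) * K powr s = K" using K0 by (simp add: powr_add[symmetric])
    hence "K * C * (K * t) powr (1 - s) * K powr s = D * t powr (1 - s)"
     unfolding powr_mult D_def by (metis (no_types) mult.assoc mult.commute)
    thus ?thesis using K0 C t D by (simp add: ennreal_mult[symmetric])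
   qed
   finally have "ennreal (t powr (1 - s)) * B (\<lambda>x. F x powr (1 - s) * G x powr s) \<le> ennreal (t powr (1 - s)) * (ennreal D * ?Q)"
    by (simp only: mult_ac)
   thus "B (\<lambda>x. F x powr (1 - s) * G x powr s) \<le> ennreal D * ?Q"
    using t by (subst (asm) ennreal_mult_le_mult_iff) auto
  qed auto
 qed
 have "space_of (convexification (1 / s) Y) \<subseteq> space_of B"
 proof
  fix h assume h: "h \<in> space_of (convexification (1 / s) Y)"
  have "ennreal D * convexification (1 / s) Y h < \<infinity>" using space_ofD(2)[OF h] by (simp add: ennreal_mult_less_top)
  thus "h \<in> space_of B" using B_le[OF h] space_ofD(1)[OF h] by (auto simp: space_of_def intro: le_less_trans)
 qed
 thus ?thesis unfolding continuously_embedded_def using D B_le by blast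
qed

section \<open>Equivalence of the inequalities with the embeddings\<close>

lemma optimality_calderon_iff:
 fixes X Y B :: "'n::finite fnorm"
 assumes k: "1 \<le> k" and s: "0 < s" "s < 1" and q: "1 \<le> q"
  and X: "ri_banach_function_space X" and Y: "ri_banach_function_space Y" and B: "ri_banach_function_space B"
  and pX: "lower_boyd_index X = ereal pX" "1 < pX" and pY: "lower_boyd_index Y = ereal pY" "1 < pY"
  and sub: "real CARD('n) * ((1 - s) / pX + s / pY - 1 / q) < s * real k"
 shows "(\<exists>C>0. \<forall>f \<in> space_of X \<inter> homogeneous_sobolev k Y.
        extended_norm B (frac_diff s k q f)
        \<le> ennreal C * ennreal_powr (X f) (1 - s) * ennreal_powr (Y (grad_norm k f)) s)
       \<longleftrightarrow> continuously_embedded (calderon_lozanovskii s X Y) B"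
proof
 assume "\<exists>C>0. \<forall>f \<in> space_of X \<inter> homogeneous_sobolev k Y.
        extended_norm B (frac_diff s k q f)
        \<le> ennreal C * ennreal_powr (X f) (1 - s) * ennreal_powr (Y (grad_norm k f)) s"
 then obtain C where C: "0 < C" "\<And>f. f \<in> space_of X ==> f \<in> homogeneous_sobolev k Y ==>
    extended_norm B (frac_diff s k q f) \<le> ennreal C * ennreal_powr (X f) (1 - s) * ennreal_powr (Y (grad_norm k f)) s" by blast
 have "0 < k" using k by simp
 thus "continuously_embedded (calderon_lozanovskii s X Y) B" by (rule optimality_calderon[OF _ s q X Y B C])
next
 assume "continuously_embedded (calderon_lozanovskii s X Y) B"
 then obtain C where C: "0 < C" "\<forall>f\<in>space_of (calderon_lozanovskii s X Y). B f \<le> ennreal C * calderon_lozanovskii s X Y f"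
  unfolding continuously_embedded_def by blast
 have bX: "ball_banach_function_space X" and bY: "ball_banach_function_space Y"
  using X Y by (auto simp: ri_banach_function_space_def intro: bfs_imp_ball_bfs)
 obtain C' where C': "0 < C'" "\<And>f. f \<in> space_of X ==> f \<in> homogeneous_sobolev k Y ==>
    extended_norm (calderon_lozanovskii s X Y) (frac_diff s k q f) \<le> ennreal C' * ennreal_powr (X f) (1 - s) * ennreal_powr (Y (grad_norm k f)) s"
  using interpolation_calderon[OF k s q bX bY pX pY sub] by blast
 show "\<exists>C>0. \<forall>f \<in> space_of X \<inter> homogeneous_sobolev k Y.
        extended_norm B (frac_diff s k q f)
        \<le> ennreal C * ennreal_powr (X f) (1 - s) * ennreal_powr (Y (grad_norm k f)) s"
 proof (intro exI[of _ "C * C'"] conjI ballI)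
  fix f assume "f \<in> space_of X \<inter> homogeneous_sobolev k Y"
  hence f: "f \<in> space_of X" "f \<in> homogeneous_sobolev k Y" by auto
  have "ennreal_powr (X f) (1 - s) < \<infinity>" "ennreal_powr (Y (grad_norm k f)) s < \<infinity>"
   using space_ofD(2)[OF f(1)] space_ofD(2)[OF grad_norm_space[OF ri_bfn[OF Y] f(2)]] by (auto simp: ennreal_powr_finite[unfolded infinity_ennreal_def])
  hence fin: "ennreal C' * ennreal_powr (X f) (1 - s) * ennreal_powr (Y (grad_norm k f)) s < \<infinity>"
   by (simp add: ennreal_mult_less_top)
  show "extended_norm B (frac_diff s k q f) \<le> ennreal (C * C') * ennreal_powr (X f) (1 - s) * ennreal_powr (Y (grad_norm k f)) s"
   using embedding_extended_norm[OF C(2,1) space_ofD(1)[OF f(1)] C'(2)[OF f] fin] C(1) C'(1) by (simp add: ennreal_mult mult.assoc)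
 qed (use C C' in simp)
qed

lemma optimality_BMO_iff:
 fixes Y B :: "'n::finite fnorm"
 assumes k: "1 \<le> k" and s: "0 < s" "s < 1" and q: "1 \<le> q"
  and Y: "ri_banach_function_space Y" and B: "ri_banach_function_space B"
  and pY: "lower_boyd_index Y = ereal pY" "1 < pY"
  and sub: "real CARD('n) * (s / pY - 1 / q) < s * real k"
 shows "(\<exists>C>0. \<forall>f \<in> BMO \<inter> homogeneous_sobolev k Y.
        extended_norm B (frac_diff s k q f)
        \<le> ennreal C * ennreal_powr (bmo_norm f) (1 - s) * ennreal_powr (Y (grad_norm k f)) s)
       \<longleftrightarrow> continuously_embedded (convexification (1 / s) Y) B"
proof
 assume "\<exists>C>0. \<forall>f \<in> BMO \<inter> homogeneous_sobolev k Y.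
        extended_norm B (frac_diff s k q f)
        \<le> ennreal C * ennreal_powr (bmo_norm f) (1 - s) * ennreal_powr (Y (grad_norm k f)) s"
 then obtain C where C: "0 < C" "\<And>f. f \<in> BMO ==> f \<in> homogeneous_sobolev k Y ==>
    extended_norm B (frac_diff s k q f) \<le> ennreal C * ennreal_powr (bmo_norm f) (1 - s) * ennreal_powr (Y (grad_norm k f)) s" by blast
 have "0 < k" using k by simp
 thus "continuously_embedded (convexification (1 / s) Y) B" by (rule optimality_BMO[OF _ s q Y B C])
next
 assume "continuously_embedded (convexification (1 / s) Y) B"
 then obtain C where C: "0 < C" "\<forall>f\<in>space_of (convexification (1 / s) Y). B f \<le> ennreal C * convexification (1 / s) Y f"
  unfolding continuously_embedded_def by blast
 have bY: "ball_banach_function_space Y"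
  using Y by (auto simp: ri_banach_function_space_def intro: bfs_imp_ball_bfs)
 obtain C' where C': "0 < C'" "\<And>f. f \<in> BMO ==> f \<in> homogeneous_sobolev k Y ==>
    extended_norm (convexification (1 / s) Y) (frac_diff s k q f) \<le> ennreal C' * ennreal_powr (bmo_norm f) (1 - s) * ennreal_powr (Y (grad_norm k f)) s"
  using interpolation_BMO[OF k s q bY pY sub] by blast
 show "\<exists>C>0. \<forall>f \<in> BMO \<inter> homogeneous_sobolev k Y.
        extended_norm B (frac_diff s k q f)
        \<le> ennreal C * ennreal_powr (bmo_norm f) (1 - s) * ennreal_powr (Y (grad_norm k f)) s"
 proof (intro exI[of _ "C * C'"] conjI ballI)
  fix f :: "real^'n => real" assume "f \<in> BMO \<inter> homogeneous_sobolev k Y"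
  hence f: "f \<in> BMO" "f \<in> homogeneous_sobolev k Y" by auto
  have fL: "f \<in> L0" "bmo_norm f < \<infinity>" using f(1) by (auto simp: BMO_def L1_loc_def)
  have "ennreal_powr (bmo_norm f) (1 - s) < \<infinity>" "ennreal_powr (Y (grad_norm k f)) s < \<infinity>"
   using fL(2) space_ofD(2)[OF grad_norm_space[OF ri_bfn[OF Y] f(2)]] by (auto simp: ennreal_powr_finite[unfolded infinity_ennreal_def])
  hence fin: "ennreal C' * ennreal_powr (bmo_norm f) (1 - s) * ennreal_powr (Y (grad_norm k f)) s < \<infinity>"
   by (simp add: ennreal_mult_less_top)
  show "extended_norm B (frac_diff s k q f) \<le> ennreal (C * C') * ennreal_powr (bmo_norm f) (1 - s) * ennreal_powr (Y (grad_norm k f)) s"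
   using embedding_extended_norm[OF C(2,1) fL(1) C'(2)[OF f] fin] C(1) C'(1) by (simp add: ennreal_mult mult.assoc)
 qed (use C C' in simp)
qed

theorem theorem1p9:
  fixes k :: nat and s q :: real
  assumes "1 \<le> k" and "0 < s" and "s < 1" and "1 \<le> q"
  shows
    "(\<forall>(X :: 'n::finite fnorm) (Y :: 'n fnorm) pX pY :: real.
        ball_banach_function_space X \<and> ball_banach_function_space Y \<and>
        lower_boyd_index X = ereal pX \<and> lower_boyd_index Y = ereal pY \<and>
        1 < pX \<and> 1 < pY \<and>
        real CARD('n) * ((1 - s) / pX + s / pY - 1 / q) < s * real k
        \<longrightarrow> (\<exists>C>0. \<forall>f \<in> space_of X \<inter> homogeneous_sobolev k Y.
              extended_norm (calderon_lozanovskii s X Y) (frac_diff s k q f)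
              \<le> ennreal C * ennreal_powr (X f) (1 - s) * ennreal_powr (Y (grad_norm k f)) s))
     \<and>
     (\<forall>(X :: 'n fnorm) (Y :: 'n fnorm) (B :: 'n fnorm) pX pY :: real.
        ri_banach_function_space X \<and> ri_banach_function_space Y \<and> ri_banach_function_space B \<and>
        lower_boyd_index X = ereal pX \<and> lower_boyd_index Y = ereal pY \<and>
        1 < pX \<and> 1 < pY \<and>
        real CARD('n) * ((1 - s) / pX + s / pY - 1 / q) < s * real k
        \<longrightarrow> ((\<exists>C>0. \<forall>f \<in> space_of X \<inter> homogeneous_sobolev k Y.
                extended_norm B (frac_diff s k q f)
                \<le> ennreal C * ennreal_powr (X f) (1 - s) * ennreal_powr (Y (grad_norm k f)) s)
             \<longleftrightarrow> continuously_embedded (calderon_lozanovskii s X Y) B))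
     \<and>
     (\<forall>(Y :: 'n fnorm) pY :: real.
        ball_banach_function_space Y \<and> lower_boyd_index Y = ereal pY \<and> 1 < pY \<and>
        real CARD('n) * (s / pY - 1 / q) < s * real k
        \<longrightarrow> (\<exists>C>0. \<forall>f \<in> BMO \<inter> homogeneous_sobolev k Y.
              extended_norm (convexification (1 / s) Y) (frac_diff s k q f)
              \<le> ennreal C * ennreal_powr (bmo_norm f) (1 - s) * ennreal_powr (Y (grad_norm k f)) s))
     \<and>
     (\<forall>(Y :: 'n fnorm) (B :: 'n fnorm) pY :: real.
        ri_banach_function_space Y \<and> ri_banach_function_space B \<and>
        lower_boyd_index Y = ereal pY \<and> 1 < pY \<and>
        real CARD('n) * (s / pY - 1 / q) < s * real k
        \<longrightarrow> ((\<exists>C>0. \<forall>f \<in> BMO \<inter> homogeneous_sobolev k Y.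
                extended_norm B (frac_diff s k q f)
                \<le> ennreal C * ennreal_powr (bmo_norm f) (1 - s) * ennreal_powr (Y (grad_norm k f)) s)
             \<longleftrightarrow> continuously_embedded (convexification (1 / s) Y) B))"
proof (intro conjI allI impI)
  fix X Y :: "'n fnorm" and pX pY :: real
  assume "ball_banach_function_space X \<and> ball_banach_function_space Y \<and>
    lower_boyd_index X = ereal pX \<and> lower_boyd_index Y = ereal pY \<and> 1 < pX \<and> 1 < pY \<and>
    real CARD('n) * ((1 - s) / pX + s / pY - 1 / q) < s * real k"
  thus "\<exists>C>0. \<forall>f \<in> space_of X \<inter> homogeneous_sobolev k Y.
      extended_norm (calderon_lozanovskii s X Y) (frac_diff s k q f)
      \<le> ennreal C * ennreal_powr (X f) (1 - s) * ennreal_powr (Y (grad_norm k f)) s"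
    using assms by (elim conjE) (rule interpolation_calderon)
next
  fix X Y B :: "'n fnorm" and pX pY :: real
  assume "ri_banach_function_space X \<and> ri_banach_function_space Y \<and> ri_banach_function_space B \<and>
    lower_boyd_index X = ereal pX \<and> lower_boyd_index Y = ereal pY \<and> 1 < pX \<and> 1 < pY \<and>
    real CARD('n) * ((1 - s) / pX + s / pY - 1 / q) < s * real k"
  thus "(\<exists>C>0. \<forall>f \<in> space_of X \<inter> homogeneous_sobolev k Y.
      extended_norm B (frac_diff s k q f)
      \<le> ennreal C * ennreal_powr (X f) (1 - s) * ennreal_powr (Y (grad_norm k f)) s)
    \<longleftrightarrow> continuously_embedded (calderon_lozanovskii s X Y) B"
    using assms by (elim conjE) (rule optimality_calderon_iff)
next
  fix Y :: "'n fnorm" and pY :: real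
  assume "ball_banach_function_space Y \<and> lower_boyd_index Y = ereal pY \<and> 1 < pY \<and>
    real CARD('n) * (s / pY - 1 / q) < s * real k"
  thus "\<exists>C>0. \<forall>f \<in> BMO \<inter> homogeneous_sobolev k Y.
      extended_norm (convexification (1 / s) Y) (frac_diff s k q f)
      \<le> ennreal C * ennreal_powr (bmo_norm f) (1 - s) * ennreal_powr (Y (grad_norm k f)) s"
    using assms by (elim conjE) (rule interpolation_BMO)
next
  fix Y B :: "'n fnorm" and pY :: real
  assume "ri_banach_function_space Y \<and> ri_banach_function_space B \<and>
    lower_boyd_index Y = ereal pY \<and> 1 < pY \<and> real CARD('n) * (s / pY - 1 / q) < s * real k"
  thus "(\<exists>C>0. \<forall>f \<in> BMO \<inter> homogeneous_sobolev k Y.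
      extended_norm B (frac_diff s k q f)
      \<le> ennreal C * ennreal_powr (bmo_norm f) (1 - s) * ennreal_powr (Y (grad_norm k f)) s)
    \<longleftrightarrow> continuously_embedded (convexification (1 / s) Y) B"
    using assms by (elim conjE) (rule optimality_BMO_iff)
qed

end
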